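(* Let $H-M\to X$ be a $G$-equivariant principal $H$-bundle with CY structure $(\omega_M,\chi_M)$, let $q=\dim H$, and let $X,G,L_1,\dots,L_s$, $L=L_1+\cdots+L_s=L_\chi$, $V,B,\mathcal Y$ satisfy the standing assumptions listed in the context for this bundle. Fix independent vector fields $x_1,\dots,x_q$ generated by $H$ on $M$. Then there is a constant $c$ such that, for all $\tau\in H^0(X,L_\chi+K_X)$ and $\sigma=(\sigma_1,\dots,\sigma_s)\in B$, with $\psi:=\sigma_1\cdots\sigma_s\in H^0(X,L_\chi)$, $$\mathbf R_\sigma(\tau)=c\,\mathrm{Res}\,\frac{\tau_M}{\psi_M}\,\iota_{x_1}\cdots\iota_{x_q}\omega_M .$$ Moreover, if $\bigcup_{\sigma\in B}Y_\sigma$ is dense in $X$, then the global Poincaré residue map $\mathbf R:H^0(X,L+K_X)\to H^0(B,\mathbb H^{top})$ is injective.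
   Context: Line bundles are written additively. Principal bundles: $G,H$ are complex Lie groups; a $G$-equivariant principal $H$-bundle $H-M\to X$ is a complex manifold $M$ with commuting holomorphic actions of $G$ (left) and $H$ ($h$ acts by $m\mapsto mh^{-1}$), the $H$-action free and proper, with $X=M/H$. An $H$-character is a holomorphic homomorphism $H\to\mathbb C^\times$. A CY structure on $M$ is a pair $(\omega_M,\chi_M)$ with $\omega_M$ a nowhere vanishing $G$-invariant holomorphic top form on $M$ and $\chi_M$ an $H$-character such that the pullback of $\omega_M$ under $m\mapsto mh$ equals $\chi_M(h)\omega_M$ for all $h\in H$. For an $H$-character $\xi$, $L_\xi=M\times_H\mathbb C_\xi$ is the quotient of $M\times\mathbb C$ by $h\cdot(m,v)=(mh^{-1},\xi(h)v)$; for $\psi\in H^0(X,L_\xi)$, $\psi_M:M\to\mathbb C$ denotes the unique holomorphic function with $\psi_M(mh^{-1})=\xi(h)\psi_M(m)$ and $\psi([m])=[m,\psi_M(m)]$. The CY structure gives an isomorphism $K_X\cong L_{\chi_M\chi_{\mathfrak h}}$, where $\chi_{\mathfrak h}$ is the character of $\wedge^q\mathfrak h$ under the adjoint representation; so $\tau\in H^0(L_\chi+K_X)=H^0(L_{\chi\chi_M\chi_{\mathfrak h}})$ is represented by a function $\tau_M$ on $M$. The vector fields generated by $H$ are those induced by a basis of $\mathfrak h=\mathrm{Lie}(H)$, namely $m\mapsto\frac{d}{dt}|_{t=0}m\exp(tx)$, $x\in\mathfrak h$. The form $\frac{\tau_M}{\psi_M}\iota_{x_1}\cdots\iota_{x_q}\omega_M$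 is $H$-basic and is regarded as a meromorphic $d$-form on $X$ with pole along $\cup_iY_{\sigma_i}$. Standing assumptions. $X$ is a compact connected complex manifold of dimension $d$ and $G\subset\mathrm{Aut}\,X$ is a complex Lie subgroup (possibly trivial). $L_1,\dots,L_s$ ($s<d$) are nontrivial $G$-equivariant line bundles with $H^0(X,L+K_X)\ne0$; each $V_i^*:=H^0(X,L_i)$ is base point free; and $L=L_\chi$ for an $H$-character $\chi$. For general $\sigma_i\in V_i^*$ the intersection $Y_\sigma=Y_{\sigma_1}\cap\cdots\cap Y_{\sigma_s}$, $Y_{\sigma_i}=\{\sigma_i=0\}$, is smooth of codimension $s$. Put $V=V_1\times\cdots\times V_s$ and $B=V^*-D$, with $D$ the set of $\sigma\in V^*$ such that $Y_\sigma$ is not smooth of codimension $s$. The number $\dim H^0(Y_\sigma,K_{Y_\sigma})$ is assumed locally constant on $B$, and $\mathbb H^{top}$ is the vector bundle on $B$ with fiber $H^0(Y_\sigma,K_{Y_\sigma})$ at $\sigma$. The map $\mathbf R$: $\mathbf R_\sigma:H^0(X,L+K_X)\to H^0(Y_\sigma,K_{Y_\sigma})$ is restriction to $Y_\sigma$ followed by the canonical adjunction isomorphism $(L+K_X)|_{Y_\sigma}\cong K_{Y_\sigma}$ (locally, with frames $e_i$ of $L_i$ and coordinates $z_1,\dots,z_d$ such that $\sigma_i=z_ie_i$ for $i\le s$, it sends $g\,e_1\otimes\cdots\otimes e_s\otimes dz_1\wedge\cdots\wedge dz_d$ to $g\,dz_{s+1}\wedge\cdots\wedge dz_d|_{Y_\sigma}$);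 $\mathbf R(\tau)$ is the section $\sigma\mapsto\mathbf R_\sigma(\tau)$. $\mathrm{Res}:H^0(\Omega_X^d(\cup_iY_{\sigma_i}))\to H^0(\Omega^{d-s}_{Y_\sigma})$ is induced by the Poincaré residue $\frac{g}{z_1\cdots z_s}dz_1\wedge\cdots\wedge dz_d\mapsto g\,dz_{s+1}\wedge\cdots\wedge dz_d|_{Y_\sigma}$, where $z_i=0$ is a local equation of $Y_{\sigma_i}$. *)

theory Defs
  imports
    "HOL-Analysis.Analysis"
    "HOL-Algebra.Group"
    "HOL-Library.Function_Algebras"
    "Jordan_Normal_Form.Determinant"
begin

section \<open>Holomorphic functions on open subsets of complex n-space\<close>

text \<open>Dimensions are natural numbers (dimension 0 has to be allowed, e.g. for a discrete structure
  group), so complex n-space is the set of sequences vanishing from position n on, with the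
  (product) topology that the type \<^typ>\<open>nat \<Rightarrow> complex\<close> carries.\<close>

definition Cn :: "nat \<Rightarrow> (nat \<Rightarrow> complex) set" where
  "Cn n = {z. \<forall>i\<ge>n. z i = 0}"

text \<open>Complex (Frechet) differentiability; the increment is measured in the l1-norm.\<close>

definition cdiff_at :: "nat \<Rightarrow> ((nat \<Rightarrow> complex) \<Rightarrow> complex) \<Rightarrow> (nat \<Rightarrow> complex) \<Rightarrow> bool" where
  "cdiff_at n f z \<longleftrightarrow> (\<exists>a. ((\<lambda>w. (f w - f z - (\<Sum>i<n. a i * (w i - z i)))
      / of_real (\<Sum>i<n. norm (w i - z i))) \<longlongrightarrow> 0) (at z within Cn n))"

definition hol_Cn :: "nat \<Rightarrow> (nat \<Rightarrow> complex) set \<Rightarrow> ((nat \<Rightarrow> complex) \<Rightarrow> complex) \<Rightarrow> bool" where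
  "hol_Cn n W f \<longleftrightarrow> openin (top_of_set (Cn n)) W \<and> (\<forall>z\<in>W. cdiff_at n f z)"

definition pderiv_Cn :: "nat \<Rightarrow> ((nat \<Rightarrow> complex) \<Rightarrow> complex) \<Rightarrow> (nat \<Rightarrow> complex) \<Rightarrow> complex" where
  "pderiv_Cn i f z = deriv (\<lambda>t. f (z(i := t))) (z i)"


section \<open>Complex manifolds\<close>

type_synonym 'a chart = "'a set \<times> ('a \<Rightarrow> nat \<Rightarrow> complex)"

record 'a cmfd =
  mtop :: "'a topology"
  mdim :: nat
  atlas :: "'a chart set"

abbreviation pts :: "'a cmfd \<Rightarrow> 'a set" where
  "pts M \<equiv> topspace (mtop M)"

definition top_chart :: "'a topology \<Rightarrow> nat \<Rightarrow> 'a chart \<Rightarrow> bool" where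
  "top_chart T n = (\<lambda>(U, \<phi>). openin T U \<and> openin (top_of_set (Cn n)) (\<phi> ` U)
      \<and> homeomorphic_map (subtopology T U) (top_of_set (\<phi> ` U)) \<phi>)"

definition hol_transition :: "nat \<Rightarrow> 'a chart \<Rightarrow> 'a chart \<Rightarrow> bool" where
  "hol_transition n = (\<lambda>(U, \<phi>) (V, \<psi>).
      \<forall>k<n. hol_Cn n (\<phi> ` (U \<inter> V)) (\<lambda>z. \<psi> (inv_into U \<phi> z) k))"

definition complex_manifold :: "'a cmfd \<Rightarrow> bool" where
  "complex_manifold M \<longleftrightarrow>
      Hausdorff_space (mtop M) \<and> second_countable (mtop M)
    \<and> (\<forall>c\<in>atlas M. top_chart (mtop M) (mdim M) c)
    \<and> (\<Union>c\<in>atlas M. fst c) = pts M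
    \<and> (\<forall>c\<in>atlas M. \<forall>c'\<in>atlas M. hol_transition (mdim M) c c')"

text \<open>Arbitrary holomorphic charts, i.e. the members of the maximal atlas.\<close>

definition hol_chart :: "'a cmfd \<Rightarrow> 'a chart \<Rightarrow> bool" where
  "hol_chart M c \<longleftrightarrow> top_chart (mtop M) (mdim M) c
    \<and> (\<forall>c'\<in>atlas M. hol_transition (mdim M) c c' \<and> hol_transition (mdim M) c' c)"

definition hol_fun :: "'a cmfd \<Rightarrow> 'a set \<Rightarrow> ('a \<Rightarrow> complex) \<Rightarrow> bool" where
  "hol_fun M S f \<longleftrightarrow> openin (mtop M) S
    \<and> (\<forall>(U, \<phi>)\<in>atlas M. hol_Cn (mdim M) (\<phi> ` (U \<inter> S)) (\<lambda>z. f (inv_into U \<phi> z)))"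

definition hol_fun_at :: "'a cmfd \<Rightarrow> ('a \<Rightarrow> complex) \<Rightarrow> 'a \<Rightarrow> bool" where
  "hol_fun_at M f p \<longleftrightarrow> (\<exists>S. p \<in> S \<and> hol_fun M S f)"

text \<open>Continuity of F is implied: in \<^const>\<open>hol_fun\<close> the preimages of chart domains
  are required to be open.\<close>

definition hol_map :: "'a cmfd \<Rightarrow> 'b cmfd \<Rightarrow> 'a set \<Rightarrow> ('a \<Rightarrow> 'b) \<Rightarrow> bool" where
  "hol_map M N S F \<longleftrightarrow> openin (mtop M) S \<and> F ` S \<subseteq> pts N
    \<and> (\<forall>(V, \<psi>)\<in>atlas N. openin (mtop M) {p\<in>S. F p \<in> V}
        \<and> (\<forall>k<mdim N. hol_fun M {p\<in>S. F p \<in> V} (\<lambda>p. \<psi> (F p) k)))"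

definition prod_mfd :: "'a cmfd \<Rightarrow> 'b cmfd \<Rightarrow> ('a \<times> 'b) cmfd" where
  "prod_mfd M N = \<lparr> mtop = prod_topology (mtop M) (mtop N), mdim = mdim M + mdim N,
     atlas = {(U \<times> V, \<lambda>(p, q) i. if i < mdim M then \<phi> p i else \<psi> q (i - mdim M))
               | U \<phi> V \<psi>. (U, \<phi>) \<in> atlas M \<and> (V, \<psi>) \<in> atlas N} \<rparr>"

definition C_mfd :: "complex cmfd" where
  "C_mfd = \<lparr> mtop = euclidean, mdim = 1, atlas = {(UNIV, \<lambda>t i. if i = 0 then t else 0)} \<rparr>"

definition Cn_mfd :: "nat \<Rightarrow> (nat \<Rightarrow> complex) cmfd" where
  "Cn_mfd n = \<lparr> mtop = top_of_set (Cn n), mdim = n, atlas = {(Cn n, \<lambda>z. z)} \<rparr>"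


section \<open>Holomorphic tangent vectors and differential forms\<close>

text \<open>A tangent vector at p is the derivation on germs of holomorphic functions at p given by a
  holomorphic curve through p, extended by 0 to functions that are not holomorphic near p.\<close>

type_synonym 'a tvec = "('a \<Rightarrow> complex) \<Rightarrow> complex"

definition velocity :: "'a cmfd \<Rightarrow> (complex \<Rightarrow> 'a) \<Rightarrow> 'a tvec" where
  "velocity M \<gamma> = (\<lambda>f. if hol_fun_at M f (\<gamma> 0) then deriv (\<lambda>t. f (\<gamma> t)) 0 else 0)"

definition tspace :: "'a cmfd \<Rightarrow> 'a \<Rightarrow> 'a tvec set" where
  "tspace M p = {velocity M \<gamma> | \<gamma> S. 0 \<in> S \<and> hol_map C_mfd M S \<gamma> \<and> \<gamma> 0 = p}"

definition push :: "'b cmfd \<Rightarrow> ('a \<Rightarrow> 'b) \<Rightarrow> 'a \<Rightarrow> 'a tvec \<Rightarrow> 'b tvec" where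
  "push N F p v = (\<lambda>f. if hol_fun_at N f (F p) then v (\<lambda>q. f (F q)) else 0)"

definition coord_vec :: "'a cmfd \<Rightarrow> 'a chart \<Rightarrow> 'a \<Rightarrow> nat \<Rightarrow> 'a tvec" where
  "coord_vec M = (\<lambda>(U, \<phi>) p i f.
      if hol_fun_at M f p then pderiv_Cn i (\<lambda>z. f (inv_into U \<phi> z)) (\<phi> p) else 0)"

definition tlists :: "'a cmfd \<Rightarrow> nat \<Rightarrow> 'a \<Rightarrow> 'a tvec list set" where
  "tlists M k p = {vs. length vs = k \<and> set vs \<subseteq> tspace M p}"

definition alt_form :: "'a cmfd \<Rightarrow> nat \<Rightarrow> 'a \<Rightarrow> ('a tvec list \<Rightarrow> complex) \<Rightarrow> bool" where
  "alt_form M k p \<alpha> \<longleftrightarrow>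
     (\<forall>vs\<in>tlists M k p. \<forall>i<k. \<forall>u\<in>tspace M p. \<forall>w\<in>tspace M p. \<forall>a b.
        \<alpha> (vs[i := (\<lambda>f. a * u f + b * w f)]) = a * \<alpha> (vs[i := u]) + b * \<alpha> (vs[i := w]))
   \<and> (\<forall>vs\<in>tlists M k p. \<forall>i<k. \<forall>j<k. i \<noteq> j \<and> vs ! i = vs ! j \<longrightarrow> \<alpha> vs = 0)"

definition hol_form :: "'a cmfd \<Rightarrow> nat \<Rightarrow> 'a set \<Rightarrow> ('a \<Rightarrow> 'a tvec list \<Rightarrow> complex) \<Rightarrow> bool" where
  "hol_form M k S \<omega> \<longleftrightarrow> openin (mtop M) S \<and> (\<forall>p\<in>S. alt_form M k p (\<omega> p))
    \<and> (\<forall>(U, \<phi>)\<in>atlas M. \<forall>ks. length ks = k \<and> set ks \<subseteq> {..<mdim M} \<longrightarrow>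
         hol_fun M (U \<inter> S) (\<lambda>p. \<omega> p (map (coord_vec M (U, \<phi>) p) ks)))"

text \<open>Global holomorphic top forms, with value 0 off the manifold and on
  lists that are not lists of tangent vectors of the right length.\<close>

definition H0K :: "'a cmfd \<Rightarrow> ('a \<Rightarrow> 'a tvec list \<Rightarrow> complex) set" where
  "H0K M = {\<omega>. hol_form M (mdim M) (pts M) \<omega>
      \<and> (\<forall>p vs. \<not> (p \<in> pts M \<and> vs \<in> tlists M (mdim M) p) \<longrightarrow> \<omega> p vs = 0)}"

definition forms_dim :: "('a \<Rightarrow> 'a tvec list \<Rightarrow> complex) set \<Rightarrow> nat" where
  "forms_dim W = vector_space.dim (\<lambda>c \<omega> p vs. c * \<omega> p vs) W"

definition contract :: "('a \<Rightarrow> 'a tvec) \<Rightarrow> ('a \<Rightarrow> 'a tvec list \<Rightarrow> complex)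
    \<Rightarrow> 'a \<Rightarrow> 'a tvec list \<Rightarrow> complex" where
  "contract x \<omega> = (\<lambda>p vs. \<omega> p (x p # vs))"

definition iter_contract :: "nat \<Rightarrow> (nat \<Rightarrow> 'a \<Rightarrow> 'a tvec) \<Rightarrow> ('a \<Rightarrow> 'a tvec list \<Rightarrow> complex)
    \<Rightarrow> 'a \<Rightarrow> 'a tvec list \<Rightarrow> complex" where
  "iter_contract q x \<omega> = foldr (\<lambda>j. contract (x j)) [0..<q] \<omega>"

text \<open>The value of the wedge product of the differentials of the k coordinates
  z_a, ..., z_(a+k-1) on a list of k tangent vectors.\<close>

definition dz_wedge :: "('a \<Rightarrow> nat \<Rightarrow> complex) \<Rightarrow> nat \<Rightarrow> nat \<Rightarrow> 'a tvec list \<Rightarrow> complex" where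
  "dz_wedge z a k vs = Determinant.det (Matrix.mat k k (\<lambda>(i, j). (vs ! j) (\<lambda>p. z p (a + i))))"


section \<open>Holomorphic line bundles\<close>

text \<open>A line bundle is given by its fibers and by local trivialisations t, where t x is a bijection
  from the fiber at x to the complex numbers; transition functions are holomorphic and nowhere
  vanishing, and the linear structure of the fibers is the one transported by the trivialisations.\<close>

record ('x, 'l) lbundle =
  fib :: "'x \<Rightarrow> 'l set"
  trivs :: "('x set \<times> ('x \<Rightarrow> 'l \<Rightarrow> complex)) set"

definition line_bundle :: "'x cmfd \<Rightarrow> ('x, 'l) lbundle \<Rightarrow> bool" where
  "line_bundle X L \<longleftrightarrow>
     (\<forall>(U, t)\<in>trivs L. openin (mtop X) U \<and> (\<forall>x\<in>U. bij_betw (t x) (fib L x) UNIV))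
   \<and> (\<Union>c\<in>trivs L. fst c) = pts X
   \<and> (\<forall>(U, t)\<in>trivs L. \<forall>(U', t')\<in>trivs L. \<exists>g. hol_fun X (U \<inter> U') g
        \<and> (\<forall>x\<in>U \<inter> U'. g x \<noteq> 0 \<and> (\<forall>l\<in>fib L x. t' x l = g x * t x l)))"

definition lzero :: "('x, 'l) lbundle \<Rightarrow> 'x \<Rightarrow> 'l" where
  "lzero L x = (THE l. l \<in> fib L x \<and> (\<forall>(U, t)\<in>trivs L. x \<in> U \<longrightarrow> t x l = 0))"

definition ladd :: "('x, 'l) lbundle \<Rightarrow> 'x \<Rightarrow> 'l \<Rightarrow> 'l \<Rightarrow> 'l" where
  "ladd L x l l' = (THE l''. l'' \<in> fib L x \<and> (\<forall>(U, t)\<in>trivs L. x \<in> U \<longrightarrow> t x l'' = t x l + t x l'))"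

definition lscale :: "('x, 'l) lbundle \<Rightarrow> 'x \<Rightarrow> complex \<Rightarrow> 'l \<Rightarrow> 'l" where
  "lscale L x c l = (THE l'. l' \<in> fib L x \<and> (\<forall>(U, t)\<in>trivs L. x \<in> U \<longrightarrow> t x l' = c * t x l))"

definition hol_section :: "'x cmfd \<Rightarrow> ('x, 'l) lbundle \<Rightarrow> 'x set \<Rightarrow> ('x \<Rightarrow> 'l) \<Rightarrow> bool" where
  "hol_section X L S \<sigma> \<longleftrightarrow> openin (mtop X) S \<and> (\<forall>x\<in>S. \<sigma> x \<in> fib L x)
    \<and> (\<forall>(U, t)\<in>trivs L. hol_fun X (U \<inter> S) (\<lambda>x. t x (\<sigma> x)))"

definition frame :: "'x cmfd \<Rightarrow> ('x, 'l) lbundle \<Rightarrow> 'x set \<Rightarrow> ('x \<Rightarrow> 'l) \<Rightarrow> bool" where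
  "frame X L S e \<longleftrightarrow> hol_section X L S e \<and> (\<forall>x\<in>S. e x \<noteq> lzero L x)"

definition H0 :: "'x cmfd \<Rightarrow> ('x, 'l) lbundle \<Rightarrow> ('x \<Rightarrow> 'l) set" where
  "H0 X L = {\<sigma>. hol_section X L (pts X) \<sigma> \<and> (\<forall>x. x \<notin> pts X \<longrightarrow> \<sigma> x = undefined)}"

definition bpf :: "'x cmfd \<Rightarrow> ('x, 'l) lbundle \<Rightarrow> bool" where
  "bpf X L \<longleftrightarrow> (\<forall>x\<in>pts X. \<exists>\<sigma>\<in>H0 X L. \<sigma> x \<noteq> lzero L x)"

definition lb_iso :: "'x cmfd \<Rightarrow> ('x, 'l) lbundle \<Rightarrow> ('x, 'k) lbundle \<Rightarrow> ('x \<Rightarrow> 'l \<Rightarrow> 'k) \<Rightarrow> bool" where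
  "lb_iso X L L' \<Theta> \<longleftrightarrow> (\<forall>x\<in>pts X. \<Theta> x ` fib L x \<subseteq> fib L' x)
    \<and> (\<forall>(U, t)\<in>trivs L. \<forall>(U', t')\<in>trivs L'. \<exists>g. hol_fun X (U \<inter> U') g
        \<and> (\<forall>x\<in>U \<inter> U'. g x \<noteq> 0 \<and> (\<forall>l\<in>fib L x. t' x (\<Theta> x l) = g x * t x l)))"

definition trivial_lb :: "'x cmfd \<Rightarrow> ('x, complex) lbundle" where
  "trivial_lb X = \<lparr> fib = (\<lambda>x. UNIV), trivs = {(pts X, \<lambda>x v. v)} \<rparr>"

definition canonical_lb :: "'x cmfd \<Rightarrow> ('x, 'x tvec list \<Rightarrow> complex) lbundle" where
  "canonical_lb X = \<lparr>
     fib = (\<lambda>x. {\<alpha>. alt_form X (mdim X) x \<alpha> \<and> (\<forall>vs. vs \<notin> tlists X (mdim X) x \<longrightarrow> \<alpha> vs = 0)}),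
     trivs = {(U, \<lambda>x \<alpha>. \<alpha> (map (coord_vec X (U, \<phi>) x) [0..<mdim X])) | U \<phi>. (U, \<phi>) \<in> atlas X} \<rparr>"

text \<open>The bundle L + K, whose fiber at x consists of the alternating forms of top degree
  on the tangent space at x with values in the fiber of L.\<close>

definition plus_K :: "'x cmfd \<Rightarrow> ('x, 'l) lbundle \<Rightarrow> ('x, 'x tvec list \<Rightarrow> 'l) lbundle" where
  "plus_K X L = \<lparr>
     fib = (\<lambda>x. {\<tau>. (\<forall>vs\<in>tlists X (mdim X) x. \<tau> vs \<in> fib L x)
                  \<and> (\<forall>(U, t)\<in>trivs L. x \<in> U \<longrightarrow> alt_form X (mdim X) x (\<lambda>vs. t x (\<tau> vs)))
                  \<and> (\<forall>vs. vs \<notin> tlists X (mdim X) x \<longrightarrow> \<tau> vs = undefined)}),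
     trivs = {(U \<inter> U', \<lambda>x \<tau>. t x (\<tau> (map (coord_vec X (U', \<phi>) x) [0..<mdim X])))
                | U t U' \<phi>. (U, t) \<in> trivs L \<and> (U', \<phi>) \<in> atlas X} \<rparr>"

text \<open>The element l times \<alpha> of the fiber of L + K.\<close>

definition tensor_K :: "'x cmfd \<Rightarrow> ('x, 'l) lbundle \<Rightarrow> 'x \<Rightarrow> 'l \<Rightarrow> ('x tvec list \<Rightarrow> complex)
    \<Rightarrow> 'x tvec list \<Rightarrow> 'l" where
  "tensor_K X L x l \<alpha> = (\<lambda>vs. if vs \<in> tlists X (mdim X) x then lscale L x (\<alpha> vs) l else undefined)"

text \<open>\<mu> exhibits L' as the tensor product of L_0, ..., L_(s-1): on fibers, \<mu> is multilinear and
  nonzero, and it is holomorphic. So \<mu> x l is the product of l_0, ..., l_(s-1).\<close>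

definition tensor_iso :: "'x cmfd \<Rightarrow> nat \<Rightarrow> (nat \<Rightarrow> ('x, 'l) lbundle) \<Rightarrow> ('x, 'k) lbundle
    \<Rightarrow> ('x \<Rightarrow> (nat \<Rightarrow> 'l) \<Rightarrow> 'k) \<Rightarrow> bool" where
  "tensor_iso X s L L' \<mu> \<longleftrightarrow>
     (\<forall>x\<in>pts X. \<forall>l\<in>Pi {..<s} (\<lambda>i. fib (L i) x). \<mu> x l \<in> fib L' x)
   \<and> (\<forall>Us ts. \<forall>(U, t)\<in>trivs L'. (\<forall>i<s. (Us i, ts i) \<in> trivs (L i)) \<longrightarrow>
        (\<exists>a. hol_fun X (U \<inter> (\<Inter>i<s. Us i)) a
           \<and> (\<forall>x\<in>U \<inter> (\<Inter>i<s. Us i). a x \<noteq> 0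
                \<and> (\<forall>l\<in>Pi {..<s} (\<lambda>i. fib (L i) x). t x (\<mu> x l) = a x * (\<Prod>i<s. ts i x (l i))))))"

definition section_prod :: "'x cmfd \<Rightarrow> ('x \<Rightarrow> (nat \<Rightarrow> 'l) \<Rightarrow> 'k) \<Rightarrow> (nat \<Rightarrow> 'x \<Rightarrow> 'l) \<Rightarrow> 'x \<Rightarrow> 'k" where
  "section_prod X \<mu> \<sigma> = (\<lambda>x\<in>pts X. \<mu> x (\<lambda>i. \<sigma> i x))"


section \<open>Lie groups, principal bundles and CY structures\<close>

definition complex_lie_group :: "'g cmfd \<Rightarrow> 'g monoid \<Rightarrow> bool" where
  "complex_lie_group Gm G \<longleftrightarrow> complex_manifold Gm \<and> Group.group G \<and> carrier G = pts Gm
    \<and> hol_map (prod_mfd Gm Gm) Gm (pts Gm \<times> pts Gm) (\<lambda>(g, h). g \<otimes>\<^bsub>G\<^esub> h)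
    \<and> hol_map Gm Gm (pts Gm) (\<lambda>g. inv\<^bsub>G\<^esub> g)"

definition hol_left_action :: "'g cmfd \<Rightarrow> 'g monoid \<Rightarrow> 'm cmfd \<Rightarrow> ('g \<Rightarrow> 'm \<Rightarrow> 'm) \<Rightarrow> bool" where
  "hol_left_action Gm G M a \<longleftrightarrow> hol_map (prod_mfd Gm M) M (pts Gm \<times> pts M) (\<lambda>(g, m). a g m)
    \<and> (\<forall>m\<in>pts M. a \<one>\<^bsub>G\<^esub> m = m
        \<and> (\<forall>g\<in>carrier G. \<forall>g'\<in>carrier G. a (g \<otimes>\<^bsub>G\<^esub> g') m = a g (a g' m)))"

definition equivariant_lb :: "'g cmfd \<Rightarrow> 'g monoid \<Rightarrow> 'x cmfd \<Rightarrow> ('g \<Rightarrow> 'x \<Rightarrow> 'x)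
    \<Rightarrow> ('x, 'l) lbundle \<Rightarrow> ('g \<Rightarrow> 'x \<Rightarrow> 'l \<Rightarrow> 'l) \<Rightarrow> bool" where
  "equivariant_lb Gm G X a L b \<longleftrightarrow> line_bundle X L
    \<and> (\<forall>x\<in>pts X. \<forall>l\<in>fib L x. b \<one>\<^bsub>G\<^esub> x l = l
        \<and> (\<forall>g\<in>carrier G. b g x l \<in> fib L (a g x)
            \<and> (\<forall>g'\<in>carrier G. b (g' \<otimes>\<^bsub>G\<^esub> g) x l = b g' (a g x) (b g x l))))
    \<and> (\<forall>(U, t)\<in>trivs L. \<forall>(U', t')\<in>trivs L.
        let S = {(g, x). g \<in> carrier G \<and> x \<in> U \<and> a g x \<in> U'}
        in \<exists>c. hol_fun (prod_mfd Gm X) S c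
             \<and> (\<forall>(g, x)\<in>S. \<forall>l\<in>fib L x. t' (a g x) (b g x l) = c (g, x) * t x l))"

text \<open>The data of an equivariant principal bundle. The structure group is written as acting on the
  right, m h; its left action sends m to ract m (inv h). bact is the action on the base.\<close>

record ('g, 'h, 'm, 'x) pbundle =
  Gmfd :: "'g cmfd"
  Ggrp :: "'g monoid"
  Hmfd :: "'h cmfd"
  Hgrp :: "'h monoid"
  total :: "'m cmfd"
  base :: "'x cmfd"
  lact :: "'g \<Rightarrow> 'm \<Rightarrow> 'm"
  ract :: "'m \<Rightarrow> 'h \<Rightarrow> 'm"
  bact :: "'g \<Rightarrow> 'x \<Rightarrow> 'x"
  proj :: "'m \<Rightarrow> 'x"

definition free_proper_right_action ::
    "'h cmfd \<Rightarrow> 'h monoid \<Rightarrow> 'm cmfd \<Rightarrow> ('m \<Rightarrow> 'h \<Rightarrow> 'm) \<Rightarrow> bool" where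
  "free_proper_right_action Hm H M r \<longleftrightarrow>
     hol_left_action Hm H M (\<lambda>h m. r m (inv\<^bsub>H\<^esub> h))
   \<and> (\<forall>m\<in>pts M. \<forall>h\<in>carrier H. r m h = m \<longrightarrow> h = \<one>\<^bsub>H\<^esub>)
   \<and> proper_map (prod_topology (mtop M) (mtop Hm)) (prod_topology (mtop M) (mtop M))
        (\<lambda>(m, h). (m, r m h))"

text \<open>The complex structure of X = M/H is the quotient structure: near every point of X there is
  a local section s such that (x, h) is mapped to s(x) h biholomorphically onto the preimage of U.\<close>

definition hol_quotient :: "('g, 'h, 'm, 'x) pbundle \<Rightarrow> bool" where
  "hol_quotient P \<longleftrightarrow>
     hol_map (total P) (base P) (pts (total P)) (proj P)
   \<and> proj P ` pts (total P) = pts (base P)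
   \<and> (\<forall>m\<in>pts (total P). \<forall>m'\<in>pts (total P).
        proj P m = proj P m' \<longleftrightarrow> (\<exists>h\<in>carrier (Hgrp P). m' = ract P m h))
   \<and> (\<forall>x\<in>pts (base P). \<exists>U s k. x \<in> U \<and> hol_map (base P) (total P) U s
        \<and> (\<forall>y\<in>U. proj P (s y) = y)
        \<and> hol_map (prod_mfd (base P) (Hmfd P)) (total P) (U \<times> pts (Hmfd P)) (\<lambda>(y, h). ract P (s y) h)
        \<and> hol_map (total P) (Hmfd P) {m\<in>pts (total P). proj P m \<in> U} k
        \<and> (\<forall>m\<in>pts (total P). proj P m \<in> U \<longrightarrow> m = ract P (s (proj P m)) (k m)))"

definition equivariant_principal_bundle :: "('g, 'h, 'm, 'x) pbundle \<Rightarrow> bool" where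
  "equivariant_principal_bundle P \<longleftrightarrow>
     complex_lie_group (Gmfd P) (Ggrp P) \<and> complex_lie_group (Hmfd P) (Hgrp P)
   \<and> complex_manifold (total P) \<and> complex_manifold (base P)
   \<and> hol_left_action (Gmfd P) (Ggrp P) (total P) (lact P)
   \<and> hol_left_action (Gmfd P) (Ggrp P) (base P) (bact P)
   \<and> free_proper_right_action (Hmfd P) (Hgrp P) (total P) (ract P)
   \<and> (\<forall>g\<in>carrier (Ggrp P). \<forall>m\<in>pts (total P).
        proj P (lact P g m) = bact P g (proj P m)
      \<and> (\<forall>h\<in>carrier (Hgrp P). lact P g (ract P m h) = ract P (lact P g m) h))
   \<and> hol_quotient P"

text \<open>A complex Lie subgroup of the automorphism group of X is given by a Lie group acting
  holomorphically and effectively on X.\<close>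

definition effective_on :: "'g monoid \<Rightarrow> 'x cmfd \<Rightarrow> ('g \<Rightarrow> 'x \<Rightarrow> 'x) \<Rightarrow> bool" where
  "effective_on G X a \<longleftrightarrow> (\<forall>g\<in>carrier G. (\<forall>x\<in>pts X. a g x = x) \<longrightarrow> g = \<one>\<^bsub>G\<^esub>)"

definition hol_character :: "'h cmfd \<Rightarrow> 'h monoid \<Rightarrow> ('h \<Rightarrow> complex) \<Rightarrow> bool" where
  "hol_character Hm H \<xi> \<longleftrightarrow> hol_fun Hm (pts Hm) \<xi> \<and> (\<forall>h\<in>carrier H. \<xi> h \<noteq> 0)
    \<and> (\<forall>h\<in>carrier H. \<forall>k\<in>carrier H. \<xi> (h \<otimes>\<^bsub>H\<^esub> k) = \<xi> h * \<xi> k)"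

definition CY_structure :: "('g, 'h, 'm, 'x) pbundle \<Rightarrow> ('m \<Rightarrow> 'm tvec list \<Rightarrow> complex)
    \<Rightarrow> ('h \<Rightarrow> complex) \<Rightarrow> bool" where
  "CY_structure P \<omega> \<xi> \<longleftrightarrow>
     (let M = total P; n = mdim M in
       \<omega> \<in> H0K M \<and> (\<forall>m\<in>pts M. \<exists>vs\<in>tlists M n m. \<omega> m vs \<noteq> 0)
     \<and> (\<forall>g\<in>carrier (Ggrp P). \<forall>m\<in>pts M. \<forall>vs\<in>tlists M n m.
          \<omega> (lact P g m) (map (push M (lact P g) m) vs) = \<omega> m vs)
     \<and> hol_character (Hmfd P) (Hgrp P) \<xi>
     \<and> (\<forall>h\<in>carrier (Hgrp P). \<forall>m\<in>pts M. \<forall>vs\<in>tlists M n m.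
          \<omega> (ract P m h) (map (push M (\<lambda>m'. ract P m' h) m) vs) = \<xi> h * \<omega> m vs))"

text \<open>The scalar by which Ad(h) acts on the top exterior power of the Lie algebra,
  i.e. by which pullback along Ad(h) multiplies every form of top degree on it.\<close>

definition adj_char :: "('g, 'h, 'm, 'x) pbundle \<Rightarrow> 'h \<Rightarrow> complex" where
  "adj_char P h = (let H = Hgrp P; Hm = Hmfd P; q = mdim Hm in
     THE c. \<forall>\<alpha>. alt_form Hm q \<one>\<^bsub>H\<^esub> \<alpha> \<longrightarrow> (\<forall>vs\<in>tlists Hm q \<one>\<^bsub>H\<^esub>.
       \<alpha> (map (push Hm (\<lambda>k. h \<otimes>\<^bsub>H\<^esub> k \<otimes>\<^bsub>H\<^esub> inv\<^bsub>H\<^esub> h) \<one>\<^bsub>H\<^esub>) vs) = c * \<alpha> vs))"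

text \<open>The curve \<gamma>_j is exp(t a_j) for a basis a_0, ..., a_(q-1) of the Lie algebra.\<close>

definition independent_generated_fields :: "('g, 'h, 'm, 'x) pbundle \<Rightarrow> (nat \<Rightarrow> 'm \<Rightarrow> 'm tvec) \<Rightarrow> bool" where
  "independent_generated_fields P x \<longleftrightarrow> (let H = Hgrp P; Hm = Hmfd P; q = mdim Hm in
     \<exists>\<gamma> :: nat \<Rightarrow> complex \<Rightarrow> _.
       (\<forall>j<q. hol_map C_mfd Hm UNIV (\<gamma> j) \<and> (\<forall>t t'. \<gamma> j (t + t') = \<gamma> j t \<otimes>\<^bsub>H\<^esub> \<gamma> j t'))
     \<and> (\<forall>c. (\<forall>f. (\<Sum>j<q. c j * velocity Hm (\<gamma> j) f) = 0) \<longrightarrow> (\<forall>j<q. c j = 0))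
     \<and> (\<forall>j<q. \<forall>m\<in>pts (total P). x j m = velocity (total P) (\<lambda>t. ract P m (\<gamma> j t))))"

definition assoc_class :: "('g, 'h, 'm, 'x) pbundle \<Rightarrow> ('h \<Rightarrow> complex) \<Rightarrow> 'm \<Rightarrow> complex
    \<Rightarrow> ('m \<times> complex) set" where
  "assoc_class P \<xi> m v = {(ract P m (inv\<^bsub>Hgrp P\<^esub> h), \<xi> h * v) | h. h \<in> carrier (Hgrp P)}"

text \<open>The quotient of M times C by H. The trivialisation attached to a local section s
  of M sends [s(x), v] to v.\<close>

definition assoc_lb :: "('g, 'h, 'm, 'x) pbundle \<Rightarrow> ('h \<Rightarrow> complex) \<Rightarrow> ('x, ('m \<times> complex) set) lbundle" where
  "assoc_lb P \<xi> = \<lparr>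
     fib = (\<lambda>x. {assoc_class P \<xi> m v | m v. m \<in> pts (total P) \<and> proj P m = x}),
     trivs = {(U, \<lambda>x l. THE v. (s x, v) \<in> l) | U s.
                hol_map (base P) (total P) U s \<and> (\<forall>x\<in>U. proj P (s x) = x)} \<rparr>"

text \<open>The function on M representing a section.\<close>

definition section_fun :: "('g, 'h, 'm, 'x) pbundle \<Rightarrow> ('h \<Rightarrow> complex) \<Rightarrow> ('x \<Rightarrow> ('m \<times> complex) set)
    \<Rightarrow> 'm \<Rightarrow> complex" where
  "section_fun P \<xi> \<psi> m = (THE v. \<psi> (proj P m) = assoc_class P \<xi> m v)"

text \<open>Let \<Theta> identify the bundle of the character \<eta> with K. A section \<tau> of (bundle of chi) + K then
  corresponds to a section of the bundle of the character chi times \<eta>: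
  [m, v] times \<Theta>[m, w] corresponds to [m, v w].\<close>

definition untwist :: "('g, 'h, 'm, 'x) pbundle \<Rightarrow> ('h \<Rightarrow> complex) \<Rightarrow> ('h \<Rightarrow> complex)
    \<Rightarrow> ('x \<Rightarrow> ('m \<times> complex) set \<Rightarrow> 'x tvec list \<Rightarrow> complex)
    \<Rightarrow> ('x \<Rightarrow> 'x tvec list \<Rightarrow> ('m \<times> complex) set) \<Rightarrow> 'x \<Rightarrow> ('m \<times> complex) set" where
  "untwist P chi \<eta> \<Theta> \<tau> = (\<lambda>x\<in>pts (base P). THE l. \<exists>m v w. m \<in> pts (total P) \<and> proj P m = x
      \<and> \<tau> x = tensor_K (base P) (assoc_lb P chi) x (assoc_class P chi m v) (\<Theta> x (assoc_class P \<eta> m w))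
      \<and> l = assoc_class P (\<lambda>h. chi h * \<eta> h) m (v * w))"

definition untwist_fun :: "('g, 'h, 'm, 'x) pbundle \<Rightarrow> ('h \<Rightarrow> complex) \<Rightarrow> ('h \<Rightarrow> complex)
    \<Rightarrow> ('x \<Rightarrow> ('m \<times> complex) set \<Rightarrow> 'x tvec list \<Rightarrow> complex)
    \<Rightarrow> ('x \<Rightarrow> 'x tvec list \<Rightarrow> ('m \<times> complex) set) \<Rightarrow> 'm \<Rightarrow> complex" where
  "untwist_fun P chi \<eta> \<Theta> \<tau> = section_fun P (\<lambda>h. chi h * \<eta> h) (untwist P chi \<eta> \<Theta> \<tau>)"

text \<open>The form on X whose pullback to M is the basic form \<alpha> of degree dim X.\<close>

definition basic_descent :: "('g, 'h, 'm, 'x) pbundle \<Rightarrow> ('m \<Rightarrow> 'm tvec list \<Rightarrow> complex)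
    \<Rightarrow> 'x \<Rightarrow> 'x tvec list \<Rightarrow> complex" where
  "basic_descent P \<alpha> = (\<lambda>x us. THE c. \<forall>m\<in>pts (total P). proj P m = x \<longrightarrow>
      (\<forall>vs\<in>tlists (total P) (mdim (base P)) m. map (push (base P) (proj P) m) vs = us \<longrightarrow> \<alpha> m vs = c))"


section \<open>Complete intersections, adjunction and the Poincare residue\<close>

text \<open>The space V* of tuples of sections; indices run over 0, ..., s-1.\<close>

definition sec_tuples :: "'x cmfd \<Rightarrow> nat \<Rightarrow> (nat \<Rightarrow> ('x, 'l) lbundle) \<Rightarrow> (nat \<Rightarrow> 'x \<Rightarrow> 'l) set" where
  "sec_tuples X s L = PiE {..<s} (\<lambda>i. H0 X (L i))"

definition tuple_add :: "'x cmfd \<Rightarrow> nat \<Rightarrow> (nat \<Rightarrow> ('x, 'l) lbundle) \<Rightarrow> (nat \<Rightarrow> 'x \<Rightarrow> 'l)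
    \<Rightarrow> (nat \<Rightarrow> 'x \<Rightarrow> 'l) \<Rightarrow> nat \<Rightarrow> 'x \<Rightarrow> 'l" where
  "tuple_add X s L \<sigma> \<sigma>' = (\<lambda>i\<in>{..<s}. \<lambda>x\<in>pts X. ladd (L i) x (\<sigma> i x) (\<sigma>' i x))"

definition tuple_scale :: "'x cmfd \<Rightarrow> nat \<Rightarrow> (nat \<Rightarrow> ('x, 'l) lbundle) \<Rightarrow> complex
    \<Rightarrow> (nat \<Rightarrow> 'x \<Rightarrow> 'l) \<Rightarrow> nat \<Rightarrow> 'x \<Rightarrow> 'l" where
  "tuple_scale X s L c \<sigma> = (\<lambda>i\<in>{..<s}. \<lambda>x\<in>pts X. lscale (L i) x c (\<sigma> i x))"

text \<open>The affine combination \<rho> + c_0 T_0 + ... + c_(k-1) T_(k-1).\<close>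

primrec tuple_affine :: "'x cmfd \<Rightarrow> nat \<Rightarrow> (nat \<Rightarrow> ('x, 'l) lbundle) \<Rightarrow> (nat \<Rightarrow> 'x \<Rightarrow> 'l)
    \<Rightarrow> (nat \<Rightarrow> nat \<Rightarrow> 'x \<Rightarrow> 'l) \<Rightarrow> (nat \<Rightarrow> complex) \<Rightarrow> nat \<Rightarrow> nat \<Rightarrow> 'x \<Rightarrow> 'l" where
  "tuple_affine X s L \<rho> T c 0 = \<rho>"
| "tuple_affine X s L \<rho> T c (Suc k) =
     tuple_add X s L (tuple_affine X s L \<rho> T c k) (tuple_scale X s L (c k) (T k))"

inductive polynomial_on_tuples :: "'x cmfd \<Rightarrow> nat \<Rightarrow> (nat \<Rightarrow> ('x, 'l) lbundle)
    \<Rightarrow> ((nat \<Rightarrow> 'x \<Rightarrow> 'l) \<Rightarrow> complex) \<Rightarrow> bool" for X s L where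
  const: "polynomial_on_tuples X s L (\<lambda>\<sigma>. c)"
| linear: "\<lbrakk>\<And>\<sigma> \<sigma>'. \<sigma> \<in> sec_tuples X s L \<Longrightarrow> \<sigma>' \<in> sec_tuples X s L
             \<Longrightarrow> f (tuple_add X s L \<sigma> \<sigma>') = f \<sigma> + f \<sigma>';
           \<And>c \<sigma>. \<sigma> \<in> sec_tuples X s L \<Longrightarrow> f (tuple_scale X s L c \<sigma>) = c * f \<sigma>\<rbrakk>
          \<Longrightarrow> polynomial_on_tuples X s L f"
| add: "\<lbrakk>polynomial_on_tuples X s L f; polynomial_on_tuples X s L g\<rbrakk>
          \<Longrightarrow> polynomial_on_tuples X s L (\<lambda>\<sigma>. f \<sigma> + g \<sigma>)"
| mult: "\<lbrakk>polynomial_on_tuples X s L f; polynomial_on_tuples X s L g\<rbrakk>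
          \<Longrightarrow> polynomial_on_tuples X s L (\<lambda>\<sigma>. f \<sigma> * g \<sigma>)"

text \<open>Q holds for general tuples: off the zero set of a nonzero polynomial.\<close>

definition for_general_tuples :: "'x cmfd \<Rightarrow> nat \<Rightarrow> (nat \<Rightarrow> ('x, 'l) lbundle)
    \<Rightarrow> ((nat \<Rightarrow> 'x \<Rightarrow> 'l) \<Rightarrow> bool) \<Rightarrow> bool" where
  "for_general_tuples X s L Q \<longleftrightarrow> (\<exists>F. polynomial_on_tuples X s L F
      \<and> (\<exists>\<sigma>\<in>sec_tuples X s L. F \<sigma> \<noteq> 0) \<and> (\<forall>\<sigma>\<in>sec_tuples X s L. F \<sigma> \<noteq> 0 \<longrightarrow> Q \<sigma>))"

text \<open>The compact-open topology. As X is compact, V* is finite-dimensional and this is its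
  standard vector space topology.\<close>

definition tuple_topology :: "'x cmfd \<Rightarrow> nat \<Rightarrow> (nat \<Rightarrow> ('x, 'l) lbundle) \<Rightarrow> (nat \<Rightarrow> 'x \<Rightarrow> 'l) topology" where
  "tuple_topology X s L = topology_generated_by (insert (sec_tuples X s L)
     {{\<sigma>\<in>sec_tuples X s L. \<forall>x\<in>K. t x (\<sigma> i x) \<in> W} | i U t K W.
        i < s \<and> (U, t) \<in> trivs (L i) \<and> K \<subseteq> U \<and> compactin (mtop X) K \<and> open W})"

definition zero_locus :: "'x cmfd \<Rightarrow> nat \<Rightarrow> (nat \<Rightarrow> ('x, 'l) lbundle) \<Rightarrow> (nat \<Rightarrow> 'x \<Rightarrow> 'l) \<Rightarrow> 'x set" where
  "zero_locus X s L \<sigma> = {x\<in>pts X. \<forall>i<s. \<sigma> i x = lzero (L i) x}"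

text \<open>Holomorphic coordinates z on U and frames e_i with \<sigma>_i = z_i e_i for all i < s.\<close>

definition adapted :: "'x cmfd \<Rightarrow> nat \<Rightarrow> (nat \<Rightarrow> ('x, 'l) lbundle) \<Rightarrow> (nat \<Rightarrow> 'x \<Rightarrow> 'l)
    \<Rightarrow> 'x set \<Rightarrow> ('x \<Rightarrow> nat \<Rightarrow> complex) \<Rightarrow> (nat \<Rightarrow> 'x \<Rightarrow> 'l) \<Rightarrow> bool" where
  "adapted X s L \<sigma> U z e \<longleftrightarrow> hol_chart X (U, z)
    \<and> (\<forall>i<s. frame X (L i) U (e i) \<and> (\<forall>x\<in>U. \<sigma> i x = lscale (L i) x (z x i) (e i x)))"

text \<open>The complete intersection is smooth of codimension s (as a scheme): it is locally cut out
  by s members of a coordinate system.\<close>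

definition smooth_ci :: "'x cmfd \<Rightarrow> nat \<Rightarrow> (nat \<Rightarrow> ('x, 'l) lbundle) \<Rightarrow> (nat \<Rightarrow> 'x \<Rightarrow> 'l) \<Rightarrow> bool" where
  "smooth_ci X s L \<sigma> \<longleftrightarrow> s \<le> mdim X
    \<and> (\<forall>p\<in>zero_locus X s L \<sigma>. \<exists>U z e. p \<in> U \<and> adapted X s L \<sigma> U z e)"

definition smooth_tuples :: "'x cmfd \<Rightarrow> nat \<Rightarrow> (nat \<Rightarrow> ('x, 'l) lbundle) \<Rightarrow> (nat \<Rightarrow> 'x \<Rightarrow> 'l) set" where
  "smooth_tuples X s L = {\<sigma>\<in>sec_tuples X s L. smooth_ci X s L \<sigma>}"

definition ci_mfd :: "'x cmfd \<Rightarrow> nat \<Rightarrow> (nat \<Rightarrow> ('x, 'l) lbundle) \<Rightarrow> (nat \<Rightarrow> 'x \<Rightarrow> 'l) \<Rightarrow> 'x cmfd" where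
  "ci_mfd X s L \<sigma> = \<lparr> mtop = subtopology (mtop X) (zero_locus X s L \<sigma>), mdim = mdim X - s,
     atlas = {(U \<inter> zero_locus X s L \<sigma>, \<lambda>x i. z x (s + i)) | U z e. adapted X s L \<sigma> U z e} \<rparr>"

text \<open>In adapted coordinates, g e_0 ... e_(s-1) dz_0 ... dz_(d-1) is sent to
  g dz_s ... dz_(d-1) restricted to the complete intersection.\<close>

definition adjunction_map :: "'x cmfd \<Rightarrow> nat \<Rightarrow> (nat \<Rightarrow> ('x, 'l) lbundle) \<Rightarrow> ('x, 'k) lbundle
    \<Rightarrow> ('x \<Rightarrow> (nat \<Rightarrow> 'l) \<Rightarrow> 'k) \<Rightarrow> (nat \<Rightarrow> 'x \<Rightarrow> 'l) \<Rightarrow> ('x \<Rightarrow> 'x tvec list \<Rightarrow> 'k)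
    \<Rightarrow> 'x \<Rightarrow> 'x tvec list \<Rightarrow> complex" where
  "adjunction_map X s L L' \<mu> \<sigma> \<tau> = (\<lambda>p vs. let d = mdim X; Y = ci_mfd X s L \<sigma> in
     if p \<in> pts Y \<and> vs \<in> tlists Y (d - s) p
     then THE a. \<exists>U z e g. p \<in> U \<and> adapted X s L \<sigma> U z e \<and> hol_fun X U g
        \<and> (\<forall>x\<in>U. \<forall>us\<in>tlists X d x.
              \<tau> x us = lscale L' x (g x * dz_wedge z 0 d us) (\<mu> x (\<lambda>i. e i x)))
        \<and> a = g p * dz_wedge z s (d - s) vs
     else 0)"

text \<open>Residue of a d-form \<beta> on the complement of the divisors; in adapted coordinates z_i is a
  local equation of the i-th divisor.\<close>

definition poincare_residue :: "'x cmfd \<Rightarrow> nat \<Rightarrow> (nat \<Rightarrow> ('x, 'l) lbundle) \<Rightarrow> (nat \<Rightarrow> 'x \<Rightarrow> 'l)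
    \<Rightarrow> ('x \<Rightarrow> 'x tvec list \<Rightarrow> complex) \<Rightarrow> 'x \<Rightarrow> 'x tvec list \<Rightarrow> complex" where
  "poincare_residue X s L \<sigma> \<beta> = (\<lambda>p vs. let d = mdim X; Y = ci_mfd X s L \<sigma> in
     if p \<in> pts Y \<and> vs \<in> tlists Y (d - s) p
     then THE a. \<exists>U z e g. p \<in> U \<and> adapted X s L \<sigma> U z e \<and> hol_fun X U g
        \<and> (\<forall>x\<in>U. (\<forall>i<s. z x i \<noteq> 0) \<longrightarrow> (\<forall>us\<in>tlists X d x.
              \<beta> x us = g x / (\<Prod>i<s. z x i) * dz_wedge z 0 d us))
        \<and> a = g p * dz_wedge z s (d - s) vs
     else 0)"

definition locally_constant_genus :: "'x cmfd \<Rightarrow> nat \<Rightarrow> (nat \<Rightarrow> ('x, 'l) lbundle) \<Rightarrow> bool" where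
  "locally_constant_genus X s L \<longleftrightarrow> (\<forall>\<sigma>\<in>smooth_tuples X s L. \<exists>N.
     openin (tuple_topology X s L) N \<and> \<sigma> \<in> N
     \<and> (\<forall>\<sigma>'\<in>N \<inter> smooth_tuples X s L.
          forms_dim (H0K (ci_mfd X s L \<sigma>')) = forms_dim (H0K (ci_mfd X s L \<sigma>))))"

text \<open>Holomorphic sections over B of the bundle with fibers H^0(Y_\<sigma>, K): families of forms that are
  locally induced by a family F of (d-s)-forms on open subsets of X depending
  holomorphically on the parameter \<sigma> and the point x. Holomorphy on (an open subset of)
  V* times X is tested on the finite-dimensional affine parametrisations of V*.\<close>

definition hodge_sections :: "'x cmfd \<Rightarrow> nat \<Rightarrow> (nat \<Rightarrow> ('x, 'l) lbundle)
    \<Rightarrow> ((nat \<Rightarrow> 'x \<Rightarrow> 'l) \<Rightarrow> 'x \<Rightarrow> 'x tvec list \<Rightarrow> complex) set" where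
  "hodge_sections X s L = {\<eta> \<in> PiE (smooth_tuples X s L) (\<lambda>\<sigma>. H0K (ci_mfd X s L \<sigma>)).
     \<forall>\<sigma>0\<in>smooth_tuples X s L. \<forall>p\<in>zero_locus X s L \<sigma>0. \<exists>N S F.
       openin (tuple_topology X s L) N \<and> \<sigma>0 \<in> N \<and> openin (mtop X) S \<and> p \<in> S
     \<and> (\<forall>\<sigma>\<in>N \<inter> smooth_tuples X s L. \<forall>x\<in>S \<inter> zero_locus X s L \<sigma>.
          \<forall>vs\<in>tlists (ci_mfd X s L \<sigma>) (mdim X - s) x. \<eta> \<sigma> x vs = F \<sigma> x (map (push X (\<lambda>y. y) x) vs))
     \<and> (\<forall>\<sigma>\<in>N. \<forall>x\<in>S. alt_form X (mdim X - s) x (F \<sigma> x))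
     \<and> (\<forall>(U, \<phi>)\<in>atlas X. \<forall>ks. length ks = mdim X - s \<and> set ks \<subseteq> {..<mdim X} \<longrightarrow>
          (\<forall>k T. \<forall>\<rho>\<in>sec_tuples X s L. (\<forall>j<k. T j \<in> sec_tuples X s L) \<longrightarrow>
            hol_fun (prod_mfd (Cn_mfd k) X)
              {(c, x). c \<in> Cn k \<and> tuple_affine X s L \<rho> T c k \<in> N \<and> x \<in> S \<inter> U}
              (\<lambda>(c, x). F (tuple_affine X s L \<rho> T c k) x (map (coord_vec X (U, \<phi>) x) ks))))}"

definition residue_map :: "'x cmfd \<Rightarrow> nat \<Rightarrow> (nat \<Rightarrow> ('x, 'l) lbundle) \<Rightarrow> ('x, 'k) lbundle
    \<Rightarrow> ('x \<Rightarrow> (nat \<Rightarrow> 'l) \<Rightarrow> 'k) \<Rightarrow> ('x \<Rightarrow> 'x tvec list \<Rightarrow> 'k)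
    \<Rightarrow> (nat \<Rightarrow> 'x \<Rightarrow> 'l) \<Rightarrow> 'x \<Rightarrow> 'x tvec list \<Rightarrow> complex" where
  "residue_map X s L L' \<mu> \<tau> = (\<lambda>\<sigma>\<in>smooth_tuples X s L. adjunction_map X s L L' \<mu> \<sigma> \<tau>)"


section \<open>The standing assumptions\<close>

definition standing_assumptions :: "('g, 'h, 'm, 'x) pbundle \<Rightarrow> nat \<Rightarrow> (nat \<Rightarrow> ('x, 'l) lbundle)
    \<Rightarrow> (nat \<Rightarrow> 'g \<Rightarrow> 'x \<Rightarrow> 'l \<Rightarrow> 'l) \<Rightarrow> ('h \<Rightarrow> complex)
    \<Rightarrow> ('x \<Rightarrow> (nat \<Rightarrow> 'l) \<Rightarrow> ('m \<times> complex) set) \<Rightarrow> bool" where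
  "standing_assumptions P s L b chi \<mu> \<longleftrightarrow> (let X = base P in
     compact_space (mtop X) \<and> connected_space (mtop X)
   \<and> effective_on (Ggrp P) X (bact P)
   \<and> s < mdim X
   \<and> (\<forall>i<s. equivariant_lb (Gmfd P) (Ggrp P) X (bact P) (L i) (b i)
          \<and> \<not> (\<exists>\<Theta>. lb_iso X (L i) (trivial_lb X) \<Theta>)
          \<and> bpf X (L i))
   \<and> hol_character (Hmfd P) (Hgrp P) chi
   \<and> tensor_iso X s L (assoc_lb P chi) \<mu>
   \<and> (\<exists>\<tau>\<in>H0 X (plus_K X (assoc_lb P chi)). \<exists>x\<in>pts X. \<tau> x \<noteq> lzero (plus_K X (assoc_lb P chi)) x)
   \<and> for_general_tuples X s L (smooth_ci X s L)
   \<and> locally_constant_genus X s L)"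

end

theory Submission
  imports Defs "HOL-Complex_Analysis.Complex_Analysis"
begin

text \<open>
  Everything is computed in coordinates adapted to the sections. If \<sigma>_i = z_i e_i for i < s, then a section of
  L + K is locally g e_0 ... e_(s-1) dz_0 ... dz_(d-1), and both adjunction and the Poincare residue keep only
  g dz_s ... dz_(d-1). That this does not depend on the coordinates and frames follows by comparison with a fixed
  reference chart (adjunction_reference): there the residue is the coefficient of the section divided by the
  Jacobian of the \<sigma>_i, an expression in which the adapted data no longer occur. The same expression makes sense
  for all tuples near a given one and is holomorphic in the tuple, so the residues form a holomorphic section of
  the Hodge bundle (residue_map_hodge). The residue also determines g on the complete intersection; if the
  complete intersections are dense in X, two sections with equal residues agree on a dense set, hence
  everywhere (residue_map_inj).

  For the formula on the principal bundle, two families of top forms on X are compared. A point m of M gives the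
  form \<Theta>[m,1] on the tangent space of X at the image of m, and the contraction of the volume form \<omega> with the
  q vertical fields gives another one. In a local trivialisation M is the product of H and X, the volume form is a
  function times a determinant, and this determinant is block triangular because the fields are vertical; so
  the contraction descends to a nowhere vanishing holomorphic multiple of the coordinate volume form
  (contraction_local). Translation of m by h multiplies the contraction by the character of \<omega> and, as
  it conjugates the fields by Ad(h), by the character of the top exterior power of the Lie algebra
  (contraction_act). This is the character \<eta> by which \<Theta>[m,1] changes. Hence the quotient of the two families is a
  holomorphic function on X, which is a constant c as X is compact and connected (contraction_ratio). As \<tau> is
  represented by \<tau>_M \<Theta>[m,1], the form with numerator \<tau>_M times the contraction and denominator \<psi>_M has the
  coefficient g / (c z_0 ... z_(s-1)) in adapted coordinates, and its residue is the adjunction image of \<tau> divided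
  by c (residue_of_form).

  The theory of holomorphic functions of several variables rests on one fact: a function that is continuous and
  holomorphic in each variable is complex differentiable, with Cauchy's formula in one variable as the only
  input; consequently partial derivatives of holomorphic functions are holomorphic, and so are
  the coefficients of forms in all charts.
\<close>

section \<open>Calculus on complex n-space\<close>

lemma Cn_upd: "z \<in> Cn n ==> i < n ==> z(i := t) \<in> Cn n"
  by (auto simp: Cn_def)

lemma Cn_eqI: "z \<in> Cn n ==> w \<in> Cn n ==> (\<And>i. i < n ==> z i = w i) ==> z = w"
proof (rule ext)
  fix i assume "z \<in> Cn n" "w \<in> Cn n" and *: "\<And>i. i < n ==> z i = w i"
  then have "z i = w i" if "\<not> i < n" using that by (simp add: Cn_def)
  then show "z i = w i" using * by blast
qed

lemma open_fun_box:
  fixes z :: "nat => complex"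
  assumes "open T" "z \<in> T" "z \<in> Cn n"
  shows "\<exists>r>0. \<forall>w\<in>Cn n. (\<forall>i<n. norm (w i - z i) < r) --> w \<in> T"
proof -
  obtain X where X: "z \<in> PiE UNIV X" "\<And>i. openin euclidean (X i)"
      "PiE UNIV X \<subseteq> T"
    using product_topology_open_contains_basis[of "\<lambda>_. euclidean" UNIV T z] assms
    unfolding open_fun_def by blast
  have "\<exists>e>0. ball (z i) e \<subseteq> X i" for i
    using X(1,2) by (meson PiE_mem UNIV_I open_contains_ball open_openin)
  then obtain e where e: "\<And>i. e i > 0" "\<And>i. ball (z i) (e i) \<subseteq> X i" by metis
  define r where "r = Min (insert 1 (e ` {..<n}))"
  have r: "r > 0" "\<And>i. i < n ==> r \<le> e i" using e(1) by (auto simp: r_def)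
  have "w \<in> T" if "w \<in> Cn n" "\<forall>i<n. norm (w i - z i) < r" for w
  proof -
    have "w i \<in> X i" for i
    proof (cases "i < n")
      case True
      then show ?thesis using e(2)[of i] r(2)[of i] that(2)
        by (force simp: dist_norm norm_minus_commute)
    next
      case False
      then have "w i = z i" using that(1) assms(3) by (simp add: Cn_def)
      then show ?thesis using X(1) by auto
    qed
    then show ?thesis using X(3) by auto
  qed
  then show ?thesis using r(1) by blast
qed

lemma open_coord_box: "open {w :: nat => complex. \<forall>i<n. norm (w i - z i) < r}"
proof -
  have "open {f. \<forall>i\<in>{..<n}. f (id i) \<in> ball (z i) r}"
    by (rule product_topology_basis') auto
  then show ?thesis by (simp add: dist_norm norm_minus_commute Ball_def)
qed

lemma openin_Cn_iff:
  "openin (top_of_set (Cn n)) W \<longleftrightarrow> W \<subseteq> Cn n \<and>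
     (\<forall>z\<in>W. \<exists>r>0. \<forall>w\<in>Cn n. (\<forall>i<n. norm (w i - z i) < r) --> w \<in> W)" (is "?L \<longleftrightarrow> ?R")
proof
  assume ?L
  then obtain T where T: "open T" "W = Cn n \<inter> T" by (auto simp: openin_open)
  then show ?R using open_fun_box[OF T(1)] by (auto 0 4)
next
  assume R: ?R
  then obtain r where r: "\<And>z. z \<in> W ==> r z > 0"
     "\<And>z w. z \<in> W ==> w \<in> Cn n ==> (\<forall>i<n. norm (w i - z i) < r z) ==> w \<in> W"
    by metis
  let ?T = "\<Union>z\<in>W. {w. \<forall>i<n. norm (w i - z i) < r z}"
  have "w \<in> W" if "w \<in> Cn n" "w \<in> ?T" for w
    using that r(2) by blast
  moreover have "w \<in> ?T" if "w \<in> W" for w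
    using that r(1) by (intro UN_I[OF that]) simp
  ultimately have "W = Cn n \<inter> ?T"
    using R by blast
  moreover have "open ?T" by (intro open_UN ballI open_coord_box)
  ultimately show ?L unfolding openin_open by (intro exI[of _ ?T] conjI)
qed

lemma eventually_Cn:
  assumes "z \<in> Cn n"
  shows "eventually P (at z within Cn n) \<longleftrightarrow>
     (\<exists>r>0. \<forall>w\<in>Cn n. w \<noteq> z \<and> (\<forall>i<n. norm (w i - z i) < r) --> P w)" (is "?L \<longleftrightarrow> ?R")
proof
  assume ?L
  then show ?R unfolding eventually_at_topological using open_fun_box[of _ z n] assms by metis
next
  assume ?R
  then obtain r where "r > 0" "\<forall>w\<in>Cn n. w \<noteq> z \<and> (\<forall>i<n. norm (w i - z i) < r) --> P w" by auto
  then show ?L unfolding eventually_at_topological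
    by (intro exI[of _ "{w. \<forall>i<n. norm (w i - z i) < r}"]) (auto simp: open_coord_box)
qed

lemma eventually_in_Cn: "eventually (\<lambda>w. w \<in> Cn n) (at z within Cn n)"
  by (auto simp: eventually_at_topological intro: exI[of _ UNIV])

lemma eventually_CnI: "(\<And>w. w \<in> Cn n ==> P w) ==> eventually P (at z within Cn n)"
  using eventually_in_Cn by (rule eventually_mono)

lemma coord_tendsto: "((\<lambda>w :: nat => complex. w i) \<longlongrightarrow> z i) (at z within S)"
  by (metis continuous_on continuous_on_product_coordinates UNIV_I tendsto_within_subset subset_UNIV)

text \<open>The composition rule for limits, in the form needed for functions that are only
  controlled on \<^term>\<open>Cn m\<close>.\<close>

lemma tendsto_into_Cn:
  assumes A: "(A \<longlongrightarrow> A y) (at y within Cn m)" and y: "y \<in> Cn m"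
    and ev: "eventually (\<lambda>w. G w \<in> Cn m) F"
    and G: "\<And>k. k < m ==> ((\<lambda>w. G w k) \<longlongrightarrow> y k) F"
  shows "((\<lambda>w. A (G w)) \<longlongrightarrow> (A y :: complex)) F"
proof (rule tendstoI)
  fix e :: real assume e: "e > 0"
  have "eventually (\<lambda>w. dist (A w) (A y) < e) (at y within Cn m)"
    using tendstoD[OF A e] .
  then obtain r where r: "r > 0"
    "\<And>w. w \<in> Cn m ==> w \<noteq> y ==> \<forall>i<m. norm (w i - y i) < r ==> dist (A w) (A y) < e"
    unfolding eventually_Cn[OF y] by blast
  have "eventually (\<lambda>w. \<forall>k\<in>{..<m}. norm (G w k - y k) < r) F"
    using tendstoD[OF G r(1)] by (intro eventually_ball_finite) (auto simp: dist_norm)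
  with ev show "eventually (\<lambda>w. dist (A (G w)) (A y) < e) F"
  proof eventually_elim
    case (elim w)
    show ?case using elim r(2)[of "G w"] e by (cases "G w = y") auto
  qed
qed

definition cderiv :: "nat => ((nat => complex) => complex) => (nat => complex) => (nat => complex) => bool" where
  "cderiv n f z a \<longleftrightarrow> ((\<lambda>w. (f w - f z - (\<Sum>i<n. a i * (w i - z i)))
      / of_real (\<Sum>i<n. norm (w i - z i))) \<longlongrightarrow> 0) (at z within Cn n)"

lemma cdiff_at_cderiv: "cdiff_at n f z \<longleftrightarrow> (\<exists>a. cderiv n f z a)"
  by (simp add: cdiff_at_def cderiv_def)

lemma cderiv_cong:
  assumes "eventually (\<lambda>w. f w = g w) (at z within Cn n)" "f z = g z"
  shows "cderiv n f z a \<longleftrightarrow> cderiv n g z a"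
  unfolding cderiv_def by (rule tendsto_cong, rule eventually_mono[OF assms(1)]) (simp add: assms(2))

text \<open>Differentiability with the increment written through continuous slopes, which turns the
  differentiation rules below into rules for limits of sums and products.\<close>

lemma cderivI_slopes:
  assumes z: "z \<in> Cn n" and ev: "eventually (\<lambda>w. f w = f z + (\<Sum>i<n. A i w * (w i - z i))) (at z within Cn n)"
    and A: "\<And>i. i < n ==> (A i \<longlongrightarrow> a i) (at z within Cn n)"
  shows "cderiv n f z a"
  unfolding cderiv_def
proof (rule Lim_null_comparison)
  have "((\<lambda>w. \<Sum>i<n. norm (A i w - a i)) \<longlongrightarrow> (\<Sum>i<n. norm (a i - a i))) (at z within Cn n)"
    by (intro tendsto_intros A) auto
  then show "((\<lambda>w. \<Sum>i<n. norm (A i w - a i)) \<longlongrightarrow> 0) (at z within Cn n)" by simp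
  show "\<forall>\<^sub>F w in at z within Cn n. norm ((f w - f z - (\<Sum>i<n. a i * (w i - z i)))
      / of_real (\<Sum>i<n. norm (w i - z i))) \<le> (\<Sum>i<n. norm (A i w - a i))"
    using ev
  proof eventually_elim
    case (elim w)
    let ?N = "\<Sum>i<n. norm (w i - z i)"
    have N: "norm (w i - z i) \<le> ?N" if "i < n" for i
      using that by (intro member_le_sum) auto
    have "f w - f z - (\<Sum>i<n. a i * (w i - z i)) = (\<Sum>i<n. (A i w - a i) * (w i - z i))"
      using elim by (simp add: left_diff_distrib sum_subtractf)
    then have "norm (f w - f z - (\<Sum>i<n. a i * (w i - z i))) \<le> (\<Sum>i<n. norm (A i w - a i) * norm (w i - z i))"
      by (metis (mono_tags, lifting) norm_mult norm_sum sum.cong)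
    also have "\<dots> \<le> (\<Sum>i<n. norm (A i w - a i) * ?N)"
      by (intro sum_mono mult_left_mono N) auto
    also have "\<dots> = (\<Sum>i<n. norm (A i w - a i)) * ?N" by (simp add: sum_distrib_right)
    finally have *: "norm (f w - f z - (\<Sum>i<n. a i * (w i - z i))) \<le> (\<Sum>i<n. norm (A i w - a i)) * ?N" .
    have N0: "?N \<ge> 0" by (simp add: sum_nonneg)
    show ?case
    proof (cases "?N = 0")
      case True
      then show ?thesis by (simp only: True) (simp add: sum_nonneg)
    next
      case False
      then have "?N > 0" using N0 by linarith
      then show ?thesis using * N0 unfolding norm_divide norm_of_real
        by (simp only: abs_of_nonneg) (simp add: field_simps)
    qed
  qed
qed

definition slope_rep :: "nat => ((nat => complex) => complex) => (nat => complex) => (nat => complex)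
    => (nat => (nat => complex) => complex) => bool" where
  "slope_rep n f z a A \<longleftrightarrow> (\<forall>w\<in>Cn n. f w = f z + (\<Sum>i<n. A i w * (w i - z i)))
     \<and> (\<forall>i<n. (A i \<longlongrightarrow> a i) (at z within Cn n)) \<and> (\<forall>i. A i z = a i)"

lemma slope_repD:
  assumes "slope_rep n f z a A"
  shows "w \<in> Cn n ==> f w = f z + (\<Sum>i<n. A i w * (w i - z i))"
    "i < n ==> (A i \<longlongrightarrow> a i) (at z within Cn n)" "A i z = a i"
  using assms unfolding slope_rep_def by blast+

text \<open>The error term is R w times the l1-norm of w - z; as the norm of a number u is u times the conjugate of
  its sign, it can be distributed over the coordinates.\<close>

lemma cderiv_slopes:
  assumes z: "z \<in> Cn n" and "cderiv n f z a"
  shows "\<exists>A. slope_rep n f z a A"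
proof -
  define N where "N w = (\<Sum>i<n. norm (w i - z i))" for w
  define R where "R w = (f w - f z - (\<Sum>i<n. a i * (w i - z i))) / of_real (N w)" for w
  define A where "A i w = a i + R w * cnj (sgn (w i - z i))" for i w
  have R: "(R \<longlongrightarrow> 0) (at z within Cn n)"
    using assms(2) unfolding cderiv_def R_def[abs_def] N_def .
  have sg: "cnj (sgn u) * u = of_real (norm u)" for u :: complex
  proof -
    have "u * cnj u = of_real (norm u) * of_real (norm u)"
      by (metis complex_norm_square of_real_mult power2_eq_square)
    then show ?thesis by (cases "u = 0") (simp_all add: sgn_div_norm scaleR_conv_of_real field_simps)
  qed
  show ?thesis unfolding slope_rep_def
  proof (intro exI[of _ A] conjI ballI allI impI)
    fix w assume w: "w \<in> Cn n"
    have "R w * of_real (N w) = f w - f z - (\<Sum>i<n. a i * (w i - z i))"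
    proof (cases "N w = 0")
      case True
      then have "\<forall>i<n. w i = z i" unfolding N_def by (subst (asm) sum_nonneg_eq_0_iff) auto
      then have "w = z" using Cn_eqI w z by blast
      then show ?thesis using True by simp
    next
      case False
      then show ?thesis by (simp add: R_def)
    qed
    moreover have "(\<Sum>i<n. A i w * (w i - z i)) = (\<Sum>i<n. a i * (w i - z i)) + R w * of_real (N w)"
    proof -
      have "A i w * (w i - z i) = a i * (w i - z i) + R w * of_real (norm (w i - z i))" for i
        unfolding A_def distrib_right mult.assoc sg ..
      then show ?thesis by (simp add: sum.distrib N_def sum_distrib_left)
    qed
    ultimately show "f w = f z + (\<Sum>i<n. A i w * (w i - z i))" by simp
  next
    fix i
    have "((\<lambda>w. R w * cnj (sgn (w i - z i))) \<longlongrightarrow> 0) (at z within Cn n)"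
    proof (rule Lim_null_comparison)
      show "((\<lambda>w. norm (R w)) \<longlongrightarrow> 0) (at z within Cn n)" using R by (simp add: tendsto_norm_zero)
      show "\<forall>\<^sub>F w in at z within Cn n. norm (R w * cnj (sgn (w i - z i))) \<le> norm (R w)"
        by (auto simp: norm_mult norm_sgn)
    qed
    then show "(A i \<longlongrightarrow> a i) (at z within Cn n)"
      unfolding A_def by (auto intro: tendsto_eq_intros)
    show "A i z = a i" by (simp add: A_def)
  qed
qed

lemma cderiv_tendsto:
  assumes "z \<in> Cn n" "cderiv n f z a" shows "(f \<longlongrightarrow> f z) (at z within Cn n)"
proof -
  obtain A where "slope_rep n f z a A" using cderiv_slopes[OF assms] by blast
  note A = slope_repD[OF this]
  have "((\<lambda>w. f z + (\<Sum>i<n. A i w * (w i - z i))) \<longlongrightarrow> f z + (\<Sum>i<n. a i * (z i - z i))) (at z within Cn n)"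
    by (intro tendsto_intros A coord_tendsto) auto
  then have "((\<lambda>w. f z + (\<Sum>i<n. A i w * (w i - z i))) \<longlongrightarrow> f z) (at z within Cn n)" by simp
  then show ?thesis
    by (rule Lim_transform_eventually) (auto simp: eventually_at_topological A(1)[symmetric] intro!: exI[of _ UNIV])
qed

lemma cderiv_const [intro]: "z \<in> Cn n ==> cderiv n (\<lambda>w. c) z (\<lambda>i. 0)"
  by (rule cderivI_slopes[where A = "\<lambda>i w. 0"]) auto

lemma cderiv_coord [intro]: "z \<in> Cn n ==> k < n ==> cderiv n (\<lambda>w. w k) z (\<lambda>i. if i = k then 1 else 0)"
  by (rule cderivI_slopes[where A = "\<lambda>i w. if i = k then 1 else 0"])
     (auto simp: if_distrib[of "\<lambda>x. x * _"] sum.delta cong: if_cong)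

lemma cderiv_add:
  assumes z: "z \<in> Cn n" and "cderiv n f z a" "cderiv n g z b"
  shows "cderiv n (\<lambda>w. f w + g w) z (\<lambda>i. a i + b i)"
proof -
  have "((\<lambda>w. (f w - f z - (\<Sum>i<n. a i * (w i - z i))) / of_real (\<Sum>i<n. norm (w i - z i))
      + (g w - g z - (\<Sum>i<n. b i * (w i - z i))) / of_real (\<Sum>i<n. norm (w i - z i))) \<longlongrightarrow> 0 + 0) (at z within Cn n)"
    using assms(2,3) unfolding cderiv_def by (rule tendsto_add)
  then show ?thesis unfolding cderiv_def
    by (simp add: add_divide_distrib[symmetric] distrib_right sum.distrib) (simp add: algebra_simps)
qed

lemma cderiv_mult:
  assumes z: "z \<in> Cn n" and f: "cderiv n f z a" and g: "cderiv n g z b"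
  shows "cderiv n (\<lambda>w. f w * g w) z (\<lambda>i. a i * g z + f z * b i)"
proof -
  obtain A where "slope_rep n f z a A" using cderiv_slopes[OF z f] by blast
  note A = slope_repD[OF this]
  obtain B where "slope_rep n g z b B" using cderiv_slopes[OF z g] by blast
  note B = slope_repD[OF this]
  show ?thesis
  proof (rule cderivI_slopes[where A = "\<lambda>i w. A i w * g w + f z * B i w"])
    have "f w * g w = f z * g z + (\<Sum>i<n. (A i w * g w + f z * B i w) * (w i - z i))" if "w \<in> Cn n" for w
    proof -
      have "(\<Sum>i<n. (A i w * g w + f z * B i w) * (w i - z i))
          = g w * (\<Sum>i<n. A i w * (w i - z i)) + f z * (\<Sum>i<n. B i w * (w i - z i))"
        unfolding sum_distrib_left sum.distrib[symmetric] by (rule sum.cong) (auto simp: algebra_simps)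
      also have "\<dots> = g w * (f w - f z) + f z * (g w - g z)"
        by (simp only: A(1)[OF that] B(1)[OF that] add_diff_cancel_left')
      finally show ?thesis by (simp add: algebra_simps)
    qed
    then show "\<forall>\<^sub>F w in at z within Cn n. f w * g w = f z * g z + (\<Sum>i<n. (A i w * g w + f z * B i w) * (w i - z i))"
      by (rule eventually_CnI)
    show "((\<lambda>w. A i w * g w + f z * B i w) \<longlongrightarrow> a i * g z + f z * b i) (at z within Cn n)" if "i < n" for i
      using that by (intro tendsto_intros A B cderiv_tendsto[OF z g])
  qed (fact z)
qed

lemma cderiv_outer:
  assumes z: "z \<in> Cn n" and f: "cderiv n f z a" and h: "(h has_field_derivative d) (at (f z))"
  shows "cderiv n (\<lambda>w. h (f w)) z (\<lambda>i. d * a i)"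
proof -
  obtain A where "slope_rep n f z a A" using cderiv_slopes[OF z f] by blast
  note A = slope_repD[OF this]
  obtain g where g: "\<And>u. h u - h (f z) = g u * (u - f z)" "isCont g (f z)" "g (f z) = d"
    using h CARAT_DERIV by metis
  show ?thesis
  proof (rule cderivI_slopes[where A = "\<lambda>i w. g (f w) * A i w"])
    have "h (f w) = h (f z) + (\<Sum>i<n. (g (f w) * A i w) * (w i - z i))" if "w \<in> Cn n" for w
    proof -
      have "(\<Sum>i<n. (g (f w) * A i w) * (w i - z i)) = g (f w) * (\<Sum>i<n. A i w * (w i - z i))"
        by (simp add: sum_distrib_left algebra_simps)
      also have "\<dots> = g (f w) * (f w - f z)" by (simp only: A(1)[OF that] add_diff_cancel_left')
      also have "\<dots> = h (f w) - h (f z)" by (simp add: g(1))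
      finally show ?thesis by simp
    qed
    then show "\<forall>\<^sub>F w in at z within Cn n. h (f w) = h (f z) + (\<Sum>i<n. (g (f w) * A i w) * (w i - z i))"
      by (rule eventually_CnI)
    show "((\<lambda>w. g (f w) * A i w) \<longlongrightarrow> d * a i) (at z within Cn n)" if "i < n" for i
      using that isCont_tendsto_compose[OF g(2) cderiv_tendsto[OF z f]] g(3)
      by (intro tendsto_intros A) auto
  qed (fact z)
qed

text \<open>The slopes of the composite are sums of products of the slopes of the two maps.\<close>

lemma cderiv_chain:
  assumes z: "z \<in> Cn n" and ev: "eventually (\<lambda>w. g w \<in> Cn m) (at z within Cn n)" and gz: "g z \<in> Cn m"
    and g: "\<And>k. k < m ==> cderiv n (\<lambda>w. g w k) z (b k)" and f: "cderiv m f (g z) a"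
  shows "cderiv n (\<lambda>w. f (g w)) z (\<lambda>i. \<Sum>k<m. a k * b k i)"
proof -
  obtain A where "slope_rep m f (g z) a A" using cderiv_slopes[OF gz f] by blast
  note A = slope_repD[OF this]
  have "\<forall>k. \<exists>B. k < m --> slope_rep n (\<lambda>w. g w k) z (b k) B"
    using cderiv_slopes[OF z g] by blast
  from choice[OF this] obtain B where "\<forall>k. k < m --> slope_rep n (\<lambda>w. g w k) z (b k) (B k)" by blast
  then have "slope_rep n (\<lambda>w. g w k) z (b k) (B k)" if "k < m" for k using that by blast
  note B = slope_repD[OF this]
  show ?thesis
  proof (rule cderivI_slopes[where A = "\<lambda>i w. \<Sum>k<m. A k (g w) * B k i w"])
    show "\<forall>\<^sub>F w in at z within Cn n. f (g w) = f (g z) + (\<Sum>i<n. (\<Sum>k<m. A k (g w) * B k i w) * (w i - z i))"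
      using ev eventually_in_Cn
    proof eventually_elim
      case (elim w)
      have "f (g w) = f (g z) + (\<Sum>k<m. A k (g w) * (g w k - g z k))" by (rule A(1)[OF elim(1)])
      also have "(\<Sum>k<m. A k (g w) * (g w k - g z k)) = (\<Sum>k<m. A k (g w) * (\<Sum>i<n. B k i w * (w i - z i)))"
        by (rule sum.cong[OF refl]) (simp add: B(1)[OF _ elim(2)])
      also have "\<dots> = (\<Sum>k<m. \<Sum>i<n. A k (g w) * B k i w * (w i - z i))"
        by (simp add: sum_distrib_left mult.assoc)
      also have "\<dots> = (\<Sum>i<n. \<Sum>k<m. A k (g w) * B k i w * (w i - z i))" by (rule sum.swap)
      also have "\<dots> = (\<Sum>i<n. (\<Sum>k<m. A k (g w) * B k i w) * (w i - z i))"
        by (simp add: sum_distrib_right)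
      finally show ?case .
    qed
    show "((\<lambda>w. \<Sum>k<m. A k (g w) * B k i w) \<longlongrightarrow> (\<Sum>k<m. a k * b k i)) (at z within Cn n)" if "i < n" for i
    proof (rule tendsto_sum, rule tendsto_mult)
      fix k assume k: "k \<in> {..<m}"
      show "(B k i \<longlongrightarrow> b k i) (at z within Cn n)" using B(2) k that by simp
      have "(A k \<longlongrightarrow> A k (g z)) (at (g z) within Cn m)" using A(2)[of k] k by (simp add: A(3))
      then have "((\<lambda>w. A k (g w)) \<longlongrightarrow> A k (g z)) (at z within Cn n)"
        by (rule tendsto_into_Cn[OF _ gz ev]) (rule cderiv_tendsto[OF z g])
      then show "((\<lambda>w. A k (g w)) \<longlongrightarrow> a k) (at z within Cn n)" by (simp add: A(3))
    qed
  qed (fact z)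
qed

lemma cderiv_curve:
  assumes ev: "eventually (\<lambda>t. c t \<in> Cn m) (at t0)" and gz: "c t0 \<in> Cn m"
    and c: "\<And>k. k < m ==> ((\<lambda>t. c t k) has_field_derivative b k) (at t0)" and f: "cderiv m f (c t0) a"
  shows "((\<lambda>t. f (c t)) has_field_derivative (\<Sum>k<m. a k * b k)) (at (t0 :: complex))"
proof -
  obtain A where "slope_rep m f (c t0) a A" using cderiv_slopes[OF gz f] by blast
  note A = slope_repD[OF this]
  have cc: "((\<lambda>t. c t k) \<longlongrightarrow> c t0 k) (at t0)" if "k < m" for k
    using DERIV_isCont[OF c[OF that]] by (simp add: isCont_def)
  have "((\<lambda>t. A k (c t)) \<longlongrightarrow> A k (c t0)) (at t0)" if "k < m" for k
  proof -
    have "(A k \<longlongrightarrow> A k (c t0)) (at (c t0) within Cn m)" using A(2)[of k] that by (simp add: A(3))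
    then show ?thesis by (rule tendsto_into_Cn[OF _ gz ev]) (rule cc)
  qed
  then have "((\<lambda>t. \<Sum>k<m. A k (c t) * ((c t k - c t0 k) / (t - t0))) \<longlongrightarrow> (\<Sum>k<m. a k * b k)) (at t0)"
    using c unfolding has_field_derivative_iff A(3) by (intro tendsto_sum tendsto_mult) auto
  then have "((\<lambda>t. (f (c t) - f (c t0)) / (t - t0)) \<longlongrightarrow> (\<Sum>k<m. a k * b k)) (at t0)"
  proof (rule Lim_transform_eventually)
    show "\<forall>\<^sub>F t in at t0. (\<Sum>k<m. A k (c t) * ((c t k - c t0 k) / (t - t0))) = (f (c t) - f (c t0)) / (t - t0)"
      using ev by eventually_elim (simp add: A(1) sum_divide_distrib)
  qed
  then show ?thesis unfolding has_field_derivative_iff .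
qed

lemma cderiv_partial:
  assumes z: "z \<in> Cn n" and f: "cderiv n f z a" and i: "i < n"
  shows "((\<lambda>t. f (z(i := t))) has_field_derivative a i) (at (z i))"
proof -
  have "((\<lambda>t. f (z(i := t))) has_field_derivative (\<Sum>k<n. a k * (if k = i then 1 else 0))) (at (z i))"
    using z f i by (intro cderiv_curve[where c = "\<lambda>t. z(i := t)"]) (auto simp: Cn_upd intro!: derivative_eq_intros)
  then show ?thesis using i by (simp add: if_distrib sum.delta cong: if_cong)
qed

lemma pderiv_eq: "z \<in> Cn n ==> cderiv n f z a ==> i < n ==> pderiv_Cn i f z = a i"
  unfolding pderiv_Cn_def by (rule DERIV_imp_deriv) (rule cderiv_partial)

lemma cderiv_restrict: "(\<And>i. i < n ==> a i = b i) ==> cderiv n f z a \<longleftrightarrow> cderiv n f z b"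
  by (simp add: cderiv_def)

lemma cdiff_cderiv: "z \<in> Cn n ==> cdiff_at n f z ==> cderiv n f z (\<lambda>i. pderiv_Cn i f z)"
  unfolding cdiff_at_cderiv using cderiv_restrict[of n "\<lambda>i. pderiv_Cn i f z"] pderiv_eq[of z n f] by blast

lemma openin_Cn_eventually:
  "openin (top_of_set (Cn n)) W ==> z \<in> W ==> eventually (\<lambda>w. w \<in> W) (at z within Cn n)"
  by (subst eventually_Cn) (auto 0 3 simp: openin_Cn_iff)

lemma hol_Cn_sub: "hol_Cn n W f ==> W \<subseteq> Cn n"
  by (auto simp: hol_Cn_def openin_Cn_iff)

lemma hol_Cn_cderiv: "hol_Cn n W f ==> z \<in> W ==> cderiv n f z (\<lambda>i. pderiv_Cn i f z)"
  using cdiff_cderiv hol_Cn_sub hol_Cn_def by blast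

lemma cdiff_cong:
  assumes "openin (top_of_set (Cn n)) W" "z \<in> W" "\<And>w. w \<in> W ==> f w = g w"
  shows "cdiff_at n f z \<longleftrightarrow> cdiff_at n g z"
  unfolding cdiff_at_cderiv using assms openin_Cn_eventually[OF assms(1,2)]
  by (intro ex_cong1 cderiv_cong) (auto elim: eventually_mono)

lemma hol_Cn_cong: "(\<And>w. w \<in> W ==> f w = g w) ==> hol_Cn n W f \<longleftrightarrow> hol_Cn n W g"
  unfolding hol_Cn_def using cdiff_cong by blast

lemma hol_Cn_cont: "hol_Cn n W f ==> continuous_on W f"
  unfolding continuous_on
  by (meson cderiv_tendsto hol_Cn_cderiv hol_Cn_sub subset_iff tendsto_within_subset)

lemma pderiv_cong:
  assumes "openin (top_of_set (Cn n)) W" "z \<in> W" "\<And>w. w \<in> W ==> f w = g w" "i < n" "cdiff_at n f z"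
  shows "pderiv_Cn i f z = pderiv_Cn i g z"
proof -
  have z: "z \<in> Cn n" using assms(1,2) openin_Cn_iff by blast
  have "cderiv n f z (\<lambda>i. pderiv_Cn i f z)" using z assms(5) by (rule cdiff_cderiv)
  then have "cderiv n g z (\<lambda>i. pderiv_Cn i f z)"
    by (rule iffD1[OF cderiv_cong, rotated -1])
       (use assms(2,3) in \<open>auto intro: eventually_mono[OF openin_Cn_eventually[OF assms(1,2)]]\<close>)
  then show ?thesis using pderiv_eq[OF z _ assms(4)] by metis
qed

subsection \<open>Partial derivatives of holomorphic functions\<close>

definition sep_hol :: "nat => (nat => complex) set => ((nat => complex) => complex) => bool" where
  "sep_hol n W f \<longleftrightarrow> openin (top_of_set (Cn n)) W \<and> continuous_on W f
     \<and> (\<forall>z\<in>W. \<forall>i<n. (\<lambda>t. f (z(i := t))) field_differentiable at (z i))"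

lemma hol_Cn_sep: "hol_Cn n W f ==> sep_hol n W f"
  unfolding sep_hol_def field_differentiable_def
proof (intro conjI ballI allI impI)
  fix z i assume h: "hol_Cn n W f" and z: "z \<in> W" and i: "i < n"
  have "z \<in> Cn n" using hol_Cn_sub[OF h] z by blast
  then show "\<exists>f'. ((\<lambda>t. f (z(i := t))) has_field_derivative f') (at (z i))"
    using cderiv_partial[OF _ hol_Cn_cderiv[OF h z] i] by blast
qed (auto simp: hol_Cn_def intro: hol_Cn_cont)

lemma closed_box:
  assumes "openin (top_of_set (Cn n)) W" "z \<in> W"
  obtains r where "r > 0" "\<And>w. w \<in> Cn n ==> (\<And>i. i < n ==> norm (w i - z i) \<le> r) ==> w \<in> W"
proof -
  obtain r where r: "r > 0" "\<forall>w\<in>Cn n. (\<forall>i<n. norm (w i - z i) < r) --> w \<in> W"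
    using assms unfolding openin_Cn_iff by blast
  show ?thesis
  proof (rule that[of "r / 2"])
    fix w assume "w \<in> Cn n" "\<And>i. i < n ==> norm (w i - z i) \<le> r / 2"
    moreover from this have "norm (w i - z i) < r" if "i < n" for i using that r(1) by fastforce
    ultimately show "w \<in> W" using r(2) by blast
  qed (use r in simp)
qed

lemma continuous_on_fun_upd:
  fixes h :: "'a :: topological_space => nat => complex"
  assumes "continuous_on S h" "continuous_on S g"
  shows "continuous_on S (\<lambda>t. (h t)(i := g t))"
proof (rule continuous_on_coordinatewise_then_product)
  fix k show "continuous_on S (\<lambda>t. ((h t)(i := g t)) k)"
    using assms continuous_on_product_then_coordinatewise[OF assms(1)] by (cases "k = i") auto
qed

text \<open>Continuity in the transversal variables is uniform along a compact subset of a coordinate slice, by the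
  tube argument.\<close>

lemma slice_uniform:
  assumes c: "continuous_on W f" and W: "openin (top_of_set (Cn n)) W" and i: "i < n"
    and K: "compact K" "\<And>t. t \<in> K ==> z(i := t) \<in> W" and e: "(e :: real) > 0"
  obtains d where "d > 0" "\<And>w t. w \<in> Cn n ==> (\<And>k. k < n ==> norm (w k - z k) < d) ==> t \<in> K
      ==> w(i := t) \<in> W \<and> norm (f (w(i := t)) - f (z(i := t)) :: complex) < e"
proof -
  have "\<exists>d>0. \<forall>w\<in>Cn n. (\<forall>k<n. norm (w k - (z(i := t)) k) < d) --> w \<in> W \<and> norm (f w - f (z(i := t))) < e / 2"
    if t: "t \<in> K" for t
  proof -
    let ?z = "z(i := t)"
    have z: "?z \<in> W" "?z \<in> Cn n" using K(2)[OF t] W openin_Cn_iff by blast+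
    have "eventually (\<lambda>w. dist (f w) (f ?z) < e / 2) (at ?z within W)"
      using tendstoD[of f "f ?z" "at ?z within W" "e / 2"] c z(1) e unfolding continuous_on by simp
    then obtain T where T: "open T" "?z \<in> T" "\<And>w. w \<in> T ==> w \<in> W ==> dist (f w) (f ?z) < e / 2"
      unfolding eventually_at_topological using e by (metis dist_self half_gt_zero)
    obtain r1 where r1: "r1 > 0" "\<forall>w\<in>Cn n. (\<forall>k<n. norm (w k - ?z k) < r1) --> w \<in> T"
      using open_fun_box[OF T(1,2) z(2)] by blast
    obtain r2 where r2: "r2 > 0" "\<forall>w\<in>Cn n. (\<forall>k<n. norm (w k - ?z k) < r2) --> w \<in> W"
      using W z(1) unfolding openin_Cn_iff by blast
    show ?thesis
      by (rule exI[of _ "min r1 r2"]) (use r1 r2 T(3) in \<open>simp add: dist_norm\<close>)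
  qed
  then obtain d where d: "\<And>t. t \<in> K ==> d t > 0"
    "\<And>t w. t \<in> K ==> w \<in> Cn n ==> (\<And>k. k < n ==> norm (w k - (z(i := t)) k) < d t)
       ==> w \<in> W \<and> norm (f w - f (z(i := t))) < e / 2" by metis
  obtain K' where K': "K' \<subseteq> K" "finite K'" "K \<subseteq> (\<Union>t\<in>K'. ball t (d t))"
    using compactE_image[OF K(1), of K "\<lambda>t. ball t (d t)"] d(1) by (metis (no_types, lifting) UN_I centre_in_ball open_ball subsetI)
  define D where "D = Min (insert 1 (d ` K'))"
  have D: "D > 0" "\<And>t. t \<in> K' ==> D \<le> d t"
    using K' d(1) by (auto simp: D_def)
  show ?thesis
  proof (rule that[OF D(1)])
    fix w t assume w: "w \<in> Cn n" "\<And>k. k < n ==> norm (w k - z k) < D" and t: "t \<in> K"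
    obtain t' where t': "t' \<in> K'" "norm (t - t') < d t'" using K'(3) t by (auto simp: dist_norm norm_minus_commute)
    have 1: "w(i := t) \<in> W \<and> norm (f (w(i := t)) - f (z(i := t'))) < e / 2"
      using t' w D(2)[OF t'(1)] K'(1) i by (intro d(2) Cn_upd) force+
    have 2: "z(i := t) \<in> W \<and> norm (f (z(i := t)) - f (z(i := t'))) < e / 2"
    proof (intro d(2))
      show "z(i := t) \<in> Cn n" using K(2)[OF t] W openin_Cn_iff by blast
    qed (use t' K'(1) i d(1) in auto)
    have "norm ((f (w(i := t)) - f (z(i := t'))) - (f (z(i := t)) - f (z(i := t')))) < e"
      using 1 2 norm_triangle_ineq4[of "f (w(i := t)) - f (z(i := t'))" "f (z(i := t)) - f (z(i := t'))"] by linarith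
    then show "w(i := t) \<in> W \<and> norm (f (w(i := t)) - f (z(i := t))) < e" using 1 by simp
  qed
qed

lemma slice_holomorphic:
  assumes f: "sep_hol n W f" and i: "i < n" and S: "open S" "\<And>t. t \<in> S ==> w(i := t) \<in> W"
  shows "(\<lambda>t. f (w(i := t))) holomorphic_on S"
proof -
  have "(\<lambda>t. f (w(i := t))) field_differentiable at t" if "t \<in> S" for t
  proof -
    have "(\<lambda>u. f ((w(i := t))(i := u))) field_differentiable at ((w(i := t)) i)"
      using f i S(2)[OF that] unfolding sep_hol_def by blast
    then show ?thesis by simp
  qed
  then show ?thesis by (simp add: S(1) field_differentiable_at_within holomorphic_on_def)
qed

text \<open>Strict differentiability in each variable, uniformly in the others, from Cauchy's estimate.\<close>

lemma sep_hol_strict: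
  assumes f: "sep_hol n W f" and z: "z \<in> W" and i: "i < n" and e: "(e :: real) > 0"
  obtains d where "d > 0" "\<And>y u v. y \<in> Cn n ==> (\<And>k. k < n ==> norm (y k - z k) < d)
     ==> norm (u - z i) < d ==> norm (v - z i) < d
     ==> norm (f (y(i := u)) - f (y(i := v)) - pderiv_Cn i f z * (u - v)) \<le> e * norm (u - v)"
proof -
  have W: "openin (top_of_set (Cn n)) W" and c: "continuous_on W f" using f by (auto simp: sep_hol_def)
  have zC: "z \<in> Cn n" using W z openin_Cn_iff by blast
  obtain r where r: "r > 0" "\<And>w. w \<in> Cn n ==> (\<And>i. i < n ==> norm (w i - z i) \<le> r) ==> w \<in> W"
    using closed_box[OF W z] by metis
  let ?B = "ball (z i) r"
  define F where "F w t = f (w(i := t))" for w t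
  have zW: "z(i := t) \<in> W" if "t \<in> cball (z i) r" for t
    using that i r(1) zC by (intro r(2) Cn_upd) (auto simp: dist_norm norm_minus_commute)
  define e' where "e' = e / 2 * (r / 3)"
  have e': "e' > 0" using e r by (simp add: e'_def)
  obtain d1 where d1: "d1 > 0" "\<And>w t. w \<in> Cn n ==> (\<And>k. k < n ==> norm (w k - z k) < d1) ==> t \<in> cball (z i) r
      ==> w(i := t) \<in> W \<and> norm (f (w(i := t)) - f (z(i := t))) < e'"
    using slice_uniform[OF c W i compact_cball zW e'] by metis
  have Fz: "F z holomorphic_on ?B"
    unfolding F_def by (rule slice_holomorphic[OF f i]) (use zW in auto)
  then have "isCont (deriv (F z)) (z i)"
    by (meson continuous_on_eq_continuous_at centre_in_ball holomorphic_deriv holomorphic_on_imp_continuous_on open_ball r(1))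
  then obtain d2 where d2: "d2 > 0" "\<And>t. norm (t - z i) < d2 ==> norm (deriv (F z) t - deriv (F z) (z i)) < e / 2"
    using e unfolding continuous_at_eps_delta by (metis dist_norm half_gt_zero)
  define d where "d = Min {d1, d2, r / 2}"
  have d: "d > 0" "d \<le> d1" "d \<le> d2" "d \<le> r / 2" using d1 d2 r by (auto simp: d_def)
  show ?thesis
  proof (rule that[OF d(1)])
    fix y u v assume y: "y \<in> Cn n" "\<And>k. k < n ==> norm (y k - z k) < d"
      and u: "norm (u - z i) < d" and v: "norm (v - z i) < d"
    have yk: "\<And>k. k < n ==> norm (y k - z k) < d1" using y(2) d(2) by (meson less_le_trans)
    note D = d1(2)[OF y(1) yk]
    have Fy: "F y holomorphic_on ?B"
      unfolding F_def by (rule slice_holomorphic[OF f i]) (use D in auto)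
    \<comment> \<open>the slices at y and z differ by at most e', hence their derivatives by at most e / 2\<close>
    define G where "G t = F y t - F z t" for t
    have G: "G holomorphic_on ?B" unfolding G_def by (intro holomorphic_intros Fy Fz)
    have GB: "norm (G t) \<le> e'" if "t \<in> ?B" for t
      using D[of t] that by (auto simp: G_def F_def)
    have G': "norm (deriv G t) \<le> e / 2" if t: "norm (t - z i) < d" for t
    proof -
      have sub: "cball t (r / 3) \<subseteq> ?B"
      proof
        fix s assume "s \<in> cball t (r / 3)"
        then have "dist (z i) s \<le> dist (z i) t + r / 3"
          using dist_triangle[of "z i" s t] by simp
        then show "s \<in> ?B" using t d(4) r(1) by (simp add: dist_norm norm_minus_commute)
      qed
      have "norm ((deriv ^^ 1) G t) \<le> fact 1 * e' / (r / 3) ^ 1"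
        using sub r(1) GB by (intro Cauchy_inequality)
          (auto simp: dist_norm subset_iff intro!: holomorphic_on_subset[OF G] holomorphic_on_imp_continuous_on)
      then show ?thesis using r(1) by (simp add: e'_def)
    qed
    define H where "H t = F y t - pderiv_Cn i f z * t" for t
    have pd: "pderiv_Cn i f z = deriv (F z) (z i)" unfolding pderiv_Cn_def F_def[abs_def] ..
    have H: "(H has_field_derivative (deriv G t + (deriv (F z) t - deriv (F z) (z i)))) (at t within ball (z i) d)"
      if "t \<in> ball (z i) d" for t
    proof -
      have tB: "t \<in> ?B" using that d r(1) by auto
      have Dy: "(F y has_field_derivative deriv (F y) t) (at t)" and Dz: "(F z has_field_derivative deriv (F z) t) (at t)"
        using Fy Fz tB holomorphic_derivI open_ball by blast+
      have G2: "deriv G t = deriv (F y) t - deriv (F z) t"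
        unfolding G_def by (intro DERIV_imp_deriv DERIV_diff Dy Dz)
      have H2: "(H has_field_derivative deriv (F y) t - pderiv_Cn i f z) (at t)"
        unfolding H_def[abs_def] by (intro DERIV_diff Dy DERIV_cmult_Id)
      have "deriv G t + (deriv (F z) t - deriv (F z) (z i)) = deriv (F y) t - pderiv_Cn i f z"
        unfolding G2 pd by (simp only: diff_add_cancel add_diff_eq)
      then show ?thesis using DERIV_subset[OF H2 subset_UNIV] by (rule ssubst)
    qed
    have "norm (H u - H v) \<le> e * norm (u - v)"
    proof (rule field_differentiable_bound[OF _ H])
      fix t assume t: "t \<in> ball (z i) d"
      then have *: "norm (t - z i) < d" by (simp add: dist_norm norm_minus_commute)
      then have "norm (deriv (F z) t - deriv (F z) (z i)) < e / 2" using d(3) d2(2) by auto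
      then show "norm (deriv G t + (deriv (F z) t - deriv (F z) (z i))) \<le> e"
        using G'[OF *] norm_triangle_ineq[of "deriv G t" "deriv (F z) t - deriv (F z) (z i)"] by linarith
    qed (use u v in \<open>auto simp: dist_norm norm_minus_commute\<close>)
    then show "norm (f (y(i := u)) - f (y(i := v)) - pderiv_Cn i f z * (u - v)) \<le> e * norm (u - v)"
      by (simp add: H_def F_def algebra_simps)
  qed
qed

lemma sep_hol_pderiv_cont:
  assumes f: "sep_hol n W f" and i: "i < n"
  shows "continuous_on W (pderiv_Cn i f)"
  unfolding continuous_on
proof (intro ballI tendstoI)
  fix z e assume z: "z \<in> W" and e: "(e :: real) > 0"
  have W: "openin (top_of_set (Cn n)) W" using f by (auto simp: sep_hol_def)
  have zC: "z \<in> Cn n" using W z openin_Cn_iff by blast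
  obtain d where d: "d > 0" "\<And>y u v. y \<in> Cn n ==> (\<And>k. k < n ==> norm (y k - z k) < d)
     ==> norm (u - z i) < d ==> norm (v - z i) < d
     ==> norm (f (y(i := u)) - f (y(i := v)) - pderiv_Cn i f z * (u - v)) \<le> (e/2) * norm (u - v)"
    using sep_hol_strict[OF f z i half_gt_zero[OF e]] by metis
  have "dist (pderiv_Cn i f y) (pderiv_Cn i f z) < e"
    if y: "y \<in> W" "\<And>k. k < n ==> norm (y k - z k) < d" for y
  proof -
    have yC: "y \<in> Cn n" using W y(1) openin_Cn_iff by blast
    define F where "F t = f (y(i := t))" for t
    have "(F has_field_derivative pderiv_Cn i f y) (at (y i))"
      using f y(1) i unfolding sep_hol_def F_def pderiv_Cn_def by (simp add: DERIV_deriv_iff_field_differentiable)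
    then have "((\<lambda>t. norm ((F t - F (y i)) / (t - y i) - pderiv_Cn i f z)) \<longlongrightarrow> norm (pderiv_Cn i f y - pderiv_Cn i f z)) (at (y i))"
      unfolding has_field_derivative_iff by (intro tendsto_intros)
    moreover have "eventually (\<lambda>t. norm ((F t - F (y i)) / (t - y i) - pderiv_Cn i f z) \<le> e / 2) (at (y i))"
    proof -
      have "eventually (\<lambda>t. t \<in> ball (z i) d) (at (y i))"
        using y(2)[OF i] by (intro eventually_at_in_open'[of "ball (z i) d"]) (auto simp: dist_norm norm_minus_commute)
      then show ?thesis using eventually_neq_at_within[of "y i" "y i" UNIV]
      proof eventually_elim
        case (elim t)
        have "norm (F t - F (y i) - pderiv_Cn i f z * (t - y i)) \<le> (e/2) * norm (t - y i)"
          unfolding F_def using elim y(2) i by (intro d(2) yC) (auto simp: dist_norm norm_minus_commute)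
        moreover have "(F t - F (y i)) / (t - y i) - pderiv_Cn i f z
           = (F t - F (y i) - pderiv_Cn i f z * (t - y i)) / (t - y i)"
          using elim by (simp add: field_simps)
        ultimately show ?case using elim by (simp add: norm_divide pos_divide_le_eq)
      qed
    qed
    ultimately have "norm (pderiv_Cn i f y - pderiv_Cn i f z) \<le> e / 2"
      by (intro tendsto_upperbound) auto
    then show ?thesis using e by (simp add: dist_norm)
  qed
  then show "\<forall>\<^sub>F y in at z within W. dist (pderiv_Cn i f y) (pderiv_Cn i f z) < e"
    unfolding eventually_at_topological using d(1)
    by (intro exI[of _ "{w. \<forall>k<n. norm (w k - z k) < d}"]) (auto simp: open_coord_box)
qed

text \<open>Osgood's lemma. Passing from z to w one coordinate at a time, each step is controlled by strict
  differentiability in that variable.\<close>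

lemma sep_hol_imp_hol:
  assumes f: "sep_hol n W f" shows "hol_Cn n W f"
  unfolding hol_Cn_def
proof (intro conjI ballI)
  show W: "openin (top_of_set (Cn n)) W" using f by (auto simp: sep_hol_def)
  fix z assume z: "z \<in> W"
  have zC: "z \<in> Cn n" using W z openin_Cn_iff by blast
  define y where "y i w k = (if k < i then w k else z k)" for i :: nat and w k
  define A where "A i w = (if w i = z i then pderiv_Cn i f z
      else (f (y (Suc i) w) - f (y i w)) / (w i - z i))" for i w
  have yu: "y (Suc i) w = (y i w)(i := w i)" "y i w = (y i w)(i := z i)" for i w
    by (auto simp: y_def fun_eq_iff less_Suc_eq)
  have yC: "y i w \<in> Cn n" if "w \<in> Cn n" for i w
    using that zC by (auto simp: y_def Cn_def)
  have "cderiv n f z (\<lambda>i. pderiv_Cn i f z)"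
  proof (rule cderivI_slopes[OF zC, where A = A])
    have "f w = f z + (\<Sum>i<n. A i w * (w i - z i))" if w: "w \<in> Cn n" for w
    proof -
      have "A i w * (w i - z i) = f (y (Suc i) w) - f (y i w)" for i
        using yu[of i w] by (auto simp: A_def)
      then have "(\<Sum>i<n. A i w * (w i - z i)) = f (y n w) - f (y 0 w)"
        using sum_lessThan_telescope[of "\<lambda>i. f (y i w)" n] by simp
      moreover have "y n w = w" using zC w by (intro Cn_eqI[of _ n] yC) (auto simp: y_def)
      moreover have "y 0 w = z" by (auto simp: y_def)
      ultimately show ?thesis by simp
    qed
    then show "\<forall>\<^sub>F w in at z within Cn n. f w = f z + (\<Sum>i<n. A i w * (w i - z i))"
      by (rule eventually_CnI)
    fix i assume i: "i < n"
    show "(A i \<longlongrightarrow> pderiv_Cn i f z) (at z within Cn n)"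
    proof (rule tendstoI)
      fix e :: real assume e: "e > 0"
      obtain d where d: "d > 0" "\<And>y u v. y \<in> Cn n ==> (\<And>k. k < n ==> norm (y k - z k) < d)
         ==> norm (u - z i) < d ==> norm (v - z i) < d
         ==> norm (f (y(i := u)) - f (y(i := v)) - pderiv_Cn i f z * (u - v)) \<le> (e/2) * norm (u - v)"
        using sep_hol_strict[OF f z i half_gt_zero[OF e]] by metis
      have "dist (A i w) (pderiv_Cn i f z) < e" if w: "w \<in> Cn n" "\<forall>k<n. norm (w k - z k) < d" for w
      proof (cases "w i = z i")
        case True
        then show ?thesis using e by (simp add: A_def)
      next
        case False
        have "norm (f ((y i w)(i := w i)) - f ((y i w)(i := z i)) - pderiv_Cn i f z * (w i - z i)) \<le> (e/2) * norm (w i - z i)"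
          using w i d(1) by (intro d(2) yC) (auto simp: y_def)
        then have 1: "norm (f (y (Suc i) w) - f (y i w) - pderiv_Cn i f z * (w i - z i)) \<le> (e/2) * norm (w i - z i)"
          using yu[of i w] by simp
        have "A i w - pderiv_Cn i f z = (f (y (Suc i) w) - f (y i w) - pderiv_Cn i f z * (w i - z i)) / (w i - z i)"
          using False by (simp add: A_def field_simps)
        then have "norm (A i w - pderiv_Cn i f z) \<le> e / 2"
          using 1 False by (simp add: norm_divide pos_divide_le_eq)
        then show ?thesis using e by (simp add: dist_norm)
      qed
      then show "\<forall>\<^sub>F w in at z within Cn n. dist (A i w) (pderiv_Cn i f z) < e"
        unfolding eventually_Cn[OF zC] using d(1) by blast
    qed
  qed
  then show "cdiff_at n f z" using cdiff_at_cderiv by blast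
qed

text \<open>By Osgood's lemma it suffices to vary one variable at a time. In a variable other than the i-th, the
  derivative is an integral of f over a circle in the i-th variable and may be differentiated under
  the integral sign.\<close>

lemma pderiv_hol:
  assumes h: "hol_Cn n W f" and i: "i < n"
  shows "hol_Cn n W (pderiv_Cn i f)"
proof (rule sep_hol_imp_hol)
  have f: "sep_hol n W f" using hol_Cn_sep[OF h] .
  have W: "openin (top_of_set (Cn n)) W" and c: "continuous_on W f" using f by (auto simp: sep_hol_def)
  show "sep_hol n W (pderiv_Cn i f)" unfolding sep_hol_def
  proof (intro conjI ballI allI impI W sep_hol_pderiv_cont[OF f i])
    fix z j assume z: "z \<in> W" and j: "j < n"
    have zC: "z \<in> Cn n" using W z openin_Cn_iff by blast
    obtain r where r: "r > 0" "\<And>w. w \<in> Cn n ==> (\<And>i. i < n ==> norm (w i - z i) \<le> r) ==> w \<in> W"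
      using closed_box[OF W z] by metis
    show "(\<lambda>t. pderiv_Cn i f (z(j := t))) field_differentiable at (z j)"
    proof (cases "j = i")
      case True
      have "(\<lambda>t. f (z(i := t))) holomorphic_on ball (z i) r"
        by (rule slice_holomorphic[OF f i]) (use r zC i in \<open>auto intro!: r(2) Cn_upd simp: dist_norm norm_minus_commute\<close>)
      then have "deriv (\<lambda>t. f (z(i := t))) holomorphic_on ball (z i) r" by (rule holomorphic_deriv) auto
      then have "deriv (\<lambda>t. f (z(i := t))) field_differentiable at (z i)"
        using r(1) holomorphic_on_imp_differentiable_at by (metis centre_in_ball open_ball)
      then show ?thesis using True by (simp add: pderiv_Cn_def)
    next
      case False
      define g where "g = circlepath (z i) r"
      \<comment> \<open>the kernel of Cauchy's formula for the first derivative, with the circle parametrised over [0, 1]\<close>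
      define q where "q x = 1 / (2 * of_real pi * \<i>) * (1 / (g x - z i) ^ 2 * vector_derivative g (at x))" for x
      define U where "U = ball (z j) r"
      have zs: "z(j := t, i := s) \<in> W" if "t \<in> cball (z j) r" "s \<in> cball (z i) r" for t s
        using that r zC i j by (auto intro!: r(2) Cn_upd simp: dist_norm norm_minus_commute)
      have gc: "g x \<in> sphere (z i) r" for x
        by (simp add: g_def circlepath dist_norm norm_mult r(1) less_imp_le)
      have gx: "g x \<in> cball (z i) r" "g x \<noteq> z i" for x using gc[of x] r(1) by auto
      have gcont: "continuous_on S g" for S unfolding g_def circlepath by (intro continuous_intros)
      have "vector_derivative g (at x) = 2 * pi * \<i> * r * exp (2 * of_real pi * \<i> * x)" for x
        by (simp add: g_def vector_derivative_circlepath)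
      then have q: "continuous_on S q" for S
        unfolding q_def using gx(2) by (auto intro!: continuous_intros gcont)
      have eq: "pderiv_Cn i f (z(j := t)) = integral (cbox 0 1) (\<lambda>x. f (z(j := t, i := g x)) * q x)"
        if t: "t \<in> U" for t
      proof -
        define F where "F s = f (z(j := t, i := s))" for s
        have "continuous_on (cball (z i) r) F" unfolding F_def
        proof (rule continuous_on_compose2[OF c])
          show "continuous_on (cball (z i) r) (\<lambda>s. z(j := t, i := s))"
            by (intro continuous_on_fun_upd continuous_on_const continuous_on_id)
        qed (use zs t in \<open>auto simp: U_def\<close>)
        moreover have "F holomorphic_on ball (z i) r" unfolding F_def
          by (rule slice_holomorphic[OF f i]) (use zs t in \<open>auto simp: U_def\<close>)
        ultimately have "deriv F (z i) = 1 / (2 * of_real pi * \<i>) * contour_integral g (\<lambda>u. F u / (u - z i) ^ 2)"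
          unfolding g_def
          by (rule DERIV_imp_deriv[OF Cauchy_derivative_integral_circlepath(2)]) (simp add: r(1))
        also have "\<dots> = integral {0..1} (\<lambda>x. 1 / (2 * of_real pi * \<i>) * (F (g x) / (g x - z i) ^ 2 * vector_derivative g (at x)))"
          unfolding contour_integral_integral by (rule integral_mult_right[symmetric])
        also have "\<dots> = integral (cbox 0 1) (\<lambda>x. F (g x) * q x)"
          unfolding cbox_interval by (rule integral_cong) (simp add: q_def)
        finally show ?thesis using False by (simp add: pderiv_Cn_def F_def[abs_def])
      qed
      have "(\<lambda>t. integral (cbox 0 1) (\<lambda>x. f (z(j := t, i := g x)) * q x)) holomorphic_on U"
      proof (rule leibniz_rule_holomorphic[where fx = "\<lambda>t x. pderiv_Cn j f (z(j := t, i := g x)) * q x"])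
        fix t and x :: real assume t: "t \<in> U"
        let ?w = "z(j := t, i := g x)"
        have "?w \<in> W" using zs gx t unfolding U_def by simp
        then have "(\<lambda>u. f (?w(j := u))) field_differentiable at (?w j)"
          using f j unfolding sep_hol_def by blast
        then have "((\<lambda>u. f (?w(j := u))) has_field_derivative pderiv_Cn j f ?w) (at (?w j))"
          unfolding pderiv_Cn_def by (simp only: DERIV_deriv_iff_field_differentiable)
        moreover have "?w(j := u) = z(j := u, i := g x)" "?w j = t" for u using False by auto
        ultimately have "((\<lambda>t. f (z(j := t, i := g x))) has_field_derivative pderiv_Cn j f ?w) (at t)"
          by simp
        then have D: "((\<lambda>t. f (z(j := t, i := g x))) has_field_derivative pderiv_Cn j f ?w) (at t within U)"
          by (rule DERIV_subset[OF _ subset_UNIV])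
        show "((\<lambda>t. f (z(j := t, i := g x)) * q x) has_field_derivative pderiv_Cn j f ?w * q x) (at t within U)"
          by (rule DERIV_cmult_right[OF D])
      next
        fix t assume t: "t \<in> U"
        show "(\<lambda>x. f (z(j := t, i := g x)) * q x) integrable_on cbox 0 1"
        proof (intro integrable_continuous continuous_on_mult q continuous_on_compose2[OF c])
          show "continuous_on (cbox 0 1) (\<lambda>x. z(j := t, i := g x))"
            by (intro continuous_on_fun_upd gcont continuous_on_const)
        qed (use zs gx t in \<open>auto simp: U_def\<close>)
      next
        have "continuous_on (U \<times> cbox 0 1) (\<lambda>tx. pderiv_Cn j f (z(j := fst tx, i := g (snd tx))) * q (snd tx))"
        proof (intro continuous_on_mult continuous_on_compose2[OF sep_hol_pderiv_cont[OF f j]] continuous_on_compose2[OF q[of UNIV]])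
          show "continuous_on (U \<times> cbox 0 1) (\<lambda>tx. z(j := fst tx, i := g (snd tx)))"
            by (intro continuous_on_fun_upd continuous_on_const continuous_on_fst continuous_on_snd
                continuous_on_id continuous_on_compose2[OF gcont[of UNIV]]) auto
          show "continuous_on (U \<times> cbox 0 1) (snd :: complex \<times> real => real)"
            by (intro continuous_on_snd continuous_on_id)
        qed (use zs gx in \<open>auto simp: U_def\<close>)
        then show "continuous_on (U \<times> cbox 0 1) (\<lambda>(t, x). pderiv_Cn j f (z(j := t, i := g x)) * q x)"
          by (simp add: case_prod_unfold)
      qed (simp add: U_def)
      then have "(\<lambda>t. pderiv_Cn i f (z(j := t))) holomorphic_on U"
        using eq by (subst holomorphic_cong[OF refl]) auto
      then show ?thesis using r(1) unfolding U_def
        by (meson centre_in_ball holomorphic_on_imp_differentiable_at open_ball)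
    qed
  qed
qed

section \<open>Holomorphic functions and maps on manifolds\<close>

subsection \<open>Germs on complex n-space\<close>

lemma openin_Cn_sub: "openin (top_of_set (Cn n)) W ==> W \<subseteq> Cn n"
  by (simp add: openin_Cn_iff)

definition hol_near :: "nat => ((nat => complex) => complex) => (nat => complex) => bool" where
  "hol_near n f z \<longleftrightarrow> (\<exists>W. z \<in> W \<and> hol_Cn n W f)"

lemma openin_Cn_box:
  "openin (top_of_set (Cn n)) W ==> z \<in> W ==> \<exists>r>0. \<forall>w\<in>Cn n. (\<forall>i<n. norm (w i - z i) < r) --> w \<in> W"
  by (simp add: openin_Cn_iff)

lemma hol_nearI: "hol_Cn n W f ==> z \<in> W ==> hol_near n f z"
  unfolding hol_near_def by (intro exI conjI)

lemma hol_near_Cn: "hol_near n f z ==> z \<in> Cn n"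
  unfolding hol_near_def using hol_Cn_sub by blast

lemma hol_near_cdiff: "hol_near n f z ==> cdiff_at n f z"
  unfolding hol_near_def hol_Cn_def by blast

lemma hol_near_cderiv: "hol_near n f z ==> cderiv n f z (\<lambda>i. pderiv_Cn i f z)"
  using cdiff_cderiv hol_near_Cn hol_near_cdiff by blast

lemma hol_Cn_iff_near: "hol_Cn n W f \<longleftrightarrow> openin (top_of_set (Cn n)) W \<and> (\<forall>z\<in>W. hol_near n f z)"
  unfolding hol_near_def hol_Cn_def by blast

lemma hol_Cn_subset: "hol_Cn n W f ==> openin (top_of_set (Cn n)) V ==> V \<subseteq> W ==> hol_Cn n V f"
  unfolding hol_Cn_def by blast

lemma hol_near_within:
  assumes "hol_near n f z" "openin (top_of_set (Cn n)) V" "z \<in> V"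
  obtains W where "z \<in> W" "W \<subseteq> V" "hol_Cn n W f"
proof -
  obtain W where "z \<in> W" "hol_Cn n W f" using assms(1) hol_near_def by blast
  then have "hol_Cn n (W \<inter> V) f" using assms(2) by (auto simp: hol_Cn_def)
  then show ?thesis using that[of "W \<inter> V"] \<open>z \<in> W\<close> assms(3) by blast
qed

lemma hol_near_cong:
  assumes "openin (top_of_set (Cn n)) V" "z \<in> V" "\<And>w. w \<in> V ==> f w = g w" "hol_near n f z"
  shows "hol_near n g z"
proof -
  obtain W where W: "z \<in> W" "W \<subseteq> V" "hol_Cn n W f" using hol_near_within[OF assms(4,1,2)] .
  then have "hol_Cn n W g" using hol_Cn_cong[of W f g n] assms(3) by blast
  then show ?thesis using W(1) hol_near_def by blast
qed

lemma hol_near_const: "z \<in> Cn n ==> hol_near n (\<lambda>w. c) z"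
  unfolding hol_near_def hol_Cn_def cdiff_at_cderiv
  by (intro exI[of _ "Cn n"]) auto

lemma hol_near_coord: "z \<in> Cn n ==> hol_near n (\<lambda>w. w k) z"
proof (cases "k < n")
  case True
  assume "z \<in> Cn n"
  then show ?thesis using True unfolding hol_near_def hol_Cn_def cdiff_at_cderiv
    by (intro exI[of _ "Cn n"]) (auto intro: cderiv_coord)
next
  case False
  assume z: "z \<in> Cn n"
  show ?thesis
    by (rule hol_near_cong[OF _ z _ hol_near_const[OF z, of 0]]) (use False in \<open>auto simp: Cn_def\<close>)
qed

lemma hol_near_add:
  assumes "hol_near n f z" "hol_near n g z" shows "hol_near n (\<lambda>w. f w + g w) z"
proof -
  obtain W V where W: "z \<in> W" "hol_Cn n W f" and V: "z \<in> V" "hol_Cn n V g"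
    using assms hol_near_def by metis
  have "cdiff_at n (\<lambda>w. f w + g w) w" if "w \<in> W \<inter> V" for w
  proof -
    have "w \<in> Cn n" using that W hol_Cn_sub by blast
    then show ?thesis using cderiv_add[OF _ hol_Cn_cderiv[OF W(2)] hol_Cn_cderiv[OF V(2)]] that
      unfolding cdiff_at_cderiv by blast
  qed
  then have "hol_Cn n (W \<inter> V) (\<lambda>w. f w + g w)" using W V by (auto simp: hol_Cn_def)
  then show ?thesis using W V hol_near_def by blast
qed

lemma hol_near_mult:
  assumes "hol_near n f z" "hol_near n g z" shows "hol_near n (\<lambda>w. f w * g w) z"
proof -
  obtain W V where W: "z \<in> W" "hol_Cn n W f" and V: "z \<in> V" "hol_Cn n V g"
    using assms hol_near_def by metis
  have "cdiff_at n (\<lambda>w. f w * g w) w" if "w \<in> W \<inter> V" for w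
  proof -
    have "w \<in> Cn n" using that W hol_Cn_sub by blast
    then show ?thesis using cderiv_mult[OF _ hol_Cn_cderiv[OF W(2)] hol_Cn_cderiv[OF V(2)]] that
      unfolding cdiff_at_cderiv by blast
  qed
  then have "hol_Cn n (W \<inter> V) (\<lambda>w. f w * g w)" using W V by (auto simp: hol_Cn_def)
  then show ?thesis using W V hol_near_def by blast
qed

lemma openin_Cn_preimage:
  assumes U: "openin (top_of_set (Cn n)) U" and V: "openin (top_of_set (Cn m)) V"
    and g: "\<And>z. z \<in> U ==> g z \<in> Cn m" and c: "\<And>k. k < m ==> continuous_on U (\<lambda>z. g z k)"
  shows "openin (top_of_set (Cn n)) {z \<in> U. g z \<in> V}"
proof -
  have "continuous_on U (\<lambda>z. g z k)" for k
  proof (cases "k < m")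
    case False
    then have "continuous_on U (\<lambda>z. g z k) \<longleftrightarrow> continuous_on U (\<lambda>z. 0 :: complex)"
      using g by (intro continuous_on_cong) (auto simp: Cn_def)
    then show ?thesis by simp
  qed (use c in blast)
  then have "continuous_on U g" by (rule continuous_on_coordinatewise_then_product)
  then have "openin (top_of_set U) (U \<inter> g -` V)"
    using V g by (intro continuous_openin_preimage[where T = "Cn m"]) auto
  then have "openin (top_of_set (Cn n)) (U \<inter> g -` V)" using U openin_trans by blast
  then show ?thesis by (simp add: Int_def vimage_def)
qed

lemma hol_near_outer:
  assumes f: "hol_near n f z" and h: "h holomorphic_on S" "open S" "f z \<in> S"
  shows "hol_near n (\<lambda>w. h (f w)) z"
proof -
  obtain W where W: "z \<in> W" "hol_Cn n W f" using f hol_near_def by blast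
  let ?V = "{w \<in> W. f w \<in> S}"
  have "openin (top_of_set W) (W \<inter> f -` S)"
    using continuous_openin_preimage_gen hol_Cn_cont[OF W(2)] h(2) by blast
  then have V: "openin (top_of_set (Cn n)) ?V"
    using W(2) openin_trans unfolding hol_Cn_def by (simp add: Int_def vimage_def) blast
  have "cdiff_at n (\<lambda>w. h (f w)) w" if "w \<in> ?V" for w
  proof -
    have "w \<in> Cn n" using that W hol_Cn_sub by blast
    moreover have "(h has_field_derivative deriv h (f w)) (at (f w))"
      using h(1,2) that holomorphic_derivI by blast
    ultimately show ?thesis using cderiv_outer[OF _ hol_Cn_cderiv[OF W(2)]] that
      unfolding cdiff_at_cderiv by blast
  qed
  then have "hol_Cn n ?V (\<lambda>w. h (f w))" using V by (auto simp: hol_Cn_def)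
  moreover have "z \<in> ?V" using W(1) h(3) by simp
  ultimately show ?thesis unfolding hol_near_def by (intro exI conjI)
qed

lemma hol_near_chain:
  assumes f: "hol_near m f (g z)" and g: "\<And>k. k < m ==> hol_near n (\<lambda>w. g w k) z"
    and U: "openin (top_of_set (Cn n)) U" "z \<in> U" "\<And>w. w \<in> U ==> g w \<in> Cn m"
  shows "hol_near n (\<lambda>w. f (g w)) z"
    "i < n ==> pderiv_Cn i (\<lambda>w. f (g w)) z = (\<Sum>k<m. pderiv_Cn k f (g z) * pderiv_Cn i (\<lambda>w. g w k) z)"
proof -
  obtain V where V: "g z \<in> V" "hol_Cn m V f" using f hol_near_def by blast
  have "\<forall>k. \<exists>W. k < m --> z \<in> W \<and> hol_Cn n W (\<lambda>w. g w k)" using g hol_near_def by blast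
  from choice[OF this] obtain W where W: "\<And>k. k < m ==> z \<in> W k \<and> hol_Cn n (W k) (\<lambda>w. g w k)" by blast
  define U' where "U' = U \<inter> (\<Inter>k\<in>{..<m}. W k)"
  have "openin (top_of_set (Cn n)) (\<Inter>k\<in>{..<m}. W k)" if "m \<noteq> 0"
    using W that by (intro openin_Inter) (auto simp: hol_Cn_def)
  then have U': "openin (top_of_set (Cn n)) U'" unfolding U'_def using U(1) by (cases "m = 0") auto
  have gk: "hol_Cn n U' (\<lambda>w. g w k)" if "k < m" for k
    by (rule hol_Cn_subset[OF conjunct2[OF W[OF that]] U']) (use that in \<open>auto simp: U'_def\<close>)
  let ?Q = "{w \<in> U'. g w \<in> V}"
  have Q: "openin (top_of_set (Cn n)) ?Q"
    using U' V(2) U(3) hol_Cn_cont[OF gk] by (intro openin_Cn_preimage[where m = m]) (auto simp: U'_def hol_Cn_def)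
  have cd: "cderiv n (\<lambda>w. f (g w)) w (\<lambda>i. \<Sum>k<m. pderiv_Cn k f (g w) * pderiv_Cn i (\<lambda>w. g w k) w)" if w: "w \<in> ?Q" for w
  proof (rule cderiv_chain[where g = g and f = f and m = m])
    show "w \<in> Cn n" using w openin_Cn_sub[OF U'] by blast
    show "eventually (\<lambda>w. g w \<in> Cn m) (at w within Cn n)"
      by (rule eventually_mono[OF openin_Cn_eventually[OF U' _]]) (use w U(3) in \<open>auto simp: U'_def\<close>)
    show "g w \<in> Cn m" using w U(3) by (auto simp: U'_def)
    show "cderiv n (\<lambda>w. g w k) w (\<lambda>i. pderiv_Cn i (\<lambda>w. g w k) w)" if "k < m" for k
      using hol_Cn_cderiv[OF gk[OF that]] w by blast
    show "cderiv m f (g w) (\<lambda>k. pderiv_Cn k f (g w))" using hol_Cn_cderiv[OF V(2)] w by blast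
  qed
  then have "hol_Cn n ?Q (\<lambda>w. f (g w))" using Q unfolding hol_Cn_def cdiff_at_cderiv by blast
  moreover have zQ: "z \<in> ?Q" using V U W by (auto simp: U'_def)
  ultimately show "hol_near n (\<lambda>w. f (g w)) z" unfolding hol_near_def by (intro exI conjI)
  show "pderiv_Cn i (\<lambda>w. f (g w)) z = (\<Sum>k<m. pderiv_Cn k f (g z) * pderiv_Cn i (\<lambda>w. g w k) z)" if "i < n"
    using pderiv_eq[OF _ cd[OF zQ] that] zQ openin_Cn_sub[OF U'] by blast
qed

lemma hol_near_pderiv: "hol_near n f z ==> i < n ==> hol_near n (pderiv_Cn i f) z"
  unfolding hol_near_def using pderiv_hol by blast

lemma pderiv_near_cong:
  assumes "openin (top_of_set (Cn n)) V" "z \<in> V" "\<And>w. w \<in> V ==> f w = g w" "hol_near n f z" "i < n"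
  shows "pderiv_Cn i f z = pderiv_Cn i g z"
  using pderiv_cong[OF assms(1-3) assms(5) hol_near_cdiff[OF assms(4)]] .

subsection \<open>Charts\<close>

lemma top_chartD:
  assumes "top_chart T n (U, \<phi>)"
  shows "openin T U" "openin (top_of_set (Cn n)) (\<phi> ` U)" "inj_on \<phi> U"
    "p \<in> U ==> \<phi> p \<in> Cn n"
    "openin T S ==> openin (top_of_set (Cn n)) (\<phi> ` (U \<inter> S))"
    "openin (top_of_set (Cn n)) W ==> openin T {p \<in> U. \<phi> p \<in> W}"
proof -
  have U: "openin T U" and V: "openin (top_of_set (Cn n)) (\<phi> ` U)"
    and h: "homeomorphic_map (subtopology T U) (top_of_set (\<phi> ` U)) \<phi>"
    using assms by (auto simp: top_chart_def)
  show "openin T U" "openin (top_of_set (Cn n)) (\<phi> ` U)" by fact+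
  have ts: "topspace (subtopology T U) = U" using openin_subset[OF U] by auto
  show "inj_on \<phi> U" using homeomorphic_imp_injective_map[OF h] ts by simp
  show "\<phi> p \<in> Cn n" if "p \<in> U" using openin_Cn_sub[OF V] that by blast
  show "openin (top_of_set (Cn n)) (\<phi> ` (U \<inter> S))" if "openin T S"
  proof -
    have "openin (subtopology T U) (U \<inter> S)"
      using that by (simp add: openin_subtopology_Int2)
    then have "openin (top_of_set (\<phi> ` U)) (\<phi> ` (U \<inter> S))"
      using homeomorphic_imp_open_map[OF h] unfolding open_map_def by blast
    then show ?thesis using V openin_trans by blast
  qed
  show "openin T {p \<in> U. \<phi> p \<in> W}" if W: "openin (top_of_set (Cn n)) W"
  proof -
    obtain A where A: "open A" "W = Cn n \<inter> A" using W by (auto simp: openin_open)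
    have "openin (top_of_set (\<phi> ` U)) (\<phi> ` U \<inter> A)" using A(1) by (auto simp: openin_open)
    then have "openin (subtopology T U) {x \<in> topspace (subtopology T U). \<phi> x \<in> \<phi> ` U \<inter> A}"
      using homeomorphic_imp_continuous_map[OF h] openin_continuous_map_preimage by blast
    moreover have "{x \<in> topspace (subtopology T U). \<phi> x \<in> \<phi> ` U \<inter> A} = {p \<in> U. \<phi> p \<in> W}"
      unfolding ts A(2) using openin_Cn_sub[OF V] by blast
    ultimately show ?thesis using U openin_trans_full by metis
  qed
qed

lemma top_chartI:
  assumes U: "openin T U" and i: "inj_on \<phi> U" and C: "\<And>p. p \<in> U ==> \<phi> p \<in> Cn n"
    and im: "\<And>S. openin T S ==> S \<subseteq> U ==> openin (top_of_set (Cn n)) (\<phi> ` S)"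
    and pre: "\<And>W. openin (top_of_set (Cn n)) W ==> openin T {p \<in> U. \<phi> p \<in> W}"
  shows "top_chart T n (U, \<phi>)"
proof -
  have ts: "topspace (subtopology T U) = U" using openin_subset[OF U] by auto
  have V: "openin (top_of_set (Cn n)) (\<phi> ` U)" using im[OF U] by simp
  have "continuous_map (subtopology T U) (top_of_set (\<phi> ` U)) \<phi>"
    unfolding continuous_map_def
  proof (intro conjI allI impI)
    fix W assume "openin (top_of_set (\<phi> ` U)) W"
    then have "openin (top_of_set (Cn n)) W" using V openin_trans by blast
    from pre[OF this] show "openin (subtopology T U) {x \<in> topspace (subtopology T U). \<phi> x \<in> W}"
      unfolding ts using U by (simp add: openin_open_subtopology)
  qed (use ts in auto)
  moreover have "open_map (subtopology T U) (top_of_set (\<phi> ` U)) \<phi>"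
    unfolding open_map_def
  proof (intro allI impI)
    fix S assume "openin (subtopology T U) S"
    then have S: "openin T S" "S \<subseteq> U" using U by (simp_all add: openin_open_subtopology)
    have "openin (top_of_set (Cn n)) (\<phi> ` S)" using im[OF S] .
    moreover have "\<phi> ` S \<subseteq> \<phi> ` U" using S(2) by blast
    moreover have "\<phi> ` U \<subseteq> Cn n" using C by blast
    ultimately show "openin (top_of_set (\<phi> ` U)) (\<phi> ` S)"
      by (meson openin_subset_trans)
  qed
  ultimately have "homeomorphic_map (subtopology T U) (top_of_set (\<phi> ` U)) \<phi>"
    using i ts by (intro bijective_open_imp_homeomorphic_map) auto
  then show ?thesis using U V by (simp add: top_chart_def)
qed

text \<open>The part of being a manifold that concerns charts; it passes to products and to complete
  intersections by checking charts alone.\<close>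

definition charted :: "'a cmfd => bool" where
  "charted M \<longleftrightarrow> (\<forall>c\<in>atlas M. top_chart (mtop M) (mdim M) c)
    \<and> (\<Union>c\<in>atlas M. fst c) = pts M
    \<and> (\<forall>c\<in>atlas M. \<forall>c'\<in>atlas M. hol_transition (mdim M) c c')"

lemma complex_manifold_charted: "complex_manifold M ==> charted M"
  by (simp add: complex_manifold_def charted_def)

lemma atlas_hol_chart: "charted M ==> c \<in> atlas M ==> hol_chart M c"
  by (auto simp: charted_def hol_chart_def)

lemma chart_at:
  assumes "charted M" "p \<in> pts M"
  obtains U \<phi> where "(U, \<phi>) \<in> atlas M" "hol_chart M (U, \<phi>)" "p \<in> U"
proof -
  obtain c where "c \<in> atlas M" "p \<in> fst c" using assms unfolding charted_def by blast
  then show ?thesis using that[of "fst c" "snd c"] atlas_hol_chart[OF assms(1)] by simp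
qed

lemma chart_ex:
  assumes "charted M" "p \<in> pts M"
  shows "\<exists>U \<phi>. (U, \<phi>) \<in> atlas M \<and> hol_chart M (U, \<phi>) \<and> p \<in> U"
  by (rule chart_at[OF assms]) blast

lemma hol_chart_top: "hol_chart M (U, \<phi>) ==> top_chart (mtop M) (mdim M) (U, \<phi>)"
  by (simp add: hol_chart_def)

lemmas hol_chartD = top_chartD[OF hol_chart_top]

lemma hol_chart_sub: "hol_chart M (U, \<phi>) ==> p \<in> U ==> p \<in> pts M"
  using hol_chartD(1) openin_subset by blast

lemma hol_fun_imp_at: "hol_fun M S f ==> p \<in> S ==> hol_fun_at M f p"
  unfolding hol_fun_at_def by (intro exI conjI)

lemma hol_fun_at_pts: "hol_fun_at M f p ==> p \<in> pts M"
  unfolding hol_fun_at_def hol_fun_def using openin_subset by blast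

lemma hol_transitionD:
  "hol_transition n (U, \<phi>) (V, \<psi>) ==> k < n ==> hol_Cn n (\<phi> ` (U \<inter> V)) (\<lambda>z. \<psi> (inv_into U \<phi> z) k)"
  by (simp add: hol_transition_def)

lemma hol_funD:
  "hol_fun M S f ==> (V, \<psi>) \<in> atlas M ==> hol_Cn (mdim M) (\<psi> ` (V \<inter> S)) (\<lambda>z. f (inv_into V \<psi> z))"
  by (auto simp: hol_fun_def)

lemma transition_near:
  assumes t: "hol_transition n (U, \<phi>) (V, \<psi>)" and c: "top_chart T n (U, \<phi>)" "top_chart T n (V, \<psi>)"
    and p: "p \<in> U" "p \<in> V" and f: "hol_near n (\<lambda>z. f (inv_into V \<psi> z)) (\<psi> p)"
  shows "hol_near n (\<lambda>z. f (inv_into U \<phi> z)) (\<phi> p)"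
proof -
  let ?W = "\<phi> ` (U \<inter> V)"
  have W: "openin (top_of_set (Cn n)) ?W" using top_chartD(5)[OF c(1) top_chartD(1)[OF c(2)]] .
  have iU: "inv_into U \<phi> (\<phi> x) = x" if "x \<in> U" for x using that top_chartD(3)[OF c(1)] by simp
  have iV: "inv_into V \<psi> (\<psi> x) = x" if "x \<in> V" for x using that top_chartD(3)[OF c(2)] by simp
  have "hol_near n (\<lambda>z. f (inv_into V \<psi> (\<psi> (inv_into U \<phi> z)))) (\<phi> p)"
  proof (rule hol_near_chain(1)[where g = "\<lambda>z. \<psi> (inv_into U \<phi> z)" and m = n and U = ?W, OF _ _ W])
    show "hol_near n (\<lambda>z. f (inv_into V \<psi> z)) (\<psi> (inv_into U \<phi> (\<phi> p)))" using f iU p by simp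
    show "hol_near n (\<lambda>z. \<psi> (inv_into U \<phi> z) k) (\<phi> p)" if "k < n" for k
      using p by (intro hol_nearI[OF hol_transitionD[OF t that]]) blast
    show "\<psi> (inv_into U \<phi> w) \<in> Cn n" if "w \<in> ?W" for w
      using that iU top_chartD(4)[OF c(2)] by auto
  qed (use p in auto)
  then show ?thesis
    by (rule hol_near_cong[OF W, rotated -1]) (use p iU iV in auto)
qed

text \<open>Any chart of the maximal atlas may be used, because germs can be moved between charts by the chain rule.\<close>

lemma hol_fun_at_chart:
  assumes M: "charted M" and c: "hol_chart M (U, \<phi>)" and p: "p \<in> U"
  shows "hol_fun_at M f p \<longleftrightarrow> hol_near (mdim M) (\<lambda>z. f (inv_into U \<phi> z)) (\<phi> p)"
proof
  assume "hol_fun_at M f p"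
  then obtain S where S: "p \<in> S" "hol_fun M S f" using hol_fun_at_def by metis
  obtain V \<psi> where V: "(V, \<psi>) \<in> atlas M" "hol_chart M (V, \<psi>)" "p \<in> V"
    using chart_at[OF M hol_chart_sub[OF c p]] .
  have "hol_near (mdim M) (\<lambda>z. f (inv_into V \<psi> z)) (\<psi> p)"
    using S(1) V(3) by (intro hol_nearI[OF hol_funD[OF S(2) V(1)]]) blast
  moreover have "hol_transition (mdim M) (U, \<phi>) (V, \<psi>)" using c V(1) unfolding hol_chart_def by blast
  ultimately show "hol_near (mdim M) (\<lambda>z. f (inv_into U \<phi> z)) (\<phi> p)"
    using transition_near[OF _ hol_chart_top[OF c] hol_chart_top[OF V(2)] p V(3)] by blast
next
  assume f: "hol_near (mdim M) (\<lambda>z. f (inv_into U \<phi> z)) (\<phi> p)"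
  obtain W where W: "\<phi> p \<in> W" "hol_Cn (mdim M) W (\<lambda>z. f (inv_into U \<phi> z))"
    using f hol_near_def by blast
  define S where "S = {q \<in> U. \<phi> q \<in> W}"
  have S: "openin (mtop M) S" unfolding S_def using W(2) by (intro hol_chartD(6)[OF c]) (simp add: hol_Cn_def)
  have "hol_fun M S f" unfolding hol_fun_def
  proof (intro conjI S ballI, clarify)
    fix V \<psi> assume V: "(V, \<psi>) \<in> atlas M"
    note V' = atlas_hol_chart[OF M V]
    show "hol_Cn (mdim M) (\<psi> ` (V \<inter> S)) (\<lambda>z. f (inv_into V \<psi> z))"
      unfolding hol_Cn_iff_near
    proof (intro conjI ballI)
      show "openin (top_of_set (Cn (mdim M))) (\<psi> ` (V \<inter> S))" using hol_chartD(5)[OF V' S] .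
      fix z assume "z \<in> \<psi> ` (V \<inter> S)"
      then obtain q where q: "z = \<psi> q" "q \<in> V" "q \<in> U" "\<phi> q \<in> W" by (auto simp: S_def)
      have "hol_transition (mdim M) (V, \<psi>) (U, \<phi>)" using c V unfolding hol_chart_def by blast
      moreover have "hol_near (mdim M) (\<lambda>z. f (inv_into U \<phi> z)) (\<phi> q)"
        by (rule hol_nearI[OF W(2) q(4)])
      ultimately show "hol_near (mdim M) (\<lambda>z. f (inv_into V \<psi> z)) z"
        using transition_near[OF _ hol_chart_top[OF V'] hol_chart_top[OF c] q(2,3)] q(1) by blast
    qed
  qed
  moreover have "p \<in> S" using p W(1) by (simp add: S_def)
  ultimately show "hol_fun_at M f p" by (rule hol_fun_imp_at)
qed

lemma hol_fun_iff_at: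
  assumes M: "charted M"
  shows "hol_fun M S f \<longleftrightarrow> openin (mtop M) S \<and> (\<forall>p\<in>S. hol_fun_at M f p)"
proof (intro iffI conjI)
  assume R: "openin (mtop M) S \<and> (\<forall>p\<in>S. hol_fun_at M f p)"
  show "hol_fun M S f" unfolding hol_fun_def
  proof (intro conjI ballI, use R in blast, clarify)
    fix V \<psi> assume V: "(V, \<psi>) \<in> atlas M"
    note V' = atlas_hol_chart[OF M V]
    show "hol_Cn (mdim M) (\<psi> ` (V \<inter> S)) (\<lambda>z. f (inv_into V \<psi> z))"
      unfolding hol_Cn_iff_near
    proof (intro conjI ballI)
      show "openin (top_of_set (Cn (mdim M))) (\<psi> ` (V \<inter> S))" using hol_chartD(5)[OF V'] R by simp
      fix z assume "z \<in> \<psi> ` (V \<inter> S)"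
      then obtain q where q: "z = \<psi> q" "q \<in> V" "q \<in> S" by auto
      then have "hol_fun_at M f q" using R by simp
      then show "hol_near (mdim M) (\<lambda>z. f (inv_into V \<psi> z)) z"
        unfolding q(1) hol_fun_at_chart[OF M V' q(2)] .
    qed
  qed
next
  assume f: "hol_fun M S f"
  show "openin (mtop M) S" using f by (simp add: hol_fun_def)
  show "\<forall>p\<in>S. hol_fun_at M f p" using hol_fun_imp_at[OF f] by simp
qed

lemma hol_fun_at_cong:
  assumes M: "charted M" and S: "openin (mtop M) S" "p \<in> S" "\<And>q. q \<in> S ==> f q = g q" and f: "hol_fun_at M f p"
  shows "hol_fun_at M g p"
proof -
  obtain U \<phi> where U: "hol_chart M (U, \<phi>)" "p \<in> U" using chart_ex[OF M hol_fun_at_pts[OF f]] by blast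
  have "hol_near (mdim M) (\<lambda>z. f (inv_into U \<phi> z)) (\<phi> p)" using f hol_fun_at_chart[OF M U] by simp
  then have "hol_near (mdim M) (\<lambda>z. g (inv_into U \<phi> z)) (\<phi> p)"
    by (rule hol_near_cong[OF hol_chartD(5)[OF U(1) S(1)], rotated -1])
      (use U S hol_chartD(3)[OF U(1)] in auto)
  then show ?thesis using hol_fun_at_chart[OF M U] by simp
qed

lemma hol_fun_at_const: "charted M ==> p \<in> pts M ==> hol_fun_at M (\<lambda>q. c) p"
  by (rule chart_at, assumption+) (simp add: hol_fun_at_chart hol_near_const hol_chartD(4))

lemma hol_fun_at_add:
  assumes M: "charted M" and f: "hol_fun_at M f p" and g: "hol_fun_at M g p"
  shows "hol_fun_at M (\<lambda>q. f q + g q) p"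
proof -
  obtain U \<phi> where U: "hol_chart M (U, \<phi>)" "p \<in> U" using chart_ex[OF M hol_fun_at_pts[OF f]] by blast
  show ?thesis using f g unfolding hol_fun_at_chart[OF M U] by (rule hol_near_add)
qed

lemma hol_fun_at_mult:
  assumes M: "charted M" and f: "hol_fun_at M f p" and g: "hol_fun_at M g p"
  shows "hol_fun_at M (\<lambda>q. f q * g q) p"
proof -
  obtain U \<phi> where U: "hol_chart M (U, \<phi>)" "p \<in> U" using chart_ex[OF M hol_fun_at_pts[OF f]] by blast
  show ?thesis using f g unfolding hol_fun_at_chart[OF M U] by (rule hol_near_mult)
qed

lemma hol_fun_at_outer:
  assumes M: "charted M" and f: "hol_fun_at M f p" and h: "h holomorphic_on S" "open S" "f p \<in> S"
  shows "hol_fun_at M (\<lambda>q. h (f q)) p"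
proof -
  obtain U \<phi> where U: "hol_chart M (U, \<phi>)" "p \<in> U" using chart_ex[OF M hol_fun_at_pts[OF f]] by blast
  have "f (inv_into U \<phi> (\<phi> p)) \<in> S" using U hol_chartD(3)[OF U(1)] h(3) by simp
  with f h(1,2) show ?thesis unfolding hol_fun_at_chart[OF M U]
    by (intro hol_near_outer[where f = "\<lambda>z. f (inv_into U \<phi> z)" and h = h and S = S])
qed

lemma hol_fun_at_inverse:
  "charted M ==> hol_fun_at M f p ==> f p \<noteq> 0 ==> hol_fun_at M (\<lambda>q. inverse (f q)) p"
  by (rule hol_fun_at_outer[where S = "- {0}" and h = inverse]) (auto intro!: holomorphic_intros)

lemma hol_fun_at_divide:
  "charted M ==> hol_fun_at M f p ==> hol_fun_at M g p ==> g p \<noteq> 0 ==> hol_fun_at M (\<lambda>q. f q / g q) p"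
  unfolding divide_inverse by (intro hol_fun_at_mult hol_fun_at_inverse)

lemma hol_fun_at_sum:
  assumes M: "charted M" and p: "p \<in> pts M"
  shows "(\<And>i. i \<in> I ==> hol_fun_at M (f i) p) ==> hol_fun_at M (\<lambda>q. \<Sum>i\<in>I. f i q) p"
proof (induction I rule: infinite_finite_induct)
  case (insert i I)
  then have "hol_fun_at M (\<lambda>q. f i q + (\<Sum>i\<in>I. f i q)) p" by (intro hol_fun_at_add M) auto
  then show ?case using insert by simp
qed (simp_all add: hol_fun_at_const M p)

lemma hol_fun_at_prod:
  assumes M: "charted M" and p: "p \<in> pts M"
  shows "(\<And>i. i \<in> I ==> hol_fun_at M (f i) p) ==> hol_fun_at M (\<lambda>q. \<Prod>i\<in>I. f i q) p"
proof (induction I rule: infinite_finite_induct)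
  case (insert i I)
  then have "hol_fun_at M (\<lambda>q. f i q * (\<Prod>i\<in>I. f i q)) p" by (intro hol_fun_at_mult M) auto
  then show ?case using insert by simp
qed (simp_all add: hol_fun_at_const M p)

lemma hol_fun_at_coord:
  assumes M: "charted M" and U: "hol_chart M (U, \<phi>)" "p \<in> U"
  shows "hol_fun_at M (\<lambda>q. \<phi> q k) p"
  unfolding hol_fun_at_chart[OF M U]
  by (rule hol_near_cong[OF hol_chartD(2)[OF U(1)] _ _ hol_near_coord[of _ _ k]])
     (use U hol_chartD(3,4)[OF U(1)] in \<open>auto simp: f_inv_into_f\<close>)

lemma hol_fun_at_nbhd:
  assumes M: "charted M" and f: "hol_fun_at M f p" and V: "open V" "f p \<in> V"
  shows "\<exists>S. openin (mtop M) S \<and> p \<in> S \<and> (\<forall>q\<in>S. f q \<in> V)"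
proof -
  obtain U \<phi> where U: "hol_chart M (U, \<phi>)" "p \<in> U" using chart_ex[OF M hol_fun_at_pts[OF f]] by blast
  let ?g = "\<lambda>z. f (inv_into U \<phi> z)"
  have iU: "inv_into U \<phi> (\<phi> x) = x" if "x \<in> U" for x using that hol_chartD(3)[OF U(1)] by simp
  obtain W where W: "\<phi> p \<in> W" "hol_Cn (mdim M) W ?g"
    using f[unfolded hol_fun_at_chart[OF M U] hol_near_def] by blast
  have "openin (top_of_set W) (W \<inter> ?g -` V)"
    using continuous_openin_preimage_gen hol_Cn_cont[OF W(2)] V(1) by blast
  then have "openin (top_of_set (Cn (mdim M))) (W \<inter> ?g -` V)"
    using W(2) openin_trans unfolding hol_Cn_def by blast
  then have o: "openin (mtop M) {q \<in> U. \<phi> q \<in> W \<inter> ?g -` V}" by (rule hol_chartD(6)[OF U(1)])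
  show ?thesis
    by (intro exI conjI, rule o) (use U(2) V(2) W(1) iU in auto)
qed

subsection \<open>Maps\<close>

text \<open>Pulling back germs: the coordinate-free form of holomorphy of a map at a point.\<close>

definition hol_at :: "'a cmfd => 'b cmfd => ('a => 'b) => 'a => bool" where
  "hol_at M N F p \<longleftrightarrow> p \<in> pts M \<and> F p \<in> pts N
    \<and> (\<forall>T. openin (mtop N) T \<and> F p \<in> T --> (\<exists>S. openin (mtop M) S \<and> p \<in> S \<and> F ` S \<subseteq> T))
    \<and> (\<forall>f. hol_fun_at N f (F p) --> hol_fun_at M (\<lambda>q. f (F q)) p)"

lemma hol_at_pts: "hol_at M N F p ==> p \<in> pts M" "hol_at M N F p ==> F p \<in> pts N"
  by (simp_all add: hol_at_def)

lemma hol_at_nbhd: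
  assumes "hol_at M N F p" "openin (mtop N) T" "F p \<in> T"
  shows "\<exists>S. openin (mtop M) S \<and> p \<in> S \<and> (\<forall>q\<in>S. F q \<in> T)"
proof -
  have "\<forall>T. openin (mtop N) T \<and> F p \<in> T --> (\<exists>S. openin (mtop M) S \<and> p \<in> S \<and> F ` S \<subseteq> T)"
    using assms(1)[unfolded hol_at_def] by (elim conjE)
  then obtain S where "openin (mtop M) S" "p \<in> S" "F ` S \<subseteq> T" using assms(2,3) by blast
  then show ?thesis by blast
qed

lemma hol_at_pull: "hol_at M N F p ==> hol_fun_at N f (F p) ==> hol_fun_at M (\<lambda>q. f (F q)) p"
  by (simp add: hol_at_def)

text \<open>Holomorphic coordinate functions suffice: continuity follows by shrinking coordinate boxes, and
  germs pull back by the chain rule.\<close>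

lemma hol_at_chartI:
  assumes M: "charted M" and N: "charted N" and p: "p \<in> pts M" and V: "hol_chart N (V, \<psi>)" "F p \<in> V"
    and S: "openin (mtop M) S" "p \<in> S" "\<And>q. q \<in> S ==> F q \<in> V"
    and c: "\<And>k. k < mdim N ==> hol_fun_at M (\<lambda>q. \<psi> (F q) k) p"
  shows "hol_at M N F p"
  unfolding hol_at_def
proof (intro conjI allI impI p)
  show "F p \<in> pts N" using hol_chart_sub V by metis
  fix T assume T: "openin (mtop N) T \<and> F p \<in> T"
  have W: "openin (top_of_set (Cn (mdim N))) (\<psi> ` (V \<inter> T))" using hol_chartD(5)[OF V(1)] T by blast
  moreover have "\<psi> (F p) \<in> \<psi> ` (V \<inter> T)" using T V by blast
  ultimately obtain r where r: "r > 0" "\<forall>w\<in>Cn (mdim N). (\<forall>i<mdim N. norm (w i - \<psi> (F p) i) < r) --> w \<in> \<psi> ` (V \<inter> T)"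
    using openin_Cn_box by blast
  have "\<exists>S. openin (mtop M) S \<and> p \<in> S \<and> (\<forall>q\<in>S. norm (\<psi> (F q) k - \<psi> (F p) k) < r)" if "k < mdim N" for k
    using hol_fun_at_nbhd[OF M c[OF that], of "ball (\<psi> (F p) k) r"] r(1)
    by (simp add: dist_norm norm_minus_commute)
  then have "\<forall>k. \<exists>S. k < mdim N --> openin (mtop M) S \<and> p \<in> S \<and> (\<forall>q\<in>S. norm (\<psi> (F q) k - \<psi> (F p) k) < r)" by blast
  from choice[OF this] obtain Q where Q: "\<And>k. k < mdim N ==> openin (mtop M) (Q k)" "\<And>k. k < mdim N ==> p \<in> Q k"
     "\<And>k q. k < mdim N ==> q \<in> Q k ==> norm (\<psi> (F q) k - \<psi> (F p) k) < r" by blast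
  define S' where "S' = S \<inter> (\<Inter>k\<in>{..<mdim N}. Q k)"
  have "openin (mtop M) (\<Inter>k\<in>{..<mdim N}. Q k)" if "mdim N \<noteq> 0"
    using Q that by (intro openin_Inter) auto
  then have "openin (mtop M) S'" unfolding S'_def using S(1) by (cases "mdim N = 0") auto
  moreover have "p \<in> S'" using S Q by (auto simp: S'_def)
  moreover have "F ` S' \<subseteq> T"
  proof
    fix y assume "y \<in> F ` S'"
    then obtain q where q: "y = F q" "q \<in> S'" by blast
    have FV: "F q \<in> V" using q S(3) by (auto simp: S'_def)
    have "\<psi> (F q) \<in> \<psi> ` (V \<inter> T)"
      using q Q(3) hol_chartD(4)[OF V(1) FV] by (intro r(2)[rule_format]) (auto simp: S'_def)
    then show "y \<in> T" using FV q(1) hol_chartD(3)[OF V(1)] by (auto dest: inj_onD)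
  qed
  ultimately show "\<exists>S. openin (mtop M) S \<and> p \<in> S \<and> F ` S \<subseteq> T" by blast
next
  fix f assume f: "hol_fun_at N f (F p)"
  obtain U \<phi> where U: "hol_chart M (U, \<phi>)" "p \<in> U" using chart_ex[OF M p] by blast
  have iU: "inv_into U \<phi> (\<phi> x) = x" if "x \<in> U" for x using that hol_chartD(3)[OF U(1)] by simp
  have iV: "inv_into V \<psi> (\<psi> x) = x" if "x \<in> V" for x using that hol_chartD(3)[OF V(1)] by simp
  let ?W = "\<phi> ` (U \<inter> S)"
  have W: "openin (top_of_set (Cn (mdim M))) ?W" using hol_chartD(5)[OF U(1) S(1)] .
  have "hol_near (mdim M) (\<lambda>z. f (inv_into V \<psi> (\<psi> (F (inv_into U \<phi> z))))) (\<phi> p)"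
  proof (rule hol_near_chain(1)[where g = "\<lambda>z. \<psi> (F (inv_into U \<phi> z))" and m = "mdim N" and U = ?W, OF _ _ W])
    show "hol_near (mdim N) (\<lambda>z. f (inv_into V \<psi> z)) (\<psi> (F (inv_into U \<phi> (\<phi> p))))"
      using f iU U unfolding hol_fun_at_chart[OF N V] by simp
    show "hol_near (mdim M) (\<lambda>z. \<psi> (F (inv_into U \<phi> z)) k) (\<phi> p)" if "k < mdim N" for k
      using c[OF that] unfolding hol_fun_at_chart[OF M U] .
    show "\<psi> (F (inv_into U \<phi> w)) \<in> Cn (mdim N)" if "w \<in> ?W" for w
      using that iU S(3) hol_chartD(4)[OF V(1)] by auto
  qed (use U S in auto)
  then have "hol_near (mdim M) (\<lambda>z. f (F (inv_into U \<phi> z))) (\<phi> p)"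
    by (rule hol_near_cong[OF W, rotated -1]) (use U S iU iV in auto)
  then show "hol_fun_at M (\<lambda>q. f (F q)) p" unfolding hol_fun_at_chart[OF M U] .
qed

lemma hol_map_iff:
  assumes M: "charted M" and N: "charted N"
  shows "hol_map M N S F \<longleftrightarrow> openin (mtop M) S \<and> (\<forall>p\<in>S. hol_at M N F p)"
proof (intro iffI conjI ballI)
  assume h: "hol_map M N S F"
  show S: "openin (mtop M) S" using h by (simp add: hol_map_def)
  fix p assume p: "p \<in> S"
  have "F p \<in> pts N" using h p by (auto simp: hol_map_def)
  then obtain V \<psi> where V: "(V, \<psi>) \<in> atlas N" "hol_chart N (V, \<psi>)" "F p \<in> V" by (rule chart_at[OF N])
  have 1: "openin (mtop M) {p\<in>S. F p \<in> V}" "\<And>k. k < mdim N ==> hol_fun M {p\<in>S. F p \<in> V} (\<lambda>p. \<psi> (F p) k)"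
    using h V(1) unfolding hol_map_def by auto
  show "hol_at M N F p"
  proof (rule hol_at_chartI[where F = F and V = V and \<psi> = \<psi> and S = "{p\<in>S. F p \<in> V}", OF M N _ V(2,3) 1(1)])
    show "p \<in> pts M" using openin_subset[OF S] p by blast
    show pV: "p \<in> {p\<in>S. F p \<in> V}" using p V(3) by simp
    show "F q \<in> V" if "q \<in> {p\<in>S. F p \<in> V}" for q using that by simp
    show "hol_fun_at M (\<lambda>q. \<psi> (F q) k) p" if "k < mdim N" for k
      by (rule hol_fun_imp_at[OF 1(2)[OF that] pV])
  qed
next
  assume R: "openin (mtop M) S \<and> (\<forall>p\<in>S. hol_at M N F p)"
  show "hol_map M N S F" unfolding hol_map_def
  proof (intro conjI ballI)
    show S: "openin (mtop M) S" by (rule conjunct1[OF R])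
    show "F ` S \<subseteq> pts N"
    proof
      fix y assume "y \<in> F ` S"
      then obtain q where q: "y = F q" "q \<in> S" by blast
      show "y \<in> pts N" unfolding q(1) by (rule hol_at_pts(2)[OF bspec[OF conjunct2[OF R] q(2)]])
    qed
    fix c assume c: "c \<in> atlas N"
    obtain V \<psi> where Vc: "c = (V, \<psi>)" by (cases c)
    have V: "(V, \<psi>) \<in> atlas N" using c Vc by simp
    note V' = atlas_hol_chart[OF N V]
    have o: "openin (mtop M) {p \<in> S. F p \<in> V}"
    proof (subst openin_subopen, intro ballI)
      fix p assume p: "p \<in> {p \<in> S. F p \<in> V}"
      then have "hol_at M N F p" using R by blast
      from hol_at_nbhd[OF this hol_chartD(1)[OF V']] p
      obtain Q where "openin (mtop M) Q" "p \<in> Q" "\<forall>q\<in>Q. F q \<in> V" by blast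
      then show "\<exists>T. openin (mtop M) T \<and> p \<in> T \<and> T \<subseteq> {p \<in> S. F p \<in> V}"
        using R p by (intro exI[of _ "Q \<inter> S"]) auto
    qed
    have "hol_fun M {p \<in> S. F p \<in> V} (\<lambda>p. \<psi> (F p) k)" if "k < mdim N" for k
      unfolding hol_fun_iff_at[OF M]
    proof (intro conjI o ballI)
      fix p assume p: "p \<in> {p \<in> S. F p \<in> V}"
      then have "hol_at M N F p" using R by simp
      then show "hol_fun_at M (\<lambda>p. \<psi> (F p) k) p"
        by (rule hol_at_pull[OF _ hol_fun_at_coord[OF N V']]) (use p in simp)
    qed
    with o show "case c of (V, \<psi>) => openin (mtop M) {p \<in> S. F p \<in> V}
        \<and> (\<forall>k<mdim N. hol_fun M {p \<in> S. F p \<in> V} (\<lambda>p. \<psi> (F p) k))"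
      unfolding Vc prod.case by simp
  qed
qed

lemma hol_at_compose:
  assumes F: "hol_at M N F p" and G: "hol_at N K G (F p)"
  shows "hol_at M K (\<lambda>q. G (F q)) p"
  unfolding hol_at_def
proof (intro conjI allI impI)
  show "p \<in> pts M" by (rule hol_at_pts(1)[OF F])
  show "G (F p) \<in> pts K" by (rule hol_at_pts(2)[OF G])
  fix T assume T: "openin (mtop K) T \<and> G (F p) \<in> T"
  obtain S where S: "openin (mtop N) S" "F p \<in> S" "\<forall>q\<in>S. G q \<in> T"
    using hol_at_nbhd[OF G conjunct1[OF T] conjunct2[OF T]] by blast
  obtain Q where "openin (mtop M) Q" "p \<in> Q" "\<forall>q\<in>Q. F q \<in> S" using hol_at_nbhd[OF F S(1,2)] by blast
  then show "\<exists>S. openin (mtop M) S \<and> p \<in> S \<and> (\<lambda>q. G (F q)) ` S \<subseteq> T" using S(3) by (intro exI[of _ Q] conjI image_subsetI) blast+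
next
  fix f assume "hol_fun_at K f (G (F p))"
  from hol_at_pull[OF F hol_at_pull[OF G this]] show "hol_fun_at M (\<lambda>q. f (G (F q))) p" .
qed

lemma hol_at_id: "p \<in> pts M ==> hol_at M M (\<lambda>q. q) p"
  unfolding hol_at_def by (auto intro: exI)

lemma hol_at_const: "charted M ==> p \<in> pts M ==> c \<in> pts N ==> hol_at M N (\<lambda>q. c) p"
  unfolding hol_at_def by (auto intro: hol_fun_at_const exI[of _ "pts M"])

lemma hol_at_cong:
  assumes M: "charted M" and S: "openin (mtop M) S" "p \<in> S" "\<And>q. q \<in> S ==> F q = G q" and F: "hol_at M N F p"
  shows "hol_at M N G p"
  unfolding hol_at_def
proof (intro conjI allI impI)
  show "p \<in> pts M" by (rule hol_at_pts(1)[OF F])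
  show "G p \<in> pts N" using hol_at_pts(2)[OF F] S by simp
  fix T assume "openin (mtop N) T \<and> G p \<in> T"
  then have T: "openin (mtop N) T" "F p \<in> T" using S by simp_all
  obtain Q where "openin (mtop M) Q" "p \<in> Q" "\<forall>q\<in>Q. F q \<in> T" using hol_at_nbhd[OF F T] by blast
  then show "\<exists>S. openin (mtop M) S \<and> p \<in> S \<and> G ` S \<subseteq> T"
    using S by (intro exI[of _ "Q \<inter> S"]) (auto simp: S(3)[symmetric])
next
  fix f assume "hol_fun_at N f (G p)"
  then have "hol_fun_at M (\<lambda>q. f (F q)) p" using hol_at_pull[OF F] S by simp
  then show "hol_fun_at M (\<lambda>q. f (G q)) p" by (rule hol_fun_at_cong[where f = "\<lambda>q. f (F q)", OF M S(1,2), rotated]) (simp add: S(3))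
qed

lemma hol_map_at: "charted M ==> charted N ==> hol_map M N S F ==> p \<in> S ==> hol_at M N F p"
  by (simp add: hol_map_iff)

subsection \<open>The complex line\<close>

lemma line_chart: "top_chart euclidean 1 (UNIV, \<lambda>(t::complex) (i::nat). if i = 0 then t else 0)"
  (is "top_chart _ _ (_, ?\<phi>)")
proof (rule top_chartI)
  show "inj ?\<phi>" by (auto simp: inj_def fun_eq_iff)
  show "?\<phi> t \<in> Cn 1" for t by (auto simp: Cn_def)
  fix S :: "complex set" assume "openin euclidean S"
  then have S: "open S" by simp
  show "openin (top_of_set (Cn 1)) (?\<phi> ` S)" unfolding openin_Cn_iff
  proof (intro conjI ballI)
    show "?\<phi> ` S \<subseteq> Cn 1" by (auto simp: Cn_def)
    fix z assume "z \<in> ?\<phi> ` S"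
    then obtain t where t: "z = ?\<phi> t" "t \<in> S" by blast
    then obtain r where r: "r > 0" "ball t r \<subseteq> S" using S open_contains_ball by blast
    have "w \<in> ?\<phi> ` S" if "w \<in> Cn 1" "\<forall>i<1. norm (w i - z i) < r" for w
    proof -
      have "w = ?\<phi> (w 0)" using that(1) by (auto simp: Cn_def fun_eq_iff)
      moreover have "w 0 \<in> S" using that(2) r(2) t(1) by (auto simp: dist_norm norm_minus_commute)
      ultimately show ?thesis by blast
    qed
    then show "\<exists>r>0. \<forall>w\<in>Cn 1. (\<forall>i<1. cmod (w i - z i) < r) --> w \<in> ?\<phi> ` S" using r(1) by blast
  qed
next
  fix W assume "openin (top_of_set (Cn 1)) W"
  then obtain A where A: "open A" "W = Cn 1 \<inter> A" by (auto simp: openin_open)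
  have "continuous_on UNIV ?\<phi>"
  proof (rule continuous_on_coordinatewise_then_product)
    fix i show "continuous_on UNIV (\<lambda>t::complex. if i = (0::nat) then t else 0)" by (cases "i = 0") auto
  qed
  then have "open (?\<phi> -` A)" using A(1) by (simp add: open_vimage)
  moreover have "{p \<in> UNIV. ?\<phi> p \<in> W} = ?\<phi> -` A" using A(2) by (auto simp: Cn_def)
  ultimately show "openin euclidean {p \<in> UNIV. ?\<phi> p \<in> W}" by simp
qed auto

lemma transition_self:
  assumes c: "top_chart T n (U, \<phi>)" shows "hol_transition n (U, \<phi>) (U, \<phi>)"
proof -
  have "hol_Cn n (\<phi> ` U) (\<lambda>z. z k)" if "k < n" for k
    using top_chartD(2)[OF c] hol_near_coord top_chartD(4)[OF c] unfolding hol_Cn_iff_near by blast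
  then show ?thesis unfolding hol_transition_def
    using hol_Cn_cong[of "\<phi> ` U" "\<lambda>z. z _" "\<lambda>z. \<phi> (inv_into U \<phi> z) _"] by (auto simp: f_inv_into_f)
qed

lemma charted_C: "charted C_mfd"
  using line_chart transition_self[OF line_chart] by (simp add: charted_def C_mfd_def)

lemma pts_C [simp]: "pts C_mfd = UNIV" "mdim C_mfd = 1" "mtop C_mfd = euclidean"
  by (simp_all add: C_mfd_def)

lemma chart_C: "hol_chart C_mfd (UNIV, \<lambda>t i. if i = 0 then t else 0)"
  by (rule atlas_hol_chart[OF charted_C]) (simp add: C_mfd_def)

text \<open>On the complex line the notion agrees with the one of complex analysis, which gives access to Cauchy's theory.\<close>

lemma hol_fun_at_C: "hol_fun_at C_mfd g t \<longleftrightarrow> (\<exists>S. open S \<and> t \<in> S \<and> g holomorphic_on S)"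
proof -
  let ?\<phi> = "\<lambda>(t::complex) (i::nat). if i = 0 then t else 0"
  have inj: "inj ?\<phi>" by (auto simp: inj_def fun_eq_iff)
  have inv: "inv_into UNIV ?\<phi> (?\<phi> u) = u" for u by (rule inv_into_f_f[OF inj UNIV_I])
  have inv0: "inv_into UNIV ?\<phi> z = z 0" if "z \<in> Cn 1" for z
  proof -
    have "z = ?\<phi> (z 0)" using that by (auto simp: Cn_def fun_eq_iff)
    then have "inv_into UNIV ?\<phi> z = inv_into UNIV ?\<phi> (?\<phi> (z 0))" by (rule arg_cong)
    then show ?thesis unfolding inv .
  qed
  have "hol_fun_at C_mfd g t \<longleftrightarrow> hol_near 1 (\<lambda>z. g (inv_into UNIV ?\<phi> z)) (?\<phi> t)"
    using hol_fun_at_chart[OF charted_C chart_C] by simp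
  also have "\<dots> \<longleftrightarrow> (\<exists>S. open S \<and> t \<in> S \<and> g holomorphic_on S)"
  proof
    assume "hol_near 1 (\<lambda>z. g (inv_into UNIV ?\<phi> z)) (?\<phi> t)"
    then obtain W where W: "?\<phi> t \<in> W" "hol_Cn 1 W (\<lambda>z. g (inv_into UNIV ?\<phi> z))" unfolding hol_near_def by blast
    let ?S = "{u \<in> UNIV. ?\<phi> u \<in> W}"
    have S: "open ?S" using top_chartD(6)[OF line_chart, of W] W(2) by (simp add: hol_Cn_def)
    have "g field_differentiable at u" if "u \<in> ?S" for u
    proof -
      have "cderiv 1 (\<lambda>z. g (inv_into UNIV ?\<phi> z)) (?\<phi> u) (\<lambda>i. pderiv_Cn i (\<lambda>z. g (inv_into UNIV ?\<phi> z)) (?\<phi> u))"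
        using hol_Cn_cderiv[OF W(2)] that by blast
      then have "((\<lambda>u. g (inv_into UNIV ?\<phi> (?\<phi> u))) has_field_derivative
          (\<Sum>k<1. pderiv_Cn k (\<lambda>z. g (inv_into UNIV ?\<phi> z)) (?\<phi> u) * (if k = 0 then 1 else 0))) (at u)"
        by (rule cderiv_curve[where c = ?\<phi>, rotated -1]) (auto simp: Cn_def)
      then show ?thesis unfolding inv field_differentiable_def by blast
    qed
    then have "g holomorphic_on ?S" using S
      by (simp add: field_differentiable_at_within holomorphic_on_def)
    then show "\<exists>S. open S \<and> t \<in> S \<and> g holomorphic_on S" using S W(1) by blast
  next
    assume "\<exists>S. open S \<and> t \<in> S \<and> g holomorphic_on S"
    then obtain S where S: "open S" "t \<in> S" "g holomorphic_on S" by blast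
    have t: "?\<phi> t \<in> Cn 1" by (simp add: Cn_def)
    have "hol_near 1 (\<lambda>z. g (z 0)) (?\<phi> t)"
      by (rule hol_near_outer[where f = "\<lambda>z. z 0" and h = g, OF hol_near_coord[OF t] S(3,1)]) (use S(2) in simp)
    then show "hol_near 1 (\<lambda>z. g (inv_into UNIV ?\<phi> z)) (?\<phi> t)"
      by (rule hol_near_cong[OF openin_subtopology_self t, rotated]) (simp add: inv0)
  qed
  finally show ?thesis .
qed

subsection \<open>Products\<close>

definition prod_chart :: "nat => ('a => nat => complex) => ('b => nat => complex) => 'a \<times> 'b => nat => complex" where
  "prod_chart m \<phi> \<psi> = (\<lambda>(p, q) i. if i < m then \<phi> p i else \<psi> q (i - m))"

lemma prod_chart_apply: "prod_chart m \<phi> \<psi> pq i = (if i < m then \<phi> (fst pq) i else \<psi> (snd pq) (i - m))"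
  by (simp add: prod_chart_def case_prod_unfold)

text \<open>The two halves of a vector of length m + n.\<close>

definition cfst :: "nat => (nat => complex) => nat => complex" where
  "cfst m w = (\<lambda>i. if i < m then w i else 0)"

definition csnd :: "nat => (nat => complex) => nat => complex" where
  "csnd m w = (\<lambda>i. w (m + i))"

lemma cfst_Cn: "cfst m w \<in> Cn m" by (simp add: cfst_def Cn_def)

lemma csnd_Cn: "w \<in> Cn (m + n) ==> csnd m w \<in> Cn n" by (simp add: csnd_def Cn_def)

lemma cfst_prod_chart: "\<phi> p \<in> Cn m ==> cfst m (prod_chart m \<phi> \<psi> (p, q)) = \<phi> p"
  by (auto simp: cfst_def prod_chart_apply Cn_def fun_eq_iff)

lemma csnd_prod_chart: "csnd m (prod_chart m \<phi> \<psi> (p, q)) = \<psi> q"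
  by (simp add: csnd_def prod_chart_apply fun_eq_iff)

lemma prod_chart_eq: "cfst m w = \<phi> p ==> csnd m w = \<psi> q ==> w = prod_chart m \<phi> \<psi> (p, q)"
proof (rule ext)
  fix i assume a: "cfst m w = \<phi> p" "csnd m w = \<psi> q"
  show "w i = prod_chart m \<phi> \<psi> (p, q) i"
  proof (cases "i < m")
    case True
    then show ?thesis using fun_cong[OF a(1), of i] by (simp add: cfst_def prod_chart_apply)
  next
    case False
    then show ?thesis using fun_cong[OF a(2), of "i - m"] by (simp add: csnd_def prod_chart_apply)
  qed
qed

lemma prod_chart_Cn: "\<phi> p \<in> Cn m ==> \<psi> q \<in> Cn n ==> prod_chart m \<phi> \<psi> (p, q) \<in> Cn (m + n)"
  by (auto simp: prod_chart_apply Cn_def)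

lemma prod_chart_inj:
  assumes c: "top_chart T m (U, \<phi>)" and d: "top_chart T' n (V, \<psi>)"
  shows "inj_on (prod_chart m \<phi> \<psi>) (U \<times> V)"
proof (rule inj_onI, clarify)
  fix a b a' b' assume ab: "a \<in> U" "b \<in> V" "a' \<in> U" "b' \<in> V"
    and e: "prod_chart m \<phi> \<psi> (a, b) = prod_chart m \<phi> \<psi> (a', b')"
  have "\<phi> a = \<phi> a'" using arg_cong[OF e, of "cfst m"] top_chartD(4)[OF c] ab by (simp add: cfst_prod_chart)
  moreover have "\<psi> b = \<psi> b'" using arg_cong[OF e, of "csnd m"] by (simp add: csnd_prod_chart)
  ultimately show "a = a' \<and> b = b'"
    using top_chartD(3)[OF c] top_chartD(3)[OF d] ab by (auto dest: inj_onD)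
qed

lemma top_chart_prod:
  assumes c: "top_chart T m (U, \<phi>)" and d: "top_chart T' n (V, \<psi>)"
  shows "top_chart (prod_topology T T') (m + n) (U \<times> V, prod_chart m \<phi> \<psi>)"
proof (rule top_chartI)
  have U: "openin T U" and V: "openin T' V" using top_chartD(1) c d by blast+
  show "openin (prod_topology T T') (U \<times> V)" using U V by (simp add: openin_prod_Times_iff)
  show "inj_on (prod_chart m \<phi> \<psi>) (U \<times> V)" by (rule prod_chart_inj[OF c d])
  show "prod_chart m \<phi> \<psi> p \<in> Cn (m + n)" if "p \<in> U \<times> V" for p
    using that top_chartD(4)[OF c] top_chartD(4)[OF d] prod_chart_Cn[of \<phi> "fst p" m \<psi> "snd p" n] by auto
next
  fix S assume S: "openin (prod_topology T T') S" "S \<subseteq> U \<times> V"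
  show "openin (top_of_set (Cn (m + n))) (prod_chart m \<phi> \<psi> ` S)"
    unfolding openin_Cn_iff
  proof (intro conjI ballI)
    show "prod_chart m \<phi> \<psi> ` S \<subseteq> Cn (m + n)"
      using S(2) top_chartD(4)[OF c] top_chartD(4)[OF d] by (auto intro!: prod_chart_Cn)
    fix z assume "z \<in> prod_chart m \<phi> \<psi> ` S"
    then obtain p q where pq: "z = prod_chart m \<phi> \<psi> (p, q)" "(p, q) \<in> S" by auto
    then have pU: "p \<in> U" "q \<in> V" using S(2) by auto
    obtain A B where AB: "openin T A" "openin T' B" "p \<in> A" "q \<in> B" "A \<times> B \<subseteq> S"
      using S(1)[unfolded openin_prod_topology_alt, rule_format, OF pq(2)] by blast
    obtain r where r: "r > 0" "\<forall>w\<in>Cn m. (\<forall>i<m. norm (w i - \<phi> p i) < r) --> w \<in> \<phi> ` (U \<inter> A)"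
      using openin_Cn_box[OF top_chartD(5)[OF c AB(1)], of "\<phi> p"] pU AB(3) by blast
    obtain r' where r': "r' > 0" "\<forall>w\<in>Cn n. (\<forall>i<n. norm (w i - \<psi> q i) < r') --> w \<in> \<psi> ` (V \<inter> B)"
      using openin_Cn_box[OF top_chartD(5)[OF d AB(2)], of "\<psi> q"] pU AB(4) by blast
    have "w \<in> prod_chart m \<phi> \<psi> ` S"
      if w: "w \<in> Cn (m + n)" "\<forall>i<m + n. norm (w i - z i) < min r r'" for w
    proof -
      have "norm (cfst m w i - \<phi> p i) < r" if "i < m" for i
        using w(2)[rule_format, of i] that by (simp add: cfst_def pq(1) prod_chart_apply)
      then have "cfst m w \<in> \<phi> ` (U \<inter> A)" using r(2) cfst_Cn by blast
      then obtain p' where p': "cfst m w = \<phi> p'" "p' \<in> A" by blast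
      have "norm (csnd m w i - \<psi> q i) < r'" if "i < n" for i
        using w(2)[rule_format, of "m + i"] that by (simp add: csnd_def pq(1) prod_chart_apply)
      then have "csnd m w \<in> \<psi> ` (V \<inter> B)" using r'(2) csnd_Cn[OF w(1)] by blast
      then obtain q' where q': "csnd m w = \<psi> q'" "q' \<in> B" by blast
      have "w = prod_chart m \<phi> \<psi> (p', q')" by (rule prod_chart_eq[where \<phi> = \<phi> and \<psi> = \<psi>]) (fact p' q')+
      moreover have "(p', q') \<in> S" using AB(5) p' q' by blast
      ultimately show ?thesis by blast
    qed
    then show "\<exists>r>0. \<forall>w\<in>Cn (m + n). (\<forall>i<m + n. cmod (w i - z i) < r) --> w \<in> prod_chart m \<phi> \<psi> ` S"
      using r(1) r'(1) by (intro exI[of _ "min r r'"]) simp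
  qed
next
  fix W assume W: "openin (top_of_set (Cn (m + n))) W"
  have box: "openin (top_of_set (Cn k)) {w \<in> Cn k. \<forall>i<k. norm (w i - y i) < r}" for k y r
    using open_coord_box[of k y r] by (auto simp: openin_open Int_def)
  show "openin (prod_topology T T') {p \<in> U \<times> V. prod_chart m \<phi> \<psi> p \<in> W}"
    unfolding openin_prod_topology_alt
  proof (intro allI impI)
    fix p q assume "(p, q) \<in> {p \<in> U \<times> V. prod_chart m \<phi> \<psi> p \<in> W}"
    then have pq: "p \<in> U" "q \<in> V" "prod_chart m \<phi> \<psi> (p, q) \<in> W" by auto
    obtain r where r: "r > 0" "\<forall>w\<in>Cn (m + n). (\<forall>i<m + n. norm (w i - prod_chart m \<phi> \<psi> (p, q) i) < r) --> w \<in> W"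
      using openin_Cn_box[OF W pq(3)] by blast
    let ?A = "{a \<in> U. \<phi> a \<in> {w \<in> Cn m. \<forall>i<m. norm (w i - \<phi> p i) < r}}"
    let ?B = "{b \<in> V. \<psi> b \<in> {w \<in> Cn n. \<forall>i<n. norm (w i - \<psi> q i) < r}}"
    have "?A \<times> ?B \<subseteq> {p \<in> U \<times> V. prod_chart m \<phi> \<psi> p \<in> W}"
    proof (clarify, intro conjI)
      fix a b assume ab: "a \<in> U" "b \<in> V" "\<phi> a \<in> Cn m" "\<psi> b \<in> Cn n"
        and n: "\<forall>i<m. norm (\<phi> a i - \<phi> p i) < r" "\<forall>i<n. norm (\<psi> b i - \<psi> q i) < r"
      show "(a, b) \<in> U \<times> V" using ab by simp
      show "prod_chart m \<phi> \<psi> (a, b) \<in> W"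
        using n by (intro r(2)[rule_format] prod_chart_Cn ab) (auto simp: prod_chart_apply)
    qed
    moreover have "openin T ?A" by (rule top_chartD(6)[OF c box])
    moreover have "openin T' ?B" by (rule top_chartD(6)[OF d box])
    moreover have "p \<in> ?A" "q \<in> ?B" using pq r(1) top_chartD(4)[OF c] top_chartD(4)[OF d] by auto
    ultimately show "\<exists>A B. openin T A \<and> openin T' B \<and> p \<in> A \<and> q \<in> B \<and> A \<times> B \<subseteq> {p \<in> U \<times> V. prod_chart m \<phi> \<psi> p \<in> W}"
      by (intro exI[of _ ?A] exI[of _ ?B] conjI)
  qed
qed

lemma hol_transition_prod:
  assumes c: "top_chart T m (U, \<phi>)" "top_chart T m (U', \<phi>')"
    and d: "top_chart T' n (V, \<psi>)" "top_chart T' n (V', \<psi>')"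
    and h: "hol_transition m (U, \<phi>) (U', \<phi>')" "hol_transition n (V, \<psi>) (V', \<psi>')"
  shows "hol_transition (m + n) (U \<times> V, prod_chart m \<phi> \<psi>) (U' \<times> V', prod_chart m \<phi>' \<psi>')"
  unfolding hol_transition_def prod.case
proof (intro allI impI)
  fix k assume k: "k < m + n"
  let ?\<chi> = "prod_chart m \<phi> \<psi>"
  let ?Q = "U \<times> V \<inter> U' \<times> V'"
  have C: "top_chart (prod_topology T T') (m + n) (U \<times> V, ?\<chi>)" by (rule top_chart_prod[OF c(1) d(1)])
  have W: "openin (top_of_set (Cn (m + n))) (?\<chi> ` ?Q)"
    by (rule top_chartD(5)[OF C top_chartD(1)[OF top_chart_prod[OF c(2) d(2)]]])
  have inv: "inv_into (U \<times> V) ?\<chi> (?\<chi> pq) = pq" if "pq \<in> U \<times> V" for pq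
    using inv_into_f_f[OF prod_chart_inj[OF c(1) d(1)] that] .
  have iU: "inv_into U \<phi> (cfst m (?\<chi> (a, b))) = a" if "a \<in> U" for a b
    using that top_chartD(3,4)[OF c(1)] by (simp add: cfst_prod_chart)
  have iV: "inv_into V \<psi> (csnd m (?\<chi> (a, b))) = b" if "b \<in> V" for a b
    using that top_chartD(3)[OF d(1)] by (simp add: csnd_prod_chart)
  let ?g = "\<lambda>w. if k < m then \<phi>' (inv_into U \<phi> (cfst m w)) k else \<psi>' (inv_into V \<psi> (csnd m w)) (k - m)"
  have eq: "?g w = prod_chart m \<phi>' \<psi>' (inv_into (U \<times> V) ?\<chi> w) k" if "w \<in> ?\<chi> ` ?Q" for w
    using that inv iU iV by (auto simp: prod_chart_apply)
  have "hol_near (m + n) ?g z" if "z \<in> ?\<chi> ` ?Q" for z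
  proof -
    obtain a b where ab: "z = ?\<chi> (a, b)" "a \<in> U" "a \<in> U'" "b \<in> V" "b \<in> V'" using \<open>z \<in> ?\<chi> ` ?Q\<close> by auto
    have zC: "z \<in> Cn (m + n)" using W \<open>z \<in> ?\<chi> ` ?Q\<close> openin_Cn_sub by blast
    have cz: "cfst m z = \<phi> a" "csnd m z = \<psi> b"
      using ab top_chartD(4)[OF c(1)] by (simp_all add: cfst_prod_chart csnd_prod_chart)
    show ?thesis
    proof (cases "k < m")
      case True
      have "hol_near (m + n) (\<lambda>w. \<phi>' (inv_into U \<phi> (cfst m w)) k) z"
      proof (rule hol_near_chain(1)[where g = "cfst m" and m = m and U = "Cn (m + n)"])
        show "hol_near m (\<lambda>z. \<phi>' (inv_into U \<phi> z) k) (cfst m z)"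
          unfolding cz by (rule hol_nearI[OF hol_transitionD[OF h(1) True]]) (use ab in blast)
        show "hol_near (m + n) (\<lambda>w. cfst m w i) z" if "i < m" for i
          using that hol_near_coord[OF zC, of i] by (simp add: cfst_def)
      qed (use zC cfst_Cn in auto)
      then show ?thesis using True by simp
    next
      case False
      then have km: "k - m < n" using k by simp
      have "hol_near (m + n) (\<lambda>w. \<psi>' (inv_into V \<psi> (csnd m w)) (k - m)) z"
      proof (rule hol_near_chain(1)[where g = "csnd m" and m = n and U = "Cn (m + n)"])
        show "hol_near n (\<lambda>z. \<psi>' (inv_into V \<psi> z) (k - m)) (csnd m z)"
          unfolding cz by (rule hol_nearI[OF hol_transitionD[OF h(2) km]]) (use ab in blast)
        show "hol_near (m + n) (\<lambda>w. csnd m w i) z" if "i < n" for i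
          using that hol_near_coord[OF zC, of "m + i"] by (simp add: csnd_def)
      qed (use zC csnd_Cn in auto)
      then show ?thesis using False by simp
    qed
  qed
  then have "hol_Cn (m + n) (?\<chi> ` ?Q) ?g" using W unfolding hol_Cn_iff_near by blast
  then show "hol_Cn (m + n) (?\<chi> ` ?Q) (\<lambda>z. prod_chart m \<phi>' \<psi>' (inv_into (U \<times> V) ?\<chi> z) k)"
    using hol_Cn_cong[of "?\<chi> ` ?Q" ?g, OF eq] by blast
qed

lemma prod_mfd_simps [simp]:
  "mtop (prod_mfd M N) = prod_topology (mtop M) (mtop N)" "mdim (prod_mfd M N) = mdim M + mdim N"
  "pts (prod_mfd M N) = pts M \<times> pts N"
  by (simp_all add: prod_mfd_def)

lemma prod_atlas: "atlas (prod_mfd M N) = {(U \<times> V, prod_chart (mdim M) \<phi> \<psi>) | U \<phi> V \<psi>. (U, \<phi>) \<in> atlas M \<and> (V, \<psi>) \<in> atlas N}"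
  by (simp add: prod_mfd_def prod_chart_def)

lemma prod_hol_chart:
  assumes c: "hol_chart M (U, \<phi>)" and d: "hol_chart N (V, \<psi>)" and M: "charted M" and N: "charted N"
  shows "hol_chart (prod_mfd M N) (U \<times> V, prod_chart (mdim M) \<phi> \<psi>)"
  unfolding hol_chart_def
proof (intro conjI ballI)
  show "top_chart (mtop (prod_mfd M N)) (mdim (prod_mfd M N)) (U \<times> V, prod_chart (mdim M) \<phi> \<psi>)"
    using top_chart_prod[OF hol_chart_top[OF c] hol_chart_top[OF d]] by simp
  fix e assume "e \<in> atlas (prod_mfd M N)"
  then obtain U' \<phi>' V' \<psi>' where e: "e = (U' \<times> V', prod_chart (mdim M) \<phi>' \<psi>')"
    and U': "(U', \<phi>') \<in> atlas M" and V': "(V', \<psi>') \<in> atlas N" unfolding prod_atlas by blast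
  have t: "top_chart (mtop M) (mdim M) (U', \<phi>')" "top_chart (mtop N) (mdim N) (V', \<psi>')"
    using U' V' M N by (auto simp: charted_def)
  show "hol_transition (mdim (prod_mfd M N)) (U \<times> V, prod_chart (mdim M) \<phi> \<psi>) e"
    using hol_transition_prod[OF hol_chart_top[OF c] t(1) hol_chart_top[OF d] t(2)] c d U' V'
    unfolding e hol_chart_def by simp
  show "hol_transition (mdim (prod_mfd M N)) e (U \<times> V, prod_chart (mdim M) \<phi> \<psi>)"
    using hol_transition_prod[OF t(1) hol_chart_top[OF c] t(2) hol_chart_top[OF d]] c d U' V'
    unfolding e hol_chart_def by simp
qed

lemma charted_prod:
  assumes M: "charted M" and N: "charted N" shows "charted (prod_mfd M N)"
  unfolding charted_def
proof (intro conjI ballI)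
  have h: "hol_chart (prod_mfd M N) c" if c: "c \<in> atlas (prod_mfd M N)" for c
    using c prod_hol_chart[OF _ _ M N] atlas_hol_chart[OF M] atlas_hol_chart[OF N] unfolding prod_atlas by blast
  show "top_chart (mtop (prod_mfd M N)) (mdim (prod_mfd M N)) c" if "c \<in> atlas (prod_mfd M N)" for c
    using h[OF that] by (simp add: hol_chart_def)
  show "hol_transition (mdim (prod_mfd M N)) c c'" if "c \<in> atlas (prod_mfd M N)" "c' \<in> atlas (prod_mfd M N)" for c c'
    using h[OF that(1)] that(2) by (simp add: hol_chart_def)
  show "(\<Union>c\<in>atlas (prod_mfd M N). fst c) = pts (prod_mfd M N)"
  proof (intro equalityI subsetI)
    fix x assume "x \<in> (\<Union>c\<in>atlas (prod_mfd M N). fst c)"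
    then obtain c where c: "c \<in> atlas (prod_mfd M N)" "x \<in> fst c" by blast
    obtain U \<phi> where "c = (U, \<phi>)" by (cases c)
    then show "x \<in> pts (prod_mfd M N)" using hol_chart_sub[of "prod_mfd M N" U \<phi> x] h[OF c(1)] c(2) by simp
  next
    fix x assume x: "x \<in> pts (prod_mfd M N)"
    then have x1: "fst x \<in> pts M" "snd x \<in> pts N" by (auto simp: mem_Times_iff)
    obtain U \<phi> where U: "(U, \<phi>) \<in> atlas M" "fst x \<in> U" using chart_ex[OF M x1(1)] by blast
    obtain V \<psi> where V: "(V, \<psi>) \<in> atlas N" "snd x \<in> V" using chart_ex[OF N x1(2)] by blast
    have "(U \<times> V, prod_chart (mdim M) \<phi> \<psi>) \<in> atlas (prod_mfd M N)" unfolding prod_atlas using U V by blast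
    moreover have "x \<in> fst (U \<times> V, prod_chart (mdim M) \<phi> \<psi>)" using U V by (simp add: mem_Times_iff)
    ultimately show "x \<in> (\<Union>c\<in>atlas (prod_mfd M N). fst c)" by blast
  qed
qed

lemma hol_at_fst:
  assumes M: "charted M" and N: "charted N" and p: "p \<in> pts M" "q \<in> pts N"
  shows "hol_at (prod_mfd M N) M fst (p, q)"
proof -
  obtain U \<phi> where U: "hol_chart M (U, \<phi>)" "p \<in> U" using chart_ex[OF M p(1)] by blast
  obtain V \<psi> where V: "hol_chart N (V, \<psi>)" "q \<in> V" using chart_ex[OF N p(2)] by blast
  note P = charted_prod[OF M N] and c = prod_hol_chart[OF U(1) V(1) M N]
  show ?thesis
  proof (rule hol_at_chartI[where F = fst and V = U and \<psi> = \<phi> and S = "U \<times> V", OF P M])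
    show "openin (mtop (prod_mfd M N)) (U \<times> V)" using hol_chartD(1)[OF c] .
    show "hol_fun_at (prod_mfd M N) (\<lambda>x. \<phi> (fst x) k) (p, q)" if "k < mdim M" for k
      using hol_fun_at_coord[OF P c, of "(p, q)" k] U V that by (simp add: prod_chart_apply)
  qed (use U V p in auto)
qed

lemma hol_at_snd:
  assumes M: "charted M" and N: "charted N" and p: "p \<in> pts M" "q \<in> pts N"
  shows "hol_at (prod_mfd M N) N snd (p, q)"
proof -
  obtain U \<phi> where U: "hol_chart M (U, \<phi>)" "p \<in> U" using chart_ex[OF M p(1)] by blast
  obtain V \<psi> where V: "hol_chart N (V, \<psi>)" "q \<in> V" using chart_ex[OF N p(2)] by blast
  note P = charted_prod[OF M N] and c = prod_hol_chart[OF U(1) V(1) M N]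
  show ?thesis
  proof (rule hol_at_chartI[where F = snd and V = V and \<psi> = \<psi> and S = "U \<times> V", OF P N])
    show "openin (mtop (prod_mfd M N)) (U \<times> V)" using hol_chartD(1)[OF c] .
    show "hol_fun_at (prod_mfd M N) (\<lambda>x. \<psi> (snd x) k) (p, q)" if "k < mdim N" for k
      using hol_fun_at_coord[OF P c, of "(p, q)" "mdim M + k"] U V that by (simp add: prod_chart_apply)
  qed (use U V p in auto)
qed

lemma hol_at_Pair:
  assumes L: "charted L" and M: "charted M" and N: "charted N"
    and F: "hol_at L M F p" and G: "hol_at L N G p"
  shows "hol_at L (prod_mfd M N) (\<lambda>x. (F x, G x)) p"
proof -
  obtain U \<phi> where U: "hol_chart M (U, \<phi>)" "F p \<in> U" using chart_ex[OF M hol_at_pts(2)[OF F]] by blast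
  obtain V \<psi> where V: "hol_chart N (V, \<psi>)" "G p \<in> V" using chart_ex[OF N hol_at_pts(2)[OF G]] by blast
  note P = charted_prod[OF M N] and c = prod_hol_chart[OF U(1) V(1) M N]
  obtain S where S: "openin (mtop L) S" "p \<in> S" "\<forall>q\<in>S. F q \<in> U"
    using hol_at_nbhd[OF F hol_chartD(1)[OF U(1)] U(2)] by blast
  obtain S' where S': "openin (mtop L) S'" "p \<in> S'" "\<forall>q\<in>S'. G q \<in> V"
    using hol_at_nbhd[OF G hol_chartD(1)[OF V(1)] V(2)] by blast
  show ?thesis
  proof (rule hol_at_chartI[where F = "\<lambda>x. (F x, G x)" and S = "S \<inter> S'", OF L P hol_at_pts(1)[OF F] c])
    show "hol_fun_at L (\<lambda>q. prod_chart (mdim M) \<phi> \<psi> (F q, G q) k) p" for k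
      using hol_at_pull[OF F hol_fun_at_coord[OF M U], of k] hol_at_pull[OF G hol_fun_at_coord[OF N V], of "k - mdim M"]
      by (cases "k < mdim M") (simp_all add: prod_chart_apply)
  qed (use S S' U V in auto)
qed

section \<open>Tangent vectors\<close>

lemma tspaceI:
  "charted M ==> hol_map C_mfd M S \<gamma> ==> 0 \<in> S ==> velocity M \<gamma> \<in> tspace M (\<gamma> 0)"
  unfolding tspace_def by (intro CollectI exI conjI) auto

lemma tspace_ex:
  assumes M: "charted M" and v: "v \<in> tspace M p"
  shows "\<exists>\<gamma> S. hol_map C_mfd M S \<gamma> \<and> 0 \<in> S \<and> hol_at C_mfd M \<gamma> 0 \<and> \<gamma> 0 = p \<and> v = velocity M \<gamma>"
proof -
  obtain \<gamma> S where g: "v = velocity M \<gamma>" "0 \<in> S" "hol_map C_mfd M S \<gamma>" "\<gamma> 0 = p"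
    using v unfolding tspace_def by blast
  have "hol_at C_mfd M \<gamma> 0" by (rule hol_map_at[OF charted_C M g(3,2)])
  with g show ?thesis by (intro exI[of _ \<gamma>] exI[of _ S]) simp
qed

lemma tspace_nonhol: "v \<in> tspace M p ==> \<not> hol_fun_at M f p ==> v f = 0"
  unfolding tspace_def velocity_def by auto

lemma tspace_pts: "charted M ==> v \<in> tspace M p ==> p \<in> pts M"
  using tspace_ex[of M v p] hol_at_pts(2) by metis

lemma hol_at_C_deriv:
  assumes "hol_fun_at C_mfd g t" shows "(g has_field_derivative deriv g t) (at t)"
proof -
  obtain S where "open S" "t \<in> S" "g holomorphic_on S" using assms unfolding hol_fun_at_C by blast
  then show ?thesis using holomorphic_derivI by blast
qed

lemma velocity_hol: "hol_fun_at M f (\<gamma> 0) ==> velocity M \<gamma> f = deriv (\<lambda>t. f (\<gamma> t)) 0"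
  by (simp add: velocity_def)

lemma velocity_deriv:
  assumes g: "hol_at C_mfd M \<gamma> 0" and f: "hol_fun_at M f (\<gamma> 0)"
  shows "((\<lambda>t. f (\<gamma> t)) has_field_derivative velocity M \<gamma> f) (at 0)"
  unfolding velocity_hol[where \<gamma> = \<gamma> and f = f, OF f] by (rule hol_at_C_deriv[OF hol_at_pull[OF g f]])

text \<open>A tangent vector is determined by its values on the coordinate functions of a chart.\<close>

lemma velocity_chart:
  assumes M: "charted M" and g: "hol_at C_mfd M \<gamma> 0" and U: "hol_chart M (U, \<phi>)" "\<gamma> 0 \<in> U"
    and f: "hol_fun_at M f (\<gamma> 0)"
  shows "velocity M \<gamma> f = (\<Sum>i<mdim M. pderiv_Cn i (\<lambda>z. f (inv_into U \<phi> z)) (\<phi> (\<gamma> 0)) * velocity M \<gamma> (\<lambda>q. \<phi> q i))"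
proof -
  let ?g = "\<lambda>z. f (inv_into U \<phi> z)"
  obtain S where S: "open S" "0 \<in> S" "\<forall>t\<in>S. \<gamma> t \<in> U"
    using hol_at_nbhd[OF g hol_chartD(1)[OF U(1)] U(2)] by auto
  have ev: "eventually (\<lambda>t. t \<in> S) (at 0)" using S by (simp add: eventually_at_in_open')
  have "((\<lambda>t. ?g (\<phi> (\<gamma> t))) has_field_derivative
      (\<Sum>k<mdim M. pderiv_Cn k ?g (\<phi> (\<gamma> 0)) * velocity M \<gamma> (\<lambda>q. \<phi> q k))) (at 0)"
  proof (rule cderiv_curve[where c = "\<lambda>t. \<phi> (\<gamma> t)" and f = ?g])
    show "\<forall>\<^sub>F t in at 0. \<phi> (\<gamma> t) \<in> Cn (mdim M)"
      using ev by eventually_elim (use S hol_chartD(4)[OF U(1)] in simp)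
    show "\<phi> (\<gamma> 0) \<in> Cn (mdim M)" using hol_chartD(4)[OF U(1)] U(2) by simp
    show "((\<lambda>t. \<phi> (\<gamma> t) k) has_field_derivative velocity M \<gamma> (\<lambda>q. \<phi> q k)) (at 0)" for k
      by (rule velocity_deriv[OF g hol_fun_at_coord[OF M U]])
    show "cderiv (mdim M) ?g (\<phi> (\<gamma> 0)) (\<lambda>k. pderiv_Cn k ?g (\<phi> (\<gamma> 0)))"
      using f unfolding hol_fun_at_chart[OF M U] by (rule hol_near_cderiv)
  qed
  then have "((\<lambda>t. f (\<gamma> t)) has_field_derivative
      (\<Sum>k<mdim M. pderiv_Cn k ?g (\<phi> (\<gamma> 0)) * velocity M \<gamma> (\<lambda>q. \<phi> q k))) (at 0)"
    by (rule has_field_derivative_transform_within_open[OF _ S(1,2)])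
       (use S(3) hol_chartD(3)[OF U(1)] in simp)
  then show ?thesis using DERIV_unique[OF velocity_deriv[OF g f]] by blast
qed

lemma coord_vec_nonhol: "\<not> hol_fun_at M f p ==> coord_vec M (U, \<phi>) p i f = 0"
  by (simp add: coord_vec_def)

lemma coord_vec_hol:
  "hol_fun_at M f p ==> coord_vec M (U, \<phi>) p i f = pderiv_Cn i (\<lambda>z. f (inv_into U \<phi> z)) (\<phi> p)"
  by (simp add: coord_vec_def)

lemma tspace_expand:
  assumes M: "charted M" and U: "hol_chart M (U, \<phi>)" "p \<in> U" and v: "v \<in> tspace M p"
  shows "v = (\<lambda>f. \<Sum>i<mdim M. v (\<lambda>q. \<phi> q i) * coord_vec M (U, \<phi>) p i f)"
proof
  fix f
  obtain \<gamma> where g: "hol_at C_mfd M \<gamma> 0" "\<gamma> 0 = p" "v = velocity M \<gamma>" using tspace_ex[OF M v] by blast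
  show "v f = (\<Sum>i<mdim M. v (\<lambda>q. \<phi> q i) * coord_vec M (U, \<phi>) p i f)"
  proof (cases "hol_fun_at M f p")
    case True
    then show ?thesis using velocity_chart[OF M g(1) U(1), of f] U(2) g(2,3) by (simp add: coord_vec_hol mult.commute)
  next
    case False
    then show ?thesis using tspace_nonhol[OF v] by (simp add: coord_vec_nonhol)
  qed
qed

lemma tspace_ext:
  assumes M: "charted M" and U: "hol_chart M (U, \<phi>)" "p \<in> U" and u: "u \<in> tspace M p" and v: "v \<in> tspace M p"
    and e: "\<And>i. i < mdim M ==> u (\<lambda>q. \<phi> q i) = v (\<lambda>q. \<phi> q i)"
  shows "u = v"
proof -
  have "u = (\<lambda>f. \<Sum>i<mdim M. u (\<lambda>q. \<phi> q i) * coord_vec M (U, \<phi>) p i f)" by (rule tspace_expand[OF M U u])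
  also have "\<dots> = (\<lambda>f. \<Sum>i<mdim M. v (\<lambda>q. \<phi> q i) * coord_vec M (U, \<phi>) p i f)" using e by simp
  also have "\<dots> = v" by (rule tspace_expand[OF M U v, symmetric])
  finally show ?thesis .
qed

text \<open>The combination is the velocity of an affine curve in the chart, so tangent spaces are vector spaces.\<close>

lemma coord_combo_tspace:
  assumes M: "charted M" and U: "hol_chart M (U, \<phi>)" "p \<in> U"
  shows "(\<lambda>f. \<Sum>i<mdim M. a i * coord_vec M (U, \<phi>) p i f) \<in> tspace M p"
proof -
  define c where "c t = (\<lambda>i. \<phi> p i + t * (if i < mdim M then a i else 0))" for t :: complex
  define \<gamma> where "\<gamma> t = inv_into U \<phi> (c t)" for t
  define S where "S = {t. c t \<in> \<phi> ` U}"
  have cC: "c t \<in> Cn (mdim M)" for t using hol_chartD(4)[OF U] by (auto simp: c_def Cn_def)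
  have c0: "c 0 = \<phi> p" by (simp add: c_def)
  have g0: "\<gamma> 0 = p" using U hol_chartD(3)[OF U(1)] by (simp add: \<gamma>_def c0)
  obtain A where A: "open A" "\<phi> ` U = Cn (mdim M) \<inter> A" using hol_chartD(2)[OF U(1)] by (auto simp: openin_open)
  have "continuous_on UNIV c" unfolding c_def
    by (intro continuous_on_coordinatewise_then_product continuous_intros)
  then have "open (c -` A)" using A(1) by (simp add: open_vimage)
  moreover have "S = c -` A" using A(2) cC by (auto simp: S_def)
  ultimately have S: "open S" by simp
  have S0: "0 \<in> S" using U(2) by (simp add: S_def c0)
  have gU: "\<gamma> t \<in> U" and gc: "\<phi> (\<gamma> t) = c t" if "t \<in> S" for t
    using that inv_into_into[of "c t" \<phi> U] f_inv_into_f[of "c t" \<phi> U] by (simp_all add: S_def \<gamma>_def)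
  have at: "hol_at C_mfd M \<gamma> t" if t: "t \<in> S" for t
  proof (rule hol_at_chartI[where F = \<gamma> and S = S, OF charted_C M _ U(1) gU[OF t]])
    fix k
    have "(\<lambda>t. c t k) holomorphic_on S" unfolding c_def by (intro holomorphic_intros)
    then have "(\<lambda>t. \<phi> (\<gamma> t) k) holomorphic_on S"
      by (rule holomorphic_transform) (simp add: gc)
    then show "hol_fun_at C_mfd (\<lambda>q. \<phi> (\<gamma> q) k) t" unfolding hol_fun_at_C using S t by blast
  qed (use S t gU in auto)
  have "hol_map C_mfd M S \<gamma>" unfolding hol_map_iff[OF charted_C M] using S at by simp
  from tspaceI[OF M this S0] have V: "velocity M \<gamma> \<in> tspace M p" by (simp add: g0)
  have vi: "velocity M \<gamma> (\<lambda>q. \<phi> q i) = (if i < mdim M then a i else 0)" for i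
  proof -
    have "((\<lambda>t. c t i) has_field_derivative (if i < mdim M then a i else 0)) (at 0)"
      unfolding c_def by (auto intro!: derivative_eq_intros)
    then have "((\<lambda>t. \<phi> (\<gamma> t) i) has_field_derivative (if i < mdim M then a i else 0)) (at 0)"
      by (rule has_field_derivative_transform_within_open[OF _ S S0]) (simp add: gc)
    moreover have "hol_fun_at M (\<lambda>q. \<phi> q i) (\<gamma> 0)" unfolding g0 by (rule hol_fun_at_coord[OF M U])
    ultimately show ?thesis by (simp only: velocity_hol DERIV_imp_deriv)
  qed
  have "velocity M \<gamma> = (\<lambda>f. \<Sum>i<mdim M. velocity M \<gamma> (\<lambda>q. \<phi> q i) * coord_vec M (U, \<phi>) p i f)"
    by (rule tspace_expand[OF M U V])
  also have "\<dots> = (\<lambda>f. \<Sum>i<mdim M. a i * coord_vec M (U, \<phi>) p i f)" unfolding vi by simp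
  finally show ?thesis using V by simp
qed

lemma tspace_lin:
  assumes M: "charted M" and u: "u \<in> tspace M p" and v: "v \<in> tspace M p"
  shows "(\<lambda>f. a * u f + b * v f) \<in> tspace M p"
proof -
  obtain U \<phi> where U: "hol_chart M (U, \<phi>)" "p \<in> U" using chart_ex[OF M tspace_pts[OF M u]] by blast
  have "(\<lambda>f. a * u f + b * v f) =
     (\<lambda>f. \<Sum>i<mdim M. (a * u (\<lambda>q. \<phi> q i) + b * v (\<lambda>q. \<phi> q i)) * coord_vec M (U, \<phi>) p i f)"
  proof
    fix f
    show "a * u f + b * v f = (\<Sum>i<mdim M. (a * u (\<lambda>q. \<phi> q i) + b * v (\<lambda>q. \<phi> q i)) * coord_vec M (U, \<phi>) p i f)"
      using fun_cong[OF tspace_expand[OF M U u], of f] fun_cong[OF tspace_expand[OF M U v], of f]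
      by (simp add: distrib_right sum.distrib sum_distrib_left mult.assoc)
  qed
  then show ?thesis using coord_combo_tspace[OF M U] by simp
qed

lemma tspace_zero:
  assumes M: "charted M" and p: "p \<in> pts M" shows "(\<lambda>f. 0) \<in> tspace M p"
proof -
  obtain U \<phi> where U: "hol_chart M (U, \<phi>)" "p \<in> U" using chart_ex[OF M p] by blast
  show ?thesis using coord_combo_tspace[OF M U, of "\<lambda>i. 0"] by simp
qed

lemma tspace_sum:
  assumes M: "charted M" and p: "p \<in> pts M" and e: "\<And>i. i < k ==> e i \<in> tspace M p"
  shows "(\<lambda>f. \<Sum>i<(k::nat). a i * e i f) \<in> tspace M p"
  using e
proof (induction k)
  case 0
  then show ?case using tspace_zero[OF M p] by simp
next
  case (Suc k)
  then have "(\<lambda>f. 1 * (\<Sum>i<k. a i * e i f) + a k * e k f) \<in> tspace M p"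
    by (intro tspace_lin[OF M]) auto
  then show ?case by simp
qed

lemma coord_vec_tspace:
  assumes M: "charted M" and U: "hol_chart M (U, \<phi>)" "p \<in> U" and i: "i < mdim M"
  shows "coord_vec M (U, \<phi>) p i \<in> tspace M p"
proof -
  have "(\<lambda>f. \<Sum>j<mdim M. (if j = i then 1 else 0) * coord_vec M (U, \<phi>) p j f) = coord_vec M (U, \<phi>) p i"
    using i by (simp add: if_distrib[of "\<lambda>x. x * _"] sum.delta cong: if_cong)
  then show ?thesis using coord_combo_tspace[OF M U, of "\<lambda>j. if j = i then 1 else 0"] by simp
qed

lemma coord_vec_dual:
  assumes M: "charted M" and U: "hol_chart M (U, \<phi>)" "p \<in> U" and i: "i < mdim M"
  shows "coord_vec M (U, \<phi>) p i (\<lambda>q. \<phi> q j) = (if j = i then 1 else 0)"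
proof -
  have z: "\<phi> p \<in> Cn (mdim M)" using hol_chartD(4)[OF U] .
  have "pderiv_Cn i (\<lambda>z. \<phi> (inv_into U \<phi> z) j) (\<phi> p) = pderiv_Cn i (\<lambda>z. z j) (\<phi> p)"
    by (rule pderiv_near_cong[OF hol_chartD(2)[OF U(1)]])
       (use U i hol_fun_at_coord[OF M U, of j] in \<open>auto simp: f_inv_into_f hol_fun_at_chart[OF M U]\<close>)
  also have "\<dots> = (if j = i then 1 else 0)"
  proof (cases "j < mdim M")
    case True
    then show ?thesis using pderiv_eq[OF z cderiv_coord[OF z True] i] by auto
  next
    case False
    have "pderiv_Cn i (\<lambda>z. z j) (\<phi> p) = deriv (\<lambda>t. \<phi> p j) (\<phi> p i)"
      unfolding pderiv_Cn_def using False i by (intro arg_cong2[where f = deriv]) auto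
    then show ?thesis using False i by auto
  qed
  finally show ?thesis using hol_fun_at_coord[OF M U, of j] by (simp add: coord_vec_hol)
qed

lemma tspace_cong:
  assumes M: "charted M" and v: "v \<in> tspace M p" and S: "openin (mtop M) S" "p \<in> S" "\<And>q. q \<in> S ==> f q = g q"
  shows "v f = v g"
proof (cases "hol_fun_at M f p")
  case True
  then have g: "hol_fun_at M g p" by (rule hol_fun_at_cong[OF M S(1,2), rotated]) (rule S(3))
  obtain \<gamma> where c: "hol_at C_mfd M \<gamma> 0" "\<gamma> 0 = p" "v = velocity M \<gamma>" using tspace_ex[OF M v] by blast
  have f': "hol_fun_at M f (\<gamma> 0)" "hol_fun_at M g (\<gamma> 0)" using True g c(2) by simp_all
  obtain Q where Q: "open Q" "0 \<in> Q" "\<forall>t\<in>Q. \<gamma> t \<in> S" using hol_at_nbhd[OF c(1) S(1)] c(2) S(2) by auto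
  have "((\<lambda>t. g (\<gamma> t)) has_field_derivative velocity M \<gamma> f) (at 0)"
    by (rule has_field_derivative_transform_within_open[OF velocity_deriv[OF c(1) f'(1)] Q(1,2)])
       (use Q(3) S(3) in simp)
  then show ?thesis using DERIV_unique[OF velocity_deriv[OF c(1) f'(2)]] c(3) by simp
next
  case False
  moreover have "\<not> hol_fun_at M g p"
    using False hol_fun_at_cong[OF M S(1,2), of g f] S(3) by auto
  ultimately show ?thesis using tspace_nonhol[OF v] by simp
qed

subsection \<open>Push-forward\<close>

lemma push_tspace:
  assumes M: "charted M" and N: "charted N" and F: "hol_map M N S F" and p: "p \<in> S" and v: "v \<in> tspace M p"
  shows "push N F p v \<in> tspace N (F p)"
proof -
  obtain \<gamma> Q where c: "hol_map C_mfd M Q \<gamma>" "0 \<in> Q" "hol_at C_mfd M \<gamma> 0" "\<gamma> 0 = p" "v = velocity M \<gamma>"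
    using tspace_ex[OF M v] by blast
  have Fat: "hol_at M N F q" if "q \<in> S" for q using hol_map_at[OF M N F that] .
  have S: "openin (mtop M) S" using F by (simp add: hol_map_def)
  let ?Q = "{t \<in> Q. \<gamma> t \<in> S}"
  have "openin euclidean ?Q"
  proof (subst openin_subopen, intro ballI)
    fix t assume t: "t \<in> ?Q"
    then have "hol_at C_mfd M \<gamma> t" using hol_map_at[OF charted_C M c(1)] by simp
    from hol_at_nbhd[OF this S] t
    obtain R where "openin (mtop C_mfd) R" "t \<in> R" "\<forall>t\<in>R. \<gamma> t \<in> S" by blast
    moreover have "open Q" using c(1) by (simp add: hol_map_def)
    ultimately show "\<exists>T. openin euclidean T \<and> t \<in> T \<and> T \<subseteq> ?Q" using t by (intro exI[of _ "R \<inter> Q"]) auto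
  qed
  moreover have "hol_at C_mfd N (\<lambda>t. F (\<gamma> t)) t" if "t \<in> ?Q" for t
    using that by (intro hol_at_compose[OF hol_map_at[OF charted_C M c(1)] Fat]) auto
  ultimately have "hol_map C_mfd N ?Q (\<lambda>t. F (\<gamma> t))" unfolding hol_map_iff[OF charted_C N] by simp
  from tspaceI[OF N this] have "velocity N (\<lambda>t. F (\<gamma> t)) \<in> tspace N (F p)" using c(2,4) p by simp
  moreover have "velocity N (\<lambda>t. F (\<gamma> t)) = push N F p v"
    using c(4,5) hol_at_pull[OF Fat[OF p]] by (auto simp: velocity_def push_def fun_eq_iff)
  ultimately show ?thesis by simp
qed

lemma push_velocity:
  assumes "hol_at M N F (\<gamma> 0)"
  shows "push N F (\<gamma> 0) (velocity M \<gamma>) = velocity N (\<lambda>t. F (\<gamma> t))"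
  using hol_at_pull[OF assms] by (auto simp: velocity_def push_def fun_eq_iff)

lemma push_hol: "hol_fun_at N f (F p) ==> push N F p v f = v (\<lambda>q. f (F q))"
  by (simp add: push_def)

lemma push_lin: "push N F p (\<lambda>f. a * u f + b * v f) = (\<lambda>f. a * push N F p u f + b * push N F p v f)"
  by (auto simp: push_def)

lemma push_sum: "push N F p (\<lambda>f. \<Sum>i\<in>I. a i * e i f) = (\<lambda>f. \<Sum>i\<in>I. a i * push N F p (e i) f)"
  by (auto simp: push_def)

lemma push_push:
  assumes "hol_at N K G (F p)"
  shows "push K G (F p) (push N F p v) = push K (\<lambda>q. G (F q)) p v"
  using hol_at_pull[OF assms] by (auto simp: push_def fun_eq_iff)

lemma push_cong:
  assumes M: "charted M" and v: "v \<in> tspace M p" and S: "openin (mtop M) S" "p \<in> S" "\<And>q. q \<in> S ==> F q = G q"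
  shows "push N F p v = push N G p v"
proof
  fix f show "push N F p v f = push N G p v f"
    using S(2,3) tspace_cong[OF M v S(1,2), of "\<lambda>q. f (F q)" "\<lambda>q. f (G q)"] by (simp add: push_def)
qed

lemma push_id: "v \<in> tspace M p ==> push M (\<lambda>q. q) p v = v"
  using tspace_nonhol by (fastforce simp: push_def)

section \<open>Alternating forms\<close>

abbreviation det_of :: "nat => (nat => nat => complex) => complex" where
  "det_of k A \<equiv> Determinant.det (Matrix.mat k k (\<lambda>(i, j). A i j))"

lemma tlists_map: "(\<And>i. i < k ==> w i \<in> tspace M p) ==> map w [0..<k] \<in> tlists M k p"
  by (auto simp: tlists_def)

lemma tlists_nth: "vs \<in> tlists M k p ==> i < k ==> vs ! i \<in> tspace M p"
  by (auto simp: tlists_def)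

lemma tlists_length: "vs \<in> tlists M k p ==> length vs = k"
  by (simp add: tlists_def)

lemma map_upt_upd: "i < k ==> (map w [0..<k])[i := u] = map (w(i := u)) [0..<k]"
  by (rule nth_equalityI) (auto simp: nth_list_update)

lemma alt_form_lin:
  assumes a: "alt_form M k p \<alpha>" and w: "\<And>j. j < k ==> w j \<in> tspace M p" and i: "i < k"
    and u: "u \<in> tspace M p" "v \<in> tspace M p"
  shows "\<alpha> (map (w(i := (\<lambda>f. a * u f + b * v f))) [0..<k])
     = a * \<alpha> (map (w(i := u)) [0..<k]) + b * \<alpha> (map (w(i := v)) [0..<k])"
  using a tlists_map[of k w M p, OF w] i u unfolding alt_form_def map_upt_upd[OF i, symmetric] by blast

lemma alt_form_eq:
  assumes a: "alt_form M k p \<alpha>" and w: "\<And>j. j < k ==> w j \<in> tspace M p" and i: "i < k" "j < k" "i \<noteq> j" "w i = w j"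
  shows "\<alpha> (map w [0..<k]) = 0"
proof -
  have "map w [0..<k] ! i = map w [0..<k] ! j" using i by simp
  then show ?thesis using a tlists_map[of k w M p, OF w] i unfolding alt_form_def by blast
qed

lemma alt_form_sum:
  assumes M: "charted M" and p: "p \<in> pts M" and a: "alt_form M k p \<alpha>"
    and w: "\<And>j. j < k ==> w j \<in> tspace M p" and i: "i < k"
    and e: "\<And>j. j < (n::nat) ==> e j \<in> tspace M p"
  shows "\<alpha> (map (w(i := (\<lambda>f. \<Sum>j<n. c j * e j f))) [0..<k]) = (\<Sum>j<n. c j * \<alpha> (map (w(i := e j)) [0..<k]))"
  using e
proof (induction n)
  case 0
  have "\<alpha> (map (w(i := (\<lambda>f. 0 * w i f + 0 * w i f))) [0..<k])
      = 0 * \<alpha> (map (w(i := w i)) [0..<k]) + 0 * \<alpha> (map (w(i := w i)) [0..<k])"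
    by (rule alt_form_lin[OF a]) (use w i in auto)
  then show ?case by (simp only: lessThan_0 sum.empty mult_zero_left add_0_left)
next
  case (Suc n)
  have "\<alpha> (map (w(i := (\<lambda>f. 1 * (\<Sum>j<n. c j * e j f) + c n * e n f))) [0..<k])
    = 1 * \<alpha> (map (w(i := (\<lambda>f. \<Sum>j<n. c j * e j f))) [0..<k]) + c n * \<alpha> (map (w(i := e n)) [0..<k])"
    using Suc.prems by (intro alt_form_lin[OF a w i tspace_sum[OF M p]]) auto
  moreover have "\<alpha> (map (w(i := (\<lambda>f. \<Sum>j<n. c j * e j f))) [0..<k]) = (\<Sum>j<n. c j * \<alpha> (map (w(i := e j)) [0..<k]))"
    by (rule Suc.IH) (simp add: Suc.prems)
  ultimately show ?case by (simp only: sum.lessThan_Suc mult_1_left)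
qed

lemma alt_form_swap:
  assumes M: "charted M" and a: "alt_form M k p \<alpha>" and w: "\<And>j. j < k ==> w j \<in> tspace M p"
    and i: "i < k" "j < k" "i \<noteq> j"
  shows "\<alpha> (map (w \<circ> Transposition.transpose i j) [0..<k]) = - \<alpha> (map w [0..<k])"
proof -
  let ?A = "\<lambda>u v. \<alpha> (map (w(i := u, j := v)) [0..<k])"
  have lin: "?A (\<lambda>f. 1 * u f + 1 * u' f) v = ?A u v + ?A u' v"
    if "u \<in> tspace M p" "u' \<in> tspace M p" "v \<in> tspace M p" for u u' v
    using alt_form_lin[OF a, of "w(j := v)" i u u' 1 1] that w i by (simp add: fun_upd_twist[OF i(3)])
  have lin': "?A v (\<lambda>f. 1 * u f + 1 * u' f) = ?A v u + ?A v u'"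
    if "u \<in> tspace M p" "u' \<in> tspace M p" "v \<in> tspace M p" for u u' v
    using alt_form_lin[OF a, of "w(i := v)" j u u' 1 1] that w i by simp
  have zero: "?A u u = 0" if "u \<in> tspace M p" for u
    by (rule alt_form_eq[OF a _ i]) (use that w i in auto)
  let ?s = "\<lambda>f. 1 * w i f + 1 * w j f"
  have s: "?s \<in> tspace M p" using tspace_lin[OF M w[OF i(1)] w[OF i(2)]] .
  have "0 = ?A ?s ?s" using zero[OF s] by simp
  also have "\<dots> = ?A (w i) (w i) + ?A (w i) (w j) + (?A (w j) (w i) + ?A (w j) (w j))"
    unfolding lin[OF w[OF i(1)] w[OF i(2)] s] lin'[OF w[OF i(1)] w[OF i(2)] w[OF i(1)]] lin'[OF w[OF i(1)] w[OF i(2)] w[OF i(2)]] ..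
  finally have "?A (w j) (w i) = - ?A (w i) (w j)"
    using zero[OF w[OF i(1)]] zero[OF w[OF i(2)]] by (simp add: eq_neg_iff_add_eq_0 add.commute)
  moreover have "w(i := w j, j := w i) = w \<circ> Transposition.transpose i j"
    using i by (auto simp: fun_eq_iff Transposition.transpose_def)
  ultimately show ?thesis by simp
qed

text \<open>An alternating form is antisymmetric, and permutations are products of transpositions.\<close>

lemma alt_form_perm:
  assumes M: "charted M" and a: "alt_form M k p \<alpha>" and \<pi>: "\<pi> permutes {0..<k}"
    and w: "\<And>j. j < k ==> w j \<in> tspace M p"
  shows "\<alpha> (map (w \<circ> \<pi>) [0..<k]) = signof \<pi> * \<alpha> (map w [0..<k])"
proof -
  have "\<forall>w. (\<forall>j<k. w j \<in> tspace M p) --> \<alpha> (map (w \<circ> \<pi>) [0..<k]) = signof \<pi> * \<alpha> (map w [0..<k])"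
    using \<pi> finite_atLeastLessThan[of 0 k]
  proof (induction rule: permutes_induct)
    case id
    show ?case by (simp add: sign_id)
  next
    case (swap i j \<sigma>)
    show ?case
    proof (intro allI impI)
      fix w :: "nat => 'a tvec" assume w: "\<forall>j<k. w j \<in> tspace M p"
      have ij: "i < k" "j < k" "i \<noteq> j" using swap by auto
      have w': "(w \<circ> Transposition.transpose i j) l \<in> tspace M p" if "l < k" for l
        using w that ij by (auto simp: Transposition.transpose_def)
      have sp: "\<sigma> permutes {0..<k}" by (fact swap)
      have sg: "sign (Transposition.transpose i j \<circ> \<sigma>) = - sign \<sigma>"
        using sign_compose[OF permutation_swap_id[of i j] permutes_imp_permutation[OF finite_atLeastLessThan sp]]
          ij by (simp add: sign_swap_id)
      have "\<alpha> (map (w \<circ> (Transposition.transpose i j \<circ> \<sigma>)) [0..<k]) = signof \<sigma> * \<alpha> (map (w \<circ> Transposition.transpose i j) [0..<k])"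
        using swap w' by (simp only: o_assoc) blast
      also have "\<dots> = - signof \<sigma> * \<alpha> (map w [0..<k])"
        using alt_form_swap[OF M a _ ij, of w] w by simp
      finally show "\<alpha> (map (w \<circ> (Transposition.transpose i j \<circ> \<sigma>)) [0..<k])
          = signof (Transposition.transpose i j \<circ> \<sigma>) * \<alpha> (map w [0..<k])"
        by (simp add: sg)
    qed
  qed
  then show ?thesis using w by blast
qed

text \<open>Maps on the first r indices, extended by the identity, so that a map with one more free value is a
  function update.\<close>

definition index_maps :: "nat => nat => (nat => nat) set" where
  "index_maps k r = {g. (\<forall>j<r. g j < k) \<and> (\<forall>j\<ge>r. g j = j)}"

lemma finite_index_maps: "finite (index_maps k k)"
proof -
  have "index_maps k k \<subseteq> (\<lambda>f j. if j < k then f j else j) ` PiE {..<k} (\<lambda>_. {..<k})"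
  proof
    fix g assume g: "g \<in> index_maps k k"
    have "g = (\<lambda>j. if j < k then (restrict g {..<k}) j else j)"
      using g by (auto simp: index_maps_def fun_eq_iff)
    moreover have "restrict g {..<k} \<in> PiE {..<k} (\<lambda>_. {..<k})" using g by (auto simp: index_maps_def)
    ultimately show "g \<in> (\<lambda>f j. if j < k then f j else j) ` PiE {..<k} (\<lambda>_. {..<k})" by blast
  qed
  then show ?thesis by (rule finite_subset) (simp add: finite_PiE)
qed

lemma sum_index_maps_Suc:
  fixes F :: "(nat => nat) => complex"
  assumes "r < k"
  shows "(\<Sum>g\<in>index_maps k r. \<Sum>i<k. F (g(r := i))) = (\<Sum>g\<in>index_maps k (Suc r). F g)"
proof -
  have "(\<Sum>g\<in>index_maps k r. \<Sum>i<k. F (g(r := i))) = (\<Sum>(g, i)\<in>index_maps k r \<times> {..<k}. F (g(r := i)))"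
    by (rule sum.cartesian_product)
  also have "\<dots> = (\<Sum>g\<in>index_maps k (Suc r). F g)"
    by (rule sum.reindex_bij_witness[where i = "\<lambda>h. (h(r := r), h r)" and j = "\<lambda>(g, i). g(r := i)"])
       (use assms in \<open>auto simp: index_maps_def less_Suc_eq fun_eq_iff\<close>)
  finally show ?thesis .
qed

text \<open>Multilinear expansion of the first r arguments, by induction on r.\<close>

lemma alt_form_expand:
  assumes M: "charted M" and p: "p \<in> pts M" and a: "alt_form M k p \<alpha>" and e: "\<And>j. j < k ==> e j \<in> tspace M p"
  shows "r \<le> k ==> (\<And>j. j < k ==> u j \<in> tspace M p) ==>
    \<alpha> (map (\<lambda>j. if j < r then (\<lambda>f. \<Sum>i<k. A i j * e i f) else u j) [0..<k])
     = (\<Sum>g\<in>index_maps k r. (\<Prod>j<r. A (g j) j) * \<alpha> (map (\<lambda>j. if j < r then e (g j) else u j) [0..<k]))"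
proof (induction r arbitrary: u)
  case 0
  have "index_maps k 0 = {\<lambda>j. j}" by (auto simp: index_maps_def fun_eq_iff)
  then show ?case by simp
next
  case (Suc r)
  let ?s = "\<lambda>j f. \<Sum>i<k. A i j * e i f"
  let ?W = "\<lambda>g j. if j < r then e (g j) else u j"
  let ?F = "\<lambda>g. (\<Prod>j<Suc r. A (g j) j) * \<alpha> (map (\<lambda>j. if j < Suc r then e (g j) else u j) [0..<k])"
  have rk: "r < k" using Suc.prems by simp
  have s: "?s j \<in> tspace M p" for j by (rule tspace_sum[OF M p e])
  have "(\<lambda>j. if j < Suc r then ?s j else u j) = (\<lambda>j. if j < r then ?s j else (u(r := ?s r)) j)"
    by (auto simp: fun_eq_iff less_Suc_eq)
  then have "\<alpha> (map (\<lambda>j. if j < Suc r then ?s j else u j) [0..<k])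
     = \<alpha> (map (\<lambda>j. if j < r then ?s j else (u(r := ?s r)) j) [0..<k])" by (simp only:)
  also have "\<dots> = (\<Sum>g\<in>index_maps k r. (\<Prod>j<r. A (g j) j) *
      \<alpha> (map (\<lambda>j. if j < r then e (g j) else (u(r := ?s r)) j) [0..<k]))"
    by (rule Suc.IH) (use rk Suc.prems s in auto)
  also have "\<dots> = (\<Sum>g\<in>index_maps k r. \<Sum>i<k. ?F (g(r := i)))"
  proof (rule sum.cong[OF refl])
    fix g assume g: "g \<in> index_maps k r"
    have W: "?W g j \<in> tspace M p" if "j < k" for j
      using that g e Suc.prems by (auto simp: index_maps_def)
    have 1: "(\<lambda>j. if j < r then e (g j) else (u(r := ?s r)) j) = (?W g)(r := ?s r)"
      by (auto simp: fun_eq_iff)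
    have 2: "(?W g)(r := e i) = (\<lambda>j. if j < Suc r then e ((g(r := i)) j) else u j)" for i
      by (auto simp: fun_eq_iff less_Suc_eq)
    have 3: "(\<Prod>j<Suc r. A ((g(r := i)) j) j) = (\<Prod>j<r. A (g j) j) * A i r" for i by simp
    have "(\<Prod>j<r. A (g j) j) * \<alpha> (map ((?W g)(r := ?s r)) [0..<k])
        = (\<Prod>j<r. A (g j) j) * (\<Sum>i<k. A i r * \<alpha> (map ((?W g)(r := e i)) [0..<k]))"
      by (subst alt_form_sum[OF M p a W rk e]) auto
    also have "\<dots> = (\<Sum>i<k. ?F (g(r := i)))" unfolding 2 3 by (simp only: sum_distrib_left mult.assoc)
    finally show "(\<Prod>j<r. A (g j) j) * \<alpha> (map (\<lambda>j. if j < r then e (g j) else (u(r := ?s r)) j) [0..<k])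
        = (\<Sum>i<k. ?F (g(r := i)))" unfolding 1 .
  qed
  also have "\<dots> = (\<Sum>g\<in>index_maps k (Suc r). ?F g)" by (rule sum_index_maps_Suc[OF rk])
  finally show ?case .
qed

text \<open>In the multilinear expansion only the injective index maps survive, and they give the terms of the Leibniz
  formula.\<close>

lemma alt_form_det:
  assumes M: "charted M" and p: "p \<in> pts M" and a: "alt_form M k p \<alpha>" and e: "\<And>j. j < k ==> e j \<in> tspace M p"
  shows "\<alpha> (map (\<lambda>j f. \<Sum>i<k. A i j * e i f) [0..<k])
     = det_of k A * \<alpha> (map e [0..<k])"
proof -
  let ?P = "{\<pi>. \<pi> permutes {0..<k}}"
  have "\<alpha> (map (\<lambda>j. if j < k then (\<lambda>f. \<Sum>i<k. A i j * e i f) else e j) [0..<k])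
     = (\<Sum>g\<in>index_maps k k. (\<Prod>j<k. A (g j) j) * \<alpha> (map (\<lambda>j. if j < k then e (g j) else e j) [0..<k]))"
    by (rule alt_form_expand[OF M p a e]) (use e in auto)
  moreover have "map (\<lambda>j. if j < k then (\<lambda>f. \<Sum>i<k. A i j * e i f) else e j) [0..<k] = map (\<lambda>j f. \<Sum>i<k. A i j * e i f) [0..<k]"
    by (rule map_cong) auto
  moreover have "map (\<lambda>j. if j < k then e (g j) else e j) [0..<k] = map (e \<circ> g) [0..<k]" for g
    by (rule map_cong) auto
  ultimately have "\<alpha> (map (\<lambda>j f. \<Sum>i<k. A i j * e i f) [0..<k])
      = (\<Sum>g\<in>index_maps k k. (\<Prod>j<k. A (g j) j) * \<alpha> (map (e \<circ> g) [0..<k]))" by (simp only:)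
  also have "\<dots> = (\<Sum>g\<in>?P. (\<Prod>j<k. A (g j) j) * \<alpha> (map (e \<circ> g) [0..<k]))"
  proof (rule sum.mono_neutral_right[OF finite_index_maps])
    show "?P \<subseteq> index_maps k k"
    proof
      fix g assume "g \<in> ?P"
      then have g: "g permutes {0..<k}" by simp
      then show "g \<in> index_maps k k"
        using permutes_in_image[OF g] permutes_not_in[OF g] by (auto simp: index_maps_def)
    qed
    show "\<forall>g\<in>index_maps k k - ?P. (\<Prod>j<k. A (g j) j) * \<alpha> (map (e \<circ> g) [0..<k]) = 0"
    proof
      fix g assume g: "g \<in> index_maps k k - ?P"
      have "\<not> inj_on g {0..<k}"
      proof
        assume i: "inj_on g {0..<k}"
        have "g ` {0..<k} \<subseteq> {0..<k}" using g by (auto simp: index_maps_def)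
        then have "bij_betw g {0..<k} {0..<k}" using i endo_inj_surj[of "{0..<k}" g] by (auto simp: bij_betw_def)
        then have "g permutes {0..<k}" by (rule bij_imp_permutes) (use g in \<open>auto simp: index_maps_def\<close>)
        then show False using g by simp
      qed
      then obtain i j where ij: "i < k" "j < k" "i \<noteq> j" "g i = g j" by (auto simp: inj_on_def)
      have "\<alpha> (map (e \<circ> g) [0..<k]) = 0"
        by (rule alt_form_eq[OF a _ ij(1-3)]) (use g e ij(4) in \<open>auto simp: index_maps_def\<close>)
      then show "(\<Prod>j<k. A (g j) j) * \<alpha> (map (e \<circ> g) [0..<k]) = 0" by simp
    qed
  qed
  also have "\<dots> = (\<Sum>\<pi>\<in>?P. signof \<pi> * (\<Prod>j<k. A (\<pi> j) j)) * \<alpha> (map e [0..<k])"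
    unfolding sum_distrib_right
  proof (rule sum.cong[OF refl])
    fix \<pi> assume "\<pi> \<in> ?P"
    then have "\<alpha> (map (e \<circ> \<pi>) [0..<k]) = signof \<pi> * \<alpha> (map e [0..<k])"
      by (intro alt_form_perm[OF M a _ e]) auto
    then show "(\<Prod>j<k. A (\<pi> j) j) * \<alpha> (map (e \<circ> \<pi>) [0..<k]) = signof \<pi> * (\<Prod>j<k. A (\<pi> j) j) * \<alpha> (map e [0..<k])"
      by (simp only: mult_ac)
  qed
  \<comment> \<open>the Leibniz formula for the transpose\<close>
  also have "(\<Sum>\<pi>\<in>?P. signof \<pi> * (\<Prod>j<k. A (\<pi> j) j)) = det_of k A"
  proof -
    have "(\<Prod>j<k. A (\<pi> j) j) = (\<Prod>j<k. Matrix.mat k k (\<lambda>(i, j). A i j) $$ (\<pi> j, j))" if "\<pi> \<in> ?P" for \<pi>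
      using that by (intro prod.cong) (auto dest: permutes_in_image)
    then show ?thesis
      by (subst det_col[of _ k]) (auto intro!: sum.cong)
  qed
  finally show ?thesis .
qed

text \<open>The tangent space has the coordinate vectors as a basis, so top forms are multiples of the coordinate volume
  form.\<close>

lemma top_form_chart:
  assumes M: "charted M" and U: "hol_chart M (U, \<phi>)" "p \<in> U" and a: "alt_form M (mdim M) p \<alpha>"
    and vs: "vs \<in> tlists M (mdim M) p"
  shows "\<alpha> vs = dz_wedge \<phi> 0 (mdim M) vs * \<alpha> (map (coord_vec M (U, \<phi>) p) [0..<mdim M])"
proof -
  let ?n = "mdim M" and ?e = "coord_vec M (U, \<phi>) p"
  have "map (\<lambda>j f. \<Sum>i<?n. (vs ! j) (\<lambda>q. \<phi> q i) * ?e i f) [0..<?n] = map (\<lambda>j. vs ! j) [0..<?n]"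
    using tspace_expand[OF M U tlists_nth[OF vs]] by (intro map_cong refl) auto
  also have "\<dots> = vs" using tlists_length[OF vs] map_nth[of vs] by simp
  finally have "\<alpha> vs = \<alpha> (map (\<lambda>j f. \<Sum>i<?n. (vs ! j) (\<lambda>q. \<phi> q i) * ?e i f) [0..<?n])" by simp
  also have "\<dots> = det_of ?n (\<lambda>i j. (vs ! j) (\<lambda>q. \<phi> q i)) * \<alpha> (map ?e [0..<?n])"
    by (rule alt_form_det[OF M hol_chart_sub[OF U] a coord_vec_tspace[OF M U]])
  finally show ?thesis by (simp add: dz_wedge_def)
qed

lemma dz_wedge_sum:
  "dz_wedge z a k vs = (\<Sum>\<pi> | \<pi> permutes {0..<k}. signof \<pi> * (\<Prod>j<k. (vs ! j) (\<lambda>p. z p (a + \<pi> j))))"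
proof -
  have "(\<Prod>j<k. Matrix.mat k k (\<lambda>(i, j). (vs ! j) (\<lambda>p. z p (a + i))) $$ (\<pi> j, j)) = (\<Prod>j<k. (vs ! j) (\<lambda>p. z p (a + \<pi> j)))"
    if "\<pi> permutes {0..<k}" for \<pi>
    using permutes_in_image[OF that] by (intro prod.cong) auto
  then show ?thesis unfolding dz_wedge_def
    by (subst det_col[of _ k]) (auto intro!: sum.cong)
qed

lemma dz_wedge_alt: "alt_form M k p (dz_wedge z a k)"
  unfolding alt_form_def
proof (intro conjI ballI allI impI)
  fix vs i u w and c d :: complex
  assume vs: "vs \<in> tlists M k p" and i: "i < k"
  let ?R = "\<lambda>\<pi>. \<Prod>j\<in>{..<k} - {i}. (vs ! j) (\<lambda>p. z p (a + \<pi> j))"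
  have *: "(\<Prod>j<k. (vs[i := v] ! j) (\<lambda>p. z p (a + \<pi> j))) = v (\<lambda>p. z p (a + \<pi> i)) * ?R \<pi>" for \<pi> v
    using i tlists_length[OF vs] by (subst prod.remove[of _ i]) (auto intro!: prod.cong arg_cong2[where f = times])
  show "dz_wedge z a k (vs[i := \<lambda>f. c * u f + d * w f]) = c * dz_wedge z a k (vs[i := u]) + d * dz_wedge z a k (vs[i := w])"
    unfolding dz_wedge_sum * sum_distrib_left sum.distrib[symmetric]
    by (rule sum.cong) (simp_all add: algebra_simps)
next
  fix vs i j assume vs: "vs \<in> tlists M k p" and ij: "i < k" "j < k" "i \<noteq> j \<and> vs ! i = vs ! j"
  show "dz_wedge z a k vs = 0" unfolding dz_wedge_def
    by (rule det_identical_columns[of _ k i j]) (use ij in \<open>auto intro!: eq_vecI\<close>)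
qed

lemma dz_wedge_coord:
  assumes M: "charted M" and U: "hol_chart M (U, \<phi>)" "p \<in> U"
  shows "dz_wedge \<phi> 0 (mdim M) (map (coord_vec M (U, \<phi>) p) [0..<mdim M]) = 1"
proof -
  have "Matrix.mat (mdim M) (mdim M) (\<lambda>(i, j). (map (coord_vec M (U, \<phi>) p) [0..<mdim M] ! j) (\<lambda>q. \<phi> q (0 + i))) = 1\<^sub>m (mdim M)"
    using coord_vec_dual[OF M U] by (intro eq_matI) auto
  then show ?thesis by (simp add: dz_wedge_def)
qed

lemma alt_form_scale:
  assumes "alt_form M k p \<alpha>" shows "alt_form M k p (\<lambda>vs. c * \<alpha> vs)"
  unfolding alt_form_def
proof (intro conjI ballI allI impI)
  fix vs i u w and a b :: complex
  assume h: "vs \<in> tlists M k p" "i < k" "u \<in> tspace M p" "w \<in> tspace M p"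
  have "\<alpha> (vs[i := \<lambda>f. a * u f + b * w f]) = a * \<alpha> (vs[i := u]) + b * \<alpha> (vs[i := w])"
    using assms h unfolding alt_form_def by blast
  then show "c * \<alpha> (vs[i := \<lambda>f. a * u f + b * w f]) = a * (c * \<alpha> (vs[i := u])) + b * (c * \<alpha> (vs[i := w]))"
    by (simp add: algebra_simps)
next
  fix vs i j assume "vs \<in> tlists M k p" "i < k" "j < k" "i \<noteq> j \<and> vs ! i = vs ! j"
  then have "\<alpha> vs = 0" using assms unfolding alt_form_def by blast
  then show "c * \<alpha> vs = 0" by simp
qed

section \<open>Line bundles\<close>

lemma lb_trivs:
  assumes "line_bundle X L"
  shows "(U, t) \<in> trivs L ==> openin (mtop X) U"
    "(U, t) \<in> trivs L ==> x \<in> U ==> bij_betw (t x) (fib L x) UNIV"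
    "x \<in> pts X ==> \<exists>U t. (U, t) \<in> trivs L \<and> x \<in> U"
proof -
  have 1: "\<forall>(U, t)\<in>trivs L. openin (mtop X) U \<and> (\<forall>x\<in>U. bij_betw (t x) (fib L x) UNIV)"
    and 2: "(\<Union>c\<in>trivs L. fst c) = pts X" using assms by (simp_all add: line_bundle_def)
  show "(U, t) \<in> trivs L ==> openin (mtop X) U"
    "(U, t) \<in> trivs L ==> x \<in> U ==> bij_betw (t x) (fib L x) UNIV" using 1 by auto
  assume "x \<in> pts X"
  then obtain c where "c \<in> trivs L" "x \<in> fst c" using 2 by blast
  then show "\<exists>U t. (U, t) \<in> trivs L \<and> x \<in> U" by (cases c) auto
qed

lemma lb_transition_ex:
  assumes "line_bundle X L" "(U, t) \<in> trivs L" "(U', t') \<in> trivs L"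
  shows "\<exists>g. hol_fun X (U \<inter> U') g \<and> (\<forall>x\<in>U \<inter> U'. g x \<noteq> 0 \<and> (\<forall>l\<in>fib L x. t' x l = g x * t x l))"
proof -
  have "\<forall>(U, t)\<in>trivs L. \<forall>(U', t')\<in>trivs L. \<exists>g. hol_fun X (U \<inter> U') g
        \<and> (\<forall>x\<in>U \<inter> U'. g x \<noteq> 0 \<and> (\<forall>l\<in>fib L x. t' x l = g x * t x l))"
    using assms(1) by (simp add: line_bundle_def)
  from bspec[OF this assms(2)] have "\<forall>(U', t')\<in>trivs L. \<exists>g. hol_fun X (U \<inter> U') g
        \<and> (\<forall>x\<in>U \<inter> U'. g x \<noteq> 0 \<and> (\<forall>l\<in>fib L x. t' x l = g x * t x l))" by simp
  from bspec[OF this assms(3)] show ?thesis by simp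
qed

lemma lb_change:
  assumes "line_bundle X L" "(U, t) \<in> trivs L" "(U', t') \<in> trivs L" "x \<in> U" "x \<in> U'"
  shows "\<exists>c. c \<noteq> 0 \<and> (\<forall>l\<in>fib L x. t' x l = c * t x l)"
proof -
  obtain g where "\<forall>x\<in>U \<inter> U'. g x \<noteq> 0 \<and> (\<forall>l\<in>fib L x. t' x l = g x * t x l)"
    using lb_transition_ex[OF assms(1-3)] by blast
  then show ?thesis using assms(4,5) by (intro exI[of _ "g x"]) auto
qed

lemma lb_eqI:
  assumes "line_bundle X L" "(U, t) \<in> trivs L" "x \<in> U" "l \<in> fib L x" "l' \<in> fib L x" "t x l = t x l'"
  shows "l = l'"
  using bij_betw_imp_inj_on[OF lb_trivs(2)[OF assms(1-3)]] assms(4-6) by (auto dest: inj_onD)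

text \<open>The values v, which change like the trivialisations do, define a unique element of the fiber. Zero, sums and
  multiples are the instances.\<close>

lemma lb_linear_the:
  assumes L: "line_bundle X L" and t: "(U, t) \<in> trivs L" "x \<in> U"
    and lin: "\<And>U' t'. (U', t') \<in> trivs L ==> x \<in> U' ==> (\<And>c l. c \<noteq> 0 ==> (\<forall>l\<in>fib L x. t' x l = c * t x l) ==> v U' t' = c * v U t)"
  shows "(THE l. l \<in> fib L x \<and> (\<forall>(U', t')\<in>trivs L. x \<in> U' --> t' x l = v U' t')) \<in> fib L x
    \<and> t x (THE l. l \<in> fib L x \<and> (\<forall>(U', t')\<in>trivs L. x \<in> U' --> t' x l = v U' t')) = v U t"
proof -
  let ?P = "\<lambda>l. l \<in> fib L x \<and> (\<forall>(U', t')\<in>trivs L. x \<in> U' --> t' x l = v U' t')"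
  have b: "bij_betw (t x) (fib L x) UNIV" by (rule lb_trivs(2)[OF L t])
  obtain l where l: "l \<in> fib L x" "t x l = v U t"
    using bij_betw_imp_surj_on[OF b] by (metis UNIV_I image_iff)
  have "t' x l = v U' t'" if c: "(U', t') \<in> trivs L" "x \<in> U'" for U' t'
  proof -
    obtain k where k: "k \<noteq> 0" "\<forall>l\<in>fib L x. t' x l = k * t x l" using lb_change[OF L t(1) c(1) t(2) c(2)] by blast
    show ?thesis using lin[OF c k] k(2) l by simp
  qed
  then have Pl: "?P l" using l(1) by auto
  have "?P (The ?P)"
  proof (rule theI[of ?P l, OF Pl])
    fix l' assume "?P l'"
    then have "l' \<in> fib L x" "t x l' = v U t" using t by auto
    then show "l' = l" using lb_eqI[OF L t] l by simp
  qed
  then show ?thesis using t by auto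
qed

lemma lb_zero:
  assumes L: "line_bundle X L" and t: "(U, t) \<in> trivs L" "x \<in> U"
  shows "lzero L x \<in> fib L x" "t x (lzero L x) = 0"
  using lb_linear_the[OF L t, of "\<lambda>_ _. 0"] unfolding lzero_def by simp_all

lemma lb_zero_iff:
  assumes L: "line_bundle X L" and t: "(U, t) \<in> trivs L" "x \<in> U" and l: "l \<in> fib L x"
  shows "l = lzero L x \<longleftrightarrow> t x l = 0"
  using lb_zero[OF L t] lb_eqI[OF L t l] by metis

lemma lb_scale:
  assumes L: "line_bundle X L" and t: "(U, t) \<in> trivs L" "x \<in> U" and l: "l \<in> fib L x"
  shows "lscale L x c l \<in> fib L x" "t x (lscale L x c l) = c * t x l"
proof -
  have "(\<And>k. k \<noteq> 0 ==> (\<forall>l\<in>fib L x. t' x l = k * t x l) ==> c * t' x l = k * (c * t x l))" for t'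
    using l by simp
  then show "lscale L x c l \<in> fib L x" "t x (lscale L x c l) = c * t x l"
    using lb_linear_the[OF L t, of "\<lambda>_ t'. c * t' x l"] unfolding lscale_def by simp_all
qed

lemma lb_add:
  assumes L: "line_bundle X L" and t: "(U, t) \<in> trivs L" "x \<in> U" and l: "l \<in> fib L x" "l' \<in> fib L x"
  shows "ladd L x l l' \<in> fib L x" "t x (ladd L x l l') = t x l + t x l'"
proof -
  have "(\<And>k. k \<noteq> 0 ==> (\<forall>l\<in>fib L x. t' x l = k * t x l) ==> t' x l + t' x l' = k * (t x l + t x l'))" for t'
    using l by (simp add: distrib_left)
  then show "ladd L x l l' \<in> fib L x" "t x (ladd L x l l') = t x l + t x l'"
    using lb_linear_the[OF L t, of "\<lambda>_ t'. t' x l + t' x l'"] unfolding ladd_def by simp_all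
qed

lemma H0_fib: "\<sigma> \<in> H0 X L ==> x \<in> pts X ==> \<sigma> x \<in> fib L x"
  by (simp add: H0_def hol_section_def)

lemma hol_section_at:
  assumes "hol_section X L S \<sigma>" "(U, t) \<in> trivs L" "p \<in> U" "p \<in> S"
  shows "hol_fun_at X (\<lambda>x. t x (\<sigma> x)) p"
proof -
  have "hol_fun X (U \<inter> S) (\<lambda>x. t x (\<sigma> x))" using assms(1,2) by (auto simp: hol_section_def)
  then show ?thesis by (rule hol_fun_imp_at) (use assms in simp)
qed

lemma H0_at: "\<sigma> \<in> H0 X L ==> (U, t) \<in> trivs L ==> p \<in> U ==> p \<in> pts X ==> hol_fun_at X (\<lambda>x. t x (\<sigma> x)) p"
  by (rule hol_section_at[where \<sigma> = \<sigma> and L = L and S = "pts X"]) (auto simp: H0_def)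

lemma frame_nonzero:
  assumes L: "line_bundle X L" and e: "frame X L S e" and t: "(U, t) \<in> trivs L" "x \<in> U" "x \<in> S"
  shows "e x \<in> fib L x" "t x (e x) \<noteq> 0" "hol_fun_at X (\<lambda>x. t x (e x)) x"
proof -
  show f: "e x \<in> fib L x" using e t by (simp add: frame_def hol_section_def)
  have "e x \<noteq> lzero L x" using e t(3) by (simp add: frame_def)
  then show "t x (e x) \<noteq> 0" using lb_zero_iff[OF L t(1,2) f] by simp
  show "hol_fun_at X (\<lambda>x. t x (e x)) x" using e t
    by (intro hol_section_at[where \<sigma> = e and L = L and S = S]) (auto simp: frame_def)
qed

subsection \<open>Coordinate derivatives and determinants are holomorphic\<close>

lemma hol_fun_at_near_all:
  "hol_fun_at M f p ==> \<exists>S. openin (mtop M) S \<and> p \<in> S \<and> (\<forall>q\<in>S. hol_fun_at M f q)"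
  unfolding hol_fun_at_def using hol_fun_def by blast

lemma hol_fun_at_coord_vec:
  assumes M: "charted M" and U: "hol_chart M (U, \<phi>)" "p \<in> U" and i: "i < mdim M" and f: "hol_fun_at M f p"
  shows "hol_fun_at M (\<lambda>q. coord_vec M (U, \<phi>) q i f) p"
proof -
  obtain S where S: "openin (mtop M) S" "p \<in> S" "\<forall>q\<in>S. hol_fun_at M f q" using hol_fun_at_near_all[OF f] by blast
  have "hol_near (mdim M) (pderiv_Cn i (\<lambda>z. f (inv_into U \<phi> z))) (\<phi> p)"
    using f unfolding hol_fun_at_chart[OF M U] by (rule hol_near_pderiv[OF _ i])
  then have "hol_near (mdim M) (\<lambda>z. coord_vec M (U, \<phi>) (inv_into U \<phi> z) i f) (\<phi> p)"
  proof (rule hol_near_cong[OF hol_chartD(5)[OF U(1) S(1)], rotated -1])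
    show "\<phi> p \<in> \<phi> ` (U \<inter> S)" using U S by blast
    fix w assume "w \<in> \<phi> ` (U \<inter> S)"
    then obtain q where q: "w = \<phi> q" "q \<in> U" "q \<in> S" by blast
    then show "pderiv_Cn i (\<lambda>z. f (inv_into U \<phi> z)) w = coord_vec M (U, \<phi>) (inv_into U \<phi> w) i f"
      using S(3) hol_chartD(3)[OF U(1)] by (simp add: coord_vec_hol)
  qed
  then show ?thesis unfolding hol_fun_at_chart[OF M U] .
qed

lemma hol_fun_at_det:
  assumes M: "charted M" and p: "p \<in> pts M" and A: "\<And>i j. i < k ==> j < k ==> hol_fun_at M (A i j) p"
  shows "hol_fun_at M (\<lambda>q. det_of k (\<lambda>i j. A i j q)) p"
proof -
  have "det_of k (\<lambda>i j. A i j q)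
      = (\<Sum>\<pi> | \<pi> permutes {0..<k}. signof \<pi> * (\<Prod>j<k. A (\<pi> j) j q))" for q
  proof -
    have "(\<Prod>j<k. Matrix.mat k k (\<lambda>(i, j). A i j q) $$ (\<pi> j, j)) = (\<Prod>j<k. A (\<pi> j) j q)"
      if "\<pi> permutes {0..<k}" for \<pi> using permutes_in_image[OF that] by (intro prod.cong) auto
    then show ?thesis by (subst det_col[of _ k]) (auto intro!: sum.cong)
  qed
  moreover have "hol_fun_at M (\<lambda>q. \<Sum>\<pi> | \<pi> permutes {0..<k}. signof \<pi> * (\<Prod>j<k. A (\<pi> j) j q)) p"
  proof (intro hol_fun_at_sum[OF M p] hol_fun_at_mult[OF M] hol_fun_at_const[OF M p] hol_fun_at_prod[OF M p])
    fix \<pi> j assume "\<pi> \<in> {\<pi>. \<pi> permutes {0..<k}}" "j \<in> {..<k}"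
    then show "hol_fun_at M (A (\<pi> j) j) p" using permutes_in_image[of \<pi> "{0..<k}" j] by (intro A) auto
  qed
  ultimately show ?thesis by (simp only:)
qed

lemma hol_fun_at_dz_wedge_coord:
  assumes M: "charted M" and U: "hol_chart M (U, \<phi>)" "p \<in> U" and V: "hol_chart M (V, \<psi>)" "p \<in> V"
    and ks: "length ks = k" "set ks \<subseteq> {..<mdim M}"
  shows "hol_fun_at M (\<lambda>q. dz_wedge \<psi> a k (map (coord_vec M (U, \<phi>) q) ks)) p"
proof -
  have "hol_fun_at M (\<lambda>q. det_of k (\<lambda>i j. coord_vec M (U, \<phi>) q (ks ! j) (\<lambda>x. \<psi> x (a + i)))) p"
    using ks by (intro hol_fun_at_det[OF M hol_chart_sub[OF U]] hol_fun_at_coord_vec[OF M U] hol_fun_at_coord[OF M V])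
      (auto simp: subset_iff)
  moreover have "Matrix.mat k k (\<lambda>(i, j). coord_vec M (U, \<phi>) q (ks ! j) (\<lambda>x. \<psi> x (a + i)))
     = Matrix.mat k k (\<lambda>(i, j). (map (coord_vec M (U, \<phi>) q) ks ! j) (\<lambda>x. \<psi> x (a + i)))" for q
    using ks(1) by (intro eq_matI) auto
  ultimately show ?thesis unfolding dz_wedge_def by (simp only:)
qed

subsection \<open>The bundle L + K\<close>

lemma plus_K_fib:
  assumes "\<tau> \<in> H0 X (plus_K X L)" "x \<in> pts X"
  shows "vs \<in> tlists X (mdim X) x ==> \<tau> x vs \<in> fib L x"
    "(U, t) \<in> trivs L ==> x \<in> U ==> alt_form X (mdim X) x (\<lambda>vs. t x (\<tau> x vs))"
    "vs \<notin> tlists X (mdim X) x ==> \<tau> x vs = undefined"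
  using H0_fib[OF assms] by (auto simp: plus_K_def)

lemma plus_K_chart:
  assumes X: "charted X" and \<tau>: "\<tau> \<in> H0 X (plus_K X L)" and t: "(U, t) \<in> trivs L" "x \<in> U"
    and V: "hol_chart X (V, z)" "x \<in> V" and vs: "vs \<in> tlists X (mdim X) x"
  shows "t x (\<tau> x vs) = t x (\<tau> x (map (coord_vec X (V, z) x) [0..<mdim X])) * dz_wedge z 0 (mdim X) vs"
  using top_form_chart[OF X V plus_K_fib(2)[OF \<tau> hol_chart_sub[OF V] t] vs] by (simp only: mult.commute)

lemma plus_K_hol:
  assumes X: "charted X" and \<tau>: "\<tau> \<in> H0 X (plus_K X L)" and t: "(U, t) \<in> trivs L" "p \<in> U" "openin (mtop X) U"
    and V: "hol_chart X (V, z)" "p \<in> V"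
  shows "hol_fun_at X (\<lambda>x. t x (\<tau> x (map (coord_vec X (V, z) x) [0..<mdim X]))) p"
proof -
  let ?d = "mdim X"
  have p: "p \<in> pts X" by (rule hol_chart_sub[OF V])
  obtain W \<phi> where W: "(W, \<phi>) \<in> atlas X" "hol_chart X (W, \<phi>)" "p \<in> W" using chart_ex[OF X p] by blast
  let ?G = "\<lambda>x. t x (\<tau> x (map (coord_vec X (W, \<phi>) x) [0..<?d]))"
  have "(U \<inter> W, \<lambda>x \<tau>. t x (\<tau> (map (coord_vec X (W, \<phi>) x) [0..<?d]))) \<in> trivs (plus_K X L)"
    unfolding plus_K_def using t(1) W(1) by auto
  from H0_at[OF \<tau> this _ p] have "hol_fun_at X ?G p" using t(2) W(3) by simp
  moreover have "hol_fun_at X (\<lambda>x. dz_wedge \<phi> 0 ?d (map (coord_vec X (V, z) x) [0..<?d])) p"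
    by (rule hol_fun_at_dz_wedge_coord[OF X V W(2,3)]) auto
  ultimately have "hol_fun_at X (\<lambda>x. ?G x * dz_wedge \<phi> 0 ?d (map (coord_vec X (V, z) x) [0..<?d])) p"
    by (rule hol_fun_at_mult[OF X])
  then show ?thesis
  proof (rule hol_fun_at_cong[OF X, rotated -1])
    show "openin (mtop X) (U \<inter> W \<inter> V)" using t(3) hol_chartD(1)[OF V(1)] hol_chartD(1)[OF W(2)] by blast
    show "p \<in> U \<inter> W \<inter> V" using t W V by blast
    fix q assume q: "q \<in> U \<inter> W \<inter> V"
    have "map (coord_vec X (V, z) q) [0..<?d] \<in> tlists X ?d q"
      using q coord_vec_tspace[OF X V(1)] by (intro tlists_map) blast
    then show "?G q * dz_wedge \<phi> 0 ?d (map (coord_vec X (V, z) q) [0..<?d]) = t q (\<tau> q (map (coord_vec X (V, z) q) [0..<?d]))"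
      using plus_K_chart[OF X \<tau> t(1) _ W(2), of q] q by simp
  qed
qed

subsection \<open>Tensor products\<close>

lemma tensor_iso_fib:
  "tensor_iso X s L L' \<mu> ==> x \<in> pts X ==> (\<And>i. i < s ==> l i \<in> fib (L i) x) ==> \<mu> x l \<in> fib L' x"
  unfolding tensor_iso_def by auto

lemma tensor_iso_ex:
  assumes "tensor_iso X s L L' \<mu>" "(U, t) \<in> trivs L'" "\<And>i. i < s ==> (Us i, ts i) \<in> trivs (L i)"
  shows "\<exists>a. hol_fun X (U \<inter> (\<Inter>i<s. Us i)) a \<and> (\<forall>x\<in>U \<inter> (\<Inter>i<s. Us i). a x \<noteq> 0
      \<and> (\<forall>l. (\<forall>i<s. l i \<in> fib (L i) x) --> t x (\<mu> x l) = a x * (\<Prod>i<s. ts i x (l i))))"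
proof -
  have "\<forall>Us ts. \<forall>(U, t)\<in>trivs L'. (\<forall>i<s. (Us i, ts i) \<in> trivs (L i)) -->
        (\<exists>a. hol_fun X (U \<inter> (\<Inter>i<s. Us i)) a
           \<and> (\<forall>x\<in>U \<inter> (\<Inter>i<s. Us i). a x \<noteq> 0
                \<and> (\<forall>l\<in>Pi {..<s} (\<lambda>i. fib (L i) x). t x (\<mu> x l) = a x * (\<Prod>i<s. ts i x (l i)))))"
    using assms(1) by (simp add: tensor_iso_def)
  from bspec[OF spec[OF spec[OF this, of Us], of ts] assms(2)] assms(3)
  have "\<exists>a. hol_fun X (U \<inter> (\<Inter>i<s. Us i)) a
           \<and> (\<forall>x\<in>U \<inter> (\<Inter>i<s. Us i). a x \<noteq> 0
                \<and> (\<forall>l\<in>Pi {..<s} (\<lambda>i. fib (L i) x). t x (\<mu> x l) = a x * (\<Prod>i<s. ts i x (l i))))" by simp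
  then show ?thesis by (simp add: Pi_iff Ball_def)
qed

lemma choose_trivs:
  assumes "\<And>i. i < s ==> line_bundle X (L i)" "p \<in> pts X"
  shows "\<exists>Us ts. \<forall>i<(s::nat). (Us i, ts i) \<in> trivs (L i) \<and> p \<in> Us i"
proof -
  have "\<forall>i. \<exists>c. i < s --> c \<in> trivs (L i) \<and> p \<in> fst c"
    using lb_trivs(3)[OF assms(1) assms(2)] by (metis fst_conv)
  from choice[OF this] obtain c where "\<forall>i. i < s --> c i \<in> trivs (L i) \<and> p \<in> fst (c i)" by blast
  then show ?thesis by (intro exI[of _ "\<lambda>i. fst (c i)"] exI[of _ "\<lambda>i. snd (c i)"]) simp
qed

section \<open>Complete intersections\<close>

lemma tspace_const:
  assumes M: "charted M" and v: "v \<in> tspace M p" shows "v (\<lambda>q. c) = 0"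
proof -
  obtain \<gamma> where g: "hol_at C_mfd M \<gamma> 0" "\<gamma> 0 = p" "v = velocity M \<gamma>" using tspace_ex[OF M v] by blast
  have "hol_fun_at M (\<lambda>q. c) (\<gamma> 0)" by (rule hol_fun_at_const[OF M hol_at_pts(2)[OF g(1)]])
  then have "velocity M \<gamma> (\<lambda>q. c) = deriv (\<lambda>t. c) 0" by (simp add: velocity_def)
  then show ?thesis by (simp add: g(3))
qed

lemma tspace_mult:
  assumes M: "charted M" and v: "v \<in> tspace M p" and f: "hol_fun_at M f p" and h: "hol_fun_at M h p"
  shows "v (\<lambda>q. f q * h q) = v f * h p + f p * v h"
proof -
  obtain \<gamma> where g: "hol_at C_mfd M \<gamma> 0" "\<gamma> 0 = p" "v = velocity M \<gamma>" using tspace_ex[OF M v] by blast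
  have fh: "hol_fun_at M f (\<gamma> 0)" "hol_fun_at M h (\<gamma> 0)" using f h g(2) by simp_all
  have "((\<lambda>t. f (\<gamma> t) * h (\<gamma> t)) has_field_derivative velocity M \<gamma> f * h (\<gamma> 0) + velocity M \<gamma> h * f (\<gamma> 0)) (at 0)"
    by (rule DERIV_mult[OF velocity_deriv[OF g(1) fh(1)] velocity_deriv[OF g(1) fh(2)]])
  from DERIV_unique[OF this velocity_deriv[OF g(1) hol_fun_at_mult[OF M fh]]]
  show ?thesis by (simp add: g(2,3) algebra_simps)
qed

text \<open>The inclusion of the last coordinates as the locus where the first s vanish.\<close>

definition slice :: "nat => (nat => complex) => nat => complex" where
  "slice s w = (\<lambda>i. if i < s then 0 else w (i - s))"

lemma slice_Cn: "s \<le> n ==> w \<in> Cn (n - s) ==> slice s w \<in> Cn n"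
  by (auto simp: slice_def Cn_def)

definition ci_chart :: "nat => ('x => nat => complex) => 'x => nat => complex" where
  "ci_chart s z = (\<lambda>x i. z x (s + i))"

lemma ci_mfd_simps [simp]:
  "mtop (ci_mfd X s L \<sigma>) = subtopology (mtop X) (zero_locus X s L \<sigma>)"
  "mdim (ci_mfd X s L \<sigma>) = mdim X - s"
  "pts (ci_mfd X s L \<sigma>) = zero_locus X s L \<sigma>"
  by (auto simp: ci_mfd_def zero_locus_def)

lemma zero_locus_Int_pts [simp]: "pts X \<inter> zero_locus X s L \<sigma> = zero_locus X s L \<sigma>"
  by (auto simp: zero_locus_def)

lemma ci_atlas: "atlas (ci_mfd X s L \<sigma>) =
   {(U \<inter> zero_locus X s L \<sigma>, ci_chart s z) | U z e. adapted X s L \<sigma> U z e}"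
  by (simp add: ci_mfd_def ci_chart_def)

lemma dz_wedge_ci_chart: "dz_wedge z s k vs = dz_wedge (ci_chart s z) 0 k vs"
  by (simp add: dz_wedge_def ci_chart_def)

locale bundle_data =
  fixes X :: "'x cmfd" and s :: nat and L :: "nat => ('x, 'l) lbundle" and L' :: "('x, 'k) lbundle"
    and \<mu> :: "'x => (nat => 'l) => 'k"
  assumes X: "charted X" and sd: "s \<le> mdim X"
    and lb: "\<And>i. i < s ==> line_bundle X (L i)" and lb': "line_bundle X L'"
    and ten: "tensor_iso X s L L' \<mu>"
begin

lemma sec_H0: "\<sigma> \<in> sec_tuples X s L ==> i < s ==> \<sigma> i \<in> H0 X (L i)"
  by (auto simp: sec_tuples_def)

lemma adapted_chart: "adapted X s L \<sigma> U z e ==> hol_chart X (U, z)"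
  by (simp add: adapted_def)

lemma adapted_frame: "adapted X s L \<sigma> U z e ==> i < s ==> frame X (L i) U (e i)"
  by (simp add: adapted_def)

lemma adapted_triv:
  assumes a: "adapted X s L \<sigma> U z e" and i: "i < s" and t: "(W, t) \<in> trivs (L i)" and x: "x \<in> U" "x \<in> W"
  shows "e i x \<in> fib (L i) x" "t x (\<sigma> i x) = z x i * t x (e i x)" "t x (e i x) \<noteq> 0"
    "hol_fun_at X (\<lambda>x. t x (e i x)) x"
proof -
  note f = frame_nonzero[OF lb[OF i] adapted_frame[OF a i] t x(2,1)]
  show "e i x \<in> fib (L i) x" "t x (e i x) \<noteq> 0" "hol_fun_at X (\<lambda>x. t x (e i x)) x" by (fact f)+
  have "\<sigma> i x = lscale (L i) x (z x i) (e i x)" using a i x(1) by (simp add: adapted_def)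
  then show "t x (\<sigma> i x) = z x i * t x (e i x)" using lb_scale(2)[OF lb[OF i] t x(2) f(1)] by simp
qed

lemma zero_locus_iff:
  assumes \<sigma>: "\<sigma> \<in> sec_tuples X s L" and a: "adapted X s L \<sigma> U z e" and x: "x \<in> U"
  shows "x \<in> zero_locus X s L \<sigma> \<longleftrightarrow> (\<forall>i<s. z x i = 0)"
proof -
  have xX: "x \<in> pts X" by (rule hol_chart_sub[OF adapted_chart[OF a] x])
  have "\<sigma> i x = lzero (L i) x \<longleftrightarrow> z x i = 0" if i: "i < s" for i
  proof -
    obtain W t where t: "(W, t) \<in> trivs (L i)" "x \<in> W" using lb_trivs(3)[OF lb[OF i] xX] by blast
    show ?thesis using lb_zero_iff[OF lb[OF i] t H0_fib[OF sec_H0[OF \<sigma> i] xX]] adapted_triv(2,3)[OF a i t(1) x t(2)] by simp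
  qed
  then show ?thesis using xX by (simp add: zero_locus_def)
qed

lemma zero_locus_pts: "x \<in> zero_locus X s L \<sigma> ==> x \<in> pts X"
  by (simp add: zero_locus_def)

lemma slice_ci_chart:
  assumes \<sigma>: "\<sigma> \<in> sec_tuples X s L" and a: "adapted X s L \<sigma> U z e" and x: "x \<in> U" "x \<in> zero_locus X s L \<sigma>"
  shows "slice s (ci_chart s z x) = z x"
  using zero_locus_iff[OF \<sigma> a x(1)] x(2) by (auto simp: slice_def ci_chart_def fun_eq_iff)

lemma ci_chart_Cn: "adapted X s L \<sigma> U z e ==> x \<in> U ==> ci_chart s z x \<in> Cn (mdim X - s)"
  using hol_chartD(4)[OF adapted_chart, of \<sigma> U z e x] by (auto simp: ci_chart_def Cn_def)

lemma ci_chart_inj: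
  assumes \<sigma>: "\<sigma> \<in> sec_tuples X s L" and a: "adapted X s L \<sigma> U z e"
  shows "inj_on (ci_chart s z) (U \<inter> zero_locus X s L \<sigma>)"
proof (rule inj_onI)
  fix x y assume xy: "x \<in> U \<inter> zero_locus X s L \<sigma>" "y \<in> U \<inter> zero_locus X s L \<sigma>"
    and e: "ci_chart s z x = ci_chart s z y"
  have "z x = z y" using slice_ci_chart[OF \<sigma> a, of x] slice_ci_chart[OF \<sigma> a, of y] xy e by simp
  then show "x = y" using hol_chartD(3)[OF adapted_chart[OF a]] xy by (auto dest: inj_onD)
qed

lemma ci_top_chart:
  assumes \<sigma>: "\<sigma> \<in> sec_tuples X s L" and a: "adapted X s L \<sigma> U z e"
  shows "top_chart (subtopology (mtop X) (zero_locus X s L \<sigma>)) (mdim X - s) (U \<inter> zero_locus X s L \<sigma>, ci_chart s z)"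
proof (rule top_chartI)
  let ?Y = "zero_locus X s L \<sigma>" and ?n = "mdim X - s"
  note c = adapted_chart[OF a]
  show "openin (subtopology (mtop X) ?Y) (U \<inter> ?Y)"
    using hol_chartD(1)[OF c] by (simp add: openin_subtopology_Int)
  show "inj_on (ci_chart s z) (U \<inter> ?Y)" by (rule ci_chart_inj[OF \<sigma> a])
  show "ci_chart s z p \<in> Cn ?n" if "p \<in> U \<inter> ?Y" for p using ci_chart_Cn[OF a] that by simp
  fix S assume S: "openin (subtopology (mtop X) ?Y) S" "S \<subseteq> U \<inter> ?Y"
  then obtain S' where S': "openin (mtop X) S'" "S = S' \<inter> ?Y" by (auto simp: openin_subtopology)
  have "ci_chart s z ` S = {w \<in> Cn ?n. slice s w \<in> z ` (U \<inter> S')}"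
  proof (intro equalityI subsetI)
    fix w assume "w \<in> ci_chart s z ` S"
    then obtain q where q: "w = ci_chart s z q" "q \<in> S" by blast
    then have "q \<in> U" "q \<in> ?Y" "q \<in> S'" using S(2) S'(2) by auto
    then show "w \<in> {w \<in> Cn ?n. slice s w \<in> z ` (U \<inter> S')}"
      using slice_ci_chart[OF \<sigma> a] ci_chart_Cn[OF a] q(1) by auto
  next
    fix w assume "w \<in> {w \<in> Cn ?n. slice s w \<in> z ` (U \<inter> S')}"
    then obtain q where q: "w \<in> Cn ?n" "slice s w = z q" "q \<in> U" "q \<in> S'" by auto
    have "z q i = 0" if "i < s" for i using fun_cong[OF q(2), of i] that by (simp add: slice_def)
    then have "q \<in> ?Y" using zero_locus_iff[OF \<sigma> a q(3)] by simp
    moreover have "w = ci_chart s z q"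
    proof
      fix i show "w i = ci_chart s z q i" using fun_cong[OF q(2), of "s + i"] by (simp add: slice_def ci_chart_def)
    qed
    ultimately show "w \<in> ci_chart s z ` S" using q(4) S'(2) by blast
  qed
  moreover have "openin (top_of_set (Cn ?n)) {w \<in> Cn ?n. slice s w \<in> z ` (U \<inter> S')}"
  proof (rule openin_Cn_preimage[OF _ hol_chartD(5)[OF c S'(1)]])
    show "slice s w \<in> Cn (mdim X)" if "w \<in> Cn ?n" for w using slice_Cn[OF sd that] .
    show "continuous_on (Cn ?n) (\<lambda>w. slice s w k)" for k
      by (cases "k < s") (auto simp: slice_def intro: continuous_on_subset[OF continuous_on_product_coordinates])
  qed simp
  ultimately show "openin (top_of_set (Cn ?n)) (ci_chart s z ` S)" by simp
next
  let ?Y = "zero_locus X s L \<sigma>" and ?n = "mdim X - s"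
  note c = adapted_chart[OF a]
  fix W assume W: "openin (top_of_set (Cn ?n)) W"
  have "openin (top_of_set (Cn (mdim X))) {w \<in> Cn (mdim X). csnd s w \<in> W}"
  proof (rule openin_Cn_preimage[OF _ W])
    show "csnd s w \<in> Cn ?n" if "w \<in> Cn (mdim X)" for w using that by (simp add: csnd_def Cn_def)
    show "continuous_on (Cn (mdim X)) (\<lambda>w. csnd s w k)" for k
      by (auto simp: csnd_def intro: continuous_on_subset[OF continuous_on_product_coordinates])
  qed simp
  then have "openin (mtop X) {q \<in> U. z q \<in> {w \<in> Cn (mdim X). csnd s w \<in> W}}" by (rule hol_chartD(6)[OF c])
  moreover have "{p \<in> U \<inter> ?Y. ci_chart s z p \<in> W} = {q \<in> U. z q \<in> {w \<in> Cn (mdim X). csnd s w \<in> W}} \<inter> ?Y"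
    using hol_chartD(4)[OF c] by (auto simp: csnd_def ci_chart_def)
  ultimately show "openin (subtopology (mtop X) ?Y) {p \<in> U \<inter> ?Y. ci_chart s z p \<in> W}"
    by (simp add: openin_subtopology_Int)
qed

text \<open>Restriction to the complete intersection is, in adapted coordinates, substitution of zeros.\<close>

lemma slice_near:
  assumes \<sigma>: "\<sigma> \<in> sec_tuples X s L" and a: "adapted X s L \<sigma> U z e" and p: "p \<in> U" "p \<in> zero_locus X s L \<sigma>"
    and f: "hol_fun_at X f p"
  shows "hol_near (mdim X - s) (\<lambda>w. f (inv_into (U \<inter> zero_locus X s L \<sigma>) (ci_chart s z) w)) (ci_chart s z p)"
proof -
  let ?Y = "zero_locus X s L \<sigma>" and ?n = "mdim X - s"
  note c = adapted_chart[OF a]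
  have zp: "slice s (ci_chart s z p) = z p" by (rule slice_ci_chart[OF \<sigma> a p])
  have "hol_near ?n (\<lambda>w. f (inv_into U z (slice s w))) (ci_chart s z p)"
  proof (rule hol_near_chain(1)[where g = "slice s" and m = "mdim X" and U = "Cn ?n"])
    show "hol_near (mdim X) (\<lambda>w. f (inv_into U z w)) (slice s (ci_chart s z p))"
      using f unfolding zp hol_fun_at_chart[OF X c p(1)] .
    show "hol_near ?n (\<lambda>w. slice s w k) (ci_chart s z p)" for k
      using hol_near_coord[OF ci_chart_Cn[OF a p(1)]] hol_near_const[OF ci_chart_Cn[OF a p(1)], of 0]
      by (cases "k < s") (simp_all add: slice_def)
  qed (use ci_chart_Cn[OF a p(1)] slice_Cn[OF sd] in auto)
  then show ?thesis
  proof (rule hol_near_cong[OF top_chartD(2)[OF ci_top_chart[OF \<sigma> a]], rotated -1])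
    show "ci_chart s z p \<in> ci_chart s z ` (U \<inter> ?Y)" using p by blast
    fix w assume "w \<in> ci_chart s z ` (U \<inter> ?Y)"
    then obtain q where q: "w = ci_chart s z q" "q \<in> U" "q \<in> ?Y" by blast
    have "inv_into (U \<inter> ?Y) (ci_chart s z) w = q" using ci_chart_inj[OF \<sigma> a] q by simp
    moreover have "inv_into U z (slice s w) = q"
      using slice_ci_chart[OF \<sigma> a q(2,3)] hol_chartD(3)[OF c] q by simp
    ultimately show "f (inv_into U z (slice s w)) = f (inv_into (U \<inter> ?Y) (ci_chart s z) w)" by simp
  qed
qed

lemma smooth_adapted:
  "smooth_ci X s L \<sigma> ==> p \<in> zero_locus X s L \<sigma> ==> \<exists>U z e. p \<in> U \<and> adapted X s L \<sigma> U z e"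
  by (simp add: smooth_ci_def)

text \<open>Two adapted charts are related by the restriction of the transition between charts of X.\<close>

lemma charted_ci:
  assumes \<sigma>: "\<sigma> \<in> sec_tuples X s L" and sm: "smooth_ci X s L \<sigma>"
  shows "charted (ci_mfd X s L \<sigma>)"
  unfolding charted_def
proof (intro conjI ballI)
  let ?Y = "zero_locus X s L \<sigma>" and ?n = "mdim X - s"
  fix c assume "c \<in> atlas (ci_mfd X s L \<sigma>)"
  then obtain U z e where c: "c = (U \<inter> ?Y, ci_chart s z)" "adapted X s L \<sigma> U z e" unfolding ci_atlas by blast
  note tc = ci_top_chart[OF \<sigma> c(2)]
  show "top_chart (mtop (ci_mfd X s L \<sigma>)) (mdim (ci_mfd X s L \<sigma>)) c" using tc c(1) by simp
  fix c' assume "c' \<in> atlas (ci_mfd X s L \<sigma>)"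
  then obtain U' z' e' where c': "c' = (U' \<inter> ?Y, ci_chart s z')" "adapted X s L \<sigma> U' z' e'" unfolding ci_atlas by blast
  note tc' = ci_top_chart[OF \<sigma> c'(2)]
  have "hol_Cn ?n (ci_chart s z ` (U \<inter> ?Y \<inter> (U' \<inter> ?Y))) (\<lambda>w. ci_chart s z' (inv_into (U \<inter> ?Y) (ci_chart s z) w) k)" for k
    unfolding hol_Cn_iff_near
  proof (intro conjI ballI)
    show "openin (top_of_set (Cn ?n)) (ci_chart s z ` (U \<inter> ?Y \<inter> (U' \<inter> ?Y)))"
      by (rule top_chartD(5)[OF tc top_chartD(1)[OF tc']])
    fix w assume "w \<in> ci_chart s z ` (U \<inter> ?Y \<inter> (U' \<inter> ?Y))"
    then obtain q where q: "w = ci_chart s z q" "q \<in> U" "q \<in> U'" "q \<in> ?Y" by blast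
    have "hol_fun_at X (\<lambda>q. z' q (s + k)) q" by (rule hol_fun_at_coord[OF X adapted_chart[OF c'(2)] q(3)])
    from slice_near[OF \<sigma> c(2) q(2,4) this]
    show "hol_near ?n (\<lambda>w. ci_chart s z' (inv_into (U \<inter> ?Y) (ci_chart s z) w) k) w"
      unfolding q(1) by (simp only: ci_chart_def)
  qed
  then show "hol_transition (mdim (ci_mfd X s L \<sigma>)) c c'" unfolding c(1) c'(1) hol_transition_def by simp
next
  show "(\<Union>c\<in>atlas (ci_mfd X s L \<sigma>). fst c) = pts (ci_mfd X s L \<sigma>)"
  proof (intro equalityI subsetI)
    fix p assume "p \<in> pts (ci_mfd X s L \<sigma>)"
    then have p: "p \<in> zero_locus X s L \<sigma>" unfolding ci_mfd_simps(3) .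
    obtain U z e where U: "p \<in> U" "adapted X s L \<sigma> U z e" using smooth_adapted[OF sm p] by blast
    have "(U \<inter> zero_locus X s L \<sigma>, ci_chart s z) \<in> atlas (ci_mfd X s L \<sigma>)" unfolding ci_atlas using U(2) by blast
    moreover have "p \<in> fst (U \<inter> zero_locus X s L \<sigma>, ci_chart s z)" using U(1) p by simp
    ultimately show "p \<in> (\<Union>c\<in>atlas (ci_mfd X s L \<sigma>). fst c)" by blast
  next
    fix p assume "p \<in> (\<Union>c\<in>atlas (ci_mfd X s L \<sigma>). fst c)"
    then show "p \<in> pts (ci_mfd X s L \<sigma>)" unfolding ci_atlas ci_mfd_simps(3) by auto
  qed
qed

lemma ci_hol_chart:
  assumes \<sigma>: "\<sigma> \<in> sec_tuples X s L" and sm: "smooth_ci X s L \<sigma>" and a: "adapted X s L \<sigma> U z e"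
  shows "hol_chart (ci_mfd X s L \<sigma>) (U \<inter> zero_locus X s L \<sigma>, ci_chart s z)"
proof (rule atlas_hol_chart[OF charted_ci[OF \<sigma> sm]])
  show "(U \<inter> zero_locus X s L \<sigma>, ci_chart s z) \<in> atlas (ci_mfd X s L \<sigma>)" unfolding ci_atlas using a by blast
qed

lemma restrict_hol:
  assumes \<sigma>: "\<sigma> \<in> sec_tuples X s L" and sm: "smooth_ci X s L \<sigma>" and p: "p \<in> zero_locus X s L \<sigma>"
    and f: "hol_fun_at X f p"
  shows "hol_fun_at (ci_mfd X s L \<sigma>) f p"
proof -
  obtain U z e where U: "p \<in> U" "adapted X s L \<sigma> U z e" using smooth_adapted[OF sm p] by blast
  have "p \<in> U \<inter> zero_locus X s L \<sigma>" using U(1) p by simp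
  from hol_fun_at_chart[OF charted_ci[OF \<sigma> sm] ci_hol_chart[OF \<sigma> sm U(2)] this]
  show ?thesis using slice_near[OF \<sigma> U(2,1) p f] by simp
qed

lemma ci_inclusion:
  assumes \<sigma>: "\<sigma> \<in> sec_tuples X s L" and sm: "smooth_ci X s L \<sigma>"
  shows "hol_map (ci_mfd X s L \<sigma>) X (zero_locus X s L \<sigma>) (\<lambda>y. y)"
  unfolding hol_map_iff[OF charted_ci[OF \<sigma> sm] X]
proof (intro conjI ballI)
  let ?Y = "zero_locus X s L \<sigma>"
  show "openin (mtop (ci_mfd X s L \<sigma>)) ?Y"
    by (rule openin_topspace[of "mtop (ci_mfd X s L \<sigma>)", unfolded ci_mfd_simps(3)])
  fix p assume p: "p \<in> ?Y"
  show "hol_at (ci_mfd X s L \<sigma>) X (\<lambda>y. y) p"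
    unfolding hol_at_def
  proof (intro conjI allI impI)
    show "p \<in> pts (ci_mfd X s L \<sigma>)" "p \<in> pts X" using p zero_locus_pts by simp_all
    show "\<exists>S. openin (mtop (ci_mfd X s L \<sigma>)) S \<and> p \<in> S \<and> (\<lambda>y. y) ` S \<subseteq> T" if "openin (mtop X) T \<and> p \<in> T" for T
      using that p by (intro exI[of _ "T \<inter> ?Y"]) (auto simp: openin_subtopology_Int)
    show "hol_fun_at (ci_mfd X s L \<sigma>) f p" if "hol_fun_at X f p" for f
      by (rule restrict_hol[OF \<sigma> sm p that])
  qed
qed

lemma ci_push:
  assumes \<sigma>: "\<sigma> \<in> sec_tuples X s L" and sm: "smooth_ci X s L \<sigma>" and p: "p \<in> zero_locus X s L \<sigma>"
    and v: "v \<in> tspace (ci_mfd X s L \<sigma>) p"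
  shows "push X (\<lambda>y. y) p v \<in> tspace X p"
    "hol_fun_at X f p ==> push X (\<lambda>y. y) p v f = v f"
  using push_tspace[OF charted_ci[OF \<sigma> sm] X ci_inclusion[OF \<sigma> sm] p v] by (simp_all add: push_def)

text \<open>The first s adapted coordinates are identically zero on the complete intersection.\<close>

lemma ci_push_zero:
  assumes \<sigma>: "\<sigma> \<in> sec_tuples X s L" and sm: "smooth_ci X s L \<sigma>" and a: "adapted X s L \<sigma> U z e"
    and p: "p \<in> U" "p \<in> zero_locus X s L \<sigma>" and v: "v \<in> tspace (ci_mfd X s L \<sigma>) p" and i: "i < s"
  shows "push X (\<lambda>y. y) p v (\<lambda>q. z q i) = 0"
proof -
  let ?Y = "zero_locus X s L \<sigma>"
  have "push X (\<lambda>y. y) p v (\<lambda>q. z q i) = v (\<lambda>q. z q i)"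
    by (rule ci_push(2)[OF \<sigma> sm p(2) v hol_fun_at_coord[OF X adapted_chart[OF a] p(1)]])
  also have "\<dots> = v (\<lambda>q. 0)"
  proof (rule tspace_cong[OF charted_ci[OF \<sigma> sm] v])
    show "openin (mtop (ci_mfd X s L \<sigma>)) (U \<inter> ?Y)"
      by (rule hol_chartD(1)[OF ci_hol_chart[OF \<sigma> sm a]])
    show "z q i = 0" if "q \<in> U \<inter> ?Y" for q using zero_locus_iff[OF \<sigma> a] that i by auto
  qed (use p in simp)
  also have "\<dots> = 0" by (rule tspace_const[OF charted_ci[OF \<sigma> sm] v])
  finally show ?thesis .
qed

text \<open>Leibniz rule for \<sigma>_i = z_i e_i at a point where z_i vanishes.\<close>

lemma adapted_deriv:
  assumes \<sigma>: "\<sigma> \<in> sec_tuples X s L" and a: "adapted X s L \<sigma> U z e"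
    and p: "p \<in> U" "p \<in> zero_locus X s L \<sigma>" and v: "v \<in> tspace X p" and i: "i < s"
    and t: "(W, t) \<in> trivs (L i)" "p \<in> W"
  shows "v (\<lambda>x. t x (\<sigma> i x)) = t p (e i p) * v (\<lambda>q. z q i)"
proof -
  have "v (\<lambda>x. t x (\<sigma> i x)) = v (\<lambda>x. z x i * t x (e i x))"
  proof (rule tspace_cong[OF X v])
    show "openin (mtop X) (U \<inter> W)" using hol_chartD(1)[OF adapted_chart[OF a]] lb_trivs(1)[OF lb[OF i] t(1)] by blast
    show "t q (\<sigma> i q) = z q i * t q (e i q)" if "q \<in> U \<inter> W" for q
      using adapted_triv(2)[OF a i t(1)] that by blast
  qed (use p t in simp)
  also have "\<dots> = v (\<lambda>q. z q i) * t p (e i p) + z p i * v (\<lambda>x. t x (e i x))"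
    by (rule tspace_mult[OF X v hol_fun_at_coord[OF X adapted_chart[OF a] p(1)] adapted_triv(4)[OF a i t(1) p(1) t(2)]])
  finally show ?thesis using zero_locus_iff[OF \<sigma> a p(1)] p(2) i by simp
qed

end

text \<open>The linear algebra behind adjunction: the columns of B are the images under J of vectors that are
  killed by the first s components of J.\<close>

lemma block_det:
  fixes J :: "nat => nat => complex"
  assumes sd: "s \<le> d"
    and z: "\<And>i j. i < s ==> j < d - s ==> (\<Sum>l<d. J i l * v j l) = 0"
    and b: "\<And>i j. i < d - s ==> j < d - s ==> (\<Sum>l<d. J (s + i) l * v j l) = b i j"
  shows "det_of s J * det_of (d - s) b
    = det_of d J * det_of (d - s) (\<lambda>i j. v j (s + i))"
proof -
  let ?n = "d - s"
  let ?J = "Matrix.mat d d (\<lambda>(i, j). J i j)"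
  let ?A1 = "Matrix.mat s ?n (\<lambda>(i, j). v j i)" and ?A2 = "Matrix.mat ?n ?n (\<lambda>(i, j). v j (s + i))"
  let ?J11 = "Matrix.mat s s (\<lambda>(i, j). J i j)" and ?J21 = "Matrix.mat ?n s (\<lambda>(i, j). J (s + i) j)"
  let ?B = "Matrix.mat ?n ?n (\<lambda>(i, j). b i j)"
  let ?N = "four_block_mat (1\<^sub>m s) ?A1 (0\<^sub>m ?n s) ?A2"
  have N: "?N = Matrix.mat d d (\<lambda>(l, j). if j < s then (if l = j then 1 else 0) else v (j - s) l)"
    using sd by (intro eq_matI) auto
  have "?J * ?N = four_block_mat ?J11 (0\<^sub>m s ?n) ?J21 ?B"
  proof (rule eq_matI)
    fix k j assume "k < dim_row (four_block_mat ?J11 (0\<^sub>m s ?n) ?J21 ?B)" "j < dim_col (four_block_mat ?J11 (0\<^sub>m s ?n) ?J21 ?B)"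
    then have kj: "k < d" "j < d" using sd by simp_all
    have "(?J * ?N) $$ (k, j) = (\<Sum>l<d. J k l * (if j < s then (if l = j then 1 else 0) else v (j - s) l))"
      unfolding N using kj by (simp add: scalar_prod_def atLeast0LessThan)
    also have "\<dots> = (if j < s then J k j else (\<Sum>l<d. J k l * v (j - s) l))"
      using kj by (simp add: if_distrib[of "\<lambda>x. _ * x"] sum.delta cong: if_cong)
    also have "\<dots> = four_block_mat ?J11 (0\<^sub>m s ?n) ?J21 ?B $$ (k, j)"
      using kj sd z[of k "j - s"] b[of "k - s" "j - s"] by auto
    finally show "(?J * ?N) $$ (k, j) = four_block_mat ?J11 (0\<^sub>m s ?n) ?J21 ?B $$ (k, j)" .
  qed (use sd in auto)
  moreover have "Determinant.det (?J * ?N) = Determinant.det ?J * Determinant.det ?N"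
    unfolding N by (rule det_mult[of _ d]) auto
  moreover have "Determinant.det ?N = Determinant.det (1\<^sub>m s :: complex mat) * Determinant.det ?A2"
    by (rule det_four_block_mat_lower_left_zero[of _ s _ ?n]) auto
  moreover have "Determinant.det (four_block_mat ?J11 (0\<^sub>m s ?n) ?J21 ?B) = Determinant.det ?J11 * Determinant.det ?B"
    by (rule det_four_block_mat_upper_right_zero[of _ s _ ?n]) auto
  ultimately show ?thesis by simp
qed

section \<open>Adjunction\<close>

lemma alt_form_cong:
  assumes M: "charted M" and e: "\<And>vs. vs \<in> tlists M k p ==> \<alpha> vs = \<beta> vs" and a: "alt_form M k p \<alpha>"
  shows "alt_form M k p \<beta>"
  unfolding alt_form_def
proof (intro conjI ballI allI impI)
  fix vs i u w and c d :: complex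
  assume h: "vs \<in> tlists M k p" "i < k" "u \<in> tspace M p" "w \<in> tspace M p"
  have up: "vs[i := v] \<in> tlists M k p" if "v \<in> tspace M p" for v
    using h(1) that set_update_subset_insert[of vs i v] by (auto simp: tlists_def)
  have "\<alpha> (vs[i := \<lambda>f. c * u f + d * w f]) = c * \<alpha> (vs[i := u]) + d * \<alpha> (vs[i := w])"
    using a h unfolding alt_form_def by blast
  then show "\<beta> (vs[i := \<lambda>f. c * u f + d * w f]) = c * \<beta> (vs[i := u]) + d * \<beta> (vs[i := w])"
    by (simp only: e[OF up[OF h(3)]] e[OF up[OF h(4)]] e[OF up[OF tspace_lin[OF M h(3,4)]]])
next
  fix vs i j assume h: "vs \<in> tlists M k p" "i < k" "j < k" "i \<noteq> j \<and> vs ! i = vs ! j"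
  then have "\<alpha> vs = 0" using a unfolding alt_form_def by blast
  then show "\<beta> vs = 0" using e[OF h(1)] by simp
qed

lemma coord_tlists:
  assumes "charted M" "hol_chart M (U, \<phi>)" "p \<in> U"
  shows "map (coord_vec M (U, \<phi>) p) [0..<mdim M] \<in> tlists M (mdim M) p"
  using coord_vec_tspace[OF assms] by (rule tlists_map)

text \<open>The Jacobian of s sections, read in trivialisations ts, with respect to the first s coordinates
  of a chart.\<close>

definition sec_jac :: "'x cmfd => nat => 'x chart => (nat => 'x => 'l => complex) => (nat => 'x => 'l) => 'x => complex" where
  "sec_jac X s c ts \<sigma> p = det_of s (\<lambda>i j. coord_vec X c p j (\<lambda>x. ts i x (\<sigma> i x)))"

text \<open>The coefficient of a section of L + K in a chart and a trivialisation of L.\<close>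

definition top_coef :: "'x cmfd => 'x chart => ('x => 'k => complex) => ('x => 'x tvec list => 'k) => 'x => complex" where
  "top_coef X c t \<tau> p = t p (\<tau> p (map (coord_vec X c p) [0..<mdim X]))"

text \<open>The coefficient g of \<tau> with respect to adapted coordinates and frames.\<close>

definition adj_local :: "'x cmfd => nat => (nat => ('x, 'l) lbundle) => ('x, 'k) lbundle
    => ('x => (nat => 'l) => 'k) => (nat => 'x => 'l) => ('x => 'x tvec list => 'k)
    => 'x set => ('x => nat => complex) => (nat => 'x => 'l) => ('x => complex) => bool" where
  "adj_local X s L L' \<mu> \<sigma> \<tau> U z e g \<longleftrightarrow> adapted X s L \<sigma> U z e \<and> hol_fun X U g
     \<and> (\<forall>x\<in>U. \<forall>us\<in>tlists X (mdim X) x. \<tau> x us = lscale L' x (g x * dz_wedge z 0 (mdim X) us) (\<mu> x (\<lambda>i. e i x)))"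

context bundle_data
begin

lemma det_row_scale:
  "det_of k (\<lambda>i j. c i * A i j)
    = (\<Prod>i<k. c i) * det_of k (\<lambda>i j. A i j :: complex)"
proof -
  have "det_of k (\<lambda>i j. c i * A i j)
      = (\<Sum>\<pi> | \<pi> permutes {0..<k}. signof \<pi> * (\<Prod>i = 0..<k. c i * A i (\<pi> i)))"
    unfolding Determinant.det_def by (auto intro!: sum.cong prod.cong dest: permutes_in_image)
  also have "\<dots> = (\<Sum>\<pi> | \<pi> permutes {0..<k}. (\<Prod>i<k. c i) * (signof \<pi> * (\<Prod>i = 0..<k. A i (\<pi> i))))"
    by (simp add: prod.distrib atLeast0LessThan mult_ac)
  also have "\<dots> = (\<Prod>i<k. c i) * det_of k A"
    unfolding Determinant.det_def by (auto simp: sum_distrib_left intro!: sum.cong prod.cong dest: permutes_in_image)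
  finally show ?thesis .
qed

lemma sec_jac_adapted:
  assumes \<sigma>: "\<sigma> \<in> sec_tuples X s L" and a: "adapted X s L \<sigma> U z e"
    and p: "p \<in> U" "p \<in> zero_locus X s L \<sigma>" and V: "hol_chart X (V, y)" "p \<in> V"
    and ts: "\<And>i. i < s ==> (Us i, ts i) \<in> trivs (L i)" "\<And>i. i < s ==> p \<in> Us i"
  shows "sec_jac X s (V, y) ts \<sigma> p = (\<Prod>i<s. ts i p (e i p))
     * det_of s (\<lambda>i j. coord_vec X (V, y) p j (\<lambda>q. z q i))"
proof -
  have "coord_vec X (V, y) p j (\<lambda>x. ts i x (\<sigma> i x)) = ts i p (e i p) * coord_vec X (V, y) p j (\<lambda>q. z q i)"
    if "i < s" "j < s" for i j
    using that sd ts by (intro adapted_deriv[OF \<sigma> a p coord_vec_tspace[OF X V]]) auto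
  then have "Matrix.mat s s (\<lambda>(i, j). coord_vec X (V, y) p j (\<lambda>x. ts i x (\<sigma> i x)))
      = Matrix.mat s s (\<lambda>(i, j). ts i p (e i p) * coord_vec X (V, y) p j (\<lambda>q. z q i))"
    by (intro eq_matI) auto
  then show ?thesis unfolding sec_jac_def by (simp only: det_row_scale)
qed

text \<open>In the adapted chart the Jacobian is the product of the values of the frames, as z_i is itself a coordinate.\<close>

lemma sec_jac_nonzero:
  assumes \<sigma>: "\<sigma> \<in> sec_tuples X s L" and a: "adapted X s L \<sigma> U z e"
    and p: "p \<in> U" "p \<in> zero_locus X s L \<sigma>"
    and ts: "\<And>i. i < s ==> (Us i, ts i) \<in> trivs (L i)" "\<And>i. i < s ==> p \<in> Us i"
  shows "sec_jac X s (U, z) ts \<sigma> p \<noteq> 0"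
proof -
  note c = adapted_chart[OF a]
  have "Matrix.mat s s (\<lambda>(i, j). coord_vec X (U, z) p j (\<lambda>q. z q i)) = 1\<^sub>m s"
    using coord_vec_dual[OF X c p(1)] sd by (intro eq_matI) auto
  then have "sec_jac X s (U, z) ts \<sigma> p = (\<Prod>i<s. ts i p (e i p))"
    using sec_jac_adapted[OF \<sigma> a p c p(1) ts] by simp
  moreover have "ts i p (e i p) \<noteq> 0" if "i < s" for i
    using adapted_triv(3)[OF a that ts(1)[OF that] p(1) ts(2)[OF that]] .
  ultimately show ?thesis by simp
qed

text \<open>The residue in adapted coordinates z against an arbitrary reference chart y. The reference side does
  not mention the adapted data, which makes the residue independent of them, and it depends
  holomorphically on the sections.\<close>

lemma adjunction_reference:
  assumes \<sigma>: "\<sigma> \<in> sec_tuples X s L" and sm: "smooth_ci X s L \<sigma>" and p: "p \<in> U" "p \<in> zero_locus X s L \<sigma>"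
    and al: "adj_local X s L L' \<mu> \<sigma> \<tau> U z e g"
    and V: "hol_chart X (V, y)" "p \<in> V"
    and ts: "\<And>i. i < s ==> (Us i, ts i) \<in> trivs (L i)" "\<And>i. i < s ==> p \<in> Us i"
    and t: "(W, t) \<in> trivs L'" "p \<in> W"
    and ap: "\<And>l. (\<And>i. i < s ==> l i \<in> fib (L i) p) ==> t p (\<mu> p l) = ap * (\<Prod>i<s. ts i p (l i))"
    and vs: "vs \<in> tlists (ci_mfd X s L \<sigma>) (mdim X - s) p"
  shows "ap * sec_jac X s (V, y) ts \<sigma> p * (g p * dz_wedge z s (mdim X - s) vs)
     = top_coef X (V, y) t \<tau> p * dz_wedge y s (mdim X - s) vs"
proof -
  let ?d = "mdim X" and ?Y = "ci_mfd X s L \<sigma>" and ?E = "coord_vec X (V, y) p"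
  let ?n = "?d - s"
  have a: "adapted X s L \<sigma> U z e" using al by (simp add: adj_local_def)
  note c = adapted_chart[OF a]
  define w where "w j = push X (\<lambda>y. y) p (vs ! j)" for j
  define J where "J k l = ?E l (\<lambda>q. z q k)" for k l
  have vj: "vs ! j \<in> tspace ?Y p" if "j < ?n" for j using tlists_nth[OF vs that] .
  have w: "w j \<in> tspace X p" and wf: "hol_fun_at X f p ==> w j f = (vs ! j) f" if "j < ?n" for j f
    unfolding w_def using ci_push[OF \<sigma> sm p(2) vj[OF that]] by blast+
  have wz: "w j (\<lambda>q. z q k) = (\<Sum>l<?d. J k l * w j (\<lambda>q. y q l))" if "j < ?n" for j k
    using fun_cong[OF tspace_expand[OF X V w[OF that]], of "\<lambda>q. z q k"] by (simp add: J_def mult.commute)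
  have w0: "w j (\<lambda>q. z q i) = 0" if "i < s" "j < ?n" for i j
    unfolding w_def by (rule ci_push_zero[OF \<sigma> sm a p vj[OF that(2)] that(1)])
  have zh: "hol_fun_at X (\<lambda>q. z q k) p" for k by (rule hol_fun_at_coord[OF X c p(1)])
  have yh: "hol_fun_at X (\<lambda>q. y q k) p" for k by (rule hol_fun_at_coord[OF X V])
  have B: "dz_wedge z s ?n vs = det_of ?n (\<lambda>i j. w j (\<lambda>q. z q (s + i)))"
    unfolding dz_wedge_def by (intro arg_cong[where f = Determinant.det] eq_matI) (auto simp: wf zh)
  have A: "dz_wedge y s ?n vs = det_of ?n (\<lambda>i j. w j (\<lambda>q. y q (s + i)))"
    unfolding dz_wedge_def by (intro arg_cong[where f = Determinant.det] eq_matI) (auto simp: wf yh)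
  \<comment> \<open>vectors tangent to the complete intersection are killed by the differentials of the first s coordinates z\<close>
  have blk: "det_of s J * dz_wedge z s ?n vs
     = det_of ?d J * dz_wedge y s ?n vs"
    unfolding A B
  proof (rule block_det[OF sd])
    show "(\<Sum>l<?d. J i l * w j (\<lambda>q. y q l)) = 0" if "i < s" "j < ?n" for i j
      using wz[OF that(2), of i] w0[OF that] by simp
    show "(\<Sum>l<?d. J (s + i) l * w j (\<lambda>q. y q l)) = w j (\<lambda>q. z q (s + i))" if "i < ?n" "j < ?n" for i j
      using wz[OF that(2)] by simp
  qed
  let ?u = "\<Prod>i<s. ts i p (e i p)"
  have ef: "e i p \<in> fib (L i) p" if "i < s" for i
    using adapted_triv(1)[OF a that ts(1)[OF that] p(1) ts(2)[OF that]] .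
  have pX: "p \<in> pts X" by (rule zero_locus_pts[OF p(2)])
  have m: "\<mu> p (\<lambda>i. e i p) \<in> fib L' p" by (rule tensor_iso_fib[OF ten pX ef])
  have us: "map ?E [0..<?d] \<in> tlists X ?d p" by (rule coord_tlists[OF X V])
  have "\<tau> p (map ?E [0..<?d]) = lscale L' p (g p * dz_wedge z 0 ?d (map ?E [0..<?d])) (\<mu> p (\<lambda>i. e i p))"
    using al us p(1) by (simp add: adj_local_def)
  then have G: "top_coef X (V, y) t \<tau> p = g p * dz_wedge z 0 ?d (map ?E [0..<?d]) * (ap * ?u)"
    using lb_scale(2)[OF lb' t m] ap[of "\<lambda>i. e i p", OF ef] by (simp add: top_coef_def)
  have dJ: "dz_wedge z 0 ?d (map ?E [0..<?d]) = det_of ?d J"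
    unfolding dz_wedge_def J_def by (intro arg_cong[where f = Determinant.det] eq_matI) auto
  have D: "sec_jac X s (V, y) ts \<sigma> p = ?u * det_of s J"
    unfolding J_def by (rule sec_jac_adapted[OF \<sigma> a p V ts])
  have "ap * sec_jac X s (V, y) ts \<sigma> p * (g p * dz_wedge z s ?n vs)
      = ap * ?u * g p * (det_of s J * dz_wedge z s ?n vs)"
    unfolding D by (simp only: mult_ac)
  also have "\<dots> = top_coef X (V, y) t \<tau> p * dz_wedge y s ?n vs"
    unfolding blk G dJ by (simp only: mult_ac)
  finally show ?thesis .
qed

lemma local_trivs_ex:
  assumes p: "p \<in> pts X"
  shows "\<exists>Us ts W t. (\<forall>i<s. (Us i, ts i) \<in> trivs (L i) \<and> p \<in> Us i) \<and> (W, t) \<in> trivs L' \<and> p \<in> W"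
proof -
  obtain Us ts where "\<forall>i<s. (Us i, ts i) \<in> trivs (L i) \<and> p \<in> Us i"
    using choose_trivs[of s X L p, OF lb p] by blast
  moreover obtain W t where "(W, t) \<in> trivs L'" "p \<in> W" using lb_trivs(3)[OF lb' p] by blast
  ultimately show ?thesis by blast
qed

text \<open>The coefficient is the value of \<tau> on the coordinate vectors divided by the product of the frames, both read in
  a trivialisation of L'.\<close>

lemma adj_local_ex:
  assumes \<sigma>: "\<sigma> \<in> sec_tuples X s L" and a: "adapted X s L \<sigma> U z e" and \<tau>: "\<tau> \<in> H0 X (plus_K X L')"
  shows "\<exists>g. adj_local X s L L' \<mu> \<sigma> \<tau> U z e g"
proof -
  let ?d = "mdim X"
  note c = adapted_chart[OF a]
  \<comment> \<open>a choice of a trivialisation at each point; g does not depend on it\<close>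
  define c0 where "c0 x = (SOME c. c \<in> trivs L' \<and> x \<in> fst c)" for x
  define T where "T x = snd (c0 x)" for x
  define g where "g x = top_coef X (U, z) (T x) \<tau> x / T x x (\<mu> x (\<lambda>i. e i x))" for x
  have T: "\<exists>W. (W, T x) \<in> trivs L' \<and> x \<in> W" if "x \<in> U" for x
  proof -
    have xX: "x \<in> pts X" by (rule hol_chart_sub[OF c that])
    obtain W t where "(W, t) \<in> trivs L'" "x \<in> W" using lb_trivs(3)[OF lb' xX] by blast
    then have "\<exists>c. c \<in> trivs L' \<and> x \<in> fst c" by (intro exI[of _ "(W, t)"]) simp
    from someI_ex[OF this] have "c0 x \<in> trivs L' \<and> x \<in> fst (c0 x)" unfolding c0_def .
    then show ?thesis by (intro exI[of _ "fst (c0 x)"]) (simp add: T_def)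
  qed
  have coef: "g x = top_coef X (U, z) t \<tau> x / t x (\<mu> x (\<lambda>i. e i x)) \<and> t x (\<mu> x (\<lambda>i. e i x)) \<noteq> 0
      \<and> \<mu> x (\<lambda>i. e i x) \<in> fib L' x" if x: "x \<in> U" and t: "(W, t) \<in> trivs L'" "x \<in> W" for x W t
  proof -
    have xX: "x \<in> pts X" by (rule hol_chart_sub[OF c x])
    obtain W' where W': "(W', T x) \<in> trivs L'" "x \<in> W'" using T[OF x] by blast
    obtain k where k: "k \<noteq> 0" "\<forall>l\<in>fib L' x. t x l = k * T x x l" using lb_change[OF lb' W'(1) t(1) W'(2) t(2)] by blast
    obtain Us ts where ts: "\<forall>i<s. (Us i, ts i) \<in> trivs (L i) \<and> x \<in> Us i"
      using choose_trivs[of s X L x, OF lb xX] by blast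
    have ef: "e i x \<in> fib (L i) x" and e0: "ts i x (e i x) \<noteq> 0" if "i < s" for i
      using adapted_triv[OF a that _ x] ts that by blast+
    have m: "\<mu> x (\<lambda>i. e i x) \<in> fib L' x" by (rule tensor_iso_fib[OF ten xX ef])
    obtain b where b: "\<forall>x\<in>W \<inter> (\<Inter>i<s. Us i). b x \<noteq> 0 \<and>
       (\<forall>l. (\<forall>i<s. l i \<in> fib (L i) x) --> t x (\<mu> x l) = b x * (\<Prod>i<s. ts i x (l i)))"
      using tensor_iso_ex[OF ten t(1), of Us ts] ts by blast
    have "x \<in> W \<inter> (\<Inter>i<s. Us i)" using t ts by blast
    then have "b x \<noteq> 0" "t x (\<mu> x (\<lambda>i. e i x)) = b x * (\<Prod>i<s. ts i x (e i x))" using b ef by simp_all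
    then have nz: "t x (\<mu> x (\<lambda>i. e i x)) \<noteq> 0" using e0 by simp
    have "\<tau> x (map (coord_vec X (U, z) x) [0..<?d]) \<in> fib L' x"
      by (rule plus_K_fib(1)[OF \<tau> xX coord_tlists[OF X c x]])
    then have "top_coef X (U, z) t \<tau> x = k * top_coef X (U, z) (T x) \<tau> x" using k(2) by (simp add: top_coef_def)
    moreover have "t x (\<mu> x (\<lambda>i. e i x)) = k * T x x (\<mu> x (\<lambda>i. e i x))" using k(2) m by simp
    ultimately show ?thesis using k(1) nz m by (simp add: g_def)
  qed
  have "hol_fun_at X g p" if p: "p \<in> U" for p
  proof -
    have pX: "p \<in> pts X" by (rule hol_chart_sub[OF c p])
    obtain Us ts W t where t: "\<forall>i<s. (Us i, ts i) \<in> trivs (L i) \<and> p \<in> Us i" "(W, t) \<in> trivs L'" "p \<in> W"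
      using local_trivs_ex[OF pX] by blast
    have tsi: "\<And>i. i < s ==> (Us i, ts i) \<in> trivs (L i)" using t(1) by blast
    obtain b where b: "hol_fun X (W \<inter> (\<Inter>i<s. Us i)) b" "\<forall>x\<in>W \<inter> (\<Inter>i<s. Us i). b x \<noteq> 0 \<and>
       (\<forall>l. (\<forall>i<s. l i \<in> fib (L i) x) --> t x (\<mu> x l) = b x * (\<Prod>i<s. ts i x (l i)))"
      using tensor_iso_ex[OF ten t(2) tsi] by blast
    let ?S = "U \<inter> (W \<inter> (\<Inter>i<s. Us i))"
    have S: "openin (mtop X) ?S" using hol_chartD(1)[OF c] b(1) by (simp add: hol_fun_def openin_Int)
    have pS: "p \<in> ?S" using p t by blast
    have m: "t x (\<mu> x (\<lambda>i. e i x)) = b x * (\<Prod>i<s. ts i x (e i x))" if x: "x \<in> ?S" for x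
    proof -
      have ef: "e i x \<in> fib (L i) x" if "i < s" for i using adapted_triv(1)[OF a that tsi[OF that]] x that by blast
      have xW: "x \<in> W \<inter> (\<Inter>i<s. Us i)" using x by blast
      show ?thesis
        by (rule spec[where x = "\<lambda>i. e i x", OF conjunct2[OF bspec[OF b(2) xW]], rule_format]) (rule ef)
    qed
    have "hol_fun_at X (top_coef X (U, z) t \<tau>) p" unfolding top_coef_def[abs_def]
      by (rule plus_K_hol[OF X \<tau> t(2,3) lb_trivs(1)[OF lb' t(2)] c p])
    moreover have "hol_fun_at X (\<lambda>x. b x * (\<Prod>i<s. ts i x (e i x))) p"
    proof (intro hol_fun_at_mult[OF X] hol_fun_at_prod[OF X pX])
      show "hol_fun_at X b p" using hol_fun_imp_at[OF b(1)] pS by blast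
      show "hol_fun_at X (\<lambda>x. ts i x (e i x)) p" if "i \<in> {..<s}" for i
        using adapted_triv(4)[OF a _ tsi p] that t(1) by simp
    qed
    moreover have "b p * (\<Prod>i<s. ts i p (e i p)) \<noteq> 0"
      using coef[OF p t(2,3)] m[OF pS] by simp
    ultimately have "hol_fun_at X (\<lambda>x. top_coef X (U, z) t \<tau> x / (b x * (\<Prod>i<s. ts i x (e i x)))) p"
      by (rule hol_fun_at_divide[OF X])
    then show ?thesis
    proof (rule hol_fun_at_cong[OF X S pS, rotated])
      fix q assume q: "q \<in> ?S"
      show "top_coef X (U, z) t \<tau> q / (b q * (\<Prod>i<s. ts i q (e i q))) = g q"
        using coef[of q W t] q t(2) m[OF q] by simp
    qed
  qed
  then have "hol_fun X U g" unfolding hol_fun_iff_at[OF X] using hol_chartD(1)[OF c] by simp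
  moreover have "\<tau> x us = lscale L' x (g x * dz_wedge z 0 ?d us) (\<mu> x (\<lambda>i. e i x))"
    if x: "x \<in> U" and us: "us \<in> tlists X ?d x" for x us
  proof -
    have xX: "x \<in> pts X" by (rule hol_chart_sub[OF c x])
    obtain W t where t: "(W, t) \<in> trivs L'" "x \<in> W" using lb_trivs(3)[OF lb' xX] by blast
    note C = coef[OF x t]
    show ?thesis
    proof (rule lb_eqI[OF lb' t])
      show "\<tau> x us \<in> fib L' x" by (rule plus_K_fib(1)[OF \<tau> xX us])
      show "lscale L' x (g x * dz_wedge z 0 ?d us) (\<mu> x (\<lambda>i. e i x)) \<in> fib L' x"
        using lb_scale(1)[OF lb' t] C by blast
      have "t x (\<tau> x us) = top_coef X (U, z) t \<tau> x * dz_wedge z 0 ?d us"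
        unfolding top_coef_def by (rule plus_K_chart[OF X \<tau> t c x us])
      also have "\<dots> = g x * dz_wedge z 0 ?d us * t x (\<mu> x (\<lambda>i. e i x))" using C by simp
      also have "\<dots> = t x (lscale L' x (g x * dz_wedge z 0 ?d us) (\<mu> x (\<lambda>i. e i x)))"
        using lb_scale(2)[OF lb' t] C by simp
      finally show "t x (\<tau> x us) = t x (lscale L' x (g x * dz_wedge z 0 ?d us) (\<mu> x (\<lambda>i. e i x)))" .
    qed
  qed
  ultimately show ?thesis using a unfolding adj_local_def by blast
qed

text \<open>All adapted data compute the same value, because each agrees with a common reference chart.\<close>

lemma adjunction_map_local:
  assumes \<sigma>: "\<sigma> \<in> sec_tuples X s L" and sm: "smooth_ci X s L \<sigma>" and p: "p \<in> U" "p \<in> zero_locus X s L \<sigma>"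
    and al: "adj_local X s L L' \<mu> \<sigma> \<tau> U z e g"
    and vs: "vs \<in> tlists (ci_mfd X s L \<sigma>) (mdim X - s) p"
  shows "adjunction_map X s L L' \<mu> \<sigma> \<tau> p vs = g p * dz_wedge z s (mdim X - s) vs"
proof -
  let ?d = "mdim X"
  have a: "adapted X s L \<sigma> U z e" using al by (simp add: adj_local_def)
  have pX: "p \<in> pts X" by (rule zero_locus_pts[OF p(2)])
  obtain Us ts W t where t: "\<forall>i<s. (Us i, ts i) \<in> trivs (L i) \<and> p \<in> Us i" "(W, t) \<in> trivs L'" "p \<in> W"
    using local_trivs_ex[OF pX] by blast
  have tsi: "\<And>i. i < s ==> (Us i, ts i) \<in> trivs (L i)" "\<And>i. i < s ==> p \<in> Us i" using t(1) by blast+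
  obtain b where b: "\<forall>x\<in>W \<inter> (\<Inter>i<s. Us i). b x \<noteq> 0 \<and>
       (\<forall>l. (\<forall>i<s. l i \<in> fib (L i) x) --> t x (\<mu> x l) = b x * (\<Prod>i<s. ts i x (l i)))"
    using tensor_iso_ex[OF ten t(2) tsi(1)] by blast
  have "p \<in> W \<inter> (\<Inter>i<s. Us i)" using t(1,3) by blast
  from bspec[OF b this] have b0: "b p \<noteq> 0"
    and bp: "\<And>l. (\<And>i. i < s ==> l i \<in> fib (L i) p) ==> t p (\<mu> p l) = b p * (\<Prod>i<s. ts i p (l i))" by blast+
  have D0: "sec_jac X s (U, z) ts \<sigma> p \<noteq> 0" by (rule sec_jac_nonzero[OF \<sigma> a p tsi])
  let ?P = "\<lambda>a. \<exists>U z e g. p \<in> U \<and> adapted X s L \<sigma> U z e \<and> hol_fun X U g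
        \<and> (\<forall>x\<in>U. \<forall>us\<in>tlists X ?d x.
              \<tau> x us = lscale L' x (g x * dz_wedge z 0 ?d us) (\<mu> x (\<lambda>i. e i x)))
        \<and> a = g p * dz_wedge z s (?d - s) vs"
  have "(THE a. ?P a) = g p * dz_wedge z s (?d - s) vs"
  proof (rule the_equality)
    show "?P (g p * dz_wedge z s (?d - s) vs)"
      using al p(1) unfolding adj_local_def by (intro exI[of _ U] exI[of _ z] exI[of _ e] exI[of _ g]) simp
    fix r assume "?P r"
    then obtain U' z' e' g' where "p \<in> U'" "adj_local X s L L' \<mu> \<sigma> \<tau> U' z' e' g'"
      and r: "r = g' p * dz_wedge z' s (?d - s) vs" unfolding adj_local_def by blast
    then have "b p * sec_jac X s (U, z) ts \<sigma> p * r = top_coef X (U, z) t \<tau> p * dz_wedge z s (?d - s) vs"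
      unfolding r by (intro adjunction_reference[OF \<sigma> sm _ p(2) _ adapted_chart[OF a] p(1) tsi t(2,3) bp vs])
    also have "\<dots> = b p * sec_jac X s (U, z) ts \<sigma> p * (g p * dz_wedge z s (?d - s) vs)"
      by (rule adjunction_reference[OF \<sigma> sm p al adapted_chart[OF a] p(1) tsi t(2,3) bp vs, symmetric])
    finally show "r = g p * dz_wedge z s (?d - s) vs" using b0 D0 by simp
  qed
  then show ?thesis unfolding adjunction_map_def Let_def using p(2) vs by simp
qed

text \<open>Near a point of the complete intersection the form is g dz_s ... dz_(d-1), read in an adapted chart.\<close>

lemma adjunction_map_H0K:
  assumes \<sigma>: "\<sigma> \<in> smooth_tuples X s L" and \<tau>: "\<tau> \<in> H0 X (plus_K X L')"
  shows "adjunction_map X s L L' \<mu> \<sigma> \<tau> \<in> H0K (ci_mfd X s L \<sigma>)"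
proof -
  let ?d = "mdim X" and ?Y = "ci_mfd X s L \<sigma>" and ?A = "adjunction_map X s L L' \<mu> \<sigma> \<tau>"
  have st: "\<sigma> \<in> sec_tuples X s L" and sm: "smooth_ci X s L \<sigma>" using \<sigma> by (simp_all add: smooth_tuples_def)
  note Y = charted_ci[OF st sm]
  have "alt_form ?Y (?d - s) p (?A p)" if p: "p \<in> zero_locus X s L \<sigma>" for p
  proof -
    obtain U z e where U: "p \<in> U" "adapted X s L \<sigma> U z e" using smooth_adapted[OF sm p] by blast
    obtain g where g: "adj_local X s L L' \<mu> \<sigma> \<tau> U z e g" using adj_local_ex[OF st U(2) \<tau>] by blast
    show ?thesis
      by (rule alt_form_cong[OF Y adjunction_map_local[OF st sm U(1) p g, symmetric] alt_form_scale[OF dz_wedge_alt]])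
  qed
  moreover have "hol_fun ?Y (V \<inter> zero_locus X s L \<sigma>) (\<lambda>p. ?A p (map (coord_vec ?Y (V, \<phi>) p) ks))"
    if V: "(V, \<phi>) \<in> atlas ?Y" and ks: "length ks = ?d - s" "set ks \<subseteq> {..<?d - s}" for V \<phi> ks
    unfolding hol_fun_iff_at[OF Y]
  proof (intro conjI ballI)
    obtain U z e where U: "V = U \<inter> zero_locus X s L \<sigma>" "\<phi> = ci_chart s z" "adapted X s L \<sigma> U z e"
      using V unfolding ci_atlas by blast
    note c = ci_hol_chart[OF st sm U(3)]
    show o: "openin (mtop ?Y) (V \<inter> zero_locus X s L \<sigma>)" using hol_chartD(1)[OF c] U(1) by (simp add: Int_assoc)
    fix p assume p: "p \<in> V \<inter> zero_locus X s L \<sigma>"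
    obtain g where g: "adj_local X s L L' \<mu> \<sigma> \<tau> U z e g" using adj_local_ex[OF st U(3) \<tau>] by blast
    define k where "k = det_of (?d - s) (\<lambda>i j. if i = ks ! j then 1 else 0 :: complex)"
    have "hol_fun X U g" using g by (simp add: adj_local_def)
    then have "hol_fun_at X g p" by (rule hol_fun_imp_at) (use p U(1) in simp)
    then have "hol_fun_at ?Y g p" by (rule restrict_hol[OF st sm, rotated]) (use p in simp)
    then have "hol_fun_at ?Y (\<lambda>p. g p * k) p"
      by (rule hol_fun_at_mult[OF Y _ hol_fun_at_const[OF Y]]) (use p in simp)
    then show "hol_fun_at ?Y (\<lambda>p. ?A p (map (coord_vec ?Y (V, \<phi>) p) ks)) p"
    proof (rule hol_fun_at_cong[OF Y o p, rotated])
      fix q assume q: "q \<in> V \<inter> zero_locus X s L \<sigma>"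
      then have qU: "q \<in> U" "q \<in> zero_locus X s L \<sigma>" "q \<in> U \<inter> zero_locus X s L \<sigma>" using U(1) by auto
      let ?E = "coord_vec ?Y (U \<inter> zero_locus X s L \<sigma>, ci_chart s z) q"
      have vs: "map ?E ks \<in> tlists ?Y (?d - s) q"
        using coord_vec_tspace[OF Y c qU(3)] ks by (auto simp: tlists_def)
      have "dz_wedge z s (?d - s) (map ?E ks) = k"
        unfolding dz_wedge_ci_chart[of z s] unfolding dz_wedge_def k_def
        using ks coord_vec_dual[OF Y c qU(3)]
        by (intro arg_cong[where f = Determinant.det] eq_matI) (auto simp: subset_iff)
      then show "g q * k = ?A q (map (coord_vec ?Y (V, \<phi>) q) ks)"
        using adjunction_map_local[OF st sm qU(1,2) g vs] U(1,2) by simp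
    qed
  qed
  moreover have "openin (mtop ?Y) (zero_locus X s L \<sigma>)"
    by (rule openin_topspace[of "mtop ?Y", unfolded ci_mfd_simps(3)])
  ultimately have "hol_form ?Y (mdim ?Y) (pts ?Y) ?A"
    unfolding hol_form_def ci_mfd_simps(2,3) by auto
  moreover have "?A p vs = 0" if "\<not> (p \<in> pts ?Y \<and> vs \<in> tlists ?Y (mdim ?Y) p)" for p vs
    using that unfolding adjunction_map_def Let_def ci_mfd_simps(2,3) by (rule if_not_P)
  ultimately show ?thesis unfolding H0K_def by blast
qed

text \<open>The form dz_s ... dz_(d-1) is not zero on the tangent space of the complete intersection, so the residue at p
  determines the coefficient g there.\<close>

lemma adjunction_map_injective_at:
  assumes \<sigma>: "\<sigma> \<in> smooth_tuples X s L" and \<tau>: "\<tau> \<in> H0 X (plus_K X L')" "\<tau>' \<in> H0 X (plus_K X L')"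
    and eq: "adjunction_map X s L L' \<mu> \<sigma> \<tau> = adjunction_map X s L L' \<mu> \<sigma> \<tau>'" and p: "p \<in> zero_locus X s L \<sigma>"
  shows "\<tau> p = \<tau>' p"
proof -
  let ?d = "mdim X" and ?Y = "ci_mfd X s L \<sigma>"
  have st: "\<sigma> \<in> sec_tuples X s L" and sm: "smooth_ci X s L \<sigma>" using \<sigma> by (simp_all add: smooth_tuples_def)
  note Y = charted_ci[OF st sm]
  obtain U z e where U: "p \<in> U" "adapted X s L \<sigma> U z e" using smooth_adapted[OF sm p] by blast
  obtain g where g: "adj_local X s L L' \<mu> \<sigma> \<tau> U z e g" using adj_local_ex[OF st U(2) \<tau>(1)] by blast
  obtain g' where g': "adj_local X s L L' \<mu> \<sigma> \<tau>' U z e g'" using adj_local_ex[OF st U(2) \<tau>(2)] by blast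
  note c = ci_hol_chart[OF st sm U(2)]
  have pU: "p \<in> U \<inter> zero_locus X s L \<sigma>" using U p by simp
  let ?vs = "map (coord_vec ?Y (U \<inter> zero_locus X s L \<sigma>, ci_chart s z) p) [0..<?d - s]"
  have vs: "?vs \<in> tlists ?Y (?d - s) p" using coord_tlists[OF Y c pU] by simp
  have "dz_wedge z s (?d - s) ?vs = 1" using dz_wedge_coord[OF Y c pU] by (simp add: dz_wedge_ci_chart[of z s])
  then have "g p = g' p"
    using adjunction_map_local[OF st sm U(1) p g vs] adjunction_map_local[OF st sm U(1) p g' vs] eq by simp
  show ?thesis
  proof
    fix us show "\<tau> p us = \<tau>' p us"
    proof (cases "us \<in> tlists X ?d p")
      case True
      then show ?thesis using g g' U(1) \<open>g p = g' p\<close> by (simp add: adj_local_def)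
    next
      case False
      then show ?thesis using plus_K_fib(3)[OF \<tau>(1) zero_locus_pts[OF p]] plus_K_fib(3)[OF \<tau>(2) zero_locus_pts[OF p]] by simp
    qed
  qed
qed

end

section \<open>Holomorphic dependence on the sections\<close>

text \<open>The determinant is a continuous function of the entries, encoded as a vector of length s^2.\<close>

lemma det_nonzero_nbhd:
  fixes M :: "nat => nat => complex"
  assumes "det_of s M \<noteq> 0"
  shows "\<exists>\<epsilon>>0. \<forall>A. (\<forall>i<s. \<forall>j<s. norm (A i j - M i j) < \<epsilon>) --> det_of s A \<noteq> 0"
proof -
  define G where "G w = det_of s (\<lambda>i j. w (i * s + j) :: complex)" for w
  \<comment> \<open>entry (i, j) sits at position i * s + j\<close>
  define vec where "vec A n = (if n < s * s then A (n div s) (n mod s) else 0 :: complex)" for A n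
  have idx: "i * s + j < s * s" "(i * s + j) div s = i" "(i * s + j) mod s = j" if "i < s" "j < s" for i j
  proof -
    have "i * s + j < (i + 1) * s" using that by simp
    also have "\<dots> \<le> s * s" using that by (intro mult_right_mono) auto
    finally show "i * s + j < s * s" .
  qed (use that in auto)
  have Gv: "G (vec A) = det_of s A" for A
    unfolding G_def vec_def by (intro arg_cong[where f = Determinant.det] eq_matI) (auto simp: idx)
  have Gs: "G = (\<lambda>w. \<Sum>\<pi> | \<pi> permutes {0..<s}. signof \<pi> * (\<Prod>i = 0..<s. w (i * s + \<pi> i)))"
    unfolding G_def Determinant.det_def
    by (auto simp: fun_eq_iff intro!: sum.cong prod.cong dest: permutes_in_image)
  have "continuous_on UNIV G" unfolding Gs
    by (intro continuous_on_sum continuous_on_mult continuous_on_const continuous_on_prod continuous_on_product_coordinates)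
  then have "open (G -` (- {0}))" by (intro open_vimage) auto
  moreover have "vec M \<in> G -` (- {0})" using assms by (simp add: Gv)
  moreover have "vec M \<in> Cn (s * s)" by (simp add: vec_def Cn_def)
  ultimately obtain r where r: "r > 0" "\<forall>w\<in>Cn (s * s). (\<forall>i<s * s. norm (w i - vec M i) < r) --> w \<in> G -` (- {0})"
    using open_fun_box by blast
  have "det_of s A \<noteq> 0" if A: "\<forall>i<s. \<forall>j<s. norm (A i j - M i j) < r" for A
  proof -
    have "norm (vec A n - vec M n) < r" if n: "n < s * s" for n
    proof -
      have "s > 0" using n by (cases s) auto
      then have "n div s < s" "n mod s < s" using n by (auto simp: less_mult_imp_div_less)
      then show ?thesis using A n by (simp add: vec_def)
    qed
    moreover have "vec A \<in> Cn (s * s)" by (simp add: vec_def Cn_def)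
    ultimately have "vec A \<in> G -` (- {0})" using r(2) by blast
    then show ?thesis by (simp add: Gv)
  qed
  then show ?thesis using r(1) by blast
qed

lemma compact_box: "compact {w \<in> Cn n. \<forall>i<n. norm (w i - a i) \<le> r}"
proof -
  let ?S = "\<lambda>i. if i < n then cball (a i) r else {0}"
  have "{w \<in> Cn n. \<forall>i<n. norm (w i - a i) \<le> r} = PiE UNIV ?S"
  proof (intro equalityI subsetI)
    fix w assume "w \<in> PiE UNIV ?S"
    then have w: "w i \<in> ?S i" for i by (rule PiE_mem) simp
    have "norm (w i - a i) \<le> r" if "i < n" for i
      using w[of i] that by (simp add: dist_norm norm_minus_commute)
    moreover have "w i = 0" if "n \<le> i" for i using w[of i] that by simp
    ultimately show "w \<in> {w \<in> Cn n. \<forall>i<n. norm (w i - a i) \<le> r}" by (simp add: Cn_def)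
  qed (auto simp: Cn_def PiE_iff dist_norm norm_minus_commute)
  moreover have "compactin (product_topology (\<lambda>i. euclidean) UNIV) (PiE UNIV ?S)"
    by (subst compactin_PiE) auto
  ultimately show ?thesis by (simp add: euclidean_product_topology)
qed

lemma chart_compact:
  assumes c: "hol_chart X (U, z)" and B: "compact B" "B \<subseteq> z ` U"
  shows "compactin (mtop X) (inv_into U z ` B)" "inv_into U z ` B \<subseteq> U"
proof -
  have h: "homeomorphic_map (subtopology (mtop X) U) (top_of_set (z ` U)) z"
    using hol_chart_top[OF c] by (simp add: top_chart_def)
  have ts: "topspace (subtopology (mtop X) U) = U" using openin_subset[OF hol_chartD(1)[OF c]] by auto
  show sub: "inv_into U z ` B \<subseteq> U" using B(2) inv_into_into[of _ z U] by blast
  have "z ` (inv_into U z ` B) = B" using B(2) by (auto simp: image_iff f_inv_into_f subset_iff)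
  then have "compactin (top_of_set (z ` U)) (z ` (inv_into U z ` B))"
    using B by (simp add: compactin_subtopology)
  moreover have "inv_into U z ` B \<subseteq> topspace (subtopology (mtop X) U)" using sub unfolding ts .
  ultimately have "compactin (subtopology (mtop X) U) (inv_into U z ` B)"
    using homeomorphic_map_compactness[OF h, of "inv_into U z ` B"] by blast
  then show "compactin (mtop X) (inv_into U z ` B)" by (simp add: compactin_subtopology)
qed

lemma tspace_add_fun:
  assumes M: "charted M" and v: "v \<in> tspace M p" and f: "hol_fun_at M f p" and h: "hol_fun_at M h p"
  shows "v (\<lambda>q. f q + h q) = v f + v h"
proof -
  obtain \<gamma> where g: "hol_at C_mfd M \<gamma> 0" "\<gamma> 0 = p" "v = velocity M \<gamma>" using tspace_ex[OF M v] by blast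
  have fh: "hol_fun_at M f (\<gamma> 0)" "hol_fun_at M h (\<gamma> 0)" using f h g(2) by simp_all
  have "((\<lambda>t. f (\<gamma> t) + h (\<gamma> t)) has_field_derivative velocity M \<gamma> f + velocity M \<gamma> h) (at 0)"
    by (rule DERIV_add[OF velocity_deriv[OF g(1) fh(1)] velocity_deriv[OF g(1) fh(2)]])
  from DERIV_unique[OF this velocity_deriv[OF g(1) hol_fun_at_add[OF M fh]]]
  show ?thesis by (simp add: g(2,3))
qed

lemma tspace_affine_fun:
  assumes M: "charted M" and v: "v \<in> tspace M p" and f: "hol_fun_at M f p" and h: "\<And>l. l < k ==> hol_fun_at M (h l) p"
  shows "v (\<lambda>q. f q + (\<Sum>l<(k::nat). c l * h l q)) = v f + (\<Sum>l<k. c l * v (h l))"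
  using h
proof (induction k)
  case (Suc k)
  have p: "p \<in> pts M" by (rule tspace_pts[OF M v])
  have 1: "hol_fun_at M (\<lambda>q. f q + (\<Sum>l<k. c l * h l q)) p"
    using Suc.prems by (intro hol_fun_at_add[OF M f] hol_fun_at_sum[OF M p] hol_fun_at_mult[OF M] hol_fun_at_const[OF M p]) auto
  have hk: "hol_fun_at M (h k) p" by (rule Suc.prems) simp
  have 2: "hol_fun_at M (\<lambda>q. c k * h k q) p" by (rule hol_fun_at_mult[OF M hol_fun_at_const[OF M p] hk])
  have "v (\<lambda>q. f q + (\<Sum>l<Suc k. c l * h l q)) = v (\<lambda>q. (f q + (\<Sum>l<k. c l * h l q)) + c k * h k q)"
    by (simp add: add.assoc)
  also have "\<dots> = v (\<lambda>q. f q + (\<Sum>l<k. c l * h l q)) + v (\<lambda>q. c k * h k q)"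
    by (rule tspace_add_fun[OF M v 1 2])
  also have "v (\<lambda>q. c k * h k q) = c k * v (h k)"
    using tspace_mult[OF M v hol_fun_at_const[OF M p, of "c k"] hk] tspace_const[OF M v, of "c k"] by simp
  also have "v (\<lambda>q. f q + (\<Sum>l<k. c l * h l q)) = v f + (\<Sum>l<k. c l * v (h l))"
    by (rule Suc.IH) (use Suc.prems in simp)
  finally show ?case by simp
qed simp

lemma chart_comp_cont:
  assumes X: "charted X" and c: "hol_chart X (U, z)" and B: "B \<subseteq> z ` U" and f: "\<And>w. w \<in> B ==> hol_fun_at X f (inv_into U z w)"
  shows "continuous_on B (\<lambda>w. f (inv_into U z w))"
  unfolding continuous_on
proof
  fix w assume w: "w \<in> B"
  then have wU: "w \<in> z ` U" using B by blast
  then have "hol_near (mdim X) (\<lambda>w. f (inv_into U z w)) (z (inv_into U z w))"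
    using f[OF w] hol_fun_at_chart[OF X c inv_into_into[OF wU]] by simp
  then have n: "hol_near (mdim X) (\<lambda>w. f (inv_into U z w)) w" by (simp add: f_inv_into_f[OF wU])
  have "((\<lambda>w. f (inv_into U z w)) \<longlongrightarrow> f (inv_into U z w)) (at w within Cn (mdim X))"
    by (rule cderiv_tendsto[OF hol_near_Cn[OF n] hol_near_cderiv[OF n]])
  moreover have "B \<subseteq> Cn (mdim X)" using B openin_Cn_sub[OF hol_chartD(2)[OF c]] by blast
  ultimately show "((\<lambda>w. f (inv_into U z w)) \<longlongrightarrow> f (inv_into U z w)) (at w within B)"
    by (rule tendsto_within_subset)
qed

text \<open>Open sets of tuples whose traces on all finite-dimensional affine families are open as well. This second
  property is what holomorphy in the parameters refers to, and it is checked for the subbasic sets.\<close>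

definition affine_open :: "'x cmfd => nat => (nat => ('x, 'l) lbundle) => (nat => 'x => 'l) set => bool" where
  "affine_open X s L N \<longleftrightarrow> openin (tuple_topology X s L) N \<and> N \<subseteq> sec_tuples X s L
     \<and> (\<forall>k \<rho> T. \<rho> \<in> sec_tuples X s L \<and> (\<forall>j<k. T j \<in> sec_tuples X s L) -->
          openin (top_of_set (Cn k)) {c \<in> Cn k. tuple_affine X s L \<rho> T c k \<in> N})"

lemma affine_openD:
  assumes "affine_open X s L N"
  shows "openin (tuple_topology X s L) N" "N \<subseteq> sec_tuples X s L"
    "\<rho> \<in> sec_tuples X s L ==> (\<And>j. j < k ==> T j \<in> sec_tuples X s L) ==>
       openin (top_of_set (Cn k)) {c \<in> Cn k. tuple_affine X s L \<rho> T c k \<in> N}"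
  using assms unfolding affine_open_def by simp_all

lemma affine_open_Int:
  assumes "affine_open X s L N" "affine_open X s L N'" shows "affine_open X s L (N \<inter> N')"
  unfolding affine_open_def
proof (intro conjI allI impI)
  show "openin (tuple_topology X s L) (N \<inter> N')" using assms affine_openD(1) by blast
  show "N \<inter> N' \<subseteq> sec_tuples X s L" using affine_openD(2)[OF assms(1)] by blast
  fix k :: nat and \<rho> T assume h: "\<rho> \<in> sec_tuples X s L \<and> (\<forall>j<k. T j \<in> sec_tuples X s L)"
  have "{c \<in> Cn k. tuple_affine X s L \<rho> T c k \<in> N \<inter> N'}
     = {c \<in> Cn k. tuple_affine X s L \<rho> T c k \<in> N} \<inter> {c \<in> Cn k. tuple_affine X s L \<rho> T c k \<in> N'}" by blast
  then show "openin (top_of_set (Cn k)) {c \<in> Cn k. tuple_affine X s L \<rho> T c k \<in> N \<inter> N'}"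
    using affine_openD(3)[OF assms(1), of \<rho> k T] affine_openD(3)[OF assms(2), of \<rho> k T] h by (simp add: openin_Int)
qed

lemma affine_open_finite:
  assumes "finite I" "\<And>i. i \<in> I ==> affine_open X s L (N i)" "affine_open X s L N0"
  shows "affine_open X s L (N0 \<inter> (\<Inter>i\<in>I. N i))"
  using assms(1,2)
proof (induction rule: finite_induct)
  case (insert i I)
  have "N0 \<inter> (\<Inter>i\<in>insert i I. N i) = (N0 \<inter> (\<Inter>i\<in>I. N i)) \<inter> N i" by blast
  then show ?case using insert by (simp only: affine_open_Int insertI1 insertI2)
qed (use assms(3) in simp)

context bundle_data
begin

lemma tuple_add_sec:
  assumes \<sigma>: "\<sigma> \<in> sec_tuples X s L" and \<sigma>': "\<sigma>' \<in> sec_tuples X s L"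
  shows "tuple_add X s L \<sigma> \<sigma>' \<in> sec_tuples X s L"
    "i < s ==> (U, t) \<in> trivs (L i) ==> x \<in> U ==> t x (tuple_add X s L \<sigma> \<sigma>' i x) = t x (\<sigma> i x) + t x (\<sigma>' i x)"
proof -
  have val: "tuple_add X s L \<sigma> \<sigma>' i x \<in> fib (L i) x \<and> t x (tuple_add X s L \<sigma> \<sigma>' i x) = t x (\<sigma> i x) + t x (\<sigma>' i x)"
    if i: "i < s" and t: "(U, t) \<in> trivs (L i)" "x \<in> U" for i U t x
  proof -
    have x: "x \<in> pts X" using openin_subset[OF lb_trivs(1)[OF lb[OF i] t(1)]] t(2) by blast
    show ?thesis
      using lb_add[OF lb[OF i] t H0_fib[OF sec_H0[OF \<sigma> i] x] H0_fib[OF sec_H0[OF \<sigma>' i] x]] i x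
      by (simp add: tuple_add_def)
  qed
  then show "i < s ==> (U, t) \<in> trivs (L i) ==> x \<in> U ==> t x (tuple_add X s L \<sigma> \<sigma>' i x) = t x (\<sigma> i x) + t x (\<sigma>' i x)" by blast
  have "tuple_add X s L \<sigma> \<sigma>' i \<in> H0 X (L i)" if i: "i < s" for i
    unfolding H0_def hol_section_def
  proof (intro CollectI conjI ballI allI impI)
    show "tuple_add X s L \<sigma> \<sigma>' i x \<in> fib (L i) x" if "x \<in> pts X" for x
      using lb_trivs(3)[OF lb[OF i] that] val[OF i] by blast
    show "tuple_add X s L \<sigma> \<sigma>' i x = undefined" if "x \<notin> pts X" for x
      using that i by (simp add: tuple_add_def)
    fix c assume "c \<in> trivs (L i)"
    then obtain U t where c: "c = (U, t)" "(U, t) \<in> trivs (L i)" by (cases c) simp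
    have U: "openin (mtop X) U" by (rule lb_trivs(1)[OF lb[OF i] c(2)])
    have "hol_fun_at X (\<lambda>x. t x (tuple_add X s L \<sigma> \<sigma>' i x)) p" if p: "p \<in> U" for p
    proof -
      have pX: "p \<in> pts X" using openin_subset[OF U] p by blast
      have "hol_fun_at X (\<lambda>x. t x (\<sigma> i x) + t x (\<sigma>' i x)) p"
        by (rule hol_fun_at_add[OF X H0_at[OF sec_H0[OF \<sigma> i] c(2) p pX] H0_at[OF sec_H0[OF \<sigma>' i] c(2) p pX]])
      then show ?thesis by (rule hol_fun_at_cong[OF X U p, rotated]) (use val[OF i c(2)] in simp)
    qed
    then show "case c of (U, t) => hol_fun X (U \<inter> pts X) (\<lambda>x. t x (tuple_add X s L \<sigma> \<sigma>' i x))"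
      unfolding c(1) prod.case hol_fun_iff_at[OF X] using U by (simp add: openin_Int)
  qed simp
  then show "tuple_add X s L \<sigma> \<sigma>' \<in> sec_tuples X s L"
    unfolding sec_tuples_def by (intro PiE_I) (auto simp: tuple_add_def)
qed

lemma tuple_scale_sec:
  assumes \<sigma>: "\<sigma> \<in> sec_tuples X s L"
  shows "tuple_scale X s L k \<sigma> \<in> sec_tuples X s L"
    "i < s ==> (U, t) \<in> trivs (L i) ==> x \<in> U ==> t x (tuple_scale X s L k \<sigma> i x) = k * t x (\<sigma> i x)"
proof -
  have val: "tuple_scale X s L k \<sigma> i x \<in> fib (L i) x \<and> t x (tuple_scale X s L k \<sigma> i x) = k * t x (\<sigma> i x)"
    if i: "i < s" and t: "(U, t) \<in> trivs (L i)" "x \<in> U" for i U t x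
  proof -
    have x: "x \<in> pts X" using openin_subset[OF lb_trivs(1)[OF lb[OF i] t(1)]] t(2) by blast
    show ?thesis
      using lb_scale[OF lb[OF i] t H0_fib[OF sec_H0[OF \<sigma> i] x]] i x by (simp add: tuple_scale_def)
  qed
  then show "i < s ==> (U, t) \<in> trivs (L i) ==> x \<in> U ==> t x (tuple_scale X s L k \<sigma> i x) = k * t x (\<sigma> i x)" by blast
  have "tuple_scale X s L k \<sigma> i \<in> H0 X (L i)" if i: "i < s" for i
    unfolding H0_def hol_section_def
  proof (intro CollectI conjI ballI allI impI)
    show "tuple_scale X s L k \<sigma> i x \<in> fib (L i) x" if "x \<in> pts X" for x
      using lb_trivs(3)[OF lb[OF i] that] val[OF i] by blast
    show "tuple_scale X s L k \<sigma> i x = undefined" if "x \<notin> pts X" for x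
      using that i by (simp add: tuple_scale_def)
    fix c assume "c \<in> trivs (L i)"
    then obtain U t where c: "c = (U, t)" "(U, t) \<in> trivs (L i)" by (cases c) simp
    have U: "openin (mtop X) U" by (rule lb_trivs(1)[OF lb[OF i] c(2)])
    have "hol_fun_at X (\<lambda>x. t x (tuple_scale X s L k \<sigma> i x)) p" if p: "p \<in> U" for p
    proof -
      have pX: "p \<in> pts X" using openin_subset[OF U] p by blast
      have "hol_fun_at X (\<lambda>x. k * t x (\<sigma> i x)) p"
        by (rule hol_fun_at_mult[OF X hol_fun_at_const[OF X pX] H0_at[OF sec_H0[OF \<sigma> i] c(2) p pX]])
      then show ?thesis by (rule hol_fun_at_cong[OF X U p, rotated]) (use val[OF i c(2)] in simp)
    qed
    then show "case c of (U, t) => hol_fun X (U \<inter> pts X) (\<lambda>x. t x (tuple_scale X s L k \<sigma> i x))"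
      unfolding c(1) prod.case hol_fun_iff_at[OF X] using U by (simp add: openin_Int)
  qed simp
  then show "tuple_scale X s L k \<sigma> \<in> sec_tuples X s L"
    unfolding sec_tuples_def by (intro PiE_I) (auto simp: tuple_scale_def)
qed

lemma tuple_affine_sec:
  assumes \<rho>: "\<rho> \<in> sec_tuples X s L"
  shows "(\<And>j. j < (k::nat) ==> T j \<in> sec_tuples X s L) ==> tuple_affine X s L \<rho> T c k \<in> sec_tuples X s L \<and>
    (\<forall>i U t x. i < s \<and> (U, t) \<in> trivs (L i) \<and> x \<in> U -->
       t x (tuple_affine X s L \<rho> T c k i x) = t x (\<rho> i x) + (\<Sum>j<k. c j * t x (T j i x)))"
proof (induction k)
  case 0
  then show ?case using \<rho> by simp
next
  case (Suc k)
  let ?A = "tuple_affine X s L \<rho> T c k" and ?B = "tuple_scale X s L (c k) (T k)"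
  have IH: "?A \<in> sec_tuples X s L" "\<And>i U t x. i < s ==> (U, t) \<in> trivs (L i) ==> x \<in> U ==>
       t x (?A i x) = t x (\<rho> i x) + (\<Sum>j<k. c j * t x (T j i x))"
    using Suc.IH Suc.prems by simp_all
  have Tk: "T k \<in> sec_tuples X s L" using Suc.prems by simp
  note B = tuple_scale_sec[OF Tk, where k = "c k"]
  note C = tuple_add_sec[OF IH(1) B(1)]
  show ?case
  proof (intro conjI allI impI)
    show "tuple_affine X s L \<rho> T c (Suc k) \<in> sec_tuples X s L" using C(1) by simp
    fix i U t x assume h: "i < s \<and> (U, t) \<in> trivs (L i) \<and> x \<in> U"
    then have h': "i < s" "(U, t) \<in> trivs (L i)" "x \<in> U" by simp_all
    show "t x (tuple_affine X s L \<rho> T c (Suc k) i x) = t x (\<rho> i x) + (\<Sum>j<Suc k. c j * t x (T j i x))"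
      by (simp add: C(2)[OF h'] IH(2)[OF h'] B(2)[OF h'])
  qed
qed

lemma affine_open_sec: "affine_open X s L (sec_tuples X s L)"
  unfolding affine_open_def
proof (intro conjI allI impI)
  show "openin (tuple_topology X s L) (sec_tuples X s L)"
    unfolding tuple_topology_def by (rule topology_generated_by_Basis) simp
  fix k :: nat and \<rho> T assume h: "\<rho> \<in> sec_tuples X s L \<and> (\<forall>j<k. T j \<in> sec_tuples X s L)"
  then have "{c \<in> Cn k. tuple_affine X s L \<rho> T c k \<in> sec_tuples X s L} = Cn k"
    using tuple_affine_sec[of \<rho> k T] by blast
  then show "openin (top_of_set (Cn k)) {c \<in> Cn k. tuple_affine X s L \<rho> T c k \<in> sec_tuples X s L}" by simp
qed simp

text \<open>On the compact set the values of the parameters enter through finitely many bounded functions, and the image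
  of the compact set keeps a positive distance from the complement of W.\<close>

lemma affine_open_subbasic:
  assumes i: "i < s" and t: "(U, t) \<in> trivs (L i)" and c: "hol_chart X (V, z)" and B: "compact B" "B \<subseteq> z ` V"
    and BU: "inv_into V z ` B \<subseteq> U" and W: "open W"
  shows "affine_open X s L {\<sigma> \<in> sec_tuples X s L. \<forall>x\<in>inv_into V z ` B. t x (\<sigma> i x) \<in> W}" (is "affine_open _ _ _ ?N")
  unfolding affine_open_def
proof (intro conjI allI impI)
  have K: "compactin (mtop X) (inv_into V z ` B)" by (rule chart_compact(1)[OF c B])
  show "openin (tuple_topology X s L) ?N"
    unfolding tuple_topology_def by (rule topology_generated_by_Basis) (use i t K BU W in blast)
  show "?N \<subseteq> sec_tuples X s L" by blast
  fix k :: nat and \<rho> T assume h: "\<rho> \<in> sec_tuples X s L \<and> (\<forall>j<k. T j \<in> sec_tuples X s L)"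
  define f where "f \<sigma> w = t (inv_into V z w) (\<sigma> i (inv_into V z w))" for \<sigma> w
  have fc: "continuous_on B (f \<sigma>)" if \<sigma>: "\<sigma> \<in> sec_tuples X s L" for \<sigma>
    unfolding f_def[abs_def]
  proof (rule chart_comp_cont[OF X c B(2)])
    fix w assume w: "w \<in> B"
    then have "inv_into V z w \<in> U" using BU by blast
    moreover have "inv_into V z w \<in> pts X" by (rule hol_chart_sub[OF c inv_into_into]) (use w B(2) in blast)
    ultimately show "hol_fun_at X (\<lambda>x. t x (\<sigma> i x)) (inv_into V z w)" by (rule H0_at[OF sec_H0[OF \<sigma> i] t])
  qed
  define g where "g c w = f \<rho> w + (\<Sum>j<k. c j * f (T j) w)" for c w
  have gf: "f (tuple_affine X s L \<rho> T c k) w = g c w" if "w \<in> B" for c w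
    using tuple_affine_sec[of \<rho> k T c] h i t BU that unfolding f_def g_def by blast
  have eq: "{c \<in> Cn k. tuple_affine X s L \<rho> T c k \<in> ?N} = {c \<in> Cn k. \<forall>w\<in>B. g c w \<in> W}"
    using tuple_affine_sec[of \<rho> k T] h gf unfolding f_def by auto
  show "openin (top_of_set (Cn k)) {c \<in> Cn k. tuple_affine X s L \<rho> T c k \<in> ?N}"
    unfolding eq openin_Cn_iff
  proof (intro conjI ballI)
    fix c assume c: "c \<in> {c \<in> Cn k. \<forall>w\<in>B. g c w \<in> W}"
    have gc: "continuous_on B (g c)" unfolding g_def[abs_def]
      by (intro continuous_on_add continuous_on_sum continuous_on_mult continuous_on_const fc) (use h in auto)
    have "compact (g c ` B)" by (rule compact_continuous_image[OF gc B(1)])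
    moreover have "g c ` B \<subseteq> W" using c by blast
    ultimately obtain \<epsilon> where \<epsilon>: "\<epsilon> > 0" "(\<Union>y\<in>g c ` B. ball y \<epsilon>) \<subseteq> W"
      using compact_subset_open_imp_ball_epsilon_subset[OF _ W] by blast
    have "continuous_on B (\<lambda>w. \<Sum>j<k. norm (f (T j) w))"
      by (intro continuous_on_sum continuous_on_norm fc) (use h in auto)
    then have "bounded ((\<lambda>w. \<Sum>j<k. norm (f (T j) w)) ` B)"
      using B(1) compact_continuous_image compact_imp_bounded by blast
    then obtain M where M: "M > 0" "\<And>w. w \<in> B ==> norm (\<Sum>j<k. norm (f (T j) w)) \<le> M"
      unfolding bounded_pos by blast
    have "c' \<in> {c \<in> Cn k. \<forall>w\<in>B. g c w \<in> W}" if c': "c' \<in> Cn k" "\<forall>j<k. norm (c' j - c j) < \<epsilon> / (2 * M)" for c'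
    proof -
      have "g c' w \<in> W" if w: "w \<in> B" for w
      proof -
        have "norm (g c' w - g c w) = norm (\<Sum>j<k. (c' j - c j) * f (T j) w)"
          by (simp add: g_def sum_subtractf left_diff_distrib)
        also have "\<dots> \<le> (\<Sum>j<k. norm ((c' j - c j) * f (T j) w))" by (rule norm_sum)
        also have "\<dots> \<le> (\<Sum>j<k. \<epsilon> / (2 * M) * norm (f (T j) w))"
        proof (rule sum_mono)
          fix j assume "j \<in> {..<k}"
          then have "norm (c' j - c j) \<le> \<epsilon> / (2 * M)" using c'(2) by (simp add: less_imp_le)
          then show "norm ((c' j - c j) * f (T j) w) \<le> \<epsilon> / (2 * M) * norm (f (T j) w)"
            unfolding norm_mult by (rule mult_right_mono) simp
        qed
        also have "\<dots> = \<epsilon> / (2 * M) * (\<Sum>j<k. norm (f (T j) w))" by (simp add: sum_distrib_left)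
        also have "\<dots> \<le> \<epsilon> / (2 * M) * M"
          using M(2)[OF w] M(1) \<epsilon>(1) by (intro mult_left_mono) (auto simp: sum_nonneg)
        also have "\<dots> < \<epsilon>" using M(1) \<epsilon>(1) by simp
        finally have "g c' w \<in> ball (g c w) \<epsilon>" by (simp add: dist_norm norm_minus_commute)
        then show ?thesis using \<epsilon>(2) w by blast
      qed
      then show ?thesis using c'(1) by blast
    qed
    then show "\<exists>r>0. \<forall>w\<in>Cn k. (\<forall>i<k. cmod (w i - c i) < r) --> w \<in> {c \<in> Cn k. \<forall>w\<in>B. g c w \<in> W}"
      using \<epsilon>(1) M(1) by (intro exI[of _ "\<epsilon> / (2 * M)"]) simp
  qed blast
qed

text \<open>In the compact-open topology, nearby sections are uniformly close on compact sets: the compact set is cut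
  into pieces on which the given section is almost constant.\<close>

lemma uniformly_near_tuples:
  assumes \<sigma>0: "\<sigma>0 \<in> sec_tuples X s L" and i: "i < s" and t: "(U, t) \<in> trivs (L i)"
    and c: "hol_chart X (V, z)" and B: "compact B" "B \<subseteq> z ` V" and BU: "inv_into V z ` B \<subseteq> U" and \<delta>: "(\<delta>::real) > 0"
  shows "\<exists>N. affine_open X s L N \<and> \<sigma>0 \<in> N \<and>
     (\<forall>\<sigma>\<in>N. \<forall>x\<in>inv_into V z ` B. norm (t x (\<sigma> i x) - t x (\<sigma>0 i x)) < \<delta>)"
proof -
  define f where "f w = t (inv_into V z w) (\<sigma>0 i (inv_into V z w))" for w
  have fc: "continuous_on B f"
    unfolding f_def[abs_def]
  proof (rule chart_comp_cont[OF X c B(2)])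
    fix w assume w: "w \<in> B"
    then have "inv_into V z w \<in> U" using BU by blast
    moreover have "inv_into V z w \<in> pts X" by (rule hol_chart_sub[OF c inv_into_into]) (use w B(2) in blast)
    ultimately show "hol_fun_at X (\<lambda>x. t x (\<sigma>0 i x)) (inv_into V z w)" by (rule H0_at[OF sec_H0[OF \<sigma>0 i] t])
  qed
  have "compact (f ` B)" by (rule compact_continuous_image[OF fc B(1)])
  then obtain C where C: "C \<subseteq> f ` B" "finite C" "f ` B \<subseteq> (\<Union>y\<in>C. ball y (\<delta> / 3))"
  proof (rule compactE_image[of "f ` B" "f ` B" "\<lambda>y. ball y (\<delta> / 3)"])
    show "f ` B \<subseteq> (\<Union>y\<in>f ` B. ball y (\<delta> / 3))" using \<delta> by force
  qed auto
  \<comment> \<open>on the piece P y the given section stays within \<delta>/3 of y, and nearby tuples are required to stay within 2\<delta>/3 of y\<close>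
  define P where "P y = B \<inter> f -` cball y (\<delta> / 3)" for y
  have P: "compact (P y)" "P y \<subseteq> B" for y
  proof -
    have "closedin (top_of_set B) (P y)"
      unfolding P_def by (rule continuous_closedin_preimage[OF fc]) simp
    then show "compact (P y)" using B(1) closedin_compact by blast
  qed (simp add: P_def)
  define N where "N y = {\<sigma> \<in> sec_tuples X s L. \<forall>x\<in>inv_into V z ` P y. t x (\<sigma> i x) \<in> ball y (2 * \<delta> / 3)}" for y
  have N: "affine_open X s L (N y)" for y
    unfolding N_def by (rule affine_open_subbasic[OF i t c P(1)]) (use P(2)[of y] B(2) BU in auto)
  have "affine_open X s L (sec_tuples X s L \<inter> (\<Inter>y\<in>C. N y))"
    by (rule affine_open_finite[OF C(2) N affine_open_sec])
  moreover have "\<sigma>0 \<in> N y" for y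
  proof -
    have "dist y (f w) < 2 * \<delta> / 3" if "w \<in> P y" for w using that \<delta> by (auto simp: P_def)
    then show ?thesis using \<sigma>0 unfolding N_def f_def by auto
  qed
  moreover have "norm (t x (\<sigma> i x) - t x (\<sigma>0 i x)) < \<delta>"
    if \<sigma>: "\<sigma> \<in> sec_tuples X s L \<inter> (\<Inter>y\<in>C. N y)" and x: "x \<in> inv_into V z ` B" for \<sigma> x
  proof -
    obtain w where w: "x = inv_into V z w" "w \<in> B" using x by blast
    obtain y where y: "y \<in> C" "dist y (f w) < \<delta> / 3" using C(3) w(2) by auto
    have "w \<in> P y" using w(2) y(2) by (simp add: P_def)
    then have "dist y (t x (\<sigma> i x)) < 2 * \<delta> / 3" using \<sigma> y(1) w(1) by (auto simp: N_def)
    then have "dist (t x (\<sigma> i x)) (f w) < \<delta>" using y(2) dist_triangle3[of "t x (\<sigma> i x)" "f w" y] by simp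
    then show ?thesis by (simp add: f_def w(1) dist_norm)
  qed
  ultimately show ?thesis using \<sigma>0
    by (intro exI[of _ "sec_tuples X s L \<inter> (\<Inter>y\<in>C. N y)"]) simp
qed

end

lemma Cn_mfd_simps [simp]: "mtop (Cn_mfd k) = top_of_set (Cn k)" "mdim (Cn_mfd k) = k" "pts (Cn_mfd k) = Cn k"
  by (simp_all add: Cn_mfd_def)

lemma charted_Cn: "charted (Cn_mfd k)"
proof -
  have "top_chart (top_of_set (Cn k)) k (Cn k, \<lambda>z. z)"
  proof (rule top_chartI)
    show "openin (top_of_set (Cn k)) {p \<in> Cn k. p \<in> W}" if "openin (top_of_set (Cn k)) W" for W
    proof -
      have "{p \<in> Cn k. p \<in> W} = W" using openin_Cn_sub[OF that] by blast
      then show ?thesis using that by simp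
    qed
  qed auto
  then show ?thesis using transition_self[of "top_of_set (Cn k)" k "Cn k" "\<lambda>z. z"]
    by (simp add: charted_def Cn_mfd_def)
qed

lemma Cn_mfd_coord: "c \<in> Cn k ==> hol_fun_at (Cn_mfd k) (\<lambda>c. c l) c"
proof -
  assume c: "c \<in> Cn k"
  have "hol_chart (Cn_mfd k) (Cn k, \<lambda>z. z)" by (rule atlas_hol_chart[OF charted_Cn]) (simp add: Cn_mfd_def)
  from hol_fun_at_coord[OF charted_Cn this c] show ?thesis .
qed

context bundle_data
begin

text \<open>Cauchy's estimate turns closeness of the sections into closeness of their Jacobians.\<close>

lemma sec_jac_nonzero_nbhd:
  assumes \<sigma>0: "\<sigma>0 \<in> sec_tuples X s L" and c: "hol_chart X (U, z)" and p: "p \<in> U"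
    and ts: "\<And>i. i < s ==> (Us i, ts i) \<in> trivs (L i)"
    and S0: "openin (mtop X) S0" "p \<in> S0" "S0 \<subseteq> U" "\<And>i. i < s ==> S0 \<subseteq> Us i"
    and D: "sec_jac X s (U, z) ts \<sigma>0 p \<noteq> 0"
  shows "\<exists>N S. affine_open X s L N \<and> \<sigma>0 \<in> N \<and> openin (mtop X) S \<and> p \<in> S \<and> S \<subseteq> S0
     \<and> (\<forall>\<sigma>\<in>N. \<forall>x\<in>S. sec_jac X s (U, z) ts \<sigma> x \<noteq> 0)"
proof -
  let ?d = "mdim X"
  define J where "J \<sigma> x i j = coord_vec X (U, z) x j (\<lambda>x. ts i x (\<sigma> i x))" for \<sigma> x i j
  define h where "h \<sigma> i w = ts i (inv_into U z w) (\<sigma> i (inv_into U z w))" for \<sigma> i w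
  have pX: "p \<in> pts X" by (rule hol_chart_sub[OF c p])
  obtain \<epsilon> where \<epsilon>: "\<epsilon> > 0" "\<forall>A. (\<forall>i<s. \<forall>j<s. norm (A i j - J \<sigma>0 p i j) < \<epsilon>) --> det_of s A \<noteq> 0"
    using det_nonzero_nbhd[of s "J \<sigma>0 p"] D unfolding sec_jac_def J_def by blast
  let ?W = "z ` (U \<inter> S0)"
  have W: "openin (top_of_set (Cn ?d)) ?W" by (rule hol_chartD(5)[OF c S0(1)])
  have zpW: "z p \<in> ?W" using p S0(2) by blast
  obtain r0 where r0: "r0 > 0" "\<And>w. w \<in> Cn ?d ==> (\<And>i. i < ?d ==> norm (w i - z p i) \<le> r0) ==> w \<in> ?W"
    using closed_box[OF W zpW] by blast
  \<comment> \<open>sections are compared on the box of radius 2r; discs of radius r around points of the box of radius r stay inside\<close>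
  define r where "r = r0 / 4"
  have r: "r > 0" using r0(1) by (simp add: r_def)
  let ?B = "{w \<in> Cn ?d. \<forall>i<?d. norm (w i - z p i) \<le> 2 * r}"
  have BW: "?B \<subseteq> ?W"
  proof
    fix w assume w: "w \<in> ?B"
    show "w \<in> ?W"
    proof (rule r0(2))
      show "norm (w i - z p i) \<le> r0" if "i < ?d" for i
      proof -
        have "norm (w i - z p i) \<le> 2 * r" using w that by blast
        then show ?thesis using r0(1) by (simp add: r_def)
      qed
    qed (use w in blast)
  qed
  have iU: "inv_into U z w \<in> U" "inv_into U z w \<in> S0" "z (inv_into U z w) = w" if w: "w \<in> ?W" for w
  proof -
    obtain q where q: "w = z q" "q \<in> U" "q \<in> S0" using w by blast
    then have "inv_into U z w = q" using hol_chartD(3)[OF c] by simp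
    then show "inv_into U z w \<in> U" "inv_into U z w \<in> S0" "z (inv_into U z w) = w" using q by simp_all
  qed
  have hh: "hol_Cn ?d ?W (h \<sigma> i)" if \<sigma>: "\<sigma> \<in> sec_tuples X s L" and i: "i < s" for \<sigma> i
    unfolding hol_Cn_iff_near
  proof (intro conjI W ballI)
    fix w assume w: "w \<in> ?W"
    have "inv_into U z w \<in> Us i" using iU(2)[OF w] S0(4)[OF i] by blast
    then have "hol_fun_at X (\<lambda>x. ts i x (\<sigma> i x)) (inv_into U z w)"
      by (rule H0_at[OF sec_H0[OF \<sigma> i] ts[OF i] _ hol_chart_sub[OF c iU(1)[OF w]]])
    then show "hol_near ?d (h \<sigma> i) w"
      unfolding hol_fun_at_chart[OF X c iU(1)[OF w]] iU(3)[OF w] h_def[abs_def] .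
  qed
  \<comment> \<open>chosen so that Cauchy's estimate on a circle of radius r gives \<epsilon> / 2 for the derivatives\<close>
  define \<delta> where "\<delta> = r * (\<epsilon> / 2)"
  have \<delta>: "\<delta> > 0" using r \<epsilon>(1) by (simp add: \<delta>_def)
  have B: "compact ?B" "?B \<subseteq> z ` U" using compact_box BW by auto
  have "\<exists>N. i < s --> affine_open X s L N \<and> \<sigma>0 \<in> N \<and>
     (\<forall>\<sigma>\<in>N. \<forall>x\<in>inv_into U z ` ?B. norm (ts i x (\<sigma> i x) - ts i x (\<sigma>0 i x)) < \<delta>)" for i
  proof (cases "i < s")
    case True
    have "inv_into U z ` ?B \<subseteq> Us i" using iU(2) BW S0(4)[OF True] by blast
    from uniformly_near_tuples[OF \<sigma>0 True ts[OF True] c B this \<delta>] show ?thesis by blast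
  qed simp
  then have "\<forall>i. \<exists>N. i < s --> affine_open X s L N \<and> \<sigma>0 \<in> N \<and>
     (\<forall>\<sigma>\<in>N. \<forall>x\<in>inv_into U z ` ?B. norm (ts i x (\<sigma> i x) - ts i x (\<sigma>0 i x)) < \<delta>)" ..
  from choice[OF this] obtain Ni where Ni: "\<forall>i. i < s --> affine_open X s L (Ni i) \<and> \<sigma>0 \<in> Ni i \<and>
     (\<forall>\<sigma>\<in>Ni i. \<forall>x\<in>inv_into U z ` ?B. norm (ts i x (\<sigma> i x) - ts i x (\<sigma>0 i x)) < \<delta>)" by blast
  define N where "N = sec_tuples X s L \<inter> (\<Inter>i\<in>{..<s}. Ni i)"
  have N: "affine_open X s L N" unfolding N_def
    by (rule affine_open_finite[OF finite_lessThan _ affine_open_sec]) (use Ni in blast)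
  have \<sigma>0N: "\<sigma>0 \<in> N" using \<sigma>0 Ni unfolding N_def by blast
  have "\<exists>Q. openin (mtop X) Q \<and> p \<in> Q \<and> (i < s \<and> j < s --> (\<forall>x\<in>Q. norm (J \<sigma>0 x i j - J \<sigma>0 p i j) < \<epsilon> / 2))" for i j
  proof (cases "i < s \<and> j < s")
    case True
    then have "hol_fun_at X (\<lambda>x. ts i x (\<sigma>0 i x)) p"
      using S0(2) S0(4)[of i] by (intro H0_at[OF sec_H0[OF \<sigma>0] ts _ pX]) auto
    then have "hol_fun_at X (\<lambda>x. J \<sigma>0 x i j) p" unfolding J_def
      using True sd by (intro hol_fun_at_coord_vec[OF X c p]) auto
    from hol_fun_at_nbhd[OF X this, of "ball (J \<sigma>0 p i j) (\<epsilon> / 2)"] \<epsilon>(1)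
    show ?thesis by (auto simp: dist_norm norm_minus_commute)
  next
    case False
    then show ?thesis using pX openin_topspace by blast
  qed
  then have "\<forall>ij. \<exists>Q. openin (mtop X) Q \<and> p \<in> Q \<and> (fst ij < s \<and> snd ij < s --> (\<forall>x\<in>Q. norm (J \<sigma>0 x (fst ij) (snd ij) - J \<sigma>0 p (fst ij) (snd ij)) < \<epsilon> / 2))" by blast
  from choice[OF this] obtain Q where Q: "\<And>ij. openin (mtop X) (Q ij) \<and> p \<in> Q ij" "\<And>i j x. i < s ==> j < s ==> x \<in> Q (i, j) ==> norm (J \<sigma>0 x i j - J \<sigma>0 p i j) < \<epsilon> / 2"
    by (metis fst_conv snd_conv)
  let ?b = "{w \<in> Cn ?d. \<forall>i<?d. norm (w i - z p i) < r}"
  have box: "openin (top_of_set (Cn ?d)) ?b"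
  proof -
    have "open {w :: nat => complex. \<forall>i<?d. norm (w i - z p i) < r}" by (rule open_coord_box)
    then have "openin (top_of_set (Cn ?d)) (Cn ?d \<inter> {w. \<forall>i<?d. norm (w i - z p i) < r})" by (rule openin_open_Int)
    then show ?thesis by (simp add: Int_def)
  qed
  define S where "S = {q \<in> U. z q \<in> ?b} \<inter> S0 \<inter> (\<Inter>ij\<in>{..<s} \<times> {..<s}. Q ij)"
  have "openin (mtop X) (S0 \<inter> (\<Inter>ij\<in>{..<s} \<times> {..<s}. Q ij))"
  proof (cases "s = 0")
    case False
    then have "openin (mtop X) (\<Inter>ij\<in>{..<s} \<times> {..<s}. Q ij)" using Q(1) by (intro openin_Inter) auto
    then show ?thesis using S0(1) by blast
  qed (use S0(1) in simp)
  then have S: "openin (mtop X) S" unfolding S_def Int_assoc using hol_chartD(6)[OF c box] by blast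
  have pS: "p \<in> S" unfolding S_def using p S0(2) Q(1) r hol_chartD(4)[OF c p] by simp
  have est: "norm (J \<sigma> x i j - J \<sigma>0 x i j) \<le> \<epsilon> / 2" if \<sigma>: "\<sigma> \<in> N" and x: "x \<in> S" and ij: "i < s" "j < s" for \<sigma> x i j
  proof -
    have jd: "j < ?d" using ij(2) sd by simp
    have xU: "x \<in> U" "x \<in> S0" and xb: "z x \<in> Cn ?d" "\<And>k. k < ?d ==> norm (z x k - z p k) < r"
      using x unfolding S_def by auto
    have \<sigma>s: "\<sigma> \<in> sec_tuples X s L" using \<sigma> unfolding N_def by blast
    have xX: "x \<in> pts X" by (rule hol_chart_sub[OF c xU(1)])
    have JJ: "J \<sigma>' x i j = deriv (\<lambda>t. h \<sigma>' i ((z x)(j := t))) (z x j)" if "\<sigma>' \<in> sec_tuples X s L" for \<sigma>'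
    proof -
      have "hol_fun_at X (\<lambda>x. ts i x (\<sigma>' i x)) x"
        using xU(2) S0(4)[OF ij(1)] by (intro H0_at[OF sec_H0[OF that ij(1)] ts[OF ij(1)] _ xX]) auto
      then show ?thesis unfolding J_def by (simp add: coord_vec_hol pderiv_Cn_def h_def)
    qed
    have ball: "(z x)(j := t) \<in> ?W" if "t \<in> ball (z x j) (2 * r)" for t
    proof (rule r0(2)[OF Cn_upd[OF xb(1) jd]])
      fix k assume k: "k < ?d"
      have "norm (t - z p j) \<le> norm (t - z x j) + norm (z x j - z p j)"
        using norm_triangle_ineq[of "t - z x j" "z x j - z p j"] by simp
      then show "norm (((z x)(j := t)) k - z p k) \<le> r0"
        using that xb(2)[OF k] xb(2)[OF jd] r by (auto simp: dist_norm norm_minus_commute r_def)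
    qed
    define G where "G t = h \<sigma> i ((z x)(j := t)) - h \<sigma>0 i ((z x)(j := t))" for t
    have H: "(\<lambda>t. h \<sigma>' i ((z x)(j := t))) holomorphic_on ball (z x j) (2 * r)" if "\<sigma>' \<in> sec_tuples X s L" for \<sigma>'
      by (rule slice_holomorphic[OF hol_Cn_sep[OF hh[OF that ij(1)]] jd open_ball ball])
    have G: "G holomorphic_on ball (z x j) (2 * r)" unfolding G_def[abs_def]
      by (intro holomorphic_on_diff H \<sigma>s \<sigma>0)
    have sub: "cball (z x j) r \<subseteq> ball (z x j) (2 * r)" using r by auto
    have "norm ((deriv ^^ 1) G (z x j)) \<le> fact 1 * \<delta> / r ^ 1"
    proof (rule Cauchy_inequality[OF _ _ r])
      show "G holomorphic_on ball (z x j) r" using holomorphic_on_subset[OF G] sub by (meson ball_subset_cball order_trans)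
      show "continuous_on (cball (z x j) r) G" using holomorphic_on_imp_continuous_on[OF G] sub continuous_on_subset by blast
      fix t assume t: "norm (z x j - t) = r"
      have "(z x)(j := t) \<in> ?B"
      proof (intro CollectI conjI allI impI Cn_upd[OF xb(1) jd])
        fix k assume k: "k < ?d"
        have "norm (t - z p j) \<le> norm (t - z x j) + norm (z x j - z p j)"
          using norm_triangle_ineq[of "t - z x j" "z x j - z p j"] by simp
        then show "norm (((z x)(j := t)) k - z p k) \<le> 2 * r"
          using t xb(2)[OF k] xb(2)[OF jd] r by (auto simp: norm_minus_commute)
      qed
      then have "inv_into U z ((z x)(j := t)) \<in> inv_into U z ` ?B" by (rule imageI)
      moreover have "\<sigma> \<in> Ni i" using \<sigma> ij(1) unfolding N_def by blast
      ultimately show "norm (G t) \<le> \<delta>" using Ni ij(1) unfolding G_def h_def by (meson less_imp_le)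
    qed
    then have "norm (deriv G (z x j)) \<le> \<epsilon> / 2" using r by (simp add: \<delta>_def)
    moreover have "deriv G (z x j) = J \<sigma> x i j - J \<sigma>0 x i j"
    proof -
      have cb: "z x j \<in> ball (z x j) (2 * r)" using r by simp
      show ?thesis unfolding JJ[OF \<sigma>s] JJ[OF \<sigma>0] G_def[abs_def]
        by (intro deriv_diff holomorphic_on_imp_differentiable_at[OF H open_ball cb] \<sigma>s \<sigma>0)
    qed
    ultimately show ?thesis by simp
  qed
  have "sec_jac X s (U, z) ts \<sigma> x \<noteq> 0" if \<sigma>: "\<sigma> \<in> N" and x: "x \<in> S" for \<sigma> x
  proof -
    have "norm (J \<sigma> x i j - J \<sigma>0 p i j) < \<epsilon>" if ij: "i < s" "j < s" for i j
    proof -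
      have "x \<in> Q (i, j)" using x ij unfolding S_def by blast
      then have "norm (J \<sigma>0 x i j - J \<sigma>0 p i j) < \<epsilon> / 2" by (rule Q(2)[OF ij])
      then show ?thesis
        using est[OF \<sigma> x ij] norm_triangle_ineq[of "J \<sigma> x i j - J \<sigma>0 x i j" "J \<sigma>0 x i j - J \<sigma>0 p i j"] by simp
    qed
    then have "det_of s (\<lambda>i j. J \<sigma> x i j) \<noteq> 0" using \<epsilon>(2) by blast
    then show ?thesis unfolding sec_jac_def J_def .
  qed
  moreover have "S \<subseteq> S0" unfolding S_def by blast
  ultimately show ?thesis using N \<sigma>0N S pS by blast
qed

text \<open>Along an affine family the entries of the Jacobian are affine in the parameters.\<close>

lemma sec_jac_affine:
  assumes c: "hol_chart X (U, z)" and x: "x \<in> U"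
    and ts: "\<And>i. i < s ==> (Us i, ts i) \<in> trivs (L i)" "\<And>i. i < s ==> x \<in> Us i"
    and \<rho>: "\<rho> \<in> sec_tuples X s L" and T: "\<And>j. j < k ==> T j \<in> sec_tuples X s L"
  shows "sec_jac X s (U, z) ts (tuple_affine X s L \<rho> T a k) x
    = det_of s (\<lambda>i j. coord_vec X (U, z) x j (\<lambda>x. ts i x (\<rho> i x))
        + (\<Sum>l<k. a l * coord_vec X (U, z) x j (\<lambda>x. ts i x (T l i x))))"
proof -
  let ?A = "tuple_affine X s L \<rho> T a k"
  have xX: "x \<in> pts X" by (rule hol_chart_sub[OF c x])
  have "coord_vec X (U, z) x j (\<lambda>x. ts i x (?A i x)) = coord_vec X (U, z) x j (\<lambda>x. ts i x (\<rho> i x))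
        + (\<Sum>l<k. a l * coord_vec X (U, z) x j (\<lambda>x. ts i x (T l i x)))" if ij: "i < s" "j < s" for i j
  proof -
    have v: "coord_vec X (U, z) x j \<in> tspace X x" using ij sd by (intro coord_vec_tspace[OF X c x]) simp
    have "coord_vec X (U, z) x j (\<lambda>x. ts i x (?A i x))
      = coord_vec X (U, z) x j (\<lambda>x. ts i x (\<rho> i x) + (\<Sum>l<k. a l * ts i x (T l i x)))"
    proof (rule tspace_cong[OF X v lb_trivs(1)[OF lb[OF ij(1)] ts(1)[OF ij(1)]] ts(2)[OF ij(1)]])
      fix q assume q: "q \<in> Us i"
      have "\<forall>i U t x. i < s \<and> (U, t) \<in> trivs (L i) \<and> x \<in> U -->
         t x (?A i x) = t x (\<rho> i x) + (\<Sum>j<k. a j * t x (T j i x))"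
        by (rule conjunct2[OF tuple_affine_sec[OF \<rho> T]])
      from this[THEN spec, of i, THEN spec, of "Us i", THEN spec, of "ts i", THEN spec, of q]
      show "ts i q (?A i q) = ts i q (\<rho> i q) + (\<Sum>l<k. a l * ts i q (T l i q))" using ij ts(1) q by simp
    qed
    also have "\<dots> = coord_vec X (U, z) x j (\<lambda>x. ts i x (\<rho> i x))
        + (\<Sum>l<k. a l * coord_vec X (U, z) x j (\<lambda>x. ts i x (T l i x)))"
      by (rule tspace_affine_fun[OF X v])
         (auto intro!: H0_at[OF sec_H0 ts(1) ts(2) xX] \<rho> T ij)
    finally show ?thesis .
  qed
  then show ?thesis unfolding sec_jac_def by (intro arg_cong[where f = Determinant.det] eq_matI) auto
qed

text \<open>The residue is locally the restriction of the forms F below, which make sense for all tuples near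
  the given one and depend holomorphically on the tuple: in the reference chart, adjunction divides by the Jacobian
  of the sections.\<close>

lemma residue_map_hodge:
  assumes \<tau>: "\<tau> \<in> H0 X (plus_K X L')"
  shows "residue_map X s L L' \<mu> \<tau> \<in> hodge_sections X s L"
  unfolding hodge_sections_def
proof (intro CollectI conjI ballI)
  let ?d = "mdim X"
  show "residue_map X s L L' \<mu> \<tau> \<in> (\<Pi>\<^sub>E \<sigma>\<in>smooth_tuples X s L. H0K (ci_mfd X s L \<sigma>))"
    unfolding residue_map_def using adjunction_map_H0K[OF _ \<tau>] by (intro PiE_I) auto
  fix \<sigma>0 p assume \<sigma>0: "\<sigma>0 \<in> smooth_tuples X s L" and p: "p \<in> zero_locus X s L \<sigma>0"
  have st0: "\<sigma>0 \<in> sec_tuples X s L" and sm0: "smooth_ci X s L \<sigma>0" using \<sigma>0 by (simp_all add: smooth_tuples_def)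
  have pX: "p \<in> pts X" by (rule zero_locus_pts[OF p])
  obtain U z e where U: "p \<in> U" "adapted X s L \<sigma>0 U z e" using smooth_adapted[OF sm0 p] by blast
  note c = adapted_chart[OF U(2)]
  obtain Us ts W t where t: "\<forall>i<s. (Us i, ts i) \<in> trivs (L i) \<and> p \<in> Us i" "(W, t) \<in> trivs L'" "p \<in> W"
    using local_trivs_ex[OF pX] by blast
  have tsi: "\<And>i. i < s ==> (Us i, ts i) \<in> trivs (L i)" "\<And>i. i < s ==> p \<in> Us i" using t(1) by blast+
  obtain b where b: "hol_fun X (W \<inter> (\<Inter>i<s. Us i)) b" "\<forall>x\<in>W \<inter> (\<Inter>i<s. Us i). b x \<noteq> 0 \<and>
     (\<forall>l. (\<forall>i<s. l i \<in> fib (L i) x) --> t x (\<mu> x l) = b x * (\<Prod>i<s. ts i x (l i)))"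
    using tensor_iso_ex[OF ten t(2) tsi(1)] by blast
  let ?S0 = "U \<inter> (W \<inter> (\<Inter>i<s. Us i))"
  have S0: "openin (mtop X) ?S0" using hol_chartD(1)[OF c] b(1) by (simp add: hol_fun_def openin_Int)
  have pS0: "p \<in> ?S0" using U(1) t by blast
  have D0: "sec_jac X s (U, z) ts \<sigma>0 p \<noteq> 0" by (rule sec_jac_nonzero[OF st0 U(2,1) p tsi])
  have S0i: "?S0 \<subseteq> Us i" if "i < s" for i using that by blast
  obtain N S where N: "affine_open X s L N" "\<sigma>0 \<in> N" and S: "openin (mtop X) S" "p \<in> S" "S \<subseteq> ?S0"
    and jac: "\<forall>\<sigma>\<in>N. \<forall>x\<in>S. sec_jac X s (U, z) ts \<sigma> x \<noteq> 0"
    using sec_jac_nonzero_nbhd[OF st0 c U(1) tsi(1) S0 pS0 Int_lower1 S0i D0] by blast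
  have xS: "x \<in> U" "x \<in> W" "\<And>i. i < s ==> x \<in> Us i" "x \<in> W \<inter> (\<Inter>i<s. Us i)" if "x \<in> S" for x
    using that S(3) by blast+
  define F where "F \<sigma> x us = top_coef X (U, z) t \<tau> x / (b x * sec_jac X s (U, z) ts \<sigma> x) * dz_wedge z s (?d - s) us" for \<sigma> x us
  have restr: "residue_map X s L L' \<mu> \<tau> \<sigma> x vs = F \<sigma> x (map (push X (\<lambda>y. y) x) vs)"
    if \<sigma>: "\<sigma> \<in> N \<inter> smooth_tuples X s L" and x: "x \<in> S \<inter> zero_locus X s L \<sigma>"
      and vs: "vs \<in> tlists (ci_mfd X s L \<sigma>) (?d - s) x" for \<sigma> x vs
  proof -
    have \<sigma>': "\<sigma> \<in> N" "\<sigma> \<in> sec_tuples X s L" "smooth_ci X s L \<sigma>" using \<sigma> by (simp_all add: smooth_tuples_def)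
    have x': "x \<in> S" "x \<in> zero_locus X s L \<sigma>" using x by simp_all
    obtain U' z' e' where U': "x \<in> U'" "adapted X s L \<sigma> U' z' e'" using smooth_adapted[OF \<sigma>'(3) x'(2)] by blast
    obtain g where g: "adj_local X s L L' \<mu> \<sigma> \<tau> U' z' e' g" using adj_local_ex[OF \<sigma>'(2) U'(2) \<tau>] by blast
    note bx = bspec[OF b(2) xS(4)[OF x'(1)]]
    have nz: "b x * sec_jac X s (U, z) ts \<sigma> x \<noteq> 0" using bx jac \<sigma>'(1) x'(1) by simp
    have "b x * sec_jac X s (U, z) ts \<sigma> x * (g x * dz_wedge z' s (?d - s) vs)
        = top_coef X (U, z) t \<tau> x * dz_wedge z s (?d - s) vs"
      using bx xS[OF x'(1)] by (intro adjunction_reference[OF \<sigma>'(2,3) U'(1) x'(2) g c _ tsi(1) _ t(2) _ _ vs]) simp_all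
    moreover have "dz_wedge z s (?d - s) (map (push X (\<lambda>y. y) x) vs) = dz_wedge z s (?d - s) vs"
    proof -
      have "push X (\<lambda>y. y) x v (\<lambda>q. z q (s + i)) = v (\<lambda>q. z q (s + i))" for v i
        using hol_fun_at_coord[OF X c xS(1)[OF x'(1)], of "s + i"] by (simp add: push_def)
      then show ?thesis unfolding dz_wedge_def using tlists_length[OF vs]
        by (intro arg_cong[where f = Determinant.det] eq_matI) auto
    qed
    moreover have "residue_map X s L L' \<mu> \<tau> \<sigma> x vs = g x * dz_wedge z' s (?d - s) vs"
      using adjunction_map_local[OF \<sigma>'(2,3) U'(1) x'(2) g vs] \<sigma> by (simp add: residue_map_def)
    ultimately show ?thesis using nz unfolding F_def by (simp add: field_simps)
  qed
  have hol: "hol_fun (prod_mfd (Cn_mfd k) X)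
              {(c, x). c \<in> Cn k \<and> tuple_affine X s L \<rho> T c k \<in> N \<and> x \<in> S \<inter> V}
              (\<lambda>(c, x). F (tuple_affine X s L \<rho> T c k) x (map (coord_vec X (V, \<phi>) x) ks))"
    if V: "(V, \<phi>) \<in> atlas X" and ks: "length ks = ?d - s" "set ks \<subseteq> {..<?d}"
      and \<rho>: "\<rho> \<in> sec_tuples X s L" and T: "\<And>j. j < k ==> T j \<in> sec_tuples X s L" for V \<phi> ks k \<rho> and T :: "nat => nat => 'x => 'l"
  proof -
    let ?P = "prod_mfd (Cn_mfd k) X"
    let ?Q = "{(c, x). c \<in> Cn k \<and> tuple_affine X s L \<rho> T c k \<in> N \<and> x \<in> S \<inter> V}"
    note P = charted_prod[OF charted_Cn X, of k]
    note V' = atlas_hol_chart[OF X V]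
    let ?C = "{c \<in> Cn k. tuple_affine X s L \<rho> T c k \<in> N}"
    have QC: "?Q = ?C \<times> (S \<inter> V)" by auto
    have C: "openin (top_of_set (Cn k)) ?C" by (rule affine_openD(3)[OF N(1) \<rho> T])
    have SV: "openin (mtop X) (S \<inter> V)" using S(1) hol_chartD(1)[OF V'] by blast
    have Q: "openin (mtop ?P) ?Q" unfolding QC by (simp add: openin_prod_Times_iff C SV)
    define M where "M i j cx = coord_vec X (U, z) (snd cx) j (\<lambda>x. ts i x (\<rho> i x))
        + (\<Sum>l<k. fst cx l * coord_vec X (U, z) (snd cx) j (\<lambda>x. ts i x (T l i x)))" for i j and cx :: "(nat => complex) \<times> 'x"
    define H where "H cx = top_coef X (U, z) t \<tau> (snd cx) / (b (snd cx) * det_of s (\<lambda>i j. M i j cx))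
       * dz_wedge z s (?d - s) (map (coord_vec X (V, \<phi>) (snd cx)) ks)" for cx
    have jacM: "sec_jac X s (U, z) ts (tuple_affine X s L \<rho> T c k) x = det_of s (\<lambda>i j. M i j (c, x))"
      if "x \<in> S" for c x
      unfolding M_def fst_conv snd_conv by (rule sec_jac_affine[OF c xS(1)[OF that] tsi(1) xS(3)[OF that] \<rho> T])
    have "hol_fun_at ?P H (a, x)" if ax: "(a, x) \<in> ?Q" for a x
    proof -
      have aC: "a \<in> Cn k" "tuple_affine X s L \<rho> T a k \<in> N" and x: "x \<in> S" "x \<in> V" using ax by auto
      have xX: "x \<in> pts X" by (rule hol_chart_sub[OF V' x(2)])
      have pP: "(a, x) \<in> pts ?P" using aC xX by simp
      have "a \<in> pts (Cn_mfd k)" using aC by simp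
      note f1 = hol_at_fst[OF charted_Cn X this xX] and f2 = hol_at_snd[OF charted_Cn X this xX]
      have pull: "hol_fun_at ?P (\<lambda>cx. f (snd cx)) (a, x)" if "hol_fun_at X f x" for f
        by (rule hol_at_pull[OF f2]) (use that in simp)
      have co: "hol_fun_at ?P (\<lambda>cx. fst cx l) (a, x)" for l
        by (rule hol_at_pull[OF f1]) (use Cn_mfd_coord[OF aC(1)] in simp)
      have cv: "hol_fun_at X (\<lambda>x. coord_vec X (U, z) x j (\<lambda>x. ts i x (\<sigma> i x))) x"
        if "i < s" "j < s" "\<sigma> \<in> sec_tuples X s L" for i j \<sigma>
      proof (rule hol_fun_at_coord_vec[OF X c xS(1)[OF x(1)]])
        show "j < ?d" using that sd by simp
        show "hol_fun_at X (\<lambda>x. ts i x (\<sigma> i x)) x"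
          by (rule H0_at[OF sec_H0[OF that(3,1)] tsi(1)[OF that(1)] xS(3)[OF x(1) that(1)] xX])
      qed
      have "hol_fun_at ?P (M i j) (a, x)" if "i < s" "j < s" for i j
        unfolding M_def[abs_def]
        by (intro hol_fun_at_add[OF P] hol_fun_at_sum[OF P pP] hol_fun_at_mult[OF P] co pull cv that \<rho> T) simp
      then have Dh: "hol_fun_at ?P (\<lambda>cx. det_of s (\<lambda>i j. M i j cx)) (a, x)"
        by (rule hol_fun_at_det[OF P pP])
      have "hol_fun_at X b x" by (rule hol_fun_imp_at[OF b(1) xS(4)[OF x(1)]])
      then have bh: "hol_fun_at ?P (\<lambda>cx. b (snd cx)) (a, x)" by (rule pull)
      have "hol_fun_at X (top_coef X (U, z) t \<tau>) x" unfolding top_coef_def[abs_def]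
        by (rule plus_K_hol[OF X \<tau> t(2) xS(2)[OF x(1)] lb_trivs(1)[OF lb' t(2)] c xS(1)[OF x(1)]])
      then have th: "hol_fun_at ?P (\<lambda>cx. top_coef X (U, z) t \<tau> (snd cx)) (a, x)" by (rule pull)
      have "hol_fun_at X (\<lambda>x. dz_wedge z s (?d - s) (map (coord_vec X (V, \<phi>) x) ks)) x"
        by (rule hol_fun_at_dz_wedge_coord[OF X V' x(2) c xS(1)[OF x(1)] ks])
      then have zh: "hol_fun_at ?P (\<lambda>cx. dz_wedge z s (?d - s) (map (coord_vec X (V, \<phi>) (snd cx)) ks)) (a, x)" by (rule pull)
      have "b x \<noteq> 0" using bspec[OF b(2) xS(4)[OF x(1)]] by blast
      moreover have "det_of s (\<lambda>i j. M i j (a, x)) \<noteq> 0"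
        using jac aC(2) x(1) jacM[OF x(1), of a] by metis
      ultimately have "b (snd (a, x)) * det_of s (\<lambda>i j. M i j (a, x)) \<noteq> 0" by simp
      then show ?thesis unfolding H_def[abs_def]
        by (intro hol_fun_at_mult[OF P _ zh] hol_fun_at_divide[OF P th] hol_fun_at_mult[OF P bh Dh])
    qed
    then have at: "hol_fun_at ?P H q" if "q \<in> ?Q" for q using that by (cases q) blast
    show ?thesis unfolding hol_fun_iff_at[OF P]
    proof (intro conjI Q ballI)
      fix q assume q: "q \<in> ?Q"
      show "hol_fun_at ?P (\<lambda>(c, x). F (tuple_affine X s L \<rho> T c k) x (map (coord_vec X (V, \<phi>) x) ks)) q"
      proof (rule hol_fun_at_cong[OF P Q q _ at[OF q]])
        fix q' assume "q' \<in> ?Q"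
        then obtain c x where q': "q' = (c, x)" "x \<in> S" by blast
        show "H q' = (case q' of (c, x) => F (tuple_affine X s L \<rho> T c k) x (map (coord_vec X (V, \<phi>) x) ks))"
          unfolding q'(1) prod.case F_def H_def snd_conv jacM[OF q'(2)] ..
      qed
    qed
  qed
  show "\<exists>N S F.
       openin (tuple_topology X s L) N \<and> \<sigma>0 \<in> N \<and> openin (mtop X) S \<and> p \<in> S
     \<and> (\<forall>\<sigma>\<in>N \<inter> smooth_tuples X s L. \<forall>x\<in>S \<inter> zero_locus X s L \<sigma>.
          \<forall>vs\<in>tlists (ci_mfd X s L \<sigma>) (mdim X - s) x. residue_map X s L L' \<mu> \<tau> \<sigma> x vs = F \<sigma> x (map (push X (\<lambda>y. y) x) vs))
     \<and> (\<forall>\<sigma>\<in>N. \<forall>x\<in>S. alt_form X (mdim X - s) x (F \<sigma> x))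
     \<and> (\<forall>(U, \<phi>)\<in>atlas X. \<forall>ks. length ks = mdim X - s \<and> set ks \<subseteq> {..<mdim X} -->
          (\<forall>k T. \<forall>\<rho>\<in>sec_tuples X s L. (\<forall>j<k. T j \<in> sec_tuples X s L) -->
            hol_fun (prod_mfd (Cn_mfd k) X)
              {(c, x). c \<in> Cn k \<and> tuple_affine X s L \<rho> T c k \<in> N \<and> x \<in> S \<inter> U}
              (\<lambda>(c, x). F (tuple_affine X s L \<rho> T c k) x (map (coord_vec X (U, \<phi>) x) ks))))"
  proof (intro exI[of _ N] exI[of _ S] exI[of _ F] conjI)
    show "openin (tuple_topology X s L) N" by (rule affine_openD(1)[OF N(1)])
    show "\<sigma>0 \<in> N" "openin (mtop X) S" "p \<in> S" by (fact N(2) S(1) S(2))+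
    show "\<forall>\<sigma>\<in>N \<inter> smooth_tuples X s L. \<forall>x\<in>S \<inter> zero_locus X s L \<sigma>.
          \<forall>vs\<in>tlists (ci_mfd X s L \<sigma>) (mdim X - s) x. residue_map X s L L' \<mu> \<tau> \<sigma> x vs = F \<sigma> x (map (push X (\<lambda>y. y) x) vs)"
      by (intro ballI) (rule restr)
    show "\<forall>\<sigma>\<in>N. \<forall>x\<in>S. alt_form X (mdim X - s) x (F \<sigma> x)"
      unfolding F_def[abs_def] by (intro ballI alt_form_scale dz_wedge_alt)
    show "\<forall>(U, \<phi>)\<in>atlas X. \<forall>ks. length ks = mdim X - s \<and> set ks \<subseteq> {..<mdim X} -->
          (\<forall>k T. \<forall>\<rho>\<in>sec_tuples X s L. (\<forall>j<k. T j \<in> sec_tuples X s L) -->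
            hol_fun (prod_mfd (Cn_mfd k) X)
              {(c, x). c \<in> Cn k \<and> tuple_affine X s L \<rho> T c k \<in> N \<and> x \<in> S \<inter> U}
              (\<lambda>(c, x). F (tuple_affine X s L \<rho> T c k) x (map (coord_vec X (U, \<phi>) x) ks)))"
    proof (intro ballI)
      fix q assume q: "q \<in> atlas X"
      obtain V \<phi> where V: "q = (V, \<phi>)" by (cases q)
      then have "(V, \<phi>) \<in> atlas X" using q by simp
      then show "case q of (U, \<phi>) => \<forall>ks. length ks = mdim X - s \<and> set ks \<subseteq> {..<mdim X} -->
          (\<forall>k T. \<forall>\<rho>\<in>sec_tuples X s L. (\<forall>j<k. T j \<in> sec_tuples X s L) -->
            hol_fun (prod_mfd (Cn_mfd k) X)
              {(c, x). c \<in> Cn k \<and> tuple_affine X s L \<rho> T c k \<in> N \<and> x \<in> S \<inter> U}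
              (\<lambda>(c, x). F (tuple_affine X s L \<rho> T c k) x (map (coord_vec X (U, \<phi>) x) ks)))"
        unfolding V prod.case by (intro allI impI ballI hol) auto
    qed
  qed
qed

end

section \<open>Residues of meromorphic forms, and injectivity\<close>

context bundle_data
begin

text \<open>The point p is in the closure of the set where no z_i vanishes, because there are such points in every
  coordinate box around p.\<close>

lemma hol_fun_zero_off_divisor:
  assumes \<sigma>: "\<sigma> \<in> sec_tuples X s L" and a: "adapted X s L \<sigma> U z e" and p: "p \<in> U" "p \<in> zero_locus X s L \<sigma>"
    and f: "hol_fun_at X f p" and z: "\<And>x. x \<in> U ==> (\<And>i. i < s ==> z x i \<noteq> 0) ==> f x = 0"
  shows "f p = 0"
proof (rule ccontr)
  assume "f p \<noteq> 0"
  then have "f p \<in> - {0}" by simp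
  from hol_fun_at_nbhd[OF X f _ this]
  obtain S where S: "openin (mtop X) S" "p \<in> S" "\<forall>q\<in>S. f q \<in> - {0}" by auto
  note c = adapted_chart[OF a]
  have "z p \<in> z ` (U \<inter> S)" using p S by blast
  from openin_Cn_box[OF hol_chartD(5)[OF c S(1)] this]
  obtain r where r: "r > 0" "\<forall>w\<in>Cn (mdim X). (\<forall>i<mdim X. norm (w i - z p i) < r) --> w \<in> z ` (U \<inter> S)" by blast
  \<comment> \<open>inside the box of radius r around z p, and off all divisors\<close>
  define w where "w i = (if i < s then of_real (r / 2) else z p i)" for i
  have zp: "z p i = 0" if "i < s" for i using zero_locus_iff[OF \<sigma> a p(1)] p(2) that by blast
  have "w \<in> Cn (mdim X)" using hol_chartD(4)[OF c p(1)] sd by (auto simp: w_def Cn_def)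
  moreover have "norm (w i - z p i) < r" for i using r(1) zp by (simp add: w_def)
  ultimately have "w \<in> z ` (U \<inter> S)" using r(2) by blast
  then obtain q where q: "w = z q" "q \<in> U" "q \<in> S" by blast
  have "z q i \<noteq> 0" if i: "i < s" for i
  proof -
    have "z q i = of_real (r / 2)" using fun_cong[OF q(1), of i] i by (simp add: w_def)
    moreover have "(of_real (r / 2) :: complex) \<noteq> 0" using r(1) by simp
    ultimately show ?thesis by (simp only: not_False_eq_True)
  qed
  then have "f q = 0" by (rule z[OF q(2)])
  then show False using S(3) q(3) by blast
qed

text \<open>If a form has simple poles with the coefficient of \<tau> divided by c, then its residue is the adjunction image of
  \<tau> divided by c. Any two adapted descriptions of the form agree where no adapted coordinate vanishes, hence
  also on the complete intersection, so the residue does not depend on them.\<close>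

lemma residue_of_form:
  assumes \<sigma>: "\<sigma> \<in> smooth_tuples X s L" and \<tau>: "\<tau> \<in> H0 X (plus_K X L')" and c0: "c \<noteq> 0"
    and \<beta>: "\<And>U z e g x us. adj_local X s L L' \<mu> \<sigma> \<tau> U z e g ==> x \<in> U ==> (\<forall>i<s. z x i \<noteq> 0)
        ==> us \<in> tlists X (mdim X) x ==> \<beta> x us = g x / c / (\<Prod>i<s. z x i) * dz_wedge z 0 (mdim X) us"
  shows "adjunction_map X s L L' \<mu> \<sigma> \<tau> = (\<lambda>p vs. c * poincare_residue X s L \<sigma> \<beta> p vs)"
proof (intro ext)
  fix p vs
  let ?d = "mdim X" and ?Y = "ci_mfd X s L \<sigma>" and ?A = "adjunction_map X s L L' \<mu> \<sigma> \<tau>"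
  have st: "\<sigma> \<in> sec_tuples X s L" and sm: "smooth_ci X s L \<sigma>" using \<sigma> by (simp_all add: smooth_tuples_def)
  show "?A p vs = c * poincare_residue X s L \<sigma> \<beta> p vs"
  proof (cases "p \<in> pts ?Y \<and> vs \<in> tlists ?Y (?d - s) p")
    case False
    have "?A p vs = 0" unfolding adjunction_map_def Let_def using False by (rule if_not_P)
    moreover have "poincare_residue X s L \<sigma> \<beta> p vs = 0" unfolding poincare_residue_def Let_def using False by (rule if_not_P)
    ultimately show ?thesis by simp
  next
    case True
    then have p: "p \<in> zero_locus X s L \<sigma>" and vs: "vs \<in> tlists ?Y (?d - s) p" unfolding ci_mfd_simps(3) by blast+
    let ?P = "\<lambda>a. \<exists>U z e g. p \<in> U \<and> adapted X s L \<sigma> U z e \<and> hol_fun X U g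
        \<and> (\<forall>x\<in>U. (\<forall>i<s. z x i \<noteq> 0) --> (\<forall>us\<in>tlists X ?d x.
              \<beta> x us = g x / (\<Prod>i<s. z x i) * dz_wedge z 0 ?d us))
        \<and> a = g p * dz_wedge z s (?d - s) vs"
    have "(THE a. ?P a) = ?A p vs / c"
    proof (rule the_equality)
      obtain U z e where U: "p \<in> U" "adapted X s L \<sigma> U z e" using smooth_adapted[OF sm p] by blast
      obtain g where g: "adj_local X s L L' \<mu> \<sigma> \<tau> U z e g" using adj_local_ex[OF st U(2) \<tau>] by blast
      have gh: "hol_fun X U g" using g by (simp add: adj_local_def)
      have "hol_fun X U (\<lambda>x. g x * inverse c)"
        unfolding hol_fun_iff_at[OF X]
      proof (intro conjI ballI)
        show "openin (mtop X) U" by (rule hol_chartD(1)[OF adapted_chart[OF U(2)]])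
        fix x assume x: "x \<in> U"
        show "hol_fun_at X (\<lambda>x. g x * inverse c) x"
          by (rule hol_fun_at_mult[OF X hol_fun_imp_at[OF gh x] hol_fun_at_const[OF X hol_chart_sub[OF adapted_chart[OF U(2)] x]]])
      qed
      then have "hol_fun X U (\<lambda>x. g x / c)" by (simp only: divide_inverse)
      moreover have "?A p vs / c = g p / c * dz_wedge z s (?d - s) vs"
        using adjunction_map_local[OF st sm U(1) p g vs] by simp
      ultimately show "?P (?A p vs / c)"
        using U \<beta>[OF g] by (intro exI[of _ U] exI[of _ z] exI[of _ e] exI[of _ "\<lambda>x. g x / c"] conjI) simp_all
    next
      fix r assume "?P r"
      then obtain U z e g where U: "p \<in> U" "adapted X s L \<sigma> U z e" and gh: "hol_fun X U g"
        and b: "\<forall>x\<in>U. (\<forall>i<s. z x i \<noteq> 0) --> (\<forall>us\<in>tlists X ?d x. \<beta> x us = g x / (\<Prod>i<s. z x i) * dz_wedge z 0 ?d us)"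
        and r: "r = g p * dz_wedge z s (?d - s) vs" by blast
      obtain g' where g': "adj_local X s L L' \<mu> \<sigma> \<tau> U z e g'" using adj_local_ex[OF st U(2) \<tau>] by blast
      have gh': "hol_fun X U g'" using g' by (simp add: adj_local_def)
      note ch = adapted_chart[OF U(2)]
      have "g p + (- inverse c) * g' p = 0"
      proof (rule hol_fun_zero_off_divisor[OF st U(2,1) p])
        show "hol_fun_at X (\<lambda>x. g x + (- inverse c) * g' x) p"
          by (intro hol_fun_at_add[OF X] hol_fun_at_mult[OF X] hol_fun_at_const[OF X zero_locus_pts[OF p]]
              hol_fun_imp_at[OF gh U(1)] hol_fun_imp_at[OF gh' U(1)])
        fix x assume x: "x \<in> U" and nz: "\<And>i. i < s ==> z x i \<noteq> 0"
        let ?us = "map (coord_vec X (U, z) x) [0..<?d]"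
        have us: "?us \<in> tlists X ?d x" by (rule coord_tlists[OF X ch x])
        have "\<beta> x ?us = g x / (\<Prod>i<s. z x i)" using b x nz us dz_wedge_coord[OF X ch x] by simp
        moreover have "\<beta> x ?us = g' x / c / (\<Prod>i<s. z x i)" using \<beta>[OF g' x _ us] nz dz_wedge_coord[OF X ch x] by simp
        moreover have "(\<Prod>i<s. z x i) \<noteq> 0" using nz by simp
        ultimately have "g x = g' x / c" by (metis divide_cancel_right)
        then show "g x + (- inverse c) * g' x = 0" by (simp add: field_simps)
      qed
      then have "g p = g' p / c" by (simp add: field_simps)
      then show "r = ?A p vs / c" using r adjunction_map_local[OF st sm U(1) p g' vs] by simp
    qed
    then have "poincare_residue X s L \<sigma> \<beta> p vs = ?A p vs / c"
      unfolding poincare_residue_def Let_def using True by simp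
    then show ?thesis using c0 by simp
  qed
qed

text \<open>Sections with equal residues agree on all complete intersections, and two holomorphic coefficients that agree on
  a dense set are equal.\<close>

lemma residue_map_inj:
  assumes dense: "mtop X closure_of (\<Union>\<sigma>\<in>smooth_tuples X s L. zero_locus X s L \<sigma>) = pts X"
  shows "inj_on (residue_map X s L L' \<mu>) (H0 X (plus_K X L'))"
proof (rule inj_onI, rule ext)
  fix \<tau> \<tau>' x
  assume \<tau>: "\<tau> \<in> H0 X (plus_K X L')" "\<tau>' \<in> H0 X (plus_K X L')"
    and eq: "residue_map X s L L' \<mu> \<tau> = residue_map X s L L' \<mu> \<tau>'"
  let ?d = "mdim X"
  have agree: "\<tau> q = \<tau>' q" if "\<sigma> \<in> smooth_tuples X s L" "q \<in> zero_locus X s L \<sigma>" for \<sigma> q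
  proof (rule adjunction_map_injective_at[OF that(1) \<tau> _ that(2)])
    show "adjunction_map X s L L' \<mu> \<sigma> \<tau> = adjunction_map X s L L' \<mu> \<sigma> \<tau>'"
      using fun_cong[OF eq, of \<sigma>] that(1) by (simp add: residue_map_def)
  qed
  show "\<tau> x = \<tau>' x"
  proof (cases "x \<in> pts X")
    case False
    then show ?thesis using \<tau> by (simp add: H0_def)
  next
    case x: True
    obtain V z where V: "hol_chart X (V, z)" "x \<in> V" using chart_ex[OF X x] by blast
    obtain W t where t: "(W, t) \<in> trivs L'" "x \<in> W" using lb_trivs(3)[OF lb' x] by blast
    note Wo = lb_trivs(1)[OF lb' t(1)]
    let ?f = "\<lambda>q. top_coef X (V, z) t \<tau> q + (- 1) * top_coef X (V, z) t \<tau>' q"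
    have h: "hol_fun_at X ?f x" unfolding top_coef_def
      by (intro hol_fun_at_add[OF X] hol_fun_at_mult[OF X] hol_fun_at_const[OF X x] plus_K_hol[OF X \<tau>(1) t Wo V] plus_K_hol[OF X \<tau>(2) t Wo V])
    have "?f x = 0"
    proof (rule ccontr)
      assume "?f x \<noteq> 0"
      then have "?f x \<in> - {0}" by simp
      from hol_fun_at_nbhd[OF X h _ this]
      obtain S where S: "openin (mtop X) S" "x \<in> S" "\<forall>q\<in>S. ?f q \<in> - {0}" by auto
      have "x \<in> mtop X closure_of (\<Union>\<sigma>\<in>smooth_tuples X s L. zero_locus X s L \<sigma>)" unfolding dense by (rule x)
      then obtain q where q: "q \<in> (\<Union>\<sigma>\<in>smooth_tuples X s L. zero_locus X s L \<sigma>)" "q \<in> S"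
        using S(1,2) unfolding in_closure_of by blast
      then have "\<tau> q = \<tau>' q" using agree by blast
      then have "?f q = 0" by (simp add: top_coef_def)
      then show False using S(3) q(2) by blast
    qed
    then have co: "top_coef X (V, z) t \<tau> x = top_coef X (V, z) t \<tau>' x" by simp
    show ?thesis
    proof
      fix us show "\<tau> x us = \<tau>' x us"
      proof (cases "us \<in> tlists X ?d x")
        case True
        show ?thesis
        proof (rule lb_eqI[OF lb' t plus_K_fib(1)[OF \<tau>(1) x True] plus_K_fib(1)[OF \<tau>(2) x True]])
          show "t x (\<tau> x us) = t x (\<tau>' x us)"
            using plus_K_chart[OF X \<tau>(1) t V True] plus_K_chart[OF X \<tau>(2) t V True] co unfolding top_coef_def by simp
        qed
      next
        case False
        then show ?thesis using plus_K_fib(3)[OF \<tau>(1) x] plus_K_fib(3)[OF \<tau>(2) x] by simp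
      qed
    qed
  qed
qed

end

section \<open>Holomorphic functions on compact connected manifolds\<close>

lemma hol_fun_continuous_map:
  assumes X: "charted X" and f: "\<And>p. p \<in> pts X ==> hol_fun_at X f p"
  shows "continuous_map (mtop X) euclidean f"
  unfolding continuous_map_def
proof (intro conjI allI impI)
  fix V :: "complex set" assume "openin euclidean V"
  then have V: "open V" by simp
  show "openin (mtop X) {x \<in> pts X. f x \<in> V}"
  proof (subst openin_subopen, intro ballI)
    fix p assume p: "p \<in> {x \<in> pts X. f x \<in> V}"
    then have "hol_fun_at X f p" "f p \<in> V" using f by simp_all
    from hol_fun_at_nbhd[OF X this(1) V this(2)]
    obtain S where S: "openin (mtop X) S" "p \<in> S" "\<forall>q\<in>S. f q \<in> V" by blast
    show "\<exists>T. openin (mtop X) T \<and> p \<in> T \<and> T \<subseteq> {x \<in> pts X. f x \<in> V}"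
      using S openin_subset[OF S(1)] by (intro exI[of _ S]) auto
  qed
qed simp

text \<open>The maximum principle on the complex line joining p to a nearby point in a chart.\<close>

lemma hol_fun_max_locally_constant:
  assumes X: "charted X" and f: "\<And>q. q \<in> pts X ==> hol_fun_at X f q" and p: "p \<in> pts X"
    and max: "\<And>q. q \<in> pts X ==> norm (f q) \<le> norm (f p)"
  shows "\<exists>S. openin (mtop X) S \<and> p \<in> S \<and> (\<forall>q\<in>S. f q = f p)"
proof -
  let ?d = "mdim X"
  obtain U z where U: "hol_chart X (U, z)" "p \<in> U" using chart_ex[OF X p] by blast
  have zp: "z p \<in> z ` U" using U(2) by blast
  obtain r where r: "r > 0" "\<forall>w\<in>Cn ?d. (\<forall>i<?d. norm (w i - z p i) < r) --> w \<in> z ` U"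
    using openin_Cn_box[OF hol_chartD(2)[OF U(1)] zp] by blast
  have box: "openin (top_of_set (Cn ?d)) {w \<in> Cn ?d. \<forall>i<?d. norm (w i - z p i) < r / 2}"
  proof -
    have "open {w :: nat => complex. \<forall>i<?d. norm (w i - z p i) < r / 2}" by (rule open_coord_box)
    then have "openin (top_of_set (Cn ?d)) (Cn ?d \<inter> {w. \<forall>i<?d. norm (w i - z p i) < r / 2})" by (rule openin_open_Int)
    then show ?thesis by (simp add: Int_def)
  qed
  let ?S = "{q \<in> U. z q \<in> {w \<in> Cn ?d. \<forall>i<?d. norm (w i - z p i) < r / 2}}"
  have "f q = f p" if q: "q \<in> ?S" for q
  proof -
    define c where "c t = (\<lambda>i. z p i + t * (z q i - z p i))" for t :: complex
    define g where "g t = f (inv_into U z (c t))" for t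
    have zC: "z p \<in> Cn ?d" "z q \<in> Cn ?d" using hol_chartD(4)[OF U(1)] U(2) q by simp_all
    have cC: "c t \<in> Cn ?d" for t using zC by (auto simp: c_def Cn_def)
    have cU: "c t \<in> z ` U" if t: "t \<in> ball 0 2" for t
    proof (rule r(2)[rule_format, OF cC])
      fix i assume i: "i < ?d"
      have n: "norm (z q i - z p i) < r / 2" using q i by simp
      have "norm (c t i - z p i) = norm t * norm (z q i - z p i)" by (simp add: c_def norm_mult)
      also have "\<dots> \<le> 2 * norm (z q i - z p i)" using t by (intro mult_right_mono) auto
      also have "\<dots> < r" using n by simp
      finally show "norm (c t i - z p i) < r" .
    qed
    have gd: "g field_differentiable at t" if t: "t \<in> ball 0 2" for t
    proof -
      have w: "inv_into U z (c t) \<in> U" by (rule inv_into_into[OF cU[OF t]])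
      have "hol_near ?d (\<lambda>w. f (inv_into U z w)) (z (inv_into U z (c t)))"
        using f[OF hol_chart_sub[OF U(1) w]] hol_fun_at_chart[OF X U(1) w] by simp
      then have n: "hol_near ?d (\<lambda>w. f (inv_into U z w)) (c t)" by (simp add: f_inv_into_f[OF cU[OF t]])
      have "((\<lambda>t. f (inv_into U z (c t))) has_field_derivative
          (\<Sum>k<?d. pderiv_Cn k (\<lambda>w. f (inv_into U z w)) (c t) * (z q k - z p k))) (at t)"
      proof (rule cderiv_curve[where c = c, OF _ cC _ hol_near_cderiv[OF n]])
        show "\<forall>\<^sub>F t in at t. c t \<in> Cn ?d" by (simp add: cC)
        show "((\<lambda>t. c t k) has_field_derivative z q k - z p k) (at t)" for k
          unfolding c_def by (auto intro!: derivative_eq_intros)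
      qed
      then show ?thesis unfolding g_def[abs_def] field_differentiable_def by blast
    qed
    have hol: "g holomorphic_on ball 0 2"
      unfolding holomorphic_on_def using gd field_differentiable_at_within by blast
    have c0: "c 0 = z p" "c 1 = z q" by (simp_all add: c_def)
    have inv: "inv_into U z (z y) = y" if "y \<in> U" for y using that hol_chartD(3)[OF U(1)] by simp
    have g01: "g 0 = f p" "g 1 = f q" using inv[OF U(2)] inv[of q] q by (simp_all add: g_def c0)
    have "g constant_on ball 0 2"
    proof (rule maximum_modulus_principle[OF hol open_ball connected_ball open_ball order_refl])
      show "(0::complex) \<in> ball 0 2" by simp
      show "norm (g t) \<le> norm (g 0)" if "t \<in> ball 0 2" for t
        unfolding g01(1) unfolding g_def by (rule max[OF hol_chart_sub[OF U(1) inv_into_into[OF cU[OF that]]]])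
    qed
    then obtain k where k: "\<And>t. t \<in> ball 0 2 ==> g t = k" unfolding constant_on_def by blast
    show ?thesis using k[of 0] k[of 1] g01 by simp
  qed
  moreover have "openin (mtop X) ?S" by (rule hol_chartD(6)[OF U(1) box])
  moreover have "p \<in> ?S" using U r(1) hol_chartD(4)[OF U] by simp
  ultimately show ?thesis by blast
qed

text \<open>The modulus attains its maximum, and the set where the value at such a point is taken is open and closed.\<close>

lemma compact_connected_constant:
  assumes X: "charted X" and f: "\<And>p. p \<in> pts X ==> hol_fun_at X f p"
    and comp: "compact_space (mtop X)" and conn: "connected_space (mtop X)" and ne: "pts X \<noteq> {}"
  shows "\<exists>c. \<forall>x\<in>pts X. f x = c"
proof -
  have fc: "continuous_map (mtop X) euclidean f" by (rule hol_fun_continuous_map[OF X f])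
  have "compactin euclidean (f ` pts X)"
    using image_compactin[OF _ fc, of "pts X"] comp by (simp add: compact_space_def)
  then have "compact (f ` pts X)" by simp
  then have "\<exists>y\<in>f ` pts X. \<forall>y'\<in>f ` pts X. norm y' \<le> norm y"
    using ne by (intro continuous_attains_sup continuous_on_norm continuous_on_id) auto
  then obtain p where p: "p \<in> pts X" "\<And>q. q \<in> pts X ==> norm (f q) \<le> norm (f p)" by blast
  let ?A = "{x \<in> pts X. f x \<in> {f p}}"
  have "closedin (mtop X) ?A" by (rule closedin_continuous_map_preimage[OF fc]) simp
  moreover have "openin (mtop X) ?A"
  proof (subst openin_subopen, intro ballI)
    fix x assume x: "x \<in> ?A"
    then have xx: "x \<in> pts X" "f x = f p" by simp_all
    have "\<And>q. q \<in> pts X ==> norm (f q) \<le> norm (f x)" using p(2) xx(2) by simp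
    from hol_fun_max_locally_constant[OF X f xx(1) this]
    obtain S where S: "openin (mtop X) S" "x \<in> S" "\<forall>q\<in>S. f q = f x" by blast
    show "\<exists>T. openin (mtop X) T \<and> x \<in> T \<and> T \<subseteq> ?A"
      using S openin_subset[OF S(1)] xx(2) by (intro exI[of _ S]) auto
  qed
  ultimately have "?A = {} \<or> ?A = pts X" using conn unfolding connected_space_clopen_in by blast
  then have "?A = pts X" using p(1) by blast
  then show ?thesis by blast
qed

section \<open>Operations on alternating forms\<close>

lemma alt_form_pull:
  assumes a: "alt_form N k p' \<alpha>" and T: "\<And>v. v \<in> tspace M p ==> T v \<in> tspace N p'"
    and lin: "\<And>u w a b. T (\<lambda>f. a * u f + b * w f) = (\<lambda>f. a * T u f + b * T w f)"
  shows "alt_form M k p (\<lambda>vs. \<alpha> (map T vs))"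
  unfolding alt_form_def
proof (intro conjI ballI allI impI)
  have Tt: "map T vs \<in> tlists N k p'" if "vs \<in> tlists M k p" for vs
    using that T by (auto simp: tlists_def subset_iff)
  fix vs i u w and c d :: complex
  assume h: "vs \<in> tlists M k p" "i < k" "u \<in> tspace M p" "w \<in> tspace M p"
  have "\<alpha> ((map T vs)[i := \<lambda>f. c * T u f + d * T w f]) = c * \<alpha> ((map T vs)[i := T u]) + d * \<alpha> ((map T vs)[i := T w])"
    using a Tt[OF h(1)] h(2) T[OF h(3)] T[OF h(4)] unfolding alt_form_def by blast
  then show "\<alpha> (map T (vs[i := \<lambda>f. c * u f + d * w f])) = c * \<alpha> (map T (vs[i := u])) + d * \<alpha> (map T (vs[i := w]))"
    by (simp only: map_update lin)
next
  fix vs i j assume h: "vs \<in> tlists M k p" "i < k" "j < k" "i \<noteq> j \<and> vs ! i = vs ! j"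
  have "map T vs \<in> tlists N k p'" using h(1) T by (auto simp: tlists_def subset_iff)
  moreover have "map T vs ! i = map T vs ! j" using h tlists_length[OF h(1)] by simp
  ultimately show "\<alpha> (map T vs) = 0" using a h unfolding alt_form_def by blast
qed

lemma alt_form_append_left:
  assumes a: "alt_form M (k + l) p \<alpha>" and ws: "ws \<in> tlists M l p"
  shows "alt_form M k p (\<lambda>vs. \<alpha> (vs @ ws))"
  unfolding alt_form_def
proof (intro conjI ballI allI impI)
  have t: "vs @ ws \<in> tlists M (k + l) p" if "vs \<in> tlists M k p" for vs
    using that ws by (auto simp: tlists_def)
  fix vs i u w and c d :: complex
  assume h: "vs \<in> tlists M k p" "i < k" "u \<in> tspace M p" "w \<in> tspace M p"
  have up: "(vs @ ws)[i := v] = vs[i := v] @ ws" for v using h(2) tlists_length[OF h(1)] by (simp add: list_update_append)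
  have "i < k + l" using h(2) by simp
  then have "\<alpha> ((vs @ ws)[i := \<lambda>f. c * u f + d * w f]) = c * \<alpha> ((vs @ ws)[i := u]) + d * \<alpha> ((vs @ ws)[i := w])"
    using a t[OF h(1)] h(3,4) unfolding alt_form_def by blast
  then show "\<alpha> (vs[i := \<lambda>f. c * u f + d * w f] @ ws) = c * \<alpha> (vs[i := u] @ ws) + d * \<alpha> (vs[i := w] @ ws)"
    unfolding up .
next
  fix vs i j assume h: "vs \<in> tlists M k p" "i < k" "j < k" "i \<noteq> j \<and> vs ! i = vs ! j"
  have t: "vs @ ws \<in> tlists M (k + l) p" using h(1) ws by (auto simp: tlists_def)
  have e: "(vs @ ws) ! i = (vs @ ws) ! j" using h tlists_length[OF h(1)] by (simp add: nth_append)
  have "i < k + l" "j < k + l" using h by simp_all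
  then show "\<alpha> (vs @ ws) = 0" using a t e h(4) unfolding alt_form_def by blast
qed

lemma alt_form_rev:
  assumes a: "alt_form M k p \<alpha>" shows "alt_form M k p (\<lambda>vs. \<alpha> (rev vs))"
  unfolding alt_form_def
proof (intro conjI ballI allI impI)
  fix vs i u w and c d :: complex
  assume h: "vs \<in> tlists M k p" "i < k" "u \<in> tspace M p" "w \<in> tspace M p"
  have t: "rev vs \<in> tlists M k p" using h(1) by (simp add: tlists_def)
  have up: "(rev vs)[k - 1 - i := v] = rev (vs[i := v])" for v
    using h(2) tlists_length[OF h(1)] by (simp add: rev_update)
  have "k - 1 - i < k" using h(2) by simp
  then have "\<alpha> ((rev vs)[k - 1 - i := \<lambda>f. c * u f + d * w f]) = c * \<alpha> ((rev vs)[k - 1 - i := u]) + d * \<alpha> ((rev vs)[k - 1 - i := w])"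
    using a t h(3,4) unfolding alt_form_def by blast
  then show "\<alpha> (rev (vs[i := \<lambda>f. c * u f + d * w f])) = c * \<alpha> (rev (vs[i := u])) + d * \<alpha> (rev (vs[i := w]))"
    unfolding up .
next
  fix vs i j assume h: "vs \<in> tlists M k p" "i < k" "j < k" "i \<noteq> j \<and> vs ! i = vs ! j"
  have t: "rev vs \<in> tlists M k p" using h(1) by (simp add: tlists_def)
  have e: "rev vs ! (k - 1 - i) = rev vs ! (k - 1 - j)" using h tlists_length[OF h(1)] by (simp add: rev_nth)
  have "k - 1 - i < k" "k - 1 - j < k" "k - 1 - i \<noteq> k - 1 - j" using h by auto
  then show "\<alpha> (rev vs) = 0" using a t e unfolding alt_form_def by blast
qed

section \<open>Local biholomorphisms\<close>

lemma push_tspace_at: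
  assumes "charted M" "charted N" "openin (mtop M) S" "\<And>q. q \<in> S ==> hol_at M N F q" "p \<in> S" "v \<in> tspace M p"
  shows "push N F p v \<in> tspace N (F p)"
proof (rule push_tspace[OF assms(1,2) _ assms(5,6)])
  show "hol_map M N S F" using assms(3,4) by (simp add: hol_map_iff[OF assms(1,2)])
qed

text \<open>With coordinate vectors and coordinate functions on both sides, the trace of the identity of the
  tangent space is computed in two ways.\<close>

lemma biholomorphic_dim:
  assumes A: "charted A" and B: "charted B"
    and F: "openin (mtop A) S" "\<And>a. a \<in> S ==> hol_at A B F a"
    and G: "openin (mtop B) T" "\<And>b. b \<in> T ==> hol_at B A G b"
    and p: "p \<in> S" "F p \<in> T" and GF: "\<And>a. a \<in> S ==> G (F a) = a" and FG: "\<And>b. b \<in> T ==> F (G b) = b"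
  shows "mdim A = mdim B"
proof -
  have pA: "p \<in> pts A" using openin_subset[OF F(1)] p(1) by blast
  have qB: "F p \<in> pts B" using openin_subset[OF G(1)] p(2) by blast
  obtain U \<kappa> where U: "hol_chart A (U, \<kappa>)" "p \<in> U" using chart_ex[OF A pA] by blast
  obtain V \<phi> where V: "hol_chart B (V, \<phi>)" "F p \<in> V" using chart_ex[OF B qB] by blast
  let ?a = "mdim A" and ?b = "mdim B"
  let ?e = "coord_vec A (U, \<kappa>) p" and ?E = "coord_vec B (V, \<phi>) (F p)"
  have GFp: "G (F p) = p" by (rule GF[OF p(1)])
  have hG: "hol_at B A G (F p)" by (rule G(2)[OF p(2)])
  have hF: "hol_at A B F (G (F p))" using F(2)[OF p(1)] GFp by simp
  have i: "(\<Sum>k<?b. push B F p (?e i) (\<lambda>q. \<phi> q k) * push A G (F p) (?E k) (\<lambda>q. \<kappa> q i)) = 1" if i: "i < ?a" for i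
  proof -
    have e: "?e i \<in> tspace A p" by (rule coord_vec_tspace[OF A U i])
    have Fe: "push B F p (?e i) \<in> tspace B (F p)" by (rule push_tspace_at[OF A B F p(1) e])
    have "push A G (F p) (push B F p (?e i)) = push A (\<lambda>a. G (F a)) p (?e i)" by (rule push_push[where N = B and K = A and G = G and F = F and p = p, OF hG])
    also have "\<dots> = push A (\<lambda>a. a) p (?e i)" by (rule push_cong[OF A e F(1) p(1) GF])
    also have "\<dots> = ?e i" by (rule push_id[OF e])
    finally have "?e i (\<lambda>q. \<kappa> q i) = push A G (F p) (push B F p (?e i)) (\<lambda>q. \<kappa> q i)" by simp
    also have "push B F p (?e i) = (\<lambda>f. \<Sum>k<?b. push B F p (?e i) (\<lambda>q. \<phi> q k) * ?E k f)"
      by (rule tspace_expand[OF B V Fe])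
    also have "push A G (F p) \<dots> = (\<lambda>f. \<Sum>k<?b. push B F p (?e i) (\<lambda>q. \<phi> q k) * push A G (F p) (?E k) f)"
      by (rule push_sum)
    finally show ?thesis using coord_vec_dual[OF A U i, of i] by simp
  qed
  have k: "(\<Sum>i<?a. push A G (F p) (?E k) (\<lambda>q. \<kappa> q i) * push B F p (?e i) (\<lambda>q. \<phi> q k)) = 1" if k: "k < ?b" for k
  proof -
    have E: "?E k \<in> tspace B (F p)" by (rule coord_vec_tspace[OF B V k])
    have GE: "push A G (F p) (?E k) \<in> tspace A p" using push_tspace_at[OF B A G p(2) E] GFp by simp
    have "push B F (G (F p)) (push A G (F p) (?E k)) = push B (\<lambda>b. F (G b)) (F p) (?E k)" by (rule push_push[where N = A and K = B and G = F and F = G and p = "F p", OF hF])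
    also have "\<dots> = push B (\<lambda>b. b) (F p) (?E k)" by (rule push_cong[OF B E G(1) p(2) FG])
    also have "\<dots> = ?E k" by (rule push_id[OF E])
    finally have "?E k (\<lambda>q. \<phi> q k) = push B F p (push A G (F p) (?E k)) (\<lambda>q. \<phi> q k)" using GFp by simp
    also have "push A G (F p) (?E k) = (\<lambda>f. \<Sum>i<?a. push A G (F p) (?E k) (\<lambda>q. \<kappa> q i) * ?e i f)"
      by (rule tspace_expand[OF A U GE])
    also have "push B F p \<dots> = (\<lambda>f. \<Sum>i<?a. push A G (F p) (?E k) (\<lambda>q. \<kappa> q i) * push B F p (?e i) f)"
      by (rule push_sum)
    finally show ?thesis using coord_vec_dual[OF B V k, of k] by simp
  qed
  have "(of_nat ?a :: complex) = (\<Sum>i<?a. \<Sum>k<?b. push B F p (?e i) (\<lambda>q. \<phi> q k) * push A G (F p) (?E k) (\<lambda>q. \<kappa> q i))"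
    using i by simp
  also have "\<dots> = (\<Sum>k<?b. \<Sum>i<?a. push A G (F p) (?E k) (\<lambda>q. \<kappa> q i) * push B F p (?e i) (\<lambda>q. \<phi> q k))"
    by (subst sum.swap) (simp add: mult.commute)
  also have "\<dots> = of_nat ?b" using k by simp
  finally show ?thesis by (simp only: of_nat_eq_iff)
qed

section \<open>Principal bundles\<close>

locale principal_bundle =
  fixes P :: "('g, 'h, 'm, 'x) pbundle"
  assumes epb: "equivariant_principal_bundle P"
begin

abbreviation "M \<equiv> total P"
abbreviation "X \<equiv> base P"
abbreviation "Hm \<equiv> Hmfd P"
abbreviation "H \<equiv> Hgrp P"
abbreviation "q \<equiv> mdim (Hmfd P)"
abbreviation "d \<equiv> mdim (base P)"
abbreviation "n \<equiv> mdim (total P)"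
abbreviation act :: "'m => 'h => 'm" (infixl "\<star>" 70) where "m \<star> h \<equiv> ract P m h"
abbreviation "pr \<equiv> proj P"

lemma charted [simp]: "charted M" "charted X" "charted Hm"
  using epb complex_manifold_charted
  unfolding equivariant_principal_bundle_def complex_lie_group_def by blast+

sublocale H: Group.group H
  using epb unfolding equivariant_principal_bundle_def complex_lie_group_def by blast

lemma H_pts: "carrier H = pts Hm"
  using epb unfolding equivariant_principal_bundle_def complex_lie_group_def by blast

lemma right_action: "free_proper_right_action Hm H M (ract P)" and quotient: "hol_quotient P"
  using epb unfolding equivariant_principal_bundle_def by blast+

lemma mult_hol:
  assumes L: "charted L" and f: "hol_at L Hm f p" and g: "hol_at L Hm g p"
  shows "hol_at L Hm (\<lambda>x. f x \<otimes>\<^bsub>H\<^esub> g x) p"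
proof -
  have m: "hol_map (prod_mfd Hm Hm) Hm (pts Hm \<times> pts Hm) (\<lambda>(g, h). g \<otimes>\<^bsub>H\<^esub> h)"
    using epb unfolding equivariant_principal_bundle_def complex_lie_group_def by blast
  have "(f p, g p) \<in> pts Hm \<times> pts Hm" using hol_at_pts(2)[OF f] hol_at_pts(2)[OF g] by simp
  from hol_map_at[OF charted_prod[OF charted(3) charted(3)] charted(3) m this]
  have "hol_at (prod_mfd Hm Hm) Hm (\<lambda>(g, h). g \<otimes>\<^bsub>H\<^esub> h) (f p, g p)" .
  from hol_at_compose[OF hol_at_Pair[OF L charted(3) charted(3) f g] this] show ?thesis by simp
qed

lemma inv_hol:
  assumes f: "hol_at L Hm f p" shows "hol_at L Hm (\<lambda>x. inv\<^bsub>H\<^esub> f x) p"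
proof -
  have m: "hol_map Hm Hm (pts Hm) (\<lambda>g. inv\<^bsub>H\<^esub> g)"
    using epb unfolding equivariant_principal_bundle_def complex_lie_group_def by blast
  show ?thesis by (rule hol_at_compose[OF f hol_map_at[OF charted(3) charted(3) m hol_at_pts(2)[OF f]]])
qed

lemma inv_action: "hol_left_action Hm H M (\<lambda>h m. m \<star> inv\<^bsub>H\<^esub> h)"
  using right_action unfolding free_proper_right_action_def by blast

lemma act_one [simp]: "m \<in> pts M ==> m \<star> \<one>\<^bsub>H\<^esub> = m"
  using inv_action unfolding hol_left_action_def by force

lemma act_mult: 
  assumes m: "m \<in> pts M" and h: "h \<in> carrier H" "k \<in> carrier H" shows "m \<star> h \<star> k = m \<star> (h \<otimes>\<^bsub>H\<^esub> k)"
proof -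
  have "m \<star> inv\<^bsub>H\<^esub> (inv\<^bsub>H\<^esub> k \<otimes>\<^bsub>H\<^esub> inv\<^bsub>H\<^esub> h) = m \<star> inv\<^bsub>H\<^esub> (inv\<^bsub>H\<^esub> h) \<star> inv\<^bsub>H\<^esub> (inv\<^bsub>H\<^esub> k)"
    using inv_action m h unfolding hol_left_action_def by simp
  then show ?thesis using h by (simp add: H.inv_mult_group)
qed

text \<open>The given action is the left action by m (inverse of h), so the inverse of the group is composed with it.\<close>

lemma act_hol:
  assumes L: "charted L" and F: "hol_at L M F p" and g: "hol_at L Hm g p"
  shows "hol_at L M (\<lambda>x. F x \<star> g x) p"
proof -
  have m: "hol_map (prod_mfd Hm M) M (pts Hm \<times> pts M) (\<lambda>(g, m). m \<star> inv\<^bsub>H\<^esub> g)"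
    using inv_action unfolding hol_left_action_def by blast
  note i = inv_hol[OF g]
  have "(inv\<^bsub>H\<^esub> g p, F p) \<in> pts Hm \<times> pts M" using hol_at_pts(2)[OF F] hol_at_pts(2)[OF i] by simp
  from hol_map_at[OF charted_prod[OF charted(3,1)] charted(1) m this]
  have "hol_at (prod_mfd Hm M) M (\<lambda>(g, m). m \<star> inv\<^bsub>H\<^esub> g) (inv\<^bsub>H\<^esub> g p, F p)" .
  from hol_at_compose[OF hol_at_Pair[OF L charted(3) charted(1) i F] this]
  have h: "hol_at L M (\<lambda>x. F x \<star> inv\<^bsub>H\<^esub> (inv\<^bsub>H\<^esub> g x)) p" by simp
  obtain S where S: "openin (mtop L) S" "p \<in> S" "\<forall>x\<in>S. g x \<in> pts Hm"
    using hol_at_nbhd[OF g openin_topspace hol_at_pts(2)[OF g]] by blast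
  show ?thesis
    by (rule hol_at_cong[OF L S(1,2) _ h]) (use S(3) in \<open>simp add: H_pts[symmetric]\<close>)
qed

lemma act_pts: "m \<in> pts M ==> h \<in> carrier H ==> m \<star> h \<in> pts M"
  using hol_at_pts(2)[OF act_hol[OF charted(1) hol_at_id hol_at_const[OF charted(1)]]] H_pts by blast

lemma act_free: 
  assumes m: "m \<in> pts M" and h: "h \<in> carrier H" "k \<in> carrier H" and e: "m \<star> h = m \<star> k" shows "h = k"
proof -
  have "m \<star> (h \<otimes>\<^bsub>H\<^esub> inv\<^bsub>H\<^esub> k) = m \<star> (k \<otimes>\<^bsub>H\<^esub> inv\<^bsub>H\<^esub> k)"
    using act_mult[OF m h(1) H.inv_closed[OF h(2)]] act_mult[OF m h(2) H.inv_closed[OF h(2)]] e by simp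
  then have "m \<star> (h \<otimes>\<^bsub>H\<^esub> inv\<^bsub>H\<^esub> k) = m" using m h by simp
  moreover have "h \<otimes>\<^bsub>H\<^esub> inv\<^bsub>H\<^esub> k \<in> carrier H" using h by simp
  ultimately have "h \<otimes>\<^bsub>H\<^esub> inv\<^bsub>H\<^esub> k = \<one>\<^bsub>H\<^esub>"
    using right_action m unfolding free_proper_right_action_def by blast
  then show ?thesis using h by (metis H.inv_equality H.inv_inv H.inv_closed)
qed

lemma pr_pts: "m \<in> pts M ==> pr m \<in> pts X"
  using quotient unfolding hol_quotient_def by blast

lemma pr_surj: "x \<in> pts X ==> \<exists>m\<in>pts M. pr m = x"
proof -
  assume x: "x \<in> pts X"
  have "pr ` pts M = pts X" using quotient unfolding hol_quotient_def by (elim conjE)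
  then have "x \<in> pr ` pts M" using x by (simp only:)
  then show "\<exists>m\<in>pts M. pr m = x" by (elim imageE) (intro bexI, rule sym)
qed

lemma pr_eq: "m \<in> pts M ==> m' \<in> pts M ==> pr m = pr m' \<longleftrightarrow> (\<exists>h\<in>carrier H. m' = m \<star> h)"
  using quotient unfolding hol_quotient_def by blast

lemma pr_act [simp]: "m \<in> pts M ==> h \<in> carrier H ==> pr (m \<star> h) = pr m"
  using pr_eq[OF _ act_pts] by metis

lemma pr_hol: "m \<in> pts M ==> hol_at M X pr m"
  using quotient hol_map_at[OF charted(1,2)] unfolding hol_quotient_def by blast

text \<open>Local trivialisations, normalised so that the section passes through a given point.\<close>

definition local_triv :: "'m => 'x set => ('x => 'm) => ('m => 'h) => bool" where
  "local_triv m U s k \<longleftrightarrow> openin (mtop X) U \<and> pr m \<in> U \<and> s (pr m) = m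
    \<and> (\<forall>y\<in>U. hol_at X M s y \<and> pr (s y) = y)
    \<and> (\<forall>m'\<in>pts M. pr m' \<in> U --> hol_at M Hm k m' \<and> m' = s (pr m') \<star> k m')"

lemma local_triv_ex:
  assumes m: "m \<in> pts M" shows "\<exists>U s k. local_triv m U s k"
proof -
  have "\<exists>U s k. pr m \<in> U \<and> hol_map X M U s
        \<and> (\<forall>y\<in>U. pr (s y) = y)
        \<and> hol_map (prod_mfd X Hm) M (U \<times> pts Hm) (\<lambda>(y, h). s y \<star> h)
        \<and> hol_map M Hm {m\<in>pts M. pr m \<in> U} k
        \<and> (\<forall>m\<in>pts M. pr m \<in> U --> m = s (pr m) \<star> k m)"
    using quotient pr_pts[OF m] unfolding hol_quotient_def by blast
  then obtain U s k where U: "pr m \<in> U" "hol_map X M U s" "\<forall>y\<in>U. pr (s y) = y"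
    "hol_map M Hm {m\<in>pts M. pr m \<in> U} k" "\<forall>m\<in>pts M. pr m \<in> U --> m = s (pr m) \<star> k m" by blast
  have sU: "openin (mtop X) U" "\<And>y. y \<in> U ==> hol_at X M s y" using U(2) by (simp_all add: hol_map_iff)
  have kU: "hol_at M Hm k m'" if "m' \<in> pts M" "pr m' \<in> U" for m' using U(4) that by (simp add: hol_map_iff)
  have km: "k m' \<in> carrier H" if "m' \<in> pts M" "pr m' \<in> U" for m' using hol_at_pts(2)[OF kU[OF that]] H_pts by simp
  have sp: "s y \<in> pts M" if "y \<in> U" for y by (rule hol_at_pts(2)[OF sU(2)[OF that]])
  let ?s = "\<lambda>y. s y \<star> k m" and ?k = "\<lambda>m'. inv\<^bsub>H\<^esub> k m \<otimes>\<^bsub>H\<^esub> k m'"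
  have "local_triv m U ?s ?k" unfolding local_triv_def
  proof (intro conjI ballI impI)
    show "s (pr m) \<star> k m = m" using U(5) m U(1) by metis
    fix y assume y: "y \<in> U"
    have "k m \<in> pts Hm" using km[OF m U(1)] H_pts by simp
    from hol_at_const[OF charted(2) hol_at_pts(1)[OF sU(2)[OF y]] this]
    show "hol_at X M ?s y" by (rule act_hol[OF charted(2) sU(2)[OF y]])
    show "pr (s y \<star> k m) = y" using U(3) y pr_act[OF sp[OF y] km[OF m U(1)]] by simp
  next
    fix m' assume m': "m' \<in> pts M" "pr m' \<in> U"
    have "inv\<^bsub>H\<^esub> k m \<in> pts Hm" using H.inv_closed[OF km[OF m U(1)]] H_pts by simp
    from hol_at_const[OF charted(1) m'(1) this]
    show "hol_at M Hm ?k m'" by (rule mult_hol[OF charted(1) _ kU[OF m']])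
    have "s (pr m') \<star> k m \<star> (inv\<^bsub>H\<^esub> k m \<otimes>\<^bsub>H\<^esub> k m') = s (pr m') \<star> k m'"
      using sp[OF m'(2)] km[OF m U(1)] km[OF m'] by (simp add: act_mult H.m_assoc[symmetric])
    then show "m' = s (pr m') \<star> k m \<star> (inv\<^bsub>H\<^esub> k m \<otimes>\<^bsub>H\<^esub> k m')" using U(5) m' by metis
  qed (use U(1) sU(1) in simp_all)
  then show ?thesis by blast
qed

lemma local_trivD:
  assumes "local_triv m U s k"
  shows "openin (mtop X) U" "pr m \<in> U" "s (pr m) = m" "y \<in> U ==> hol_at X M s y" "y \<in> U ==> pr (s y) = y"
    "m' \<in> pts M ==> pr m' \<in> U ==> hol_at M Hm k m'" "m' \<in> pts M ==> pr m' \<in> U ==> s (pr m') \<star> k m' = m'"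
    "y \<in> U ==> s y \<in> pts M" "m' \<in> pts M ==> pr m' \<in> U ==> k m' \<in> carrier H"
proof -
  note a = assms[unfolded local_triv_def]
  show "openin (mtop X) U" "pr m \<in> U" "s (pr m) = m" "y \<in> U ==> hol_at X M s y" "y \<in> U ==> pr (s y) = y"
    using a by simp_all
  then show "y \<in> U ==> s y \<in> pts M" using hol_at_pts(2) by metis
  show k: "m' \<in> pts M ==> pr m' \<in> U ==> hol_at M Hm k m'" using a by blast
  then show "m' \<in> pts M ==> pr m' \<in> U ==> k m' \<in> carrier H" using hol_at_pts(2) H_pts by metis
  show "m' \<in> pts M ==> pr m' \<in> U ==> s (pr m') \<star> k m' = m'" using a by metis
qed

text \<open>On a local trivialisation k is the group coordinate, by freeness of the action.\<close>

lemma local_triv_act: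
  assumes t: "local_triv m U s k" and y: "y \<in> U" and h: "h \<in> carrier H" shows "k (s y \<star> h) = h"
proof -
  note D = local_trivD[OF t]
  have p: "s y \<star> h \<in> pts M" "pr (s y \<star> h) = y" using D(5,8)[OF y] act_pts h by simp_all
  have "s y \<star> k (s y \<star> h) = s y \<star> h" using D(7)[OF p(1)] p(2) y by simp
  then show ?thesis by (rule act_free[OF D(8)[OF y] _ h, rotated]) (use D(9)[OF p(1)] p(2) y in simp)
qed

section \<open>Associated line bundles\<close>

definition multiplicative :: "('h => complex) => bool" where
  "multiplicative \<xi> \<longleftrightarrow> (\<forall>h\<in>carrier H. \<xi> h \<noteq> 0 \<and> (\<forall>k\<in>carrier H. \<xi> (h \<otimes>\<^bsub>H\<^esub> k) = \<xi> h * \<xi> k))"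

lemma multiplicativeD:
  assumes "multiplicative \<xi>"
  shows "h \<in> carrier H ==> \<xi> h \<noteq> 0" "h \<in> carrier H ==> k \<in> carrier H ==> \<xi> (h \<otimes>\<^bsub>H\<^esub> k) = \<xi> h * \<xi> k"
  using assms by (simp_all add: multiplicative_def)

lemma multiplicative_one: assumes "multiplicative \<xi>" shows "\<xi> \<one>\<^bsub>H\<^esub> = 1"
proof -
  have "\<xi> \<one>\<^bsub>H\<^esub> * 1 = \<xi> \<one>\<^bsub>H\<^esub> * \<xi> \<one>\<^bsub>H\<^esub>"
    using multiplicativeD(2)[OF assms H.one_closed H.one_closed] by simp
  then show ?thesis using multiplicativeD(1)[OF assms H.one_closed] by simp
qed

lemma hol_character_multiplicative: "hol_character Hm H \<xi> ==> multiplicative \<xi>"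
  by (simp add: hol_character_def multiplicative_def)

lemma multiplicative_mult: "multiplicative \<xi> ==> multiplicative \<zeta> ==> multiplicative (\<lambda>h. \<xi> h * \<zeta> h)"
  by (simp add: multiplicative_def)

abbreviation "cls \<equiv> assoc_class P"

lemma cls_mem:
  assumes \<xi>: "multiplicative \<xi>" and m: "m \<in> pts M" shows "(m, w) \<in> cls \<xi> m v \<longleftrightarrow> w = v"
proof
  assume "(m, w) \<in> cls \<xi> m v"
  then obtain h where h: "h \<in> carrier H" "m = m \<star> inv\<^bsub>H\<^esub> h" "w = \<xi> h * v" by (auto simp: assoc_class_def)
  have "m \<star> \<one>\<^bsub>H\<^esub> = m \<star> inv\<^bsub>H\<^esub> h" using h(2) m by simp
  then have "inv\<^bsub>H\<^esub> h = \<one>\<^bsub>H\<^esub>" using act_free[OF m H.one_closed H.inv_closed[OF h(1)]] by simp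
  then have "h = \<one>\<^bsub>H\<^esub>" using H.inv_inv[OF h(1)] by simp
  then show "w = v" using h(3) multiplicative_one[OF \<xi>] by simp
next
  assume "w = v"
  then show "(m, w) \<in> cls \<xi> m v" unfolding assoc_class_def
    using m multiplicative_one[OF \<xi>] by (intro CollectI exI[of _ "\<one>\<^bsub>H\<^esub>"]) simp
qed

lemma cls_inj: "multiplicative \<xi> ==> m \<in> pts M ==> cls \<xi> m v = cls \<xi> m w \<longleftrightarrow> v = w"
  using cls_mem by metis

text \<open>The elements [m h, v] and [m, \<xi>(h) v] are the same orbit, by the substitution k h for k.\<close>

lemma cls_act:
  assumes \<xi>: "multiplicative \<xi>" and m: "m \<in> pts M" and h: "h \<in> carrier H"
  shows "cls \<xi> (m \<star> h) v = cls \<xi> m (\<xi> h * v)"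
proof -
  have 1: "m \<star> h \<star> inv\<^bsub>H\<^esub> (k \<otimes>\<^bsub>H\<^esub> h) = m \<star> inv\<^bsub>H\<^esub> k" "\<xi> (k \<otimes>\<^bsub>H\<^esub> h) * v = \<xi> k * (\<xi> h * v)" if "k \<in> carrier H" for k
    using that h m multiplicativeD(2)[OF \<xi>] by (simp_all add: act_mult H.inv_mult_group H.m_assoc[symmetric])
  have e: "(a, b) \<in> cls \<xi> (m \<star> h) v \<longleftrightarrow> (a, b) \<in> cls \<xi> m (\<xi> h * v)" for a b
  proof
    assume "(a, b) \<in> cls \<xi> (m \<star> h) v"
    then obtain k where k: "k \<in> carrier H" "a = m \<star> h \<star> inv\<^bsub>H\<^esub> k" "b = \<xi> k * v" by (auto simp: assoc_class_def)
    let ?l = "k \<otimes>\<^bsub>H\<^esub> inv\<^bsub>H\<^esub> h"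
    have l: "?l \<in> carrier H" "?l \<otimes>\<^bsub>H\<^esub> h = k" using k(1) h by (simp_all add: H.m_assoc)
    show "(a, b) \<in> cls \<xi> m (\<xi> h * v)" unfolding assoc_class_def
      using 1[OF l(1)] k l by (intro CollectI exI[of _ ?l]) simp
  next
    assume "(a, b) \<in> cls \<xi> m (\<xi> h * v)"
    then obtain k where k: "k \<in> carrier H" "a = m \<star> inv\<^bsub>H\<^esub> k" "b = \<xi> k * (\<xi> h * v)" by (auto simp: assoc_class_def)
    then show "(a, b) \<in> cls \<xi> (m \<star> h) v" unfolding assoc_class_def
      using 1(1)[OF k(1)] multiplicativeD(2)[OF \<xi> k(1) h] h k(1)
      by (intro CollectI exI[of _ "k \<otimes>\<^bsub>H\<^esub> h"]) (simp add: mult.assoc)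
  qed
  show ?thesis
  proof (rule Set.set_eqI)
    fix p show "p \<in> cls \<xi> (m \<star> h) v \<longleftrightarrow> p \<in> cls \<xi> m (\<xi> h * v)" using e[of "fst p" "snd p"] by simp
  qed
qed

lemma assoc_fib:
  assumes \<xi>: "multiplicative \<xi>" and m: "m \<in> pts M"
  shows "fib (assoc_lb P \<xi>) (pr m) = range (cls \<xi> m)"
proof
  show "range (cls \<xi> m) \<subseteq> fib (assoc_lb P \<xi>) (pr m)" using m by (auto simp: assoc_lb_def)
  show "fib (assoc_lb P \<xi>) (pr m) \<subseteq> range (cls \<xi> m)"
  proof
    fix l assume "l \<in> fib (assoc_lb P \<xi>) (pr m)"
    then obtain m' v where l: "l = cls \<xi> m' v" "m' \<in> pts M" "pr m' = pr m" by (auto simp: assoc_lb_def)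
    then obtain h where "h \<in> carrier H" "m' = m \<star> h" using pr_eq[OF m l(2)] by metis
    then show "l \<in> range (cls \<xi> m)" using l(1) cls_act[OF \<xi> m] by simp
  qed
qed

lemma assoc_triv: "multiplicative \<xi> ==> m \<in> pts M ==> (THE w. (m, w) \<in> cls \<xi> m v) = v"
  by (simp add: cls_mem)

lemma assoc_trivs: "(U, t) \<in> trivs (assoc_lb P \<xi>) \<longleftrightarrow>
    (\<exists>s. t = (\<lambda>x l. THE v. (s x, v) \<in> l) \<and> openin (mtop X) U \<and> (\<forall>x\<in>U. hol_at X M s x \<and> pr (s x) = x))"
  unfolding assoc_lb_def by (auto simp: hol_map_iff)

lemma local_triv_trivs:
  "local_triv m U s k ==> (U, \<lambda>x l. THE v. (s x, v) \<in> l) \<in> trivs (assoc_lb P \<xi>)"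
  unfolding assoc_trivs local_triv_def by blast

text \<open>Two local sections differ by a holomorphic function h with values in the group, so that the
  transition function is the character applied to h.\<close>

lemma assoc_line_bundle:
  assumes \<xi>: "hol_character Hm H \<xi>" shows "line_bundle X (assoc_lb P \<xi>)"
  unfolding line_bundle_def
proof (intro conjI)
  note mu = hol_character_multiplicative[OF \<xi>]
  show "\<forall>(U, t)\<in>trivs (assoc_lb P \<xi>). openin (mtop X) U \<and> (\<forall>x\<in>U. bij_betw (t x) (fib (assoc_lb P \<xi>) x) UNIV)"
  proof (clarify, intro conjI ballI)
    fix U t assume "(U, t) \<in> trivs (assoc_lb P \<xi>)"
    then obtain s where s: "t = (\<lambda>x l. THE v. (s x, v) \<in> l)" "openin (mtop X) U" "\<forall>x\<in>U. hol_at X M s x \<and> pr (s x) = x"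
      unfolding assoc_trivs by blast
    show "openin (mtop X) U" by (rule s(2))
    fix x assume x: "x \<in> U"
    have sx: "s x \<in> pts M" "pr (s x) = x" using s(3) x hol_at_pts(2) by metis+
    have "fib (assoc_lb P \<xi>) x = range (cls \<xi> (s x))" using assoc_fib[OF mu sx(1)] sx(2) by simp
    then show "bij_betw (t x) (fib (assoc_lb P \<xi>) x) UNIV" unfolding s(1)
      by (intro bij_betwI[where g = "cls \<xi> (s x)"]) (auto simp: assoc_triv[OF mu sx(1)])
  qed
  show "(\<Union>c\<in>trivs (assoc_lb P \<xi>). fst c) = pts X"
  proof
    show "(\<Union>c\<in>trivs (assoc_lb P \<xi>). fst c) \<subseteq> pts X"
    proof (rule UN_least)
      fix c assume "c \<in> trivs (assoc_lb P \<xi>)"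
      then have "(fst c, snd c) \<in> trivs (assoc_lb P \<xi>)" by simp
      then have "openin (mtop X) (fst c)" unfolding assoc_trivs by blast
      then show "fst c \<subseteq> pts X" by (rule openin_subset)
    qed
    show "pts X \<subseteq> (\<Union>c\<in>trivs (assoc_lb P \<xi>). fst c)"
    proof
      fix x assume "x \<in> pts X"
      then obtain m where m: "m \<in> pts M" "pr m = x" using pr_surj by blast
      obtain U s k where t: "local_triv m U s k" using local_triv_ex[OF m(1)] by blast
      show "x \<in> (\<Union>c\<in>trivs (assoc_lb P \<xi>). fst c)"
        using local_triv_trivs[OF t] local_trivD(2)[OF t] m(2) by force
    qed
  qed
  show "\<forall>(U, t)\<in>trivs (assoc_lb P \<xi>). \<forall>(U', t')\<in>trivs (assoc_lb P \<xi>). \<exists>g. hol_fun X (U \<inter> U') g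
        \<and> (\<forall>x\<in>U \<inter> U'. g x \<noteq> 0 \<and> (\<forall>l\<in>fib (assoc_lb P \<xi>) x. t' x l = g x * t x l))"
  proof (clarify)
    fix U t U' t' assume "(U, t) \<in> trivs (assoc_lb P \<xi>)" "(U', t') \<in> trivs (assoc_lb P \<xi>)"
    then obtain s s' where s: "t = (\<lambda>x l. THE v. (s x, v) \<in> l)" "openin (mtop X) U" "\<forall>x\<in>U. hol_at X M s x \<and> pr (s x) = x"
      and s': "t' = (\<lambda>x l. THE v. (s' x, v) \<in> l)" "openin (mtop X) U'" "\<forall>x\<in>U'. hol_at X M s' x \<and> pr (s' x) = x"
      unfolding assoc_trivs by blast
    have "\<exists>h. x \<in> U \<inter> U' --> h \<in> carrier H \<and> s x = s' x \<star> h" for x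
    proof (cases "x \<in> U \<inter> U'")
      case True
      then have "s' x \<in> pts M" "s x \<in> pts M" "pr (s' x) = pr (s x)" using s(3) s'(3) hol_at_pts(2) by (metis IntD1 IntD2)+
      then show ?thesis using pr_eq by metis
    qed blast
    then obtain h where h: "\<And>x. x \<in> U \<inter> U' ==> h x \<in> carrier H \<and> s x = s' x \<star> h x" by metis
    have "hol_fun X (U \<inter> U') (\<lambda>x. \<xi> (h x))" unfolding hol_fun_iff_at[OF charted(2)]
    proof (intro conjI ballI)
      show op: "openin (mtop X) (U \<inter> U')" using s(2) s'(2) by blast
      fix x assume x: "x \<in> U \<inter> U'"
      have sx: "s x \<in> pts M" "pr (s x) = x" using s(3) x hol_at_pts(2) by (metis IntD1)+
      obtain W \<sigma> k where W: "local_triv (s x) W \<sigma> k" using local_triv_ex[OF sx(1)] by blast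
      note D = local_trivD[OF W]
      have xW: "x \<in> W" using D(2) sx(2) by simp
      have k: "hol_at X Hm (\<lambda>y. k (u y)) x" if "hol_at X M u x" "pr (u x) = x" for u
        by (rule hol_at_compose[OF that(1) D(6)[OF hol_at_pts(2)[OF that(1)]]]) (use that(2) xW in simp)
      \<comment> \<open>the quotient of the group coordinates of the two sections in one local trivialisation is h\<close>
      have "hol_at X Hm (\<lambda>y. inv\<^bsub>H\<^esub> k (s' y) \<otimes>\<^bsub>H\<^esub> k (s y)) x"
        by (rule mult_hol[OF charted(2) inv_hol[OF k] k]) (use s(3) s'(3) x in simp_all)
      moreover have "inv\<^bsub>H\<^esub> k (s' y) \<otimes>\<^bsub>H\<^esub> k (s y) = h y" if y: "y \<in> (U \<inter> U') \<inter> W" for y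
      proof -
        have s'y: "s' y \<in> pts M" "pr (s' y) = y" using s'(3) y hol_at_pts(2) by (metis IntD1 IntD2)+
        note ky = D(9)[OF s'y(1)]
        have hy: "h y \<in> carrier H" "s y = s' y \<star> h y" using h[of y] y by blast+
        have "s' y = \<sigma> y \<star> k (s' y)" using D(7)[OF s'y(1)] s'y(2) y by simp
        then have "s y = \<sigma> y \<star> (k (s' y) \<otimes>\<^bsub>H\<^esub> h y)"
          using hy act_mult[OF D(8)[of y] _ hy(1), of "k (s' y)"] ky s'y(2) y by simp
        then have "k (s y) = k (s' y) \<otimes>\<^bsub>H\<^esub> h y" using local_triv_act[OF W, of y] y hy(1) ky s'y(2) by simp
        then show ?thesis using hy(1) ky s'y(2) y by (simp add: H.m_assoc[symmetric])
      qed
      ultimately have "hol_at X Hm h x"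
        by (intro hol_at_cong[OF charted(2) _ _ _ \<open>hol_at X Hm (\<lambda>y. inv\<^bsub>H\<^esub> k (s' y) \<otimes>\<^bsub>H\<^esub> k (s y)) x\<close>, of "(U \<inter> U') \<inter> W"])
          (use op D(1) x xW in auto)
      moreover have "hol_fun_at Hm \<xi> (h x)"
        using \<xi> h[OF x] H_pts unfolding hol_character_def hol_fun_iff_at[OF charted(3)] by simp
      ultimately show "hol_fun_at X (\<lambda>x. \<xi> (h x)) x" by (rule hol_at_pull)
    qed
    moreover have "\<xi> (h x) \<noteq> 0 \<and> (\<forall>l\<in>fib (assoc_lb P \<xi>) x. t' x l = \<xi> (h x) * t x l)" if x: "x \<in> U \<inter> U'" for x
    proof (intro conjI ballI)
      note hx = h[OF x]
      show "\<xi> (h x) \<noteq> 0" using multiplicativeD(1)[OF mu] hx by blast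
      have sx: "s x \<in> pts M" "pr (s x) = x" using s(3) x hol_at_pts(2) by (metis IntD1)+
      have s'x: "s' x \<in> pts M" using s'(3) x hol_at_pts(2) by (metis IntD2)
      fix l assume "l \<in> fib (assoc_lb P \<xi>) x"
      then obtain v where v: "l = cls \<xi> (s x) v" using assoc_fib[OF mu sx(1)] sx(2) by auto
      then have v': "l = cls \<xi> (s' x) (\<xi> (h x) * v)" using cls_act[OF mu s'x] hx by simp
      have "t x l = v" unfolding v s(1) by (rule assoc_triv[OF mu sx(1)])
      moreover have "t' x l = \<xi> (h x) * v" unfolding v' s'(1) by (rule assoc_triv[OF mu s'x])
      ultimately show "t' x l = \<xi> (h x) * t x l" by simp
    qed
    ultimately show "\<exists>g. hol_fun X (U \<inter> U') g
        \<and> (\<forall>x\<in>U \<inter> U'. g x \<noteq> 0 \<and> (\<forall>l\<in>fib (assoc_lb P \<xi>) x. t' x l = g x * t x l))"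
      by (intro exI[of _ "\<lambda>x. \<xi> (h x)"]) simp
  qed
qed

lemma assoc_scale:
  assumes \<xi>: "hol_character Hm H \<xi>" and m: "m \<in> pts M"
  shows "lscale (assoc_lb P \<xi>) (pr m) c (cls \<xi> m v) = cls \<xi> m (c * v)"
proof -
  note mu = hol_character_multiplicative[OF \<xi>] and lb = assoc_line_bundle[OF \<xi>]
  obtain U s k where t: "local_triv m U s k" using local_triv_ex[OF m] by blast
  note D = local_trivD[OF t] and t' = local_triv_trivs[OF t, of \<xi>]
  have f: "cls \<xi> m w \<in> fib (assoc_lb P \<xi>) (pr m)" for w using assoc_fib[OF mu m] by simp
  show ?thesis
    by (rule lb_eqI[OF lb t' D(2) lb_scale(1)[OF lb t' D(2) f] f], subst lb_scale(2)[OF lb t' D(2) f])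
      (simp add: D(3) assoc_triv[OF mu m])
qed

end

section \<open>The contracted volume form\<close>

text \<open>The outermost contraction inserts its field last, so the fields appear in reverse order.\<close>

lemma iter_contract_rev:
  "iter_contract q x \<omega> m vs = \<omega> m (rev (map (\<lambda>j. x j m) [0..<q]) @ vs)"
proof (induction q arbitrary: \<omega> vs)
  case (Suc q)
  have "iter_contract (Suc q) x \<omega> = iter_contract q x (contract (x q) \<omega>)" by (simp add: iter_contract_def)
  then show ?case by (simp add: Suc.IH contract_def)
qed (simp add: iter_contract_def)

context principal_bundle
begin

abbreviation "Ad h \<equiv> push Hm (\<lambda>k. h \<otimes>\<^bsub>H\<^esub> k \<otimes>\<^bsub>H\<^esub> inv\<^bsub>H\<^esub> h) \<one>\<^bsub>H\<^esub>"

lemma one_pts: "\<one>\<^bsub>H\<^esub> \<in> pts Hm" using H.one_closed H_pts by simp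

lemma conj_hol:
  assumes L: "charted L" and h: "h \<in> carrier H" and f: "hol_at L Hm f p"
  shows "hol_at L Hm (\<lambda>x. h \<otimes>\<^bsub>H\<^esub> f x \<otimes>\<^bsub>H\<^esub> inv\<^bsub>H\<^esub> h) p"
proof -
  have c: "hol_at L Hm (\<lambda>x. g) p" if "g \<in> carrier H" for g
    by (rule hol_at_const[OF L hol_at_pts(1)[OF f]]) (use that H_pts in simp)
  show ?thesis by (intro mult_hol[OF L] c f h H.inv_closed)
qed

lemma conj_one: "h \<in> carrier H ==> h \<otimes>\<^bsub>H\<^esub> \<one>\<^bsub>H\<^esub> \<otimes>\<^bsub>H\<^esub> inv\<^bsub>H\<^esub> h = \<one>\<^bsub>H\<^esub>" by simp

lemma Ad_tspace:
  assumes h: "h \<in> carrier H" and v: "v \<in> tspace Hm \<one>\<^bsub>H\<^esub>" shows "Ad h v \<in> tspace Hm \<one>\<^bsub>H\<^esub>"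
  using push_tspace_at[OF charted(3,3) openin_topspace conj_hol[OF charted(3) h hol_at_id] one_pts v]
  by (simp only: conj_one[OF h])

lemma Ad_mult:
  assumes h: "h \<in> carrier H" "k \<in> carrier H" and v: "v \<in> tspace Hm \<one>\<^bsub>H\<^esub>"
  shows "Ad (h \<otimes>\<^bsub>H\<^esub> k) v = Ad h (Ad k v)"
proof -
  let ?c = "\<lambda>h g. h \<otimes>\<^bsub>H\<^esub> g \<otimes>\<^bsub>H\<^esub> inv\<^bsub>H\<^esub> h"
  have c1: "?c k \<one>\<^bsub>H\<^esub> = \<one>\<^bsub>H\<^esub>" by (rule conj_one[OF h(2)])
  have "hol_at Hm Hm (?c h) (?c k \<one>\<^bsub>H\<^esub>)" unfolding c1 by (rule conj_hol[OF charted(3) h(1) hol_at_id[OF one_pts]])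
  from push_push[where N = Hm and K = Hm and G = "?c h" and F = "?c k" and p = "\<one>\<^bsub>H\<^esub>", OF this, of v]
  have "Ad h (Ad k v) = push Hm (\<lambda>g. ?c h (?c k g)) \<one>\<^bsub>H\<^esub> v" unfolding c1 .
  also have "\<dots> = Ad (h \<otimes>\<^bsub>H\<^esub> k) v"
    by (rule push_cong[OF charted(3) v openin_topspace one_pts])
      (use h in \<open>simp add: H_pts[symmetric] H.m_assoc H.inv_mult_group\<close>)
  finally show ?thesis by simp
qed

lemma Ad_one:
  assumes v: "v \<in> tspace Hm \<one>\<^bsub>H\<^esub>" shows "Ad \<one>\<^bsub>H\<^esub> v = v"
proof -
  have "Ad \<one>\<^bsub>H\<^esub> v = push Hm (\<lambda>k. k) \<one>\<^bsub>H\<^esub> v"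
    by (rule push_cong[OF charted(3) v openin_topspace one_pts]) (simp add: H_pts[symmetric])
  then show ?thesis using push_id[OF v] by simp
qed

text \<open>The determinant of Ad(h) in a chart at the unit works for every form, because top forms at the unit are
  proportional.\<close>

lemma adj_char_form:
  assumes h: "h \<in> carrier H" and \<alpha>: "alt_form Hm q \<one>\<^bsub>H\<^esub> \<alpha>" and vs: "vs \<in> tlists Hm q \<one>\<^bsub>H\<^esub>"
  shows "\<alpha> (map (Ad h) vs) = adj_char P h * \<alpha> vs"
proof -
  obtain W \<phi> where W: "hol_chart Hm (W, \<phi>)" "\<one>\<^bsub>H\<^esub> \<in> W" using chart_ex[OF charted(3) one_pts] by blast
  let ?E = "map (coord_vec Hm (W, \<phi>) \<one>\<^bsub>H\<^esub>) [0..<q]"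
  have E: "?E \<in> tlists Hm q \<one>\<^bsub>H\<^esub>" by (rule coord_tlists[OF charted(3) W])
  have AdE: "map (Ad h) us \<in> tlists Hm q \<one>\<^bsub>H\<^esub>" if "us \<in> tlists Hm q \<one>\<^bsub>H\<^esub>" for us
    using that Ad_tspace[OF h] by (auto simp: tlists_def)
  let ?c = "dz_wedge \<phi> 0 q (map (Ad h) ?E)"
  have c: "\<beta> (map (Ad h) us) = ?c * \<beta> us" if \<beta>: "alt_form Hm q \<one>\<^bsub>H\<^esub> \<beta>" and us: "us \<in> tlists Hm q \<one>\<^bsub>H\<^esub>" for \<beta> us
  proof -
    have "alt_form Hm q \<one>\<^bsub>H\<^esub> (\<lambda>us. \<beta> (map (Ad h) us))"
      by (rule alt_form_pull[OF \<beta> Ad_tspace[OF h] push_lin])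
    from top_form_chart[OF charted(3) W this us]
    have "\<beta> (map (Ad h) us) = dz_wedge \<phi> 0 q us * \<beta> (map (Ad h) ?E)" .
    also have "\<beta> (map (Ad h) ?E) = ?c * \<beta> ?E" by (rule top_form_chart[OF charted(3) W \<beta> AdE[OF E]])
    finally show ?thesis using top_form_chart[OF charted(3) W \<beta> us] by simp
  qed
  have "adj_char P h = ?c" unfolding adj_char_def Let_def
  proof (rule the_equality)
    show "\<forall>\<alpha>. alt_form Hm q \<one>\<^bsub>H\<^esub> \<alpha> --> (\<forall>vs\<in>tlists Hm q \<one>\<^bsub>H\<^esub>. \<alpha> (map (Ad h) vs) = ?c * \<alpha> vs)"
      using c by (intro allI impI ballI)
    fix c' assume "\<forall>\<alpha>. alt_form Hm q \<one>\<^bsub>H\<^esub> \<alpha> --> (\<forall>vs\<in>tlists Hm q \<one>\<^bsub>H\<^esub>. \<alpha> (map (Ad h) vs) = c' * \<alpha> vs)"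
    from this[rule_format, OF dz_wedge_alt E] show "c' = ?c" using dz_wedge_coord[OF charted(3) W] by simp
  qed
  then show ?thesis using c[OF \<alpha> vs] by simp
qed

text \<open>Ad is a homomorphism, and the form dz takes the value 1 on the coordinate basis.\<close>

lemma adj_char_multiplicative: "multiplicative (adj_char P)"
proof -
  obtain W \<phi> where W: "hol_chart Hm (W, \<phi>)" "\<one>\<^bsub>H\<^esub> \<in> W" using chart_ex[OF charted(3) one_pts] by blast
  let ?E = "map (coord_vec Hm (W, \<phi>) \<one>\<^bsub>H\<^esub>) [0..<q]" and ?\<alpha> = "dz_wedge \<phi> 0 q"
  have E: "?E \<in> tlists Hm q \<one>\<^bsub>H\<^esub>" by (rule coord_tlists[OF charted(3) W])
  then have Et: "v \<in> tspace Hm \<one>\<^bsub>H\<^esub>" if "v \<in> set ?E" for v using that unfolding tlists_def by blast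
  have alt: "alt_form Hm q \<one>\<^bsub>H\<^esub> ?\<alpha>" by (rule dz_wedge_alt)
  have E1: "?\<alpha> ?E = 1" by (rule dz_wedge_coord[OF charted(3) W])
  have v: "?\<alpha> (map (Ad h) ?E) = adj_char P h" if "h \<in> carrier H" for h using adj_char_form[OF that alt E] E1 by simp
  have m: "adj_char P (h \<otimes>\<^bsub>H\<^esub> k) = adj_char P h * adj_char P k" if hk: "h \<in> carrier H" "k \<in> carrier H" for h k
  proof -
    have e: "map (Ad (h \<otimes>\<^bsub>H\<^esub> k)) ?E = map (Ad h) (map (Ad k) ?E)"
      unfolding map_map[of "Ad h"] comp_def by (rule map_cong[OF refl], rule Ad_mult[OF hk], rule Et)
    have "map (Ad k) ?E \<in> tlists Hm q \<one>\<^bsub>H\<^esub>" using E Ad_tspace[OF hk(2)] by (auto simp: tlists_def)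
    from adj_char_form[OF hk(1) alt this]
    have "?\<alpha> (map (Ad (h \<otimes>\<^bsub>H\<^esub> k)) ?E) = adj_char P h * ?\<alpha> (map (Ad k) ?E)" unfolding e .
    then show ?thesis unfolding v[OF hk(2)] v[OF H.m_closed[OF hk]] .
  qed
  have "map (Ad \<one>\<^bsub>H\<^esub>) ?E = map (\<lambda>v. v) ?E" by (rule map_cong[OF refl], rule Ad_one, rule Et)
  then have "map (Ad \<one>\<^bsub>H\<^esub>) ?E = ?E" by (simp only: list.map_ident)
  then have 1: "adj_char P \<one>\<^bsub>H\<^esub> = 1" using v[OF H.one_closed] E1 by (simp only:)
  have "adj_char P h \<noteq> 0" if h: "h \<in> carrier H" for h
  proof
    assume "adj_char P h = 0"
    then have "adj_char P (h \<otimes>\<^bsub>H\<^esub> inv\<^bsub>H\<^esub> h) = 0" using m[OF h H.inv_closed[OF h]] by simp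
    then show False using 1 h by simp
  qed
  with m show ?thesis unfolding multiplicative_def by blast
qed

definition generates :: "(nat => complex => 'h) => (nat => 'm => 'm tvec) => bool" where
  "generates \<gamma> x \<longleftrightarrow> (\<forall>j<q. hol_map C_mfd Hm UNIV (\<gamma> j) \<and> (\<forall>t t'. \<gamma> j (t + t') = \<gamma> j t \<otimes>\<^bsub>H\<^esub> \<gamma> j t'))
     \<and> (\<forall>c. (\<forall>f. (\<Sum>j<q. c j * velocity Hm (\<gamma> j) f) = 0) --> (\<forall>j<q. c j = 0))
     \<and> (\<forall>j<q. \<forall>m\<in>pts M. x j m = velocity M (\<lambda>t. m \<star> \<gamma> j t))"

lemma generates_ex: "independent_generated_fields P x ==> \<exists>\<gamma>. generates \<gamma> x"
  unfolding independent_generated_fields_def Let_def generates_def .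

lemma generatesD:
  assumes g: "generates \<gamma> x" and j: "j < q"
  shows "hol_at C_mfd Hm (\<gamma> j) t" "\<gamma> j t \<in> carrier H" "\<gamma> j 0 = \<one>\<^bsub>H\<^esub>" "m \<in> pts M ==> x j m = velocity M (\<lambda>t. m \<star> \<gamma> j t)"
    "velocity Hm (\<gamma> j) \<in> tspace Hm \<one>\<^bsub>H\<^esub>"
proof -
  have h: "hol_map C_mfd Hm UNIV (\<gamma> j)" and a: "\<gamma> j (0 + 0) = \<gamma> j 0 \<otimes>\<^bsub>H\<^esub> \<gamma> j 0"
    using g j unfolding generates_def by blast+
  show hol: "hol_at C_mfd Hm (\<gamma> j) t" for t by (rule hol_map_at[OF charted_C charted(3) h UNIV_I])
  show c: "\<gamma> j t \<in> carrier H" for t using hol_at_pts(2)[OF hol] H_pts by simp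
  show 0: "\<gamma> j 0 = \<one>\<^bsub>H\<^esub>" using a H.l_cancel_one'[OF c[of 0] c[of 0]] by simp
  show "m \<in> pts M ==> x j m = velocity M (\<lambda>t. m \<star> \<gamma> j t)" using g j unfolding generates_def by blast
  show "velocity Hm (\<gamma> j) \<in> tspace Hm \<one>\<^bsub>H\<^esub>" using tspaceI[OF charted(3) h UNIV_I] 0 by simp
qed

lemma orbit_hol: "m \<in> pts M ==> g \<in> pts Hm ==> hol_at Hm M (\<lambda>g. m \<star> g) g"
  by (rule act_hol[OF charted(3) hol_at_const[OF charted(3)] hol_at_id])

lemma act_right_hol: "m \<in> pts M ==> h \<in> carrier H ==> hol_at M M (\<lambda>m. m \<star> h) m"
  by (rule act_hol[OF charted(1) hol_at_id hol_at_const[OF charted(1)]]) (simp_all add: H_pts)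

lemma orbit_tspace:
  assumes m: "m \<in> pts M" and v: "v \<in> tspace Hm \<one>\<^bsub>H\<^esub>" shows "push M (\<lambda>g. m \<star> g) \<one>\<^bsub>H\<^esub> v \<in> tspace M m"
  using push_tspace_at[OF charted(3,1) openin_topspace orbit_hol[OF m] one_pts v] m by simp

lemma field_orbit:
  assumes g: "generates \<gamma> x" and j: "j < q" and m: "m \<in> pts M"
  shows "x j m = push M (\<lambda>g. m \<star> g) \<one>\<^bsub>H\<^esub> (velocity Hm (\<gamma> j))"
proof -
  note D = generatesD[OF g j]
  have "hol_at Hm M (\<lambda>g. m \<star> g) (\<gamma> j 0)" using orbit_hol[OF m one_pts] D(3) by simp
  from push_velocity[where F = "\<lambda>g. m \<star> g" and \<gamma> = "\<gamma> j", OF this] show ?thesis using D(3) D(4)[OF m] by simp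
qed

text \<open>Moving the base point by h turns the field of a into the translate of the field of Ad(h) a.\<close>

lemma field_act:
  assumes g: "generates \<gamma> x" and j: "j < q" and m: "m \<in> pts M" and h: "h \<in> carrier H"
  shows "x j (m \<star> h) = push M (\<lambda>m. m \<star> h) m (push M (\<lambda>g. m \<star> g) \<one>\<^bsub>H\<^esub> (Ad h (velocity Hm (\<gamma> j))))"
proof -
  note D = generatesD[OF g j]
  define \<delta> where "\<delta> t = h \<otimes>\<^bsub>H\<^esub> \<gamma> j t \<otimes>\<^bsub>H\<^esub> inv\<^bsub>H\<^esub> h" for t
  have \<delta>c: "\<delta> t \<in> carrier H" for t using D(2) h by (simp add: \<delta>_def)
  have \<delta>0: "\<delta> 0 = \<one>\<^bsub>H\<^esub>" using D(3) h by (simp add: \<delta>_def)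
  have "m \<star> h \<star> \<gamma> j t = m \<star> \<delta> t \<star> h" for t
    using m h D(2) \<delta>c by (simp add: act_mult \<delta>_def H.m_assoc)
  then have "x j (m \<star> h) = velocity M (\<lambda>t. m \<star> \<delta> t \<star> h)" using D(4)[OF act_pts[OF m h]] by simp
  also have "\<dots> = push M (\<lambda>m. m \<star> h) (m \<star> \<delta> 0) (velocity M (\<lambda>t. m \<star> \<delta> t))"
    by (rule push_velocity[where F = "\<lambda>m. m \<star> h" and \<gamma> = "\<lambda>t. m \<star> \<delta> t", symmetric, OF act_right_hol[OF act_pts[OF m \<delta>c] h]])
  also have "velocity M (\<lambda>t. m \<star> \<delta> t) = push M (\<lambda>g. m \<star> g) (\<delta> 0) (velocity Hm \<delta>)"
    by (rule push_velocity[where F = "\<lambda>g. m \<star> g" and \<gamma> = \<delta>, symmetric, OF orbit_hol[OF m]]) (use \<delta>c H_pts in simp)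
  also have "velocity Hm \<delta> = Ad h (velocity Hm (\<gamma> j))"
    using push_velocity[where F = "\<lambda>k. h \<otimes>\<^bsub>H\<^esub> k \<otimes>\<^bsub>H\<^esub> inv\<^bsub>H\<^esub> h" and \<gamma> = "\<gamma> j" and M = Hm and N = Hm,
        OF conj_hol[OF charted(3) h hol_at_id]] D(2,3) H_pts one_pts unfolding \<delta>_def[abs_def] by simp
  finally show ?thesis using m \<delta>0 by simp
qed

lemma field_tspace: "generates \<gamma> x ==> j < q ==> m \<in> pts M ==> x j m \<in> tspace M m"
  using field_orbit orbit_tspace generatesD(5) by metis

lemma CY_D:
  assumes "CY_structure P \<omega> \<xi>"
  shows "m \<in> pts M ==> alt_form M n m (\<omega> m)"
    "(U, \<phi>) \<in> atlas M ==> m \<in> U ==> hol_fun_at M (\<lambda>p. \<omega> p (map (coord_vec M (U, \<phi>) p) [0..<n])) m"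
    "m \<in> pts M ==> \<exists>vs\<in>tlists M n m. \<omega> m vs \<noteq> 0"
    "multiplicative \<xi>"
    "h \<in> carrier H ==> m \<in> pts M ==> vs \<in> tlists M n m ==> \<omega> (m \<star> h) (map (push M (\<lambda>m. m \<star> h) m) vs) = \<xi> h * \<omega> m vs"
proof -
  note a = assms[unfolded CY_structure_def Let_def]
  have f: "hol_form M n (pts M) \<omega>" using a by (simp add: H0K_def)
  then show "m \<in> pts M ==> alt_form M n m (\<omega> m)" by (simp add: hol_form_def)
  show "multiplicative \<xi>" using a hol_character_multiplicative by blast
  show "m \<in> pts M ==> \<exists>vs\<in>tlists M n m. \<omega> m vs \<noteq> 0"
    "h \<in> carrier H ==> m \<in> pts M ==> vs \<in> tlists M n m ==> \<omega> (m \<star> h) (map (push M (\<lambda>m. m \<star> h) m) vs) = \<xi> h * \<omega> m vs"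
    using a by blast+
  assume U: "(U, \<phi>) \<in> atlas M" "m \<in> U"
  have "hol_fun M (U \<inter> pts M) (\<lambda>p. \<omega> p (map (coord_vec M (U, \<phi>) p) [0..<n]))"
  proof -
    have "\<forall>ks. length ks = n \<and> set ks \<subseteq> {..<n} --> hol_fun M (U \<inter> pts M) (\<lambda>p. \<omega> p (map (coord_vec M (U, \<phi>) p) ks))"
      using bspec[OF conjunct2[OF conjunct2[OF f[unfolded hol_form_def]]] U(1)] by simp
    from spec[OF this, of "[0..<n]"] show ?thesis by (simp add: atLeast0LessThan)
  qed
  moreover have "m \<in> U \<inter> pts M" using U hol_chart_sub[OF atlas_hol_chart[OF charted(1) U(1)]] by blast
  ultimately show "hol_fun_at M (\<lambda>p. \<omega> p (map (coord_vec M (U, \<phi>) p) [0..<n])) m" by (rule hol_fun_imp_at)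
qed

end

lemma det_block_triangular:
  fixes E :: "nat => nat => complex"
  assumes "\<And>i j. i < d ==> j < q ==> E (q + i) j = 0"
  shows "det_of (q + d) E
    = det_of q E * det_of d (\<lambda>i j. E (q + i) (q + j))"
proof -
  let ?A = "Matrix.mat q q (\<lambda>(i, j). E i j)" and ?B = "Matrix.mat q d (\<lambda>(i, j). E i (q + j))"
    and ?D = "Matrix.mat d d (\<lambda>(i, j). E (q + i) (q + j))"
  have "Matrix.mat (q + d) (q + d) (\<lambda>(i, j). E i j) = four_block_mat ?A ?B (0\<^sub>m d q) ?D"
  proof (rule eq_matI)
    fix i j assume "i < dim_row (four_block_mat ?A ?B (0\<^sub>m d q) ?D)" "j < dim_col (four_block_mat ?A ?B (0\<^sub>m d q) ?D)"
    then have ij: "i < q + d" "j < q + d" by simp_all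
    then show "Matrix.mat (q + d) (q + d) (\<lambda>(i, j). E i j) $$ (i, j) = four_block_mat ?A ?B (0\<^sub>m d q) ?D $$ (i, j)"
      using assms[of "i - q" j] by auto
  qed simp_all
  then show ?thesis using det_four_block_mat_lower_left_zero[of ?A q ?B d "0\<^sub>m d q" ?D] by simp
qed

text \<open>A vector in the kernel of the matrix would be a linear relation, as tangent vectors are determined by their
  values on the coordinates.\<close>

lemma tspace_independent_det:
  assumes N: "charted N" and W: "hol_chart N (W, \<phi>)" "p \<in> W" and v: "\<And>j. j < mdim N ==> v j \<in> tspace N p"
    and ind: "\<And>c. (\<And>f. (\<Sum>j<mdim N. c j * v j f) = 0) ==> \<forall>j<mdim N. c j = 0"
  shows "det_of (mdim N) (\<lambda>i j. v j (\<lambda>h. \<phi> h i)) \<noteq> 0"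
proof
  let ?q = "mdim N" and ?A = "Matrix.mat (mdim N) (mdim N) (\<lambda>(i, j). v j (\<lambda>h. \<phi> h i))"
  assume "Determinant.det ?A = 0"
  then have "\<exists>w. w \<in> carrier_vec ?q \<and> w \<noteq> 0\<^sub>v ?q \<and> ?A *\<^sub>v w = 0\<^sub>v ?q"
    using det_0_iff_vec_prod_zero[of ?A ?q] by simp
  then obtain w where w: "w \<in> carrier_vec ?q" "w \<noteq> 0\<^sub>v ?q" "?A *\<^sub>v w = 0\<^sub>v ?q" by blast
  have z: "(\<Sum>j<?q. w $ j * v j (\<lambda>h. \<phi> h i)) = 0" if "i < ?q" for i
  proof -
    have "(?A *\<^sub>v w) $ i = (\<Sum>j<?q. v j (\<lambda>h. \<phi> h i) * w $ j)"
      using that w(1) by (simp add: scalar_prod_def atLeast0LessThan)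
    then show ?thesis using w(3) that by (simp add: mult.commute)
  qed
  have p: "p \<in> pts N" by (rule hol_chart_sub[OF W])
  have "(\<lambda>f. \<Sum>j<?q. w $ j * v j f) = (\<lambda>f. 0)"
  proof (rule tspace_ext[OF N W])
    show "(\<lambda>f. \<Sum>j<?q. w $ j * v j f) \<in> tspace N p" by (rule tspace_sum[OF N p v])
    show "(\<lambda>f. 0) \<in> tspace N p" by (rule tspace_zero[OF N p])
  qed (rule z)
  then have "(\<Sum>j<?q. w $ j * v j f) = 0" for f by (rule fun_cong)
  from ind[of "\<lambda>j. w $ j", OF this] have "\<forall>j<?q. w $ j = 0" .
  then have "w = 0\<^sub>v ?q" using w(1) by (intro eq_vecI) auto
  with w(2) show False by simp
qed

context principal_bundle
begin

lemma local_triv_maps: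
  assumes t: "local_triv m U s k"
  defines "F \<equiv> \<lambda>a. s (snd a) \<star> fst a" and "G \<equiv> \<lambda>m'. (k m', pr m')" and "T \<equiv> {m' \<in> pts M. pr m' \<in> U}"
  shows "openin (mtop (prod_mfd Hm X)) (pts Hm \<times> U)" "openin (mtop M) T"
    "a \<in> pts Hm \<times> U ==> hol_at (prod_mfd Hm X) M F a" "a \<in> pts Hm \<times> U ==> G (F a) = a" "a \<in> pts Hm \<times> U ==> F a \<in> T"
    "m' \<in> T ==> hol_at M (prod_mfd Hm X) G m'" "m' \<in> T ==> F (G m') = m'"
proof -
  note D = local_trivD[OF t] and A = charted_prod[OF charted(3) charted(2)]
  show "openin (mtop (prod_mfd Hm X)) (pts Hm \<times> U)" using D(1) by (simp add: openin_prod_Times_iff)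
  show "openin (mtop M) T"
  proof (subst openin_subopen, intro ballI)
    fix m' assume m': "m' \<in> T"
    then have "m' \<in> pts M" "pr m' \<in> U" by (simp_all add: T_def)
    from hol_at_nbhd[OF pr_hol[OF this(1)] D(1) this(2)]
    obtain S where S: "openin (mtop M) S" "m' \<in> S" "\<forall>q\<in>S. pr q \<in> U" by blast
    then show "\<exists>S. openin (mtop M) S \<and> m' \<in> S \<and> S \<subseteq> T"
      using openin_subset[OF S(1)] unfolding T_def by (intro exI[of _ S]) blast
  qed
  show "m' \<in> T ==> hol_at M (prod_mfd Hm X) G m'" unfolding G_def T_def
    by (intro hol_at_Pair[OF charted(1,3,2)] D(6) pr_hol) simp_all
  show "m' \<in> T ==> F (G m') = m'" unfolding F_def G_def T_def using D(7) by simp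
  assume a: "a \<in> pts Hm \<times> U"
  have fs: "fst a \<in> pts Hm" "snd a \<in> U" "fst a \<in> carrier H" using a by (simp_all add: mem_Times_iff H_pts)
  have sX: "snd a \<in> pts X" using openin_subset[OF D(1)] fs(2) by blast
  have 1: "hol_at (prod_mfd Hm X) Hm fst a" and 2: "hol_at (prod_mfd Hm X) X snd a"
    using hol_at_fst[OF charted(3,2) fs(1) sX] hol_at_snd[OF charted(3,2) fs(1) sX] by simp_all
  show "hol_at (prod_mfd Hm X) M F a" unfolding F_def
    by (rule act_hol[OF A hol_at_compose[OF 2 D(4)[OF fs(2)]] 1])
  show "F a \<in> T" unfolding F_def T_def using D(5,8)[OF fs(2)] act_pts fs(2,3) by simp
  show "G (F a) = a" unfolding F_def G_def
    using D(5,8)[OF fs(2)] fs(3) local_triv_act[OF t fs(2,3)] by (intro prod_eqI) simp_all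
qed

text \<open>A local trivialisation is a biholomorphic map onto an open subset of M.\<close>

lemma dim_total: "m \<in> pts M ==> n = q + d"
proof -
  assume m: "m \<in> pts M"
  obtain U s k where t: "local_triv m U s k" using local_triv_ex[OF m] by blast
  note L = local_triv_maps[OF t]
  have p: "(\<one>\<^bsub>H\<^esub>, pr m) \<in> pts Hm \<times> U" using one_pts local_trivD(2)[OF t] by simp
  from biholomorphic_dim[OF charted_prod[OF charted(3) charted(2)] charted(1) L(1) L(3) L(2) L(6) p L(5)[OF p] L(4) L(7)]
  show ?thesis by simp
qed

text \<open>In a local trivialisation the volume form is a function times the determinant in product coordinates
  on the group times the base. The fields are vertical and, at the points of the section, have constant
  group components, so the determinant splits off the constant determinant of the basis of the Lie
  algebra.\<close>

lemma contraction_local: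
  assumes cy: "CY_structure P \<omega> \<xi>" and gen: "generates \<gamma> x" and m0: "m0 \<in> pts M"
  shows "\<exists>U s V z K. openin (mtop X) U \<and> (\<forall>y\<in>U. hol_at X M s y \<and> pr (s y) = y) \<and> (V, z) \<in> atlas X
    \<and> hol_chart X (V, z) \<and> pr m0 \<in> U \<inter> V \<and> (\<forall>y\<in>U \<inter> V. hol_fun_at X K y \<and> K y \<noteq> 0 \<and> (\<forall>vs\<in>tlists M d (s y).
        iter_contract q x \<omega> (s y) vs = K y * dz_wedge z 0 d (map (push X pr (s y)) vs)))"
proof -
  obtain U s k where t: "local_triv m0 U s k" using local_triv_ex[OF m0] by blast
  note D = local_trivD[OF t] and L = local_triv_maps[OF t] and CY = CY_D[OF cy]
  let ?F = "\<lambda>a. s (snd a) \<star> fst a" and ?G = "\<lambda>m'. (k m', pr m')" and ?A = "prod_mfd Hm X"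
  obtain V z where V: "(V, z) \<in> atlas X" "hol_chart X (V, z)" "pr m0 \<in> V" using chart_ex[OF charted(2) pr_pts[OF m0]] by blast
  obtain W \<phi> where W: "hol_chart Hm (W, \<phi>)" "\<one>\<^bsub>H\<^esub> \<in> W" using chart_ex[OF charted(3) one_pts] by blast
  let ?\<kappa> = "prod_chart q \<phi> z"
  have A: "charted ?A" by (rule charted_prod[OF charted(3) charted(2)])
  have ch: "hol_chart ?A (W \<times> V, ?\<kappa>)" by (rule prod_hol_chart[OF W(1) V(2) charted(3) charted(2)])
  have n: "n = q + d" by (rule dim_total[OF m0])
  let ?E = "\<lambda>y. coord_vec ?A (W \<times> V, ?\<kappa>) (\<one>\<^bsub>H\<^esub>, y)"
  \<comment> \<open>coefficient of the volume form in product coordinates, at the unit of the group\<close>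
  define w where "w y = \<omega> (s y) (map (\<lambda>i. push M ?F (\<one>\<^bsub>H\<^esub>, y) (?E y i)) [0..<n])" for y
  \<comment> \<open>the determinant of the basis of the Lie algebra, in the reversed order in which the fields are inserted\<close>
  define c where "c = det_of q (\<lambda>i j. velocity Hm (\<gamma> (q - 1 - j)) (\<lambda>h. \<phi> h i))"
  have c0: "c \<noteq> 0" unfolding c_def
  proof (rule tspace_independent_det[OF charted(3) W, of "\<lambda>j. velocity Hm (\<gamma> (q - 1 - j))"])
    show "velocity Hm (\<gamma> (q - 1 - j)) \<in> tspace Hm \<one>\<^bsub>H\<^esub>" if "j < q" for j
      by (rule generatesD(5)[OF gen]) (use that in simp)
    fix b assume b: "\<And>f. (\<Sum>j<q. b j * velocity Hm (\<gamma> (q - 1 - j)) f) = 0"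
    have "(\<Sum>j<q. b (q - 1 - j) * velocity Hm (\<gamma> j) f) = 0" for f
      using b[of f] by (subst sum.nat_diff_reindex[symmetric]) (simp add: atLeast0LessThan cong: sum.cong_simp)
    moreover have "\<forall>c. (\<forall>f. (\<Sum>j<q. c j * velocity Hm (\<gamma> j) f) = 0) --> (\<forall>j<q. c j = 0)"
      using gen unfolding generates_def by (elim conjE)
    from spec[OF this, of "\<lambda>j. b (q - 1 - j)"]
    have "(\<forall>f. (\<Sum>j<q. b (q - 1 - j) * velocity Hm (\<gamma> j) f) = 0) --> (\<forall>j<q. b (q - 1 - j) = 0)" .
    ultimately have b0: "\<forall>j<q. b (q - 1 - j) = 0" by (simp only: simp_thms)
    show "\<forall>j<q. b j = 0"
    proof (intro allI impI)
      fix j assume "j < q"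
      then show "b j = 0" using b0[rule_format, of "q - 1 - j"] by simp
    qed
  qed
  have y1: "(\<one>\<^bsub>H\<^esub>, y) \<in> pts Hm \<times> U" "?F (\<one>\<^bsub>H\<^esub>, y) = s y" "(\<one>\<^bsub>H\<^esub>, y) \<in> W \<times> V" "y \<in> pts X"
    if "y \<in> U \<inter> V" for y using that one_pts W(2) D(8)[of y] openin_subset[OF D(1)] by auto
  have Gs: "?G (s y) = (\<one>\<^bsub>H\<^esub>, y)" "s y \<in> {m' \<in> pts M. pr m' \<in> U}" if "y \<in> U \<inter> V" for y
    using L(4)[OF y1(1)[OF that]] L(5)[OF y1(1)[OF that]] y1(2)[OF that] by simp_all
  have FE: "push M ?F (\<one>\<^bsub>H\<^esub>, y) (?E y i) \<in> tspace M (s y)" if y: "y \<in> U \<inter> V" and i: "i < n" for y i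
    using push_tspace_at[OF A charted(1) L(1) L(3) y1(1)[OF y] coord_vec_tspace[OF A ch y1(3)[OF y], of i]] y1(2)[OF y] i n by simp
  have form: "\<omega> (s y) us = dz_wedge ?\<kappa> 0 (q + d) (map (push ?A ?G (s y)) us) * w y"
    if y: "y \<in> U \<inter> V" and us: "us \<in> tlists M n (s y)" for y us
  proof -
    let ?a = "(\<one>\<^bsub>H\<^esub>, y)"
    define \<alpha> where "\<alpha> ws = \<omega> (s y) (map (push M ?F ?a) ws)" for ws
    have sy: "s y \<in> pts M" using Gs(2)[OF y] by simp
    have Ft: "push M ?F ?a v \<in> tspace M (s y)" if "v \<in> tspace ?A ?a" for v
      using push_tspace_at[OF A charted(1) L(1) L(3) y1(1)[OF y] that] y1(2)[OF y] by simp
    have "alt_form ?A n ?a \<alpha>" unfolding \<alpha>_def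
    proof (rule alt_form_pull[OF CY(1)[OF sy]])
      show "push M ?F ?a v \<in> tspace M (s y)" if "v \<in> tspace ?A ?a" for v by (rule Ft[OF that])
      show "push M ?F ?a (\<lambda>f. a * u f + b * v f) = (\<lambda>f. a * push M ?F ?a u f + b * push M ?F ?a v f)" for u v a b
        by (rule push_lin)
    qed
    then have alt: "alt_form ?A (mdim ?A) ?a \<alpha>" by (simp add: n)
    have Gt: "push ?A ?G (s y) v \<in> tspace ?A ?a" if "v \<in> tspace M (s y)" for v
      using push_tspace_at[OF charted(1) A L(2) L(6) Gs(2)[OF y] that] Gs(1)[OF y] by simp
    have Gus: "map (push ?A ?G (s y)) us \<in> tlists ?A (mdim ?A) ?a" using us Gt n by (auto simp: tlists_def)
    have FG: "push M ?F ?a (push ?A ?G (s y) v) = v" if v: "v \<in> tspace M (s y)" for v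
    proof -
      have "hol_at ?A M ?F (?G (s y))" unfolding Gs(1)[OF y] by (rule L(3)[OF y1(1)[OF y]])
      from push_push[where N = ?A and K = M and G = ?F and F = ?G and p = "s y", OF this, of v]
      have "push M ?F ?a (push ?A ?G (s y) v) = push M (\<lambda>m'. ?F (?G m')) (s y) v" unfolding Gs(1)[OF y] .
      also have "\<dots> = push M (\<lambda>m'. m') (s y) v" by (rule push_cong[OF charted(1) v L(2) Gs(2)[OF y] L(7)])
      finally show ?thesis using push_id[OF v] by simp
    qed
    have "map (push M ?F ?a) (map (push ?A ?G (s y)) us) = map (\<lambda>v. v) us"
      unfolding map_map comp_def by (rule map_cong[OF refl]) (use us FG in \<open>auto simp: tlists_def\<close>)
    then have "\<omega> (s y) us = \<alpha> (map (push ?A ?G (s y)) us)" unfolding \<alpha>_def by (simp only: list.map_ident)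
    also have "\<dots> = dz_wedge ?\<kappa> 0 (mdim ?A) (map (push ?A ?G (s y)) us) * \<alpha> (map (?E y) [0..<mdim ?A])"
      by (rule top_form_chart[OF A ch y1(3)[OF y] alt Gus])
    also have "\<alpha> (map (?E y) [0..<mdim ?A]) = w y" unfolding \<alpha>_def w_def n by (simp add: comp_def)
    finally show ?thesis by simp
  qed
  have w0: "w y \<noteq> 0" if y: "y \<in> U \<inter> V" for y
    using CY(3)[of "s y"] Gs(2)[OF y] form[OF y] by fastforce
  have whol: "hol_fun_at X w y1" if y1U: "y1 \<in> U \<inter> V" for y1
  proof -
    have s1: "s y1 \<in> pts M" using Gs(2)[OF y1U] by simp
    obtain N \<psi> where N: "(N, \<psi>) \<in> atlas M" "hol_chart M (N, \<psi>)" "s y1 \<in> N" using chart_ex[OF charted(1) s1] by blast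
    have hs: "hol_at X M s y1" using D(4) y1U by blast
    obtain Q where Q: "openin (mtop X) Q" "y1 \<in> Q" "\<forall>y\<in>Q. s y \<in> N" using hol_at_nbhd[OF hs hol_chartD(1)[OF N(2)] N(3)] by blast
    let ?J = "\<lambda>i j y. ?E y j (\<lambda>a. \<psi> (?F a) i)"
    have hF: "hol_fun_at ?A (\<lambda>a. \<psi> (?F a) i) (\<one>\<^bsub>H\<^esub>, y)" if y: "y \<in> U \<inter> V" "s y \<in> N" for y i
    proof (rule hol_at_pull[where F = ?F and f = "\<lambda>m. \<psi> m i", OF L(3)[OF y1(1)[OF y(1)]]])
      show "hol_fun_at M (\<lambda>m. \<psi> m i) (?F (\<one>\<^bsub>H\<^esub>, y))"
        unfolding y1(2)[OF y(1)] by (rule hol_fun_at_coord[OF charted(1) N(2) y(2)])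
    qed
    have J: "hol_fun_at X (?J i j) y1" if "j < n" for i j
    proof (rule hol_at_pull[where F = "\<lambda>y. (\<one>\<^bsub>H\<^esub>, y)" and f = "\<lambda>a. coord_vec ?A (W \<times> V, ?\<kappa>) a j (\<lambda>a. \<psi> (?F a) i)"])
      show "hol_at X ?A (\<lambda>y. (\<one>\<^bsub>H\<^esub>, y)) y1"
        by (rule hol_at_Pair[OF charted(2,3,2) hol_at_const[OF charted(2) y1(4)[OF y1U] one_pts] hol_at_id[OF y1(4)[OF y1U]]])
      show "hol_fun_at ?A (\<lambda>a. coord_vec ?A (W \<times> V, ?\<kappa>) a j (\<lambda>a. \<psi> (?F a) i)) (\<one>\<^bsub>H\<^esub>, y1)"
        by (rule hol_fun_at_coord_vec[OF A ch y1(3)[OF y1U] _ hF[OF y1U N(3)]]) (use that n in simp)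
    qed
    have h: "hol_fun_at X (\<lambda>y. det_of n (\<lambda>i j. ?J i j y) * \<omega> (s y) (map (coord_vec M (N, \<psi>) (s y)) [0..<n])) y1"
      by (intro hol_fun_at_mult[OF charted(2)] hol_fun_at_det[OF charted(2) y1(4)[OF y1U]] J
          hol_at_pull[where F = s and f = "\<lambda>m. \<omega> m (map (coord_vec M (N, \<psi>) m) [0..<n])", OF hs CY(2)[OF N(1,3)]])
    show ?thesis
    proof (rule hol_fun_at_cong[OF charted(2) _ _ _ h])
      show "openin (mtop X) (Q \<inter> (U \<inter> V))" using Q(1) D(1) hol_chartD(1)[OF V(2)] by blast
      show "y1 \<in> Q \<inter> (U \<inter> V)" using Q(2) y1U by blast
      fix y assume "y \<in> Q \<inter> (U \<inter> V)"
      then have y: "y \<in> U \<inter> V" "s y \<in> N" using Q(3) by auto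
      have sy: "s y \<in> pts M" using Gs(2)[OF y(1)] by simp
      let ?us = "map (\<lambda>i. push M ?F (\<one>\<^bsub>H\<^esub>, y) (?E y i)) [0..<n]"
      have us: "?us \<in> tlists M n (s y)" by (rule tlists_map[OF FE[OF y(1)]])
      have "push M ?F (\<one>\<^bsub>H\<^esub>, y) v (\<lambda>m. \<psi> m i) = v (\<lambda>a. \<psi> (?F a) i)" for v i
        by (rule push_hol[where F = ?F and f = "\<lambda>m. \<psi> m i"], unfold y1(2)[OF y(1)])
          (rule hol_fun_at_coord[OF charted(1) N(2) y(2)])
      then have "dz_wedge \<psi> 0 n ?us = det_of n (\<lambda>i j. ?J i j y)"
        unfolding dz_wedge_def by (intro arg_cong[where f = Determinant.det] eq_matI) simp_all
      then show "det_of n (\<lambda>i j. ?J i j y) * \<omega> (s y) (map (coord_vec M (N, \<psi>) (s y)) [0..<n]) = w y"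
        unfolding w_def using top_form_chart[OF charted(1) N(2) y(2) CY(1)[OF sy] us] by simp
    qed
  qed
  have fin: "iter_contract q x \<omega> (s y) vs = c * w y * dz_wedge z 0 d (map (push X pr (s y)) vs)"
    if y: "y \<in> U \<inter> V" and vs: "vs \<in> tlists M d (s y)" for y vs
  proof -
    have sy: "s y \<in> pts M" "pr (s y) = y" using Gs[OF y] by simp_all
    let ?us = "rev (map (\<lambda>j. x j (s y)) [0..<q]) @ vs"
    have us: "?us \<in> tlists M n (s y)" using vs field_tspace[OF gen _ sy(1)] n by (auto simp: tlists_def)
    have coord: "hol_fun_at M (\<lambda>m. ?\<kappa> (?G m) i) (s y)" for i
    proof (rule hol_at_pull[where F = ?G and f = "\<lambda>a. ?\<kappa> a i", OF L(6)[OF Gs(2)[OF y]]])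
      show "hol_fun_at ?A (\<lambda>a. ?\<kappa> a i) (?G (s y))" unfolding Gs(1)[OF y] by (rule hol_fun_at_coord[OF A ch y1(3)[OF y]])
    qed
    \<comment> \<open>G is the inverse of the trivialisation F, and coordinates of the product are pulled back along it\<close>
    have P: "push ?A ?G (s y) v (\<lambda>a. ?\<kappa> a i) = v (\<lambda>m. ?\<kappa> (?G m) i)" for v i
      by (rule push_hol[where F = ?G and f = "\<lambda>a. ?\<kappa> a i"], unfold Gs(1)[OF y]) (rule hol_fun_at_coord[OF A ch y1(3)[OF y]])
    have xs: "x j (s y) (\<lambda>m. ?\<kappa> (?G m) i) = (if i < q then velocity Hm (\<gamma> j) (\<lambda>h. \<phi> h i) else 0)" if j: "j < q" for i j
    proof -
      note g = generatesD[OF gen j]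
      have kp: "k (s y \<star> \<gamma> j t) = \<gamma> j t" "pr (s y \<star> \<gamma> j t) = y" for t
        using local_triv_act[OF t _ g(2)] pr_act[OF sy(1) g(2)] sy(2) y by simp_all
      have s0: "s y \<star> \<gamma> j 0 = s y" using g(3) sy(1) by simp
      have "velocity M (\<lambda>t. s y \<star> \<gamma> j t) (\<lambda>m. ?\<kappa> (?G m) i) = deriv (\<lambda>t. ?\<kappa> (?G (s y \<star> \<gamma> j t)) i) 0"
        by (rule velocity_hol[where \<gamma> = "\<lambda>t. s y \<star> \<gamma> j t" and f = "\<lambda>m. ?\<kappa> (?G m) i"], unfold s0) (rule coord)
      then have e: "x j (s y) (\<lambda>m. ?\<kappa> (?G m) i) = deriv (\<lambda>t. if i < q then \<phi> (\<gamma> j t) i else z y (i - q)) 0"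
        unfolding g(4)[OF sy(1)] prod_chart_apply kp fst_conv snd_conv .
      have "velocity Hm (\<gamma> j) (\<lambda>h. \<phi> h i) = deriv (\<lambda>t. \<phi> (\<gamma> j t) i) 0"
        by (rule velocity_hol[where \<gamma> = "\<gamma> j" and f = "\<lambda>h. \<phi> h i"], unfold g(3)) (rule hol_fun_at_coord[OF charted(3) W])
      then show ?thesis unfolding e by (cases "i < q") simp_all
    qed
    have vi: "v (\<lambda>m. ?\<kappa> (?G m) (q + i)) = push X pr (s y) v (\<lambda>y. z y i)" for v i
      using push_hol[of X "\<lambda>y. z y i" pr "s y" v] hol_fun_at_coord[OF charted(2) V(2), of y i] y sy(2)
      by (simp add: prod_chart_apply)
    define E where "E i j = (?us ! j) (\<lambda>m. ?\<kappa> (?G m) i)" for i j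
    have nth: "?us ! j = x (q - 1 - j) (s y)" if "j < q" for j
      using that by (simp add: nth_append rev_nth)
    \<comment> \<open>the block below the diagonal vanishes, since the fields do not move the base point\<close>
    have El: "E i j = (if i < q then velocity Hm (\<gamma> (q - 1 - j)) (\<lambda>h. \<phi> h i) else 0)" if "j < q" for i j
      unfolding E_def nth[OF that] by (rule xs) (use that in simp)
    have lv: "length vs = d" by (rule tlists_length[OF vs])
    have "dz_wedge ?\<kappa> 0 (q + d) (map (push ?A ?G (s y)) ?us) = det_of (q + d) E"
      unfolding dz_wedge_def by (intro arg_cong[where f = Determinant.det] eq_matI)
        (simp_all add: E_def P lv del: map_append)
    also have "\<dots> = det_of q E * det_of d (\<lambda>i j. E (q + i) (q + j))"
      by (rule det_block_triangular) (simp add: El)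
    also have "Matrix.mat q q (\<lambda>(i, j). E i j) = Matrix.mat q q (\<lambda>(i, j). velocity Hm (\<gamma> (q - 1 - j)) (\<lambda>h. \<phi> h i))"
      by (rule eq_matI) (simp_all add: El)
    also have "Matrix.mat d d (\<lambda>(i, j). E (q + i) (q + j)) = Matrix.mat d d (\<lambda>(i, j). (map (push X pr (s y)) vs ! j) (\<lambda>y. z y (0 + i)))"
      by (rule eq_matI) (simp_all add: E_def nth_append vi lv)
    finally have "dz_wedge ?\<kappa> 0 (q + d) (map (push ?A ?G (s y)) ?us) = c * dz_wedge z 0 d (map (push X pr (s y)) vs)"
      unfolding c_def dz_wedge_def .
    then show ?thesis unfolding iter_contract_rev form[OF y us] by simp
  qed
  have "hol_fun_at X (\<lambda>y. c * w y) y" if "y \<in> U \<inter> V" for y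
    by (intro hol_fun_at_mult[OF charted(2)] hol_fun_at_const[OF charted(2) y1(4)[OF that]] whol that)
  then show ?thesis using D(1,2,4,5) V c0 w0 fin
    by (intro exI[of _ U] exI[of _ s] exI[of _ V] exI[of _ z] exI[of _ "\<lambda>y. c * w y"]) simp
qed

end

section \<open>Comparison with the canonical bundle\<close>

context principal_bundle
begin

text \<open>A local section through m lifts tangent vectors of the base.\<close>

lemma lift_ex:
  assumes m: "m \<in> pts M" and us: "us \<in> tlists X l (pr m)"
  shows "\<exists>vs\<in>tlists M l m. map (push X pr m) vs = us"
proof -
  obtain U s k where t: "local_triv m U s k" using local_triv_ex[OF m] by blast
  note D = local_trivD[OF t]
  let ?y = "pr m"
  have sv: "push M s ?y u \<in> tspace M m" if "u \<in> tspace X ?y" for u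
    using push_tspace_at[OF charted(2,1) D(1) D(4) D(2) that] D(3) by simp
  have pu: "push X pr m (push M s ?y u) = u" if u: "u \<in> tspace X ?y" for u
  proof -
    have "hol_at M X pr (s ?y)" unfolding D(3) by (rule pr_hol[OF m])
    from push_push[where N = M and K = X and G = pr and F = s and p = ?y, OF this, of u]
    have "push X pr m (push M s ?y u) = push X (\<lambda>y. pr (s y)) ?y u" unfolding D(3) .
    also have "\<dots> = push X (\<lambda>y. y) ?y u" by (rule push_cong[OF charted(2) u D(1,2) D(5)])
    finally show ?thesis using push_id[OF u] by simp
  qed
  have ut: "u \<in> tspace X ?y" if "u \<in> set us" for u using us that by (auto simp: tlists_def)
  have "map (push X pr m) (map (push M s ?y) us) = map (\<lambda>u. u) us"
    unfolding map_map comp_def by (rule map_cong[OF refl], rule pu, rule ut)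
  then have "map (push X pr m) (map (push M s ?y) us) = us" by (simp only: list.map_ident)
  moreover have "map (push M s ?y) us \<in> tlists M l m" using us sv ut by (auto simp: tlists_def)
  ultimately show ?thesis by blast
qed

text \<open>Translation by h changes the volume form by its character and the fields by Ad(h).\<close>

lemma contraction_act:
  assumes cy: "CY_structure P \<omega> \<xi>" and gen: "generates \<gamma> x" and m: "m \<in> pts M" and h: "h \<in> carrier H"
    and vs: "vs \<in> tlists M d m"
  shows "iter_contract q x \<omega> (m \<star> h) (map (push M (\<lambda>m. m \<star> h) m) vs) = \<xi> h * adj_char P h * iter_contract q x \<omega> m vs"
proof -
  let ?o = "push M (\<lambda>g. m \<star> g) \<one>\<^bsub>H\<^esub>" and ?R = "push M (\<lambda>m. m \<star> h) m"
  let ?as = "map (\<lambda>j. velocity Hm (\<gamma> j)) [0..<q]"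
  define \<alpha> where "\<alpha> bs = \<omega> m (rev (map ?o bs) @ vs)" for bs
  have n: "n = q + d" by (rule dim_total[OF m])
  have as: "?as \<in> tlists Hm q \<one>\<^bsub>H\<^esub>" by (rule tlists_map[OF generatesD(5)[OF gen]])
  have Adas: "map (Ad h) ?as \<in> tlists Hm q \<one>\<^bsub>H\<^esub>" using as Ad_tspace[OF h] by (auto simp: tlists_def)
  have alt: "alt_form Hm q \<one>\<^bsub>H\<^esub> \<alpha>" unfolding \<alpha>_def
  proof (rule alt_form_pull[where \<alpha> = "\<lambda>ws. \<omega> m (rev ws @ vs)" and T = ?o])
    have "alt_form M (q + d) m (\<omega> m)" using CY_D(1)[OF cy m] n by simp
    from alt_form_append_left[OF this vs] have "alt_form M q m (\<lambda>ws. \<omega> m (ws @ vs))" .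
    from alt_form_rev[OF this] show "alt_form M q m (\<lambda>ws. \<omega> m (rev ws @ vs))" .
    show "?o v \<in> tspace M m" if "v \<in> tspace Hm \<one>\<^bsub>H\<^esub>" for v by (rule orbit_tspace[OF m that])
    show "?o (\<lambda>f. a * u f + b * w f) = (\<lambda>f. a * ?o u f + b * ?o w f)" for u w a b by (rule push_lin)
  qed
  have "map (\<lambda>j. x j (m \<star> h)) [0..<q] = map (\<lambda>j. ?R (?o (Ad h (velocity Hm (\<gamma> j))))) [0..<q]"
    by (rule map_cong[OF refl], rule field_act[OF gen _ m h]) simp
  then have e1: "map (\<lambda>j. x j (m \<star> h)) [0..<q] = map ?R (map ?o (map (Ad h) ?as))"
    by (simp only: map_map comp_def)
  have "map (\<lambda>j. x j m) [0..<q] = map (\<lambda>j. ?o (velocity Hm (\<gamma> j))) [0..<q]"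
    by (rule map_cong[OF refl], rule field_orbit[OF gen _ m]) simp
  then have e2: "map (\<lambda>j. x j m) [0..<q] = map ?o ?as" by (simp only: map_map comp_def)
  have t: "rev (map ?o (map (Ad h) ?as)) @ vs \<in> tlists M n m"
    using Adas vs orbit_tspace[OF m] n by (auto simp: tlists_def subset_iff)
  have "iter_contract q x \<omega> (m \<star> h) (map ?R vs) = \<omega> (m \<star> h) (map ?R (rev (map ?o (map (Ad h) ?as)) @ vs))"
    unfolding iter_contract_rev e1 by (simp only: rev_map map_append)
  also have "\<dots> = \<xi> h * \<alpha> (map (Ad h) ?as)" unfolding CY_D(5)[OF cy h m t] \<alpha>_def ..
  also have "\<alpha> (map (Ad h) ?as) = adj_char P h * \<alpha> ?as" by (rule adj_char_form[OF h alt as])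
  also have "\<alpha> ?as = iter_contract q x \<omega> m vs" unfolding \<alpha>_def iter_contract_rev e2 ..
  finally show ?thesis by simp
qed

text \<open>Translation by h identifies the tangent spaces at m and m h over the base.\<close>

lemma right_translate:
  assumes m: "m \<in> pts M" and h: "h \<in> carrier H" and vs: "vs \<in> tlists M l (m \<star> h)"
  shows "\<exists>ws\<in>tlists M l m. map (push M (\<lambda>m. m \<star> h) m) ws = vs \<and> map (push X pr m) ws = map (push X pr (m \<star> h)) vs"
proof -
  let ?i = "inv\<^bsub>H\<^esub> h" and ?R = "push M (\<lambda>m. m \<star> h) m"
  have i: "?i \<in> carrier H" and mh: "m \<star> h \<in> pts M" using h act_pts[OF m] by simp_all
  have undo: "m' \<star> h \<star> ?i = m'" "m' \<star> ?i \<star> h = m'" if "m' \<in> pts M" for m' using that h i by (simp_all add: act_mult)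
  let ?S = "push M (\<lambda>m. m \<star> ?i) (m \<star> h)"
  have S: "?S v \<in> tspace M m" if "v \<in> tspace M (m \<star> h)" for v
    using push_tspace_at[OF charted(1,1) openin_topspace act_right_hol[OF _ i] mh that] undo(1)[OF m] by simp
  have RS: "?R (?S v) = v" if v: "v \<in> tspace M (m \<star> h)" for v
  proof -
    have "hol_at M M (\<lambda>m. m \<star> h) (m \<star> h \<star> ?i)" unfolding undo(1)[OF m] by (rule act_right_hol[OF m h])
    from push_push[where N = M and K = M and G = "\<lambda>m. m \<star> h" and F = "\<lambda>m. m \<star> ?i" and p = "m \<star> h", OF this, of v]
    have "?R (?S v) = push M (\<lambda>m. m \<star> ?i \<star> h) (m \<star> h) v" unfolding undo(1)[OF m] .
    also have "\<dots> = push M (\<lambda>m. m) (m \<star> h) v" by (rule push_cong[OF charted(1) v openin_topspace mh undo(2)])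
    finally show ?thesis using push_id[OF v] by simp
  qed
  have pR: "push X pr (m \<star> h) (?R w) = push X pr m w" if w: "w \<in> tspace M m" for w
  proof -
    from push_push[where N = M and K = X and G = pr and F = "\<lambda>m. m \<star> h" and p = m, OF pr_hol[OF mh], of w]
    have "push X pr (m \<star> h) (?R w) = push X (\<lambda>m. pr (m \<star> h)) m w" .
    also have "\<dots> = push X pr m w" by (rule push_cong[OF charted(1) w openin_topspace m]) (rule pr_act[OF _ h])
    finally show ?thesis .
  qed
  have vt: "v \<in> tspace M (m \<star> h)" if "v \<in> set vs" for v using vs that by (auto simp: tlists_def)
  have "map ?R (map ?S vs) = map (\<lambda>v. v) vs"
    unfolding map_map comp_def by (rule map_cong[OF refl], rule RS, rule vt)
  then have 1: "map ?R (map ?S vs) = vs" by (simp only: list.map_ident)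
  have "push X pr m (?S v) = push X pr (m \<star> h) v" if "v \<in> set vs" for v
    using pR[OF S[OF vt[OF that]]] RS[OF vt[OF that]] by simp
  then have "map (push X pr m) (map ?S vs) = map (push X pr (m \<star> h)) vs" by simp
  moreover have "map ?S vs \<in> tlists M l m" using vs S vt by (auto simp: tlists_def)
  ultimately show ?thesis using 1 by blast
qed

text \<open>A homomorphism of line bundles is linear on fibers, and top forms are determined by their coefficient.\<close>

lemma canonical_iso_section:
  assumes iso: "lb_iso X (assoc_lb P \<eta>) (canonical_lb X) \<Theta>" and \<eta>: "multiplicative \<eta>"
    and s: "openin (mtop X) U" "\<And>y. y \<in> U ==> hol_at X M s y" "\<And>y. y \<in> U ==> pr (s y) = y" and V: "(V, z) \<in> atlas X"
  shows "\<exists>g. hol_fun X (U \<inter> V) g \<and> (\<forall>y\<in>U \<inter> V. g y \<noteq> 0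
    \<and> (\<forall>v. \<forall>us\<in>tlists X d y. \<Theta> y (cls \<eta> (s y) v) us = v * g y * dz_wedge z 0 d us))"
proof -
  let ?t = "\<lambda>x l. THE v. (s x, v) \<in> l" and ?k = "\<lambda>x \<alpha>. \<alpha> (map (coord_vec X (V, z) x) [0..<d])"
  have t: "(U, ?t) \<in> trivs (assoc_lb P \<eta>)" using s unfolding assoc_trivs by blast
  have k: "(V, ?k) \<in> trivs (canonical_lb X)" using V unfolding canonical_lb_def by auto
  have "\<forall>(U, t)\<in>trivs (assoc_lb P \<eta>). \<forall>(U', t')\<in>trivs (canonical_lb X). \<exists>g. hol_fun X (U \<inter> U') g
        \<and> (\<forall>x\<in>U \<inter> U'. g x \<noteq> 0 \<and> (\<forall>l\<in>fib (assoc_lb P \<eta>) x. t' x (\<Theta> x l) = g x * t x l))"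
    using iso unfolding lb_iso_def by (elim conjE)
  from bspec[OF this t] have "\<forall>(U', t')\<in>trivs (canonical_lb X). \<exists>g. hol_fun X (U \<inter> U') g
        \<and> (\<forall>x\<in>U \<inter> U'. g x \<noteq> 0 \<and> (\<forall>l\<in>fib (assoc_lb P \<eta>) x. t' x (\<Theta> x l) = g x * ?t x l))" by simp
  from bspec[OF this k] obtain g where g: "hol_fun X (U \<inter> V) g"
    "\<forall>x\<in>U \<inter> V. g x \<noteq> 0 \<and> (\<forall>l\<in>fib (assoc_lb P \<eta>) x. ?k x (\<Theta> x l) = g x * ?t x l)" by auto
  have "\<Theta> y (cls \<eta> (s y) v) us = v * g y * dz_wedge z 0 d us" if y: "y \<in> U \<inter> V" and us: "us \<in> tlists X d y" for y v us
  proof -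
    have sy: "s y \<in> pts M" using hol_at_pts(2)[OF s(2)] y by blast
    have yX: "y \<in> pts X" using openin_subset[OF s(1)] y by blast
    have f: "cls \<eta> (s y) v \<in> fib (assoc_lb P \<eta>) y" using assoc_fib[OF \<eta> sy] s(3)[of y] y by auto
    have "\<Theta> y (cls \<eta> (s y) v) \<in> fib (canonical_lb X) y" using iso f yX unfolding lb_iso_def by blast
    then have alt: "alt_form X d y (\<Theta> y (cls \<eta> (s y) v))" by (simp add: canonical_lb_def)
    have yV: "y \<in> V" using y by blast
    have "?k y (\<Theta> y (cls \<eta> (s y) v)) = g y * ?t y (cls \<eta> (s y) v)" using g(2) y f by blast
    also have "?t y (cls \<eta> (s y) v) = v" by (rule assoc_triv[OF \<eta> sy])
    finally show ?thesis
      using top_form_chart[OF charted(2) atlas_hol_chart[OF charted(2) V] yV alt us] by simp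
  qed
  then show ?thesis using g by (intro exI[of _ g]) blast
qed

lemma canonical_iso_at:
  assumes iso: "lb_iso X (assoc_lb P \<eta>) (canonical_lb X) \<Theta>" and \<eta>: "multiplicative \<eta>" and m: "m \<in> pts M"
  shows "\<exists>V z c. hol_chart X (V, z) \<and> pr m \<in> V \<and> c \<noteq> 0
    \<and> (\<forall>v. \<forall>us\<in>tlists X d (pr m). \<Theta> (pr m) (cls \<eta> m v) us = v * c * dz_wedge z 0 d us)"
proof -
  obtain U s k where t: "local_triv m U s k" using local_triv_ex[OF m] by blast
  note D = local_trivD[OF t]
  obtain V z where V: "(V, z) \<in> atlas X" "hol_chart X (V, z)" "pr m \<in> V" using chart_ex[OF charted(2) pr_pts[OF m]] by blast
  have y: "pr m \<in> U \<inter> V" using D(2) V(3) by simp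
  obtain g where "\<forall>y\<in>U \<inter> V. g y \<noteq> 0
    \<and> (\<forall>v. \<forall>us\<in>tlists X d y. \<Theta> y (cls \<eta> (s y) v) us = v * g y * dz_wedge z 0 d us)"
    using canonical_iso_section[OF iso \<eta> D(1,4,5) V(1)] by blast
  from bspec[OF this y] show ?thesis using V(2,3) unfolding D(3) by blast
qed

lemma canonical_iso_act:
  assumes iso: "lb_iso X (assoc_lb P \<eta>) (canonical_lb X) \<Theta>" and \<eta>: "multiplicative \<eta>" and m: "m \<in> pts M"
    and h: "h \<in> carrier H" and us: "us \<in> tlists X d (pr m)"
  shows "\<Theta> (pr m) (cls \<eta> (m \<star> h) v) us = \<eta> h * v * \<Theta> (pr m) (cls \<eta> m 1) us"
proof -
  obtain V z c where "\<forall>v. \<forall>us\<in>tlists X d (pr m). \<Theta> (pr m) (cls \<eta> m v) us = v * c * dz_wedge z 0 d us"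
    using canonical_iso_at[OF iso \<eta> m] by blast
  then show ?thesis unfolding cls_act[OF \<eta> m h] using us by simp
qed

text \<open>Both sides are holomorphic families of nonzero top forms on the base that transform under the group
  by the same character, so their quotient is a holomorphic function on the compact connected base.\<close>

lemma contraction_ratio:
  assumes cy: "CY_structure P \<omega> \<xi>" and gen: "generates \<gamma> x" and \<eta>_def: "\<eta> = (\<lambda>h. \<xi> h * adj_char P h)"
    and iso: "lb_iso X (assoc_lb P \<eta>) (canonical_lb X) \<Theta>"
    and comp: "compact_space (mtop X)" "connected_space (mtop X)" and ne: "pts X \<noteq> {}"
  shows "\<exists>c. c \<noteq> 0 \<and> (\<forall>m\<in>pts M. \<forall>vs\<in>tlists M d m.
    \<Theta> (pr m) (cls \<eta> m 1) (map (push X pr m) vs) = c * iter_contract q x \<omega> m vs)"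
proof -
  have \<eta>: "multiplicative \<eta>" unfolding \<eta>_def by (rule multiplicative_mult[OF CY_D(4)[OF cy] adj_char_multiplicative])
  define ratio where "ratio y c \<longleftrightarrow> (\<forall>m\<in>pts M. pr m = y --> (\<forall>vs\<in>tlists M d m.
    \<Theta> y (cls \<eta> m 1) (map (push X pr m) vs) = c * iter_contract q x \<omega> m vs))" for y c
  have loc: "\<exists>U f. openin (mtop X) U \<and> x0 \<in> U \<and> (\<forall>y\<in>U. hol_fun_at X f y \<and> f y \<noteq> 0 \<and> ratio y (f y) \<and> (\<forall>c. ratio y c --> c = f y))"
    if x0: "x0 \<in> pts X" for x0
  proof -
    obtain m0 where m0: "m0 \<in> pts M" "pr m0 = x0" using pr_surj[OF x0] by blast
    obtain U s V z K where U: "openin (mtop X) U" "\<forall>y\<in>U. hol_at X M s y \<and> pr (s y) = y" "(V, z) \<in> atlas X"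
      "hol_chart X (V, z)" "pr m0 \<in> U \<inter> V" and K: "\<forall>y\<in>U \<inter> V. hol_fun_at X K y \<and> K y \<noteq> 0 \<and> (\<forall>vs\<in>tlists M d (s y).
        iter_contract q x \<omega> (s y) vs = K y * dz_wedge z 0 d (map (push X pr (s y)) vs))"
      using contraction_local[OF cy gen m0(1)] by (elim exE conjE)
    have sU: "hol_at X M s y" "pr (s y) = y" if "y \<in> U" for y using U(2) that by simp_all
    have "\<exists>g. hol_fun X (U \<inter> V) g \<and> (\<forall>y\<in>U \<inter> V. g y \<noteq> 0
      \<and> (\<forall>v. \<forall>us\<in>tlists X d y. \<Theta> y (cls \<eta> (s y) v) us = v * g y * dz_wedge z 0 d us))"
      by (rule canonical_iso_section[OF iso \<eta> U(1) sU U(3)])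
    then obtain g where g: "hol_fun X (U \<inter> V) g" "\<forall>y\<in>U \<inter> V. g y \<noteq> 0
      \<and> (\<forall>v. \<forall>us\<in>tlists X d y. \<Theta> y (cls \<eta> (s y) v) us = v * g y * dz_wedge z 0 d us)"
      by (elim exE conjE)
    have "hol_fun_at X (\<lambda>y. g y / K y) y \<and> g y / K y \<noteq> 0 \<and> ratio y (g y / K y) \<and> (\<forall>c. ratio y c --> c = g y / K y)"
      if y: "y \<in> U \<inter> V" for y
    proof (intro conjI allI impI)
      have Ky: "hol_fun_at X K y" "K y \<noteq> 0" and It: "\<And>vs. vs \<in> tlists M d (s y) ==>
          iter_contract q x \<omega> (s y) vs = K y * dz_wedge z 0 d (map (push X pr (s y)) vs)"
        using K y by simp_all
      have gy: "g y \<noteq> 0" and Th: "\<And>v us. us \<in> tlists X d y ==> \<Theta> y (cls \<eta> (s y) v) us = v * g y * dz_wedge z 0 d us"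
        using g(2) y by simp_all
      have sy: "s y \<in> pts M" "pr (s y) = y" using hol_at_pts(2)[OF sU(1)] sU(2) y by simp_all
      show "hol_fun_at X (\<lambda>y. g y / K y) y"
        by (rule hol_fun_at_divide[OF charted(2) hol_fun_imp_at[OF g(1) y] Ky])
      show "g y / K y \<noteq> 0" using gy Ky(2) by simp
      have push_t: "map (push X pr (s y)) ws \<in> tlists X d y" if "ws \<in> tlists M d (s y)" for ws
        using that push_tspace_at[OF charted(1,2) openin_topspace pr_hol sy(1)] sy(2) by (auto simp: tlists_def)
      show "ratio y (g y / K y)" unfolding ratio_def
      proof (intro ballI impI)
        fix m vs assume m: "m \<in> pts M" "pr m = y" and vs: "vs \<in> tlists M d m"
        obtain h where h: "h \<in> carrier H" "m = s y \<star> h" using pr_eq[OF sy(1) m(1)] sy(2) m(2) by blast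
        obtain ws where ws: "ws \<in> tlists M d (s y)" "map (push M (\<lambda>m. m \<star> h) (s y)) ws = vs"
          "map (push X pr (s y)) ws = map (push X pr m) vs" using right_translate[OF sy(1) h(1), of vs] vs h(2) by blast
        have us: "map (push X pr m) vs \<in> tlists X d y" using push_t[OF ws(1)] ws(3) by simp
        have "\<Theta> y (cls \<eta> m 1) (map (push X pr m) vs) = \<eta> h * \<Theta> y (cls \<eta> (s y) 1) (map (push X pr m) vs)"
          using canonical_iso_act[OF iso \<eta> sy(1) h(1), of "map (push X pr m) vs" 1] us sy(2) h(2) by simp
        also have "\<dots> = \<eta> h * (g y * dz_wedge z 0 d (map (push X pr m) vs))" using Th[OF us, of 1] by simp
        finally have 1: "\<Theta> y (cls \<eta> m 1) (map (push X pr m) vs) = \<eta> h * (g y * dz_wedge z 0 d (map (push X pr m) vs))" .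
        have "iter_contract q x \<omega> m vs = \<eta> h * iter_contract q x \<omega> (s y) ws"
          using contraction_act[OF cy gen sy(1) h(1) ws(1)] ws(2) h(2) by (simp add: \<eta>_def)
        also have "\<dots> = \<eta> h * (K y * dz_wedge z 0 d (map (push X pr m) vs))" using It[OF ws(1)] ws(3) by simp
        finally show "\<Theta> y (cls \<eta> m 1) (map (push X pr m) vs) = g y / K y * iter_contract q x \<omega> m vs"
          unfolding 1 using Ky(2) by simp
      qed
      fix c assume c: "ratio y c"
      have yV: "y \<in> V" using y by blast
      let ?us = "map (coord_vec X (V, z) y) [0..<d]"
      have us: "?us \<in> tlists X d y" by (rule coord_tlists[OF charted(2) U(4) yV])
      obtain vs where vs: "vs \<in> tlists M d (s y)" "map (push X pr (s y)) vs = ?us"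
        using lift_ex[OF sy(1), of ?us d] us sy(2) by auto
      have "\<Theta> y (cls \<eta> (s y) 1) ?us = c * iter_contract q x \<omega> (s y) vs"
        using c[unfolded ratio_def, rule_format, OF sy vs(1)] vs(2) by simp
      then show "c = g y / K y"
        using Th[OF us, of 1] It[OF vs(1)] vs(2) dz_wedge_coord[OF charted(2) U(4) yV] Ky(2) by (simp add: field_simps)
    qed
    moreover have "openin (mtop X) (U \<inter> V)" using U(1) hol_chartD(1)[OF U(4)] by blast
    ultimately show ?thesis using U(5) m0(2) by (intro exI[of _ "U \<inter> V"] exI[of _ "\<lambda>y. g y / K y"]) simp
  qed
  define f where "f y = (SOME c. ratio y c)" for y
  have f: "hol_fun_at X f y \<and> f y \<noteq> 0 \<and> ratio y (f y)" if y: "y \<in> pts X" for y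
  proof -
    obtain U g where U: "openin (mtop X) U" "y \<in> U"
      "\<forall>y\<in>U. hol_fun_at X g y \<and> g y \<noteq> 0 \<and> ratio y (g y) \<and> (\<forall>c. ratio y c --> c = g y)" using loc[OF y] by (elim exE conjE)
    have fg: "g y' = f y'" if "y' \<in> U" for y'
    proof -
      have r: "ratio y' (g y')" "\<And>c. ratio y' c ==> c = g y'" using U(3) that by simp_all
      show ?thesis using r(2)[OF someI[of "ratio y'", OF r(1)]] by (simp add: f_def)
    qed
    have "hol_fun_at X f y" by (rule hol_fun_at_cong[OF charted(2) U(1,2) fg]) (use U(2,3) in simp_all)
    moreover have "g y \<noteq> 0" "ratio y (g y)" using U(2,3) by simp_all
    ultimately show ?thesis unfolding fg[OF U(2)] by simp
  qed
  obtain c where c: "\<forall>y\<in>pts X. f y = c"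
    using compact_connected_constant[OF charted(2) _ comp ne, of f] f by blast
  have "c \<noteq> 0" using f c ne by fastforce
  moreover have "ratio y c" if "y \<in> pts X" for y using f[OF that] c that by simp
  ultimately show ?thesis using pr_pts unfolding ratio_def by blast
qed

text \<open>Both \<tau> and \<Theta>[m,1] are multiples of the coordinate volume form at the image of m, and the second one is not zero.\<close>

lemma untwist_ex:
  assumes chi: "hol_character Hm H chi" and iso: "lb_iso X (assoc_lb P \<eta>) (canonical_lb X) \<Theta>" and \<eta>: "multiplicative \<eta>"
    and \<tau>: "\<tau> \<in> H0 X (plus_K X (assoc_lb P chi))" and m: "m \<in> pts M"
  shows "\<exists>N. \<forall>us\<in>tlists X d (pr m). \<tau> (pr m) us = cls chi m (N * \<Theta> (pr m) (cls \<eta> m 1) us)"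
proof -
  note mu = hol_character_multiplicative[OF chi]
  obtain U s k where t: "local_triv m U s k" using local_triv_ex[OF m] by blast
  note D = local_trivD[OF t]
  let ?t = "\<lambda>x l. THE v. (s x, v) \<in> l"
  obtain V z c where V: "hol_chart X (V, z)" "pr m \<in> V" and c: "c \<noteq> 0"
    "\<forall>v. \<forall>us\<in>tlists X d (pr m). \<Theta> (pr m) (cls \<eta> m v) us = v * c * dz_wedge z 0 d us"
    using canonical_iso_at[OF iso \<eta> m] by blast
  let ?a = "?t (pr m) (\<tau> (pr m) (map (coord_vec X (V, z) (pr m)) [0..<d]))"
  have "\<tau> (pr m) us = cls chi m (?a / c * \<Theta> (pr m) (cls \<eta> m 1) us)" if us: "us \<in> tlists X d (pr m)" for us
  proof -
    have "\<tau> (pr m) us \<in> range (cls chi m)" using plus_K_fib(1)[OF \<tau> pr_pts[OF m] us] assoc_fib[OF mu m] by simp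
    then obtain v where v: "\<tau> (pr m) us = cls chi m v" by blast
    have "v = ?t (pr m) (\<tau> (pr m) us)" unfolding v D(3) by (rule assoc_triv[OF mu m, symmetric])
    also have "\<dots> = ?a * dz_wedge z 0 d us"
      by (rule plus_K_chart[OF charted(2) \<tau> local_triv_trivs[OF t] D(2) V us])
    finally show ?thesis using c us v by simp
  qed
  then show ?thesis by blast
qed

lemma section_value: "multiplicative chi ==> m \<in> pts M ==> \<psi> (pr m) = cls chi m v ==> section_fun P chi \<psi> m = v"
  unfolding section_fun_def by (simp add: cls_inj)

text \<open>Every representation of \<tau> as a product [m',v] \<Theta>[m',w] can be moved to m, where the product v w is determined by
  evaluating on the coordinate vectors.\<close>

lemma untwist_value:
  assumes chi: "hol_character Hm H chi" and iso: "lb_iso X (assoc_lb P \<eta>) (canonical_lb X) \<Theta>" and \<eta>: "multiplicative \<eta>"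
    and \<tau>: "\<tau> \<in> H0 X (plus_K X (assoc_lb P chi))" and m: "m \<in> pts M"
    and N: "\<forall>us\<in>tlists X d (pr m). \<tau> (pr m) us = cls chi m (N * \<Theta> (pr m) (cls \<eta> m 1) us)"
  shows "untwist_fun P chi \<eta> \<Theta> \<tau> m = N"
proof -
  let ?y = "pr m" and ?\<zeta> = "\<lambda>h. chi h * \<eta> h" and ?L = "assoc_lb P chi"
  note mu = hol_character_multiplicative[OF chi]
  have \<zeta>: "multiplicative ?\<zeta>" by (rule multiplicative_mult[OF mu \<eta>])
  obtain V z c where V: "hol_chart X (V, z)" "pr m \<in> V" and c: "c \<noteq> 0"
    "\<forall>v. \<forall>us\<in>tlists X d (pr m). \<Theta> (pr m) (cls \<eta> m v) us = v * c * dz_wedge z 0 d us"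
    using canonical_iso_at[OF iso \<eta> m] by blast
  have "untwist P chi \<eta> \<Theta> \<tau> ?y = cls ?\<zeta> m N" unfolding untwist_def restrict_apply'[OF pr_pts[OF m]]
  proof (rule the_equality)
    have "\<tau> ?y = tensor_K X ?L ?y (cls chi m N) (\<Theta> ?y (cls \<eta> m 1))"
    proof (rule ext)
      fix us show "\<tau> ?y us = tensor_K X ?L ?y (cls chi m N) (\<Theta> ?y (cls \<eta> m 1)) us"
      proof (cases "us \<in> tlists X d ?y")
        case True
        then show ?thesis using N assoc_scale[OF chi m] by (simp add: tensor_K_def mult.commute)
      qed (simp add: tensor_K_def plus_K_fib(3)[OF \<tau> pr_pts[OF m]])
    qed
    then show "\<exists>m' v w. m' \<in> pts M \<and> pr m' = ?y \<and> \<tau> ?y = tensor_K X ?L ?y (cls chi m' v) (\<Theta> ?y (cls \<eta> m' w))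
        \<and> cls ?\<zeta> m N = cls ?\<zeta> m' (v * w)"
      using m by (intro exI[of _ m] exI[of _ N] exI[of _ 1]) simp
    fix l assume "\<exists>m' v w. m' \<in> pts M \<and> pr m' = ?y \<and> \<tau> ?y = tensor_K X ?L ?y (cls chi m' v) (\<Theta> ?y (cls \<eta> m' w))
        \<and> l = cls ?\<zeta> m' (v * w)"
    then obtain m' v w where m': "m' \<in> pts M" "pr m' = ?y" and e: "\<tau> ?y = tensor_K X ?L ?y (cls chi m' v) (\<Theta> ?y (cls \<eta> m' w))"
      and l: "l = cls ?\<zeta> m' (v * w)" by (elim exE conjE)
    obtain h where h: "h \<in> carrier H" "m' = m \<star> h" using pr_eq[OF m m'(1)] m'(2) by metis
    let ?us = "map (coord_vec X (V, z) ?y) [0..<d]"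
    have us: "?us \<in> tlists X d ?y" by (rule coord_tlists[OF charted(2) V])
    note dz = dz_wedge_coord[OF charted(2) V]
    have "\<Theta> ?y (cls \<eta> m' w) ?us = \<eta> h * w * c"
      unfolding h(2) using canonical_iso_act[OF iso \<eta> m h(1) us] c(2) us dz by simp
    then have "\<tau> ?y ?us = cls chi m (\<eta> h * w * c * (chi h * v))"
      unfolding e h(2) cls_act[OF mu m h(1)] using us assoc_scale[OF chi m] by (simp add: tensor_K_def)
    moreover have "\<tau> ?y ?us = cls chi m (N * c)" using N us c(2) dz by simp
    ultimately have e': "\<eta> h * w * c * (chi h * v) = N * c" by (simp only: cls_inj[OF mu m])
    have "(chi h * \<eta> h * (v * w)) * c = N * c" unfolding e'[symmetric] by (simp only: mult_ac)
    then have "chi h * \<eta> h * (v * w) = N" using c(1) by simp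
    then show "l = cls ?\<zeta> m N" unfolding l h(2) cls_act[OF \<zeta> m h(1)] by simp
  qed
  then show ?thesis unfolding untwist_fun_def by (rule section_value[OF \<zeta> m])
qed

text \<open>Along the fiber \<tau>_M is divided by chi(h) \<eta>(h), \<psi>_M by chi(h), and the contraction is multiplied by \<eta>(h), so the
  product is constant; every list of tangent vectors of the base has a lift.\<close>

lemma descent_value:
  assumes chi: "hol_character Hm H chi" and iso: "lb_iso X (assoc_lb P \<eta>) (canonical_lb X) \<Theta>" and \<eta>: "multiplicative \<eta>"
    and \<tau>: "\<tau> \<in> H0 X (plus_K X (assoc_lb P chi))" and m: "m \<in> pts M"
    and N: "\<forall>us\<in>tlists X d (pr m). \<tau> (pr m) us = cls chi m (N * \<Theta> (pr m) (cls \<eta> m 1) us)"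
    and \<psi>: "\<psi> (pr m) = cls chi m w" and us: "us \<in> tlists X d (pr m)"
    and c: "c \<noteq> 0" "\<forall>m\<in>pts M. \<forall>vs\<in>tlists M d m. \<Theta> (pr m) (cls \<eta> m 1) (map (push X pr m) vs) = c * D m vs"
  shows "basic_descent P (\<lambda>m vs. untwist_fun P chi \<eta> \<Theta> \<tau> m / section_fun P chi \<psi> m * D m vs) (pr m) us
    = N / w * \<Theta> (pr m) (cls \<eta> m 1) us / c"
proof -
  let ?y = "pr m"
  note mu = hol_character_multiplicative[OF chi]
  have val: "untwist_fun P chi \<eta> \<Theta> \<tau> m' / section_fun P chi \<psi> m' * D m' vs = N / w * \<Theta> ?y (cls \<eta> m 1) us / c"
    if m': "m' \<in> pts M" "pr m' = ?y" and vs: "vs \<in> tlists M d m'" "map (push X pr m') vs = us" for m' vs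
  proof -
    obtain h where h: "h \<in> carrier H" "m' = m \<star> h" using pr_eq[OF m m'(1)] m'(2) by metis
    have nz: "chi h \<noteq> 0" "\<eta> h \<noteq> 0" using multiplicativeD(1)[OF mu h(1)] multiplicativeD(1)[OF \<eta> h(1)] by simp_all
    have T: "\<Theta> ?y (cls \<eta> m' 1) us' = \<eta> h * \<Theta> ?y (cls \<eta> m 1) us'" if "us' \<in> tlists X d ?y" for us'
      unfolding h(2) using canonical_iso_act[OF iso \<eta> m h(1) that, of 1] by simp
    have "\<psi> (pr m') = cls chi m' (w / chi h)" unfolding m'(2) \<psi> unfolding h(2) cls_act[OF mu m h(1)] using nz by simp
    then have 1: "section_fun P chi \<psi> m' = w / chi h" by (rule section_value[OF mu m'(1)])
    have "\<tau> (pr m') us' = cls chi m' (N / (chi h * \<eta> h) * \<Theta> (pr m') (cls \<eta> m' 1) us')" if "us' \<in> tlists X d (pr m')" for us'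
    proof -
      have u: "us' \<in> tlists X d ?y" using that m'(2) by simp
      have "\<tau> ?y us' = cls chi m (N * \<Theta> ?y (cls \<eta> m 1) us')" using N u by blast
      moreover have "cls chi m' (N / (chi h * \<eta> h) * \<Theta> ?y (cls \<eta> m' 1) us') = cls chi m (N * \<Theta> ?y (cls \<eta> m 1) us')"
        unfolding T[OF u] unfolding h(2) cls_act[OF mu m h(1)] using nz by simp
      ultimately show ?thesis using m'(2) by simp
    qed
    then have 2: "untwist_fun P chi \<eta> \<Theta> \<tau> m' = N / (chi h * \<eta> h)"
      by (intro untwist_value[OF chi iso \<eta> \<tau> m'(1)] ballI)
    have "c * D m' vs = \<Theta> ?y (cls \<eta> m' 1) us" using c(2) m' vs by auto
    also have "\<dots> = \<eta> h * \<Theta> ?y (cls \<eta> m 1) us" by (rule T[OF us])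
    finally have "D m' vs = \<eta> h * \<Theta> ?y (cls \<eta> m 1) us / c" using c(1) by (simp add: field_simps)
    then show ?thesis unfolding 1 2 using nz by simp
  qed
  obtain vs where vs: "vs \<in> tlists M d m" "map (push X pr m) vs = us" using lift_ex[OF m us] by blast
  show ?thesis unfolding basic_descent_def
  proof (rule the_equality)
    show "\<forall>m'\<in>pts M. pr m' = ?y --> (\<forall>vs\<in>tlists M d m'. map (push X pr m') vs = us
        --> untwist_fun P chi \<eta> \<Theta> \<tau> m' / section_fun P chi \<psi> m' * D m' vs = N / w * \<Theta> ?y (cls \<eta> m 1) us / c)"
      using val by simp
    fix b assume "\<forall>m'\<in>pts M. pr m' = ?y --> (\<forall>vs\<in>tlists M d m'. map (push X pr m') vs = us
        --> untwist_fun P chi \<eta> \<Theta> \<tau> m' / section_fun P chi \<psi> m' * D m' vs = b)"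
    from this[rule_format, OF m refl vs] show "b = N / w * \<Theta> ?y (cls \<eta> m 1) us / c" using val[OF m refl vs] by simp
  qed
qed

end

theorem theorem7p2:
  fixes P :: "('g, 'h, 'm, 'x) pbundle"
    and \<omega>\<^sub>M :: "'m \<Rightarrow> 'm tvec list \<Rightarrow> complex"
    and chi\<^sub>M chi :: "'h \<Rightarrow> complex"
    and s :: nat
    and L :: "nat \<Rightarrow> ('x, 'l) lbundle"
    and b :: "nat \<Rightarrow> 'g \<Rightarrow> 'x \<Rightarrow> 'l \<Rightarrow> 'l"
    and \<mu> :: "'x \<Rightarrow> (nat \<Rightarrow> 'l) \<Rightarrow> ('m \<times> complex) set"
    and \<Theta> :: "'x \<Rightarrow> ('m \<times> complex) set \<Rightarrow> 'x tvec list \<Rightarrow> complex"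
    and x :: "nat \<Rightarrow> 'm \<Rightarrow> 'm tvec"
  defines "X \<equiv> base P"
    and "q \<equiv> mdim (Hmfd P)"
    and "L\<^sub>chi \<equiv> assoc_lb P chi"
    and "\<eta> \<equiv> (\<lambda>h. chi\<^sub>M h * adj_char P h)"
    and "B \<equiv> smooth_tuples (base P) s L"
  assumes principal: "equivariant_principal_bundle P"
    and cy: "CY_structure P \<omega>\<^sub>M chi\<^sub>M"
    and standing: "standing_assumptions P s L b chi \<mu>"
    and canonical_iso: "lb_iso X (assoc_lb P \<eta>) (canonical_lb X) \<Theta>"
    and fields: "independent_generated_fields P x"
  shows "(\<exists>c. \<forall>\<tau>\<in>H0 X (plus_K X L\<^sub>chi). \<forall>\<sigma>\<in>B.
            let \<psi> = section_prod X \<mu> \<sigma>;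
                \<psi>\<^sub>M = section_fun P chi \<psi>;
                \<tau>\<^sub>M = untwist_fun P chi \<eta> \<Theta> \<tau>;
                form = basic_descent P
                  (\<lambda>m vs. \<tau>\<^sub>M m / \<psi>\<^sub>M m * iter_contract q x \<omega>\<^sub>M m vs)
            in adjunction_map X s L L\<^sub>chi \<mu> \<sigma> \<tau> = (\<lambda>p vs. c * poincare_residue X s L \<sigma> form p vs))
       \<and> residue_map X s L L\<^sub>chi \<mu> \<in> H0 X (plus_K X L\<^sub>chi) \<rightarrow> hodge_sections X s L
       \<and> (mtop X closure_of (\<Union>\<sigma>\<in>B. zero_locus X s L \<sigma>) = pts X
            \<longrightarrow> inj_on (residue_map X s L L\<^sub>chi \<mu>) (H0 X (plus_K X L\<^sub>chi)))"
proof -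
  let ?L = "assoc_lb P chi"
  interpret PB: principal_bundle P by (rule principal_bundle.intro[OF principal])
  note S = standing[unfolded standing_assumptions_def Let_def]
  have comp: "compact_space (mtop X)" "connected_space (mtop X)" and sd: "s < mdim X"
    and Li: "\<forall>i<s. equivariant_lb (Gmfd P) (Ggrp P) X (bact P) (L i) (b i)
          \<and> \<not> (\<exists>\<Theta>. lb_iso X (L i) (trivial_lb X) \<Theta>) \<and> bpf X (L i)"
    and chi: "hol_character (Hmfd P) (Hgrp P) chi" and ten: "tensor_iso X s L ?L \<mu>"
    and ex: "\<exists>\<tau>\<in>H0 X (plus_K X ?L). \<exists>x\<in>pts X. \<tau> x \<noteq> lzero (plus_K X ?L) x"
    unfolding X_def by (insert S, (elim conjE, assumption)+)
  have ne: "pts X \<noteq> {}" using ex by blast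
  have lbL: "line_bundle X (L i)" if "i < s" for i using Li that by (simp add: equivariant_lb_def)
  have lb': "line_bundle X ?L" unfolding X_def by (rule PB.assoc_line_bundle[OF chi])
  have cX: "charted X" unfolding X_def by (rule PB.charted(2))
  interpret BD: bundle_data X s L ?L \<mu>
    by (rule bundle_data.intro[OF cX less_imp_le[OF sd] lbL lb' ten])
  have eta: "PB.multiplicative \<eta>" unfolding \<eta>_def
    by (rule PB.multiplicative_mult[OF PB.CY_D(4)[OF cy] PB.adj_char_multiplicative])
  note mu = PB.hol_character_multiplicative[OF chi]
  note iso = canonical_iso[unfolded X_def]
  obtain \<gamma> where gen: "PB.generates \<gamma> x" using PB.generates_ex[OF fields] by blast
  have "\<exists>c. c \<noteq> 0 \<and> (\<forall>m\<in>pts (total P). \<forall>vs\<in>tlists (total P) (mdim (base P)) m.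
      \<Theta> (proj P m) (assoc_class P \<eta> m 1) (map (push (base P) (proj P) m) vs) = c * iter_contract (mdim (Hmfd P)) x \<omega>\<^sub>M m vs)"
    by (rule PB.contraction_ratio[OF cy gen meta_eq_to_obj_eq[OF \<eta>_def] iso comp[unfolded X_def] ne[unfolded X_def]])
  then obtain c where c: "c \<noteq> 0" "\<forall>m\<in>pts (total P). \<forall>vs\<in>tlists (total P) (mdim (base P)) m.
      \<Theta> (proj P m) (assoc_class P \<eta> m 1) (map (push (base P) (proj P) m) vs) = c * iter_contract q x \<omega>\<^sub>M m vs"
    unfolding q_def by blast
  have res: "adjunction_map X s L ?L \<mu> \<sigma> \<tau> = (\<lambda>p vs. c * poincare_residue X s L \<sigma> (basic_descent P
      (\<lambda>m vs. untwist_fun P chi \<eta> \<Theta> \<tau> m / section_fun P chi (section_prod X \<mu> \<sigma>) m * iter_contract q x \<omega>\<^sub>M m vs)) p vs)"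
    if \<tau>: "\<tau> \<in> H0 X (plus_K X ?L)" and \<sigma>: "\<sigma> \<in> smooth_tuples X s L" for \<tau> \<sigma>
  proof (rule BD.residue_of_form[OF \<sigma> \<tau> c(1)])
    fix U z e g p us
    assume al: "adj_local X s L ?L \<mu> \<sigma> \<tau> U z e g" and p: "p \<in> U" and nz: "\<forall>i<s. z p i \<noteq> 0" and us: "us \<in> tlists X (mdim X) p"
    have ad: "adapted X s L \<sigma> U z e" and val: "\<tau> p us = lscale ?L p (g p * dz_wedge z 0 (mdim X) us) (\<mu> p (\<lambda>i. e i p))"
      using al p us unfolding adj_local_def by blast+
    have pX: "p \<in> pts X" by (rule hol_chart_sub[OF BD.adapted_chart[OF ad] p])
    obtain m where m: "m \<in> pts (total P)" "proj P m = p" using PB.pr_surj[of p] pX unfolding X_def by blast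
    obtain Us ts where Us: "\<forall>i<s. (Us i, ts i) \<in> trivs (L i) \<and> p \<in> Us i" using choose_trivs[of s X L p, OF lbL pX] by blast
    obtain W t where W: "(W, t) \<in> trivs ?L" "p \<in> W" using lb_trivs(3)[OF lb' pX] by blast
    have Us': "(Us i, ts i) \<in> trivs (L i)" "p \<in> Us i" if "i < s" for i using Us that by simp_all
    obtain a where a: "\<forall>x\<in>W \<inter> (\<Inter>i<s. Us i). a x \<noteq> 0
      \<and> (\<forall>l. (\<forall>i<s. l i \<in> fib (L i) x) --> t x (\<mu> x l) = a x * (\<Prod>i<s. ts i x (l i)))"
      using tensor_iso_ex[of X s L ?L \<mu> W t Us ts, OF ten W(1) Us'(1)] by blast
    have pW: "p \<in> W \<inter> (\<Inter>i<s. Us i)" using W(2) Us'(2) by blast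
    note at = BD.adapted_triv[OF ad _ Us'(1) p Us'(2)]
    have sf: "\<sigma> i p \<in> fib (L i) p" if "i < s" for i
      using \<sigma> H0_fib[OF BD.sec_H0[OF _ that] pX] by (simp add: smooth_tuples_def)
    have tl: "t p (\<mu> p l) = a p * (\<Prod>i<s. ts i p (l i))" if "\<And>i. i < s ==> l i \<in> fib (L i) p" for l
      using bspec[OF a pW] that by simp
    \<comment> \<open>at p the product of the sections is z_0 ... z_(s-1) times the product of the frames\<close>
    have te: "t p (\<mu> p (\<lambda>i. e i p)) = a p * (\<Prod>i<s. ts i p (e i p))" by (rule tl, rule at(1))
    have ts: "t p (\<mu> p (\<lambda>i. \<sigma> i p)) = a p * (\<Prod>i<s. ts i p (\<sigma> i p))" by (rule tl, rule sf)
    also have "(\<Prod>i<s. ts i p (\<sigma> i p)) = (\<Prod>i<s. z p i) * (\<Prod>i<s. ts i p (e i p))"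
      using at(2) by (simp add: prod.distrib[symmetric])
    finally have te': "t p (\<mu> p (\<lambda>i. \<sigma> i p)) = (\<Prod>i<s. z p i) * t p (\<mu> p (\<lambda>i. e i p))" by (simp add: te)
    have fe: "\<mu> p (\<lambda>i. e i p) \<in> fib ?L p" by (rule tensor_iso_fib[OF ten pX], rule at(1))
    have fs: "\<mu> p (\<lambda>i. \<sigma> i p) \<in> fib ?L p" by (rule tensor_iso_fib[OF ten pX], rule sf)
    have fm: "fib ?L p = range (assoc_class P chi m)" using PB.assoc_fib[OF mu m(1)] m(2) by simp
    obtain E where E: "\<mu> p (\<lambda>i. e i p) = assoc_class P chi m E" using fe unfolding fm by blast
    have sc: "lscale ?L p k (assoc_class P chi m v) = assoc_class P chi m (k * v)" for k v
      using PB.assoc_scale[OF chi m(1)] m(2) by simp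
    have "\<mu> p (\<lambda>i. \<sigma> i p) = lscale ?L p (\<Prod>i<s. z p i) (\<mu> p (\<lambda>i. e i p))"
      by (rule lb_eqI[OF lb' W fs lb_scale(1)[OF lb' W fe]], subst lb_scale(2)[OF lb' W fe]) (rule te')
    then have psi: "section_prod X \<mu> \<sigma> (proj P m) = assoc_class P chi m ((\<Prod>i<s. z p i) * E)"
      using pX m(2) by (simp add: section_prod_def E sc)
    have "E \<noteq> 0"
    proof
      assume "E = 0"
      then have "lscale ?L p 0 (\<mu> p (\<lambda>i. e i p)) = \<mu> p (\<lambda>i. e i p)" unfolding E sc by simp
      then have "t p (\<mu> p (\<lambda>i. e i p)) = 0" using lb_scale(2)[OF lb' W fe, of 0] by simp
      then show False using te bspec[OF a pW] at(3) by simp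
    qed
    obtain N where N: "\<forall>us\<in>tlists (base P) (mdim (base P)) (proj P m).
        \<tau> (proj P m) us = assoc_class P chi m (N * \<Theta> (proj P m) (assoc_class P \<eta> m 1) us)"
      using PB.untwist_ex[OF chi iso eta \<tau>[unfolded X_def] m(1)] by blast
    have us': "us \<in> tlists (base P) (mdim (base P)) (proj P m)" using us m(2) by (simp add: X_def)
    have "assoc_class P chi m (N * \<Theta> p (assoc_class P \<eta> m 1) us) = assoc_class P chi m (g p * dz_wedge z 0 (mdim X) us * E)"
      using N us' val unfolding m(2) E sc by simp
    \<comment> \<open>both sides are the value of \<tau> in the fiber coordinate given by m\<close>
    then have key: "N * \<Theta> p (assoc_class P \<eta> m 1) us = g p * dz_wedge z 0 (mdim X) us * E"
      by (simp only: PB.cls_inj[OF mu m(1)])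
    have "basic_descent P (\<lambda>m vs. untwist_fun P chi \<eta> \<Theta> \<tau> m / section_fun P chi (section_prod X \<mu> \<sigma>) m
        * iter_contract q x \<omega>\<^sub>M m vs) p us = N / ((\<Prod>i<s. z p i) * E) * \<Theta> p (assoc_class P \<eta> m 1) us / c"
      using PB.descent_value[where \<psi> = "section_prod X \<mu> \<sigma>" and D = "iter_contract q x \<omega>\<^sub>M" and N = N and \<tau> = \<tau>
          and w = "(\<Prod>i<s. z p i) * E" and us = us and c = c, OF chi iso eta \<tau>[unfolded X_def] m(1) N psi us' c] unfolding m(2) .
    also have "\<dots> = (N * \<Theta> p (assoc_class P \<eta> m 1) us) / ((\<Prod>i<s. z p i) * E) / c" by simp
    also have "\<dots> = g p / c / (\<Prod>i<s. z p i) * dz_wedge z 0 (mdim X) us" unfolding key using \<open>E \<noteq> 0\<close> by simp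
    finally show "basic_descent P (\<lambda>m vs. untwist_fun P chi \<eta> \<Theta> \<tau> m / section_fun P chi (section_prod X \<mu> \<sigma>) m
        * iter_contract q x \<omega>\<^sub>M m vs) p us = g p / c / (\<Prod>i<s. z p i) * dz_wedge z 0 (mdim X) us" .
  qed
  show ?thesis
  proof (intro conjI impI)
    show "\<exists>c. \<forall>\<tau>\<in>H0 X (plus_K X L\<^sub>chi). \<forall>\<sigma>\<in>B.
            let \<psi> = section_prod X \<mu> \<sigma>;
                \<psi>\<^sub>M = section_fun P chi \<psi>;
                \<tau>\<^sub>M = untwist_fun P chi \<eta> \<Theta> \<tau>;
                form = basic_descent P
                  (\<lambda>m vs. \<tau>\<^sub>M m / \<psi>\<^sub>M m * iter_contract q x \<omega>\<^sub>M m vs)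
            in adjunction_map X s L L\<^sub>chi \<mu> \<sigma> \<tau> = (\<lambda>p vs. c * poincare_residue X s L \<sigma> form p vs)"
      unfolding Let_def L\<^sub>chi_def B_def X_def[symmetric] using res by (intro exI[of _ c] ballI)
    show "residue_map X s L L\<^sub>chi \<mu> \<in> H0 X (plus_K X L\<^sub>chi) \<rightarrow> hodge_sections X s L"
      unfolding L\<^sub>chi_def by (rule funcsetI, rule BD.residue_map_hodge)
    assume "mtop X closure_of (\<Union>\<sigma>\<in>B. zero_locus X s L \<sigma>) = pts X"
    then show "inj_on (residue_map X s L L\<^sub>chi \<mu>) (H0 X (plus_K X L\<^sub>chi))"
      unfolding L\<^sub>chi_def B_def X_def[symmetric] by (rule BD.residue_map_inj)
  qed
qed

end
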